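(* Let $A$ and $B$ be finite square $\{0,1\}$-matrices (possibly of different sizes) with no zero rows and no zero columns, and let $h\colon \mathsf{X}_A\to \mathsf{X}_B$ be a homeomorphism. The following are equivalent. (i) The homeomorphism $h$ is a conjugacy, i.e. $h\circ\sigma_A=\sigma_B\circ h$. (ii) There is an isomorphism of topological groupoids $\Phi\colon \mathcal{G}_A\to\mathcal{G}_B$ satisfying $c_B\circ\Phi=c_A$, $\Phi^{(0)}=h$, and $\Phi\circ\epsilon_A=\epsilon_B\circ\Phi$. (iii) There is an isomorphism of topological groupoids $\Phi\colon \mathcal{G}_A\to\mathcal{G}_B$ satisfying $\Phi^{(0)}=h$ and $\Phi\circ\epsilon_A=\epsilon_B\circ\Phi$. (iv) There is a $*$-isomorphism $\Psi\colon \mathcal{O}_A\to\mathcal{O}_B$ satisfying $\Psi\circ\gamma^A_z=\gamma^B_z\circ\Psi$ for all $z\in\mathbb{T}$, $\Psi\circ d_A=d_B\circ\Psi$, $\Psi(f)=f\circ h^{-1}$ for all $f\in\mathcal{D}_A$, $\Psi\circ\phi_A|_{\mathcal{D}_A}=\phi_B\circ\Psi|_{\mathcal{D}_A}$, and $\Psi\circ\tau_A=\tau_B\circ\Psi$. (v) There is a $*$-isomorphism $\Psi\colon\mathcal{O}_A\to\mathcal{O}_B$ satisfying $\Psi(\mathcal{D}_A)=\mathcal{D}_B$, $\Psi(f)=f\circ h^{-1}$ for all $f\in\mathcal{D}_A$, and $\Psi\circ\tau_A=\tau_B\circ\Psi$. (vi) There is a $*$-isomorphism $\Theta\colon\mathcal{D}_A\to\mathcal{D}_B$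 satisfying $\Theta(f)=f\circ h^{-1}$ for all $f\in\mathcal{D}_A$, and $\Theta\circ\phi_A|_{\mathcal{D}_A}=\phi_B\circ\Theta$.
   Context: Let $\mathbb{N}=\{0,1,2,\dots\}$ and let $\mathbb{T}\subseteq\mathbb{C}$ be the unit circle group. Let $A$ be an $N\times N$ matrix with entries in $\{0,1\}$ and no zero rows and no zero columns. Shift space. $\mathsf{X}_A=\{x=(x_n)_{n\in\mathbb{N}}\in\{1,\dots,N\}^{\mathbb{N}} : A(x_n,x_{n+1})=1 \text{ for all } n\in\mathbb{N}\}$ with the subspace topology of the product topology, and $\sigma_A\colon\mathsf{X}_A\to\mathsf{X}_A$ is the shift $(\sigma_A(x))_n=x_{n+1}$. A word is a finite string $\alpha=\alpha_0\cdots\alpha_{n-1}$ of symbols with $A(\alpha_{i-1},\alpha_i)=1$ for $1\le i\le n-1$; $Z_\alpha=\{x\in\mathsf{X}_A : x_0\cdots x_{n-1}=\alpha\}$. Groupoid. $\mathcal{G}_A=\{(x,n,y)\in\mathsf{X}_A\times\mathbb{Z}\times\mathsf{X}_A : \exists k,l\in\mathbb{N},\ n=k-l,\ \sigma_A^k(x)=\sigma_A^l(y)\}$, with product $(x,n,y)(y,n',y')=(x,n+n',y')$, inverse $(x,n,y)^{-1}=(y,-n,x)$, range $r(x,n,y)=(x,0,x)$, source $s(x,n,y)=(y,0,y)$, unit space $\mathcal{G}_A^{(0)}=\{(x,0,x):x\in\mathsf{X}_A\}$, identified with $\mathsf{X}_A$ via $(x,0,x)\mapsto x$. Its topology has as basis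 the sets $Z(U,k,l,V)=\{(x,k-l,y)\in\mathcal{G}_A : x\in U,\ y\in V,\ \sigma_A^k(x)=\sigma_A^l(y)\}$, where $k,l\in\mathbb{N}$ and $U,V\subseteq\mathsf{X}_A$ are open such that $\sigma_A^k|_U$ and $\sigma_A^l|_V$ are injective and $\sigma_A^k(U)=\sigma_A^l(V)$. This makes $\mathcal{G}_A$ a second countable, étale, locally compact Hausdorff, amenable groupoid. The canonical continuous cocycle is $c_A\colon\mathcal{G}_A\to\mathbb{Z}$, $c_A(x,n,y)=n$. The map $\epsilon_A\colon\mathcal{G}_A\to\mathcal{G}_A$ is the continuous groupoid homomorphism $\epsilon_A(x,n,y)=(\sigma_A(x),n,\sigma_A(y))$. For an isomorphism of topological groupoids (an algebraic isomorphism that is a homeomorphism) $\Phi\colon\mathcal{G}_A\to\mathcal{G}_B$, $\Phi^{(0)}\colon\mathsf{X}_A\to\mathsf{X}_B$ is the homeomorphism induced by the restriction of $\Phi$ to unit spaces. Cuntz–Krieger algebra. $\mathcal{O}_A$ is the universal unital $C^*$-algebra generated (as a $C^*$-algebra, so that $\sum_i s_is_i^*=1$) by partial isometries $s_1,\dots,s_N$ subject to $s_i^*s_j=0$ for $i\ne j$ and $s_i^*s_i=\sum_{j=1}^N A(i,j)s_js_j^*$. For a word $\alpha$, $s_\alpha=s_{\alpha_0}\cdots s_{\alpha_{n-1}}$. The diagonal $\mathcal{D}_A$ is the abelian $C^*$-subalgebra generated by the projections $s_\alpha s_\alpha^*$; it is identified with $C(\mathsf{X}_A)$ via $s_\alpha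 s_\alpha^*\leftrightarrow\chi_{Z_\alpha}$ (so expressions such as $f\circ h^{-1}$ for $f\in\mathcal{D}_A$ make sense). The gauge action $\gamma^A\colon\mathbb{T}\curvearrowright\mathcal{O}_A$ is given by $\gamma^A_z(s_i)=zs_i$. The algebra $\mathcal{O}_A$ is identified with $C^*(\mathcal{G}_A)$ by sending $s_i$ to the indicator function of $\{(x,1,\sigma_A(x)) : x\in\mathsf{X}_A,\ x_0=i\}$; this takes $\mathcal{D}_A$ to $C(\mathcal{G}_A^{(0)})=C(\mathsf{X}_A)$. Elements of $\mathcal{O}_A=C^*(\mathcal{G}_A)$ are regarded as functions in $C_0(\mathcal{G}_A)$ via the canonical linear injection $C^*(\mathcal{G}_A)\to C_0(\mathcal{G}_A)$, and $d_A\colon\mathcal{O}_A\to\mathcal{D}_A$ is the conditional expectation $d_A(f)=f|_{\mathcal{G}_A^{(0)}}$. Completely positive maps $\phi_A,\tau_A\colon\mathcal{O}_A\to\mathcal{O}_A$: $\phi_A(y)=\sum_{i=1}^N s_iys_i^*$, and $\tau_A(y)=sys^*=\sum_{i,j=1}^N s_jys_i^*$ where $s=\sum_{i=1}^N s_i$. The map $\phi_A$ restricts to a $*$-homomorphism $\mathcal{D}_A\to\mathcal{D}_A$. The same notation is used with $B$ in place of $A$. *)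

theory Defs
  imports
    "HOL-Analysis.Analysis"
    "HOL-Algebra.Module"
    "HOL-Algebra.QuotRing"
begin

section \<open>Shift spaces\<close>

text \<open>The alphabet \<open>{1,\<dots>,N}\<close> is an arbitrary finite type \<open>'n\<close> with \<open>N = CARD('n)\<close>.\<close>

definition ck_matrix :: "nat^'n^'n \<Rightarrow> bool" where
  "ck_matrix A \<longleftrightarrow>
     (\<forall>i j. A $ i $ j \<in> {0, 1}) \<and> (\<forall>i. \<exists>j. A $ i $ j \<noteq> 0) \<and> (\<forall>j. \<exists>i. A $ i $ j \<noteq> 0)"

definition shift_space :: "nat^'n^'n \<Rightarrow> (nat \<Rightarrow> 'n) set" where
  "shift_space A = {x. \<forall>n. A $ x n $ x (Suc n) = 1}"

definition shift_topology :: "nat^'n^'n \<Rightarrow> (nat \<Rightarrow> 'n) topology" where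
  "shift_topology A =
     subtopology (product_topology (\<lambda>_. discrete_topology UNIV) UNIV) (shift_space A)"

definition shift :: "(nat \<Rightarrow> 'n) \<Rightarrow> nat \<Rightarrow> 'n" where
  "shift x = (\<lambda>n. x (Suc n))"

definition admissible_word :: "nat^'n^'n \<Rightarrow> 'n list \<Rightarrow> bool" where
  "admissible_word A \<alpha> \<longleftrightarrow> (\<forall>i. Suc i < length \<alpha> \<longrightarrow> A $ (\<alpha> ! i) $ (\<alpha> ! Suc i) = 1)"


section \<open>The groupoid of a shift space\<close>

type_synonym 'n arrow = "(nat \<Rightarrow> 'n) \<times> int \<times> (nat \<Rightarrow> 'n)"

definition ck_groupoid :: "nat^'n^'n \<Rightarrow> 'n arrow set" where
  "ck_groupoid A = {(x, n, y). x \<in> shift_space A \<and> y \<in> shift_space A \<and>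
     (\<exists>k l. n = int k - int l \<and> (shift ^^ k) x = (shift ^^ l) y)}"

text \<open>The product is total here; it is meaningful only if \<open>gsource \<gamma> = grange \<eta>\<close>.\<close>

fun gmult :: "'n arrow \<Rightarrow> 'n arrow \<Rightarrow> 'n arrow" where
  "gmult (x, n, y) (y', n', z) = (x, n + n', z)"

fun ginv :: "'n arrow \<Rightarrow> 'n arrow" where
  "ginv (x, n, y) = (y, - n, x)"

definition gunit :: "(nat \<Rightarrow> 'n) \<Rightarrow> 'n arrow" where
  "gunit x = (x, 0, x)"

fun grange :: "'n arrow \<Rightarrow> 'n arrow" where
  "grange (x, n, y) = gunit x"

fun gsource :: "'n arrow \<Rightarrow> 'n arrow" where
  "gsource (x, n, y) = gunit y"

definition unit_space :: "nat^'n^'n \<Rightarrow> 'n arrow set" where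
  "unit_space A = gunit ` shift_space A"

definition basic_bisection ::
    "(nat \<Rightarrow> 'n) set \<Rightarrow> nat \<Rightarrow> nat \<Rightarrow> (nat \<Rightarrow> 'n) set \<Rightarrow> 'n arrow set" where
  "basic_bisection U k l V =
     {(x, int k - int l, y) | x y. x \<in> U \<and> y \<in> V \<and> (shift ^^ k) x = (shift ^^ l) y}"

definition groupoid_topology :: "nat^'n^'n \<Rightarrow> 'n arrow topology" where
  "groupoid_topology A = topology_generated_by
     {basic_bisection U k l V | U k l V.
        openin (shift_topology A) U \<and> openin (shift_topology A) V \<and>
        inj_on (shift ^^ k) U \<and> inj_on (shift ^^ l) V \<and>
        (shift ^^ k) ` U = (shift ^^ l) ` V}"

fun ck_cocycle :: "'n arrow \<Rightarrow> int" where
  "ck_cocycle (x, n, y) = n"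

fun ck_epsilon :: "'n arrow \<Rightarrow> 'n arrow" where
  "ck_epsilon (x, n, y) = (shift x, n, shift y)"

text \<open>For a bijection, preservation of composable pairs and of products already implies that
  units, inverses, and (in both directions) composability are preserved.\<close>

definition topological_groupoid_iso ::
    "nat^'n^'n \<Rightarrow> nat^'m^'m \<Rightarrow> ('n arrow \<Rightarrow> 'm arrow) \<Rightarrow> bool" where
  "topological_groupoid_iso A B \<Phi> \<longleftrightarrow>
     bij_betw \<Phi> (ck_groupoid A) (ck_groupoid B) \<and>
     (\<forall>\<gamma>\<in>ck_groupoid A. \<forall>\<eta>\<in>ck_groupoid A. gsource \<gamma> = grange \<eta> \<longrightarrow>
        gsource (\<Phi> \<gamma>) = grange (\<Phi> \<eta>) \<and> \<Phi> (gmult \<gamma> \<eta>) = gmult (\<Phi> \<gamma>) (\<Phi> \<eta>)) \<and>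
     homeomorphic_map (groupoid_topology A) (groupoid_topology B) \<Phi>"

text \<open>\<open>\<Phi>\<^sup>(\<^sup>0\<^sup>) = h\<close> under the identification of \<open>(x, 0, x)\<close> with \<open>x\<close>.\<close>

definition induces_on_units ::
    "nat^'n^'n \<Rightarrow> ('n arrow \<Rightarrow> 'm arrow) \<Rightarrow> ((nat \<Rightarrow> 'n) \<Rightarrow> (nat \<Rightarrow> 'm)) \<Rightarrow> bool" where
  "induces_on_units A \<Phi> h \<longleftrightarrow> (\<forall>x\<in>shift_space A. \<Phi> (gunit x) = gunit (h x))"


section \<open>Star-algebras and enveloping C*-algebras\<close>

record 'a star_algebra = "(complex, 'a) module" +
  adj :: "'a \<Rightarrow> 'a"

record 'a cstar_algebra = "'a star_algebra" +
  cnorm :: "'a \<Rightarrow> real"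

definition star_iso ::
    "('a, 'r) star_algebra_scheme \<Rightarrow> ('b, 's) star_algebra_scheme \<Rightarrow> ('a \<Rightarrow> 'b) \<Rightarrow> bool" where
  "star_iso R S \<Psi> \<longleftrightarrow> \<Psi> \<in> ring_iso R S \<and>
     (\<forall>c. \<forall>a\<in>carrier R. \<Psi> (c \<odot>\<^bsub>R\<^esub> a) = c \<odot>\<^bsub>S\<^esub> \<Psi> a) \<and>
     (\<forall>a\<in>carrier R. \<Psi> (adj R a) = adj S (\<Psi> a))"

definition cstar_seminorm :: "('a, 'r) star_algebra_scheme \<Rightarrow> ('a \<Rightarrow> real) \<Rightarrow> bool" where
  "cstar_seminorm R \<rho> \<longleftrightarrow>
     (\<forall>a\<in>carrier R. 0 \<le> \<rho> a) \<and>
     (\<forall>a\<in>carrier R. \<forall>b\<in>carrier R. \<rho> (a \<oplus>\<^bsub>R\<^esub> b) \<le> \<rho> a + \<rho> b) \<and>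
     (\<forall>c. \<forall>a\<in>carrier R. \<rho> (c \<odot>\<^bsub>R\<^esub> a) = cmod c * \<rho> a) \<and>
     (\<forall>a\<in>carrier R. \<forall>b\<in>carrier R. \<rho> (a \<otimes>\<^bsub>R\<^esub> b) \<le> \<rho> a * \<rho> b) \<and>
     (\<forall>a\<in>carrier R. \<rho> (adj R a \<otimes>\<^bsub>R\<^esub> a) = (\<rho> a)\<^sup>2)"

text \<open>
  C*-seminorms on a *-algebra \<open>R\<close> are exactly the functions \<open>a \<mapsto> \<parallel>\<pi> a\<parallel>\<close> for *-homomorphisms \<open>\<pi>\<close>
  into C*-algebras (for the converse, complete the quotient by the null space). So
  \<open>envelope R E\<close> below is the C*-algebra that is universal for *-homomorphisms of \<open>R\<close> into
  C*-algebras that annihilate the set of relators \<open>E\<close>, provided that the supremum is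
  finite. Its elements are the classes of Cauchy sequences in \<open>R\<close> modulo null sequences.
\<close>

definition universal_seminorm ::
    "('a, 'r) star_algebra_scheme \<Rightarrow> 'a set \<Rightarrow> 'a \<Rightarrow> real" where
  "universal_seminorm R E a = (SUP \<rho>\<in>{\<rho>. cstar_seminorm R \<rho> \<and> (\<forall>e\<in>E. \<rho> e = 0)}. \<rho> a)"

definition cauchy_seqs :: "('a, 'r) star_algebra_scheme \<Rightarrow> 'a set \<Rightarrow> (nat \<Rightarrow> 'a) set" where
  "cauchy_seqs R E = {X. (\<forall>n. X n \<in> carrier R) \<and>
     (\<forall>e>0. \<exists>M. \<forall>m\<ge>M. \<forall>n\<ge>M. universal_seminorm R E (X m \<ominus>\<^bsub>R\<^esub> X n) < e)}"

definition null_rel ::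
    "('a, 'r) star_algebra_scheme \<Rightarrow> 'a set \<Rightarrow> ((nat \<Rightarrow> 'a) \<times> (nat \<Rightarrow> 'a)) set" where
  "null_rel R E = {(X, Y). X \<in> cauchy_seqs R E \<and> Y \<in> cauchy_seqs R E \<and>
     (\<lambda>n. universal_seminorm R E (X n \<ominus>\<^bsub>R\<^esub> Y n)) \<longlonglongrightarrow> 0}"

definition envelope ::
    "('a, 'r) star_algebra_scheme \<Rightarrow> 'a set \<Rightarrow> (nat \<Rightarrow> 'a) set cstar_algebra" where
  "envelope R E =
     \<lparr>carrier = cauchy_seqs R E // null_rel R E,
      monoid.mult = (\<lambda>a b. \<Union>X\<in>a. \<Union>Y\<in>b. null_rel R E `` {\<lambda>n. X n \<otimes>\<^bsub>R\<^esub> Y n}),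
      one = null_rel R E `` {\<lambda>_. \<one>\<^bsub>R\<^esub>},
      zero = null_rel R E `` {\<lambda>_. \<zero>\<^bsub>R\<^esub>},
      add = (\<lambda>a b. \<Union>X\<in>a. \<Union>Y\<in>b. null_rel R E `` {\<lambda>n. X n \<oplus>\<^bsub>R\<^esub> Y n}),
      smult = (\<lambda>c a. \<Union>X\<in>a. null_rel R E `` {\<lambda>n. c \<odot>\<^bsub>R\<^esub> X n}),
      adj = (\<lambda>a. \<Union>X\<in>a. null_rel R E `` {\<lambda>n. adj R (X n)}),
      cnorm = (\<lambda>a. THE r. \<forall>X\<in>a. (\<lambda>n. universal_seminorm R E (X n)) \<longlonglongrightarrow> r)\<rparr>"

definition envelope_emb :: "('a, 'r) star_algebra_scheme \<Rightarrow> 'a set \<Rightarrow> 'a \<Rightarrow> (nat \<Rightarrow> 'a) set" where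
  "envelope_emb R E a = null_rel R E `` {\<lambda>_. a}"

text \<open>The continuous extension of a map \<open>f\<close> from \<open>R\<close> to another *-algebra \<open>S\<close> with relators \<open>F\<close>.\<close>

definition envelope_map ::
    "('b, 's) star_algebra_scheme \<Rightarrow> 'b set \<Rightarrow> ('a \<Rightarrow> 'b) \<Rightarrow> (nat \<Rightarrow> 'a) set \<Rightarrow> (nat \<Rightarrow> 'b) set" where
  "envelope_map S F f a = (\<Union>X\<in>a. null_rel S F `` {\<lambda>n. f (X n)})"

definition closed_star_subalgebra :: "('a, 'r) cstar_algebra_scheme \<Rightarrow> 'a set \<Rightarrow> bool" where
  "closed_star_subalgebra R D \<longleftrightarrow>
     D \<subseteq> carrier R \<and> \<zero>\<^bsub>R\<^esub> \<in> D \<and>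
     (\<forall>a\<in>D. \<forall>b\<in>D. a \<oplus>\<^bsub>R\<^esub> b \<in> D \<and> a \<otimes>\<^bsub>R\<^esub> b \<in> D) \<and>
     (\<forall>c. \<forall>a\<in>D. c \<odot>\<^bsub>R\<^esub> a \<in> D) \<and> (\<forall>a\<in>D. adj R a \<in> D) \<and>
     (\<forall>X. \<forall>a\<in>carrier R. (\<forall>n::nat. X n \<in> D) \<and> (\<lambda>n. cnorm R (X n \<ominus>\<^bsub>R\<^esub> a)) \<longlonglongrightarrow> 0 \<longrightarrow> a \<in> D)"

definition generated_cstar_subalgebra :: "('a, 'r) cstar_algebra_scheme \<Rightarrow> 'a set \<Rightarrow> 'a set" where
  "generated_cstar_subalgebra R G = \<Inter>{D. closed_star_subalgebra R D \<and> G \<subseteq> D}"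


section \<open>The free unital *-algebra\<close>

text \<open>A letter \<open>(i, False)\<close> stands for the generator \<open>s\<^sub>i\<close>, and \<open>(i, True)\<close> for its adjoint. An
  element is a finitely supported complex function on words in these letters.\<close>

type_synonym 'n star_poly = "('n \<times> bool) list \<Rightarrow> complex"

definition free_star_algebra :: "'n star_poly star_algebra" where
  "free_star_algebra =
     \<lparr>carrier = {p. finite {w. p w \<noteq> 0}},
      monoid.mult = (\<lambda>p q w. \<Sum>k\<le>length w. p (take k w) * q (drop k w)),
      one = (\<lambda>w. if w = [] then 1 else 0),
      zero = (\<lambda>w. 0),
      add = (\<lambda>p q w. p w + q w),
      smult = (\<lambda>c p w. c * p w),
      adj = (\<lambda>p w. cnj (p (map (\<lambda>(i, b). (i, \<not> b)) (rev w))))\<rparr>"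

definition free_gen :: "'n \<Rightarrow> 'n star_poly" where
  "free_gen i = (\<lambda>w. if w = [(i, False)] then 1 else 0)"

fun eval_word ::
    "('a, 'r) star_algebra_scheme \<Rightarrow> ('n \<Rightarrow> 'a) \<Rightarrow> ('n \<times> bool) list \<Rightarrow> 'a" where
  "eval_word R t [] = \<one>\<^bsub>R\<^esub>"
| "eval_word R t ((i, b) # w) = (if b then adj R (t i) else t i) \<otimes>\<^bsub>R\<^esub> eval_word R t w"

text \<open>Substitution of a family \<open>t\<close> of elements of \<open>R\<close> for the generators.\<close>

definition eval_poly ::
    "('a, 'r) star_algebra_scheme \<Rightarrow> ('n \<Rightarrow> 'a) \<Rightarrow> 'n star_poly \<Rightarrow> 'a" where
  "eval_poly R t p = (\<Oplus>\<^bsub>R\<^esub>w\<in>{w. p w \<noteq> 0}. p w \<odot>\<^bsub>R\<^esub> eval_word R t w)"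


section \<open>Cuntz--Krieger algebras\<close>

definition ck_relators :: "nat^'n^'n \<Rightarrow> 'n star_poly set" where
  "ck_relators A = (let F = free_star_algebra; s = free_gen in
     {s i \<otimes>\<^bsub>F\<^esub> adj F (s i) \<otimes>\<^bsub>F\<^esub> s i \<ominus>\<^bsub>F\<^esub> s i | i. True} \<union>
     {adj F (s i) \<otimes>\<^bsub>F\<^esub> s j | i j. i \<noteq> j} \<union>
     {adj F (s i) \<otimes>\<^bsub>F\<^esub> s i \<ominus>\<^bsub>F\<^esub>
        (\<Oplus>\<^bsub>F\<^esub>j\<in>UNIV. of_nat (A $ i $ j) \<odot>\<^bsub>F\<^esub> (s j \<otimes>\<^bsub>F\<^esub> adj F (s j))) | i. True} \<union>
     {(\<Oplus>\<^bsub>F\<^esub>i\<in>UNIV. s i \<otimes>\<^bsub>F\<^esub> adj F (s i)) \<ominus>\<^bsub>F\<^esub> \<one>\<^bsub>F\<^esub>})"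

type_synonym 'n ck_elem = "(nat \<Rightarrow> 'n star_poly) set"

definition ck_algebra :: "nat^'n^'n \<Rightarrow> 'n ck_elem cstar_algebra" where
  "ck_algebra A = envelope free_star_algebra (ck_relators A)"

definition ck_gen :: "nat^'n^'n \<Rightarrow> 'n \<Rightarrow> 'n ck_elem" where
  "ck_gen A i = envelope_emb free_star_algebra (ck_relators A) (free_gen i)"

definition ck_word :: "nat^'n^'n \<Rightarrow> 'n list \<Rightarrow> 'n ck_elem" where
  "ck_word A \<alpha> = foldr (\<lambda>i a. ck_gen A i \<otimes>\<^bsub>ck_algebra A\<^esub> a) \<alpha> \<one>\<^bsub>ck_algebra A\<^esub>"

definition diagonal :: "nat^'n^'n \<Rightarrow> 'n ck_elem set" where
  "diagonal A = generated_cstar_subalgebra (ck_algebra A)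
     {ck_word A \<alpha> \<otimes>\<^bsub>ck_algebra A\<^esub> adj (ck_algebra A) (ck_word A \<alpha>) | \<alpha>. admissible_word A \<alpha>}"

definition diagonal_algebra :: "nat^'n^'n \<Rightarrow> 'n ck_elem cstar_algebra" where
  "diagonal_algebra A = (ck_algebra A)\<lparr>carrier := diagonal A\<rparr>"

text \<open>The automorphism determined by \<open>s\<^sub>i \<mapsto> z s\<^sub>i\<close>.\<close>

definition gauge_action :: "nat^'n^'n \<Rightarrow> complex \<Rightarrow> 'n ck_elem \<Rightarrow> 'n ck_elem" where
  "gauge_action A z = envelope_map free_star_algebra (ck_relators A)
     (eval_poly free_star_algebra (\<lambda>i. z \<odot>\<^bsub>free_star_algebra\<^esub> free_gen i))"

definition ck_phi :: "nat^'n^'n \<Rightarrow> 'n ck_elem \<Rightarrow> 'n ck_elem" where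
  "ck_phi A y = (\<Oplus>\<^bsub>ck_algebra A\<^esub>i\<in>UNIV.
     ck_gen A i \<otimes>\<^bsub>ck_algebra A\<^esub> y \<otimes>\<^bsub>ck_algebra A\<^esub> adj (ck_algebra A) (ck_gen A i))"

definition ck_gen_sum :: "nat^'n^'n \<Rightarrow> 'n ck_elem" where
  "ck_gen_sum A = (\<Oplus>\<^bsub>ck_algebra A\<^esub>i\<in>UNIV. ck_gen A i)"

definition ck_tau :: "nat^'n^'n \<Rightarrow> 'n ck_elem \<Rightarrow> 'n ck_elem" where
  "ck_tau A y =
     ck_gen_sum A \<otimes>\<^bsub>ck_algebra A\<^esub> y \<otimes>\<^bsub>ck_algebra A\<^esub> adj (ck_algebra A) (ck_gen_sum A)"


section \<open>Groupoid C*-algebras\<close>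

text \<open>The convolution *-algebra of continuous compactly supported functions. Functions are
  extended by zero outside the groupoid. As the groupoid is etale, only finitely many arrows
  in a range fibre lie in the support of such a function, so the convolution is a finite sum. The
  algebra is unital because the unit space is clopen and compact.\<close>

definition convolution_algebra :: "nat^'n^'n \<Rightarrow> ('n arrow \<Rightarrow> complex) star_algebra" where
  "convolution_algebra A =
     \<lparr>carrier = {f. (\<forall>\<gamma>. \<gamma> \<notin> ck_groupoid A \<longrightarrow> f \<gamma> = 0) \<and>
         continuous_map (groupoid_topology A) euclidean f \<and>
         compactin (groupoid_topology A) (groupoid_topology A closure_of {\<gamma>. f \<gamma> \<noteq> 0})},
      monoid.mult = (\<lambda>f g \<gamma>.
        \<Sum>\<alpha> | \<alpha> \<in> ck_groupoid A \<and> grange \<alpha> = grange \<gamma> \<and> f \<alpha> \<noteq> 0. f \<alpha> * g (gmult (ginv \<alpha>) \<gamma>)),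
      one = indicator (unit_space A),
      zero = (\<lambda>\<gamma>. 0),
      add = (\<lambda>f g \<gamma>. f \<gamma> + g \<gamma>),
      smult = (\<lambda>c f \<gamma>. c * f \<gamma>),
      adj = (\<lambda>f \<gamma>. cnj (f (ginv \<gamma>)))\<rparr>"

text \<open>The full groupoid C*-algebra, that is, the completion in the largest C*-seminorm.\<close>

type_synonym 'n groupoid_elem = "(nat \<Rightarrow> 'n arrow \<Rightarrow> complex) set"

definition groupoid_cstar_algebra :: "nat^'n^'n \<Rightarrow> 'n groupoid_elem cstar_algebra" where
  "groupoid_cstar_algebra A = envelope (convolution_algebra A) {}"

text \<open>The canonical injection into \<open>C\<^sub>0\<close> of the groupoid: the continuous extension of the
  inclusion of the convolution algebra, the supremum norm being dominated by the C*-norm.\<close>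

definition groupoid_fun :: "'n groupoid_elem \<Rightarrow> 'n arrow \<Rightarrow> complex" where
  "groupoid_fun a \<gamma> = (THE c. \<forall>X\<in>a. (\<lambda>n. X n \<gamma>) \<longlonglongrightarrow> c)"

definition groupoid_gen :: "nat^'n^'n \<Rightarrow> 'n \<Rightarrow> 'n arrow \<Rightarrow> complex" where
  "groupoid_gen A i = indicator {(x, 1, shift x) | x. x \<in> shift_space A \<and> x 0 = i}"

text \<open>The isomorphism of the Cuntz--Krieger algebra with the groupoid C*-algebra that is
  determined by \<open>s\<^sub>i \<mapsto> groupoid_gen A i\<close>.\<close>

definition ck_to_groupoid :: "nat^'n^'n \<Rightarrow> 'n ck_elem \<Rightarrow> 'n groupoid_elem" where
  "ck_to_groupoid A = envelope_map (convolution_algebra A) {}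
     (eval_poly (convolution_algebra A) (groupoid_gen A))"

definition ck_fun :: "nat^'n^'n \<Rightarrow> 'n ck_elem \<Rightarrow> 'n arrow \<Rightarrow> complex" where
  "ck_fun A a = groupoid_fun (ck_to_groupoid A a)"

text \<open>For \<open>a\<close> in the diagonal this is the function on the shift space identified with \<open>a\<close>;
  the projection \<open>s\<^sub>\<alpha> s\<^sub>\<alpha>\<^sup>*\<close> corresponds to the indicator function of the cylinder set of \<open>\<alpha>\<close>.\<close>

definition diagonal_fun :: "nat^'n^'n \<Rightarrow> 'n ck_elem \<Rightarrow> (nat \<Rightarrow> 'n) \<Rightarrow> complex" where
  "diagonal_fun A a x = ck_fun A a (gunit x)"

text \<open>The conditional expectation \<open>f \<mapsto> f|\<close>(unit space): the element of the diagonal whose function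
  is that of \<open>y\<close> restricted to the unit space (and zero elsewhere).\<close>

definition cond_exp :: "nat^'n^'n \<Rightarrow> 'n ck_elem \<Rightarrow> 'n ck_elem" where
  "cond_exp A y = (THE a. a \<in> diagonal A \<and>
     (\<forall>\<gamma>\<in>ck_groupoid A. ck_fun A a \<gamma> = (if \<gamma> \<in> unit_space A then ck_fun A y \<gamma> else 0)))"

text \<open>\<open>\<Psi> f = f \<circ> h\<^sup>-\<^sup>1\<close> for \<open>f\<close> in the diagonal, both diagonals being identified with function
  algebras.\<close>

definition implements_on_diagonal ::
    "nat^'n^'n \<Rightarrow> nat^'m^'m \<Rightarrow> ((nat \<Rightarrow> 'n) \<Rightarrow> (nat \<Rightarrow> 'm)) \<Rightarrow> ('n ck_elem \<Rightarrow> 'm ck_elem) \<Rightarrow> bool"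
  where
  "implements_on_diagonal A B h \<Psi> \<longleftrightarrow>
     (\<forall>f\<in>diagonal A. \<Psi> f \<in> diagonal B \<and>
        (\<forall>y\<in>shift_space B.
           diagonal_fun B (\<Psi> f) y = diagonal_fun A f (inv_into (shift_space A) h y)))"

end

theory Submission
  imports Defs
begin

text \<open>
  A conjugacy \<open>h\<close> acts on the groupoids by \<open>(x, n, y) \<mapsto> (h x, n, h y)\<close>. On the algebras, put
  \<open>t\<^sub>i = p\<^sub>i s\<close> where \<open>s\<close> is the sum of the generators of the algebra of \<open>B\<close> and \<open>p\<^sub>i\<close> is the projection in
  its diagonal that corresponds to \<open>{y. (h\<^sup>-\<^sup>1 y)\<^sub>0 = i}\<close>. These elements form a Cuntz--Krieger family for
  \<open>A\<close> with sum \<open>s\<close>, and the same construction applied to \<open>h\<^sup>-\<^sup>1\<close> recovers the generators, so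
  universality gives an isomorphism. It commutes with \<open>\<tau>\<close> because it preserves \<open>s\<close>; the remaining
  identities are compared on generators or as functions on the shift space.

  Conversely, \<open>\<phi>\<close> acts on the diagonal as composition with the shift, and compatibility with
  \<open>\<epsilon>\<close>, read off on units, is conjugacy. For \<open>\<tau>\<close>, one uses that \<open>g \<tau>(f)\<close> with
  diagonal \<open>f\<close> and \<open>g\<close> vanishes if \<open>g \<cdot> (f \<circ> \<sigma>) = 0\<close>, while \<open>p s s\<^sup>* p = p\<close> for every nontrivial cylinder
  projection \<open>p\<close>.

  That the diagonal is the algebra of continuous functions on the shift space rests on two estimates:
  a locally constant function has a C*-norm of at most its supremum, as functions with values in the unit
  circle correspond to unitaries, and values of a function on the groupoid are bounded by its norm in the regular
  representation.
\<close>

section \<open>Star-algebras and their enveloping C*-algebras\<close>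

text \<open>Both algebras are completions in suprema of C*-seminorms, so every such supremum first
  has to be shown finite: in the free algebra the relations bound each generator by 1, and a
  function on one bisection is a combination of four functions of modulus 1 there. The groupoid
  picture enters through function values: evaluating polynomials at the generators is contractive,
  and values are limits along Cauchy sequences. Convolution is treated as multiplication of row- and
  column-finite matrices; that polynomials in the generators yield continuous functions of compact
  support is shown by multiplying one letter at a time. The projection p_i depends on finitely many
  coordinates because the homeomorphism and its inverse are uniformly continuous. The window
  \<open>conj_level\<close> is also long enough to recover y_0 from the first letter of the preimage
  of y together with the shift of y, which is what shows that p_i s is a partial isometry. Since p_i
  s is again a polynomial in the generators, universality becomes substitution of
  polynomials.\<close>

locale star_alg = ring R for R :: "('a, 'r) star_algebra_scheme" (structure) +
  assumes smult_closed [simp, intro]: "a \<in> carrier R \<Longrightarrow> c \<odot> a \<in> carrier R"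
    and smult_add_right: "\<lbrakk>a \<in> carrier R; b \<in> carrier R\<rbrakk> \<Longrightarrow> c \<odot> (a \<oplus> b) = c \<odot> a \<oplus> c \<odot> b"
    and smult_add_left: "a \<in> carrier R \<Longrightarrow> (c + d) \<odot> a = c \<odot> a \<oplus> d \<odot> a"
    and smult_smult: "a \<in> carrier R \<Longrightarrow> c \<odot> (d \<odot> a) = (c * d) \<odot> a"
    and smult_1 [simp]: "a \<in> carrier R \<Longrightarrow> 1 \<odot> a = a"
    and smult_mult_left: "\<lbrakk>a \<in> carrier R; b \<in> carrier R\<rbrakk> \<Longrightarrow> (c \<odot> a) \<otimes> b = c \<odot> (a \<otimes> b)"
    and smult_mult_right: "\<lbrakk>a \<in> carrier R; b \<in> carrier R\<rbrakk> \<Longrightarrow> a \<otimes> (c \<odot> b) = c \<odot> (a \<otimes> b)"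
    and adj_closed [simp, intro]: "a \<in> carrier R \<Longrightarrow> adj R a \<in> carrier R"
    and adj_adj [simp]: "a \<in> carrier R \<Longrightarrow> adj R (adj R a) = a"
    and adj_add: "\<lbrakk>a \<in> carrier R; b \<in> carrier R\<rbrakk> \<Longrightarrow> adj R (a \<oplus> b) = adj R a \<oplus> adj R b"
    and adj_mult: "\<lbrakk>a \<in> carrier R; b \<in> carrier R\<rbrakk> \<Longrightarrow> adj R (a \<otimes> b) = adj R b \<otimes> adj R a"
    and adj_smult: "a \<in> carrier R \<Longrightarrow> adj R (c \<odot> a) = cnj c \<odot> adj R a"
begin

lemma smult_0_left [simp]: "a \<in> carrier R \<Longrightarrow> 0 \<odot> a = \<zero>"
proof -
  assume a: "a \<in> carrier R"
  have "0 \<odot> a \<oplus> 0 \<odot> a = 0 \<odot> a" using smult_add_left[OF a, of 0 0] a by simp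
  then show ?thesis using a add.l_cancel_one[of "0 \<odot> a" "0 \<odot> a"] by simp
qed

lemma smult_zero_right [simp]: "c \<odot> \<zero> = \<zero>"
  by (metis mult_zero_right smult_0_left smult_smult zero_closed)

lemma smult_minus_1: "a \<in> carrier R \<Longrightarrow> (-1) \<odot> a = \<ominus> a"
proof -
  assume a: "a \<in> carrier R"
  have "(-1) \<odot> a \<oplus> a = \<zero>" using smult_add_left[OF a, of "-1" 1] a by simp
  then show ?thesis using a by (metis minus_equality smult_closed)
qed

lemma adj_zero [simp]: "adj R \<zero> = \<zero>"
  by (metis adj_closed adj_smult complex_cnj_zero smult_0_left zero_closed)

lemma adj_one [simp]: "adj R \<one> = \<one>"
  by (metis adj_adj adj_closed adj_mult l_one one_closed r_one)

lemma adj_minus: "a \<in> carrier R \<Longrightarrow> adj R (\<ominus> a) = \<ominus> adj R a"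
  by (metis adj_closed adj_smult complex_cnj_minus complex_cnj_one smult_minus_1)

lemma finsum_adj:
  "f \<in> I \<rightarrow> carrier R \<Longrightarrow> adj R (finsum R f I) = (\<Oplus>i\<in>I. adj R (f i))"
proof (induction I rule: infinite_finite_induct)
  case (insert i I)
  then have "f \<in> I \<rightarrow> carrier R" "f i \<in> carrier R" by auto
  with insert show ?case
    by (subst finsum_insert; (subst finsum_insert)?) (auto simp: adj_add)
qed auto

lemma finsum_smult:
  "f \<in> I \<rightarrow> carrier R \<Longrightarrow> c \<odot> (finsum R f I) = (\<Oplus>i\<in>I. c \<odot> f i)"
proof (induction I rule: infinite_finite_induct)
  case (insert i I)
  then have "f \<in> I \<rightarrow> carrier R" "f i \<in> carrier R" by auto
  with insert show ?case
    by (subst finsum_insert; (subst finsum_insert)?) (auto simp: smult_add_right)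
qed auto

lemma finsum_smult_left:
  "a \<in> carrier R \<Longrightarrow> (\<Oplus>i\<in>I. c i \<odot> a) = (\<Sum>i\<in>I. c i) \<odot> a"
proof (induction I rule: infinite_finite_induct)
  case (insert i I)
  then show ?case
    by (subst finsum_insert) (auto simp: smult_add_left)
qed auto

lemma finsum_swap:
  assumes "finite I" "finite J" "\<And>i j. i \<in> I \<Longrightarrow> j \<in> J \<Longrightarrow> f i j \<in> carrier R"
  shows "(\<Oplus>i\<in>I. \<Oplus>j\<in>J. f i j) = (\<Oplus>j\<in>J. \<Oplus>i\<in>I. f i j)"
  using assms(1,3)
proof (induction I)
  case empty
  then show ?case by simp
next
  case (insert i I)
  then have "(\<Oplus>i\<in>insert i I. \<Oplus>j\<in>J. f i j) = (\<Oplus>j\<in>J. f i j) \<oplus> (\<Oplus>j\<in>J. \<Oplus>i\<in>I. f i j)"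
    by (subst finsum_insert) (auto simp: Pi_def)
  also have "\<dots> = (\<Oplus>j\<in>J. f i j \<oplus> (\<Oplus>i\<in>I. f i j))"
    using insert by (subst finsum_addf) auto
  also have "\<dots> = (\<Oplus>j\<in>J. \<Oplus>i\<in>insert i I. f i j)"
    using insert by (intro finsum_cong') (auto simp: Pi_def finsum_insert)
  finally show ?case .
qed

lemma finsum_single:
  assumes "finite I" "i \<in> I" "f i \<in> carrier R" "\<And>j. j \<in> I \<Longrightarrow> j \<noteq> i \<Longrightarrow> f j = \<zero>"
  shows "finsum R f I = f i"
proof -
  have "finsum R f (insert i (I - {i})) = f i \<oplus> finsum R f (I - {i})"
    using assms by (intro finsum_insert) (auto simp: Pi_def)
  also have "finsum R f (I - {i}) = \<zero>"
    using assms by (intro add.finprod_one_eqI) auto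
  finally show ?thesis using assms by (simp add: insert_absorb)
qed

end

definition star_hom ::
    "('a, 'r) star_algebra_scheme \<Rightarrow> ('b, 's) star_algebra_scheme \<Rightarrow> ('a \<Rightarrow> 'b) \<Rightarrow> bool" where
  "star_hom R S f \<longleftrightarrow> f \<in> carrier R \<rightarrow> carrier S \<and> f \<one>\<^bsub>R\<^esub> = \<one>\<^bsub>S\<^esub> \<and>
     (\<forall>a\<in>carrier R. \<forall>b\<in>carrier R. f (a \<otimes>\<^bsub>R\<^esub> b) = f a \<otimes>\<^bsub>S\<^esub> f b) \<and>
     (\<forall>a\<in>carrier R. \<forall>b\<in>carrier R. f (a \<oplus>\<^bsub>R\<^esub> b) = f a \<oplus>\<^bsub>S\<^esub> f b) \<and>
     (\<forall>c. \<forall>a\<in>carrier R. f (c \<odot>\<^bsub>R\<^esub> a) = c \<odot>\<^bsub>S\<^esub> f a) \<and>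
     (\<forall>a\<in>carrier R. f (adj R a) = adj S (f a))"

lemma star_hom_comp:
  "star_hom R S f \<Longrightarrow> star_hom S T g \<Longrightarrow> star_hom R T (g \<circ> f)"
  unfolding star_hom_def by (auto simp: Pi_def)

locale star_alg_hom = R: star_alg R + S: star_alg S
  for R :: "('a, 'r) star_algebra_scheme" (structure)
    and S :: "('b, 's) star_algebra_scheme" (structure) +
  fixes f :: "'a \<Rightarrow> 'b"
  assumes hom: "star_hom R S f"
begin

lemma
  shows hom_closed [simp]: "a \<in> carrier R \<Longrightarrow> f a \<in> carrier S"
    and hom_one [simp]: "f \<one>\<^bsub>R\<^esub> = \<one>\<^bsub>S\<^esub>"
    and hom_mult: "a \<in> carrier R \<Longrightarrow> b \<in> carrier R \<Longrightarrow> f (a \<otimes>\<^bsub>R\<^esub> b) = f a \<otimes>\<^bsub>S\<^esub> f b"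
    and hom_add: "a \<in> carrier R \<Longrightarrow> b \<in> carrier R \<Longrightarrow> f (a \<oplus>\<^bsub>R\<^esub> b) = f a \<oplus>\<^bsub>S\<^esub> f b"
    and hom_smult: "a \<in> carrier R \<Longrightarrow> f (c \<odot>\<^bsub>R\<^esub> a) = c \<odot>\<^bsub>S\<^esub> f a"
    and hom_adj: "a \<in> carrier R \<Longrightarrow> f (adj R a) = adj S (f a)"
  using hom unfolding star_hom_def by auto

lemma hom_zero [simp]: "f \<zero>\<^bsub>R\<^esub> = \<zero>\<^bsub>S\<^esub>"
  by (metis R.smult_0_left R.zero_closed S.smult_0_left hom_closed hom_smult)

lemma hom_uminus: "a \<in> carrier R \<Longrightarrow> f (\<ominus>\<^bsub>R\<^esub> a) = \<ominus>\<^bsub>S\<^esub> f a"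
  by (metis R.smult_minus_1 S.smult_minus_1 hom_closed hom_smult)

lemma hom_minus: "a \<in> carrier R \<Longrightarrow> b \<in> carrier R \<Longrightarrow> f (a \<ominus>\<^bsub>R\<^esub> b) = f a \<ominus>\<^bsub>S\<^esub> f b"
  by (simp add: a_minus_def hom_add hom_uminus)

lemma hom_finsum:
  "g \<in> I \<rightarrow> carrier R \<Longrightarrow> f (finsum R g I) = finsum S (\<lambda>i. f (g i)) I"
proof (induction I rule: infinite_finite_induct)
  case (insert i I)
  then have "g \<in> I \<rightarrow> carrier R" "g i \<in> carrier R" by auto
  with insert show ?case
    by (subst R.finsum_insert; (subst S.finsum_insert)?) (auto simp: hom_add Pi_def)
qed auto

text \<open>A pullback along a star-homomorphism competes in the supremum that defines the universal
  seminorm of the source. Contractivity of the induced maps rests on this.\<close>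

lemma seminorm_comp:
  assumes "cstar_seminorm S \<rho>"
  shows "cstar_seminorm R (\<rho> \<circ> f)"
  using assms unfolding cstar_seminorm_def
  by (auto simp: hom_add hom_mult hom_smult hom_adj[symmetric])
     (simp_all add: hom_adj)

end

context star_alg
begin

context
  fixes \<rho> assumes rho: "cstar_seminorm R \<rho>"
begin

lemma
  shows seminorm_nonneg: "a \<in> carrier R \<Longrightarrow> 0 \<le> \<rho> a"
    and seminorm_add: "a \<in> carrier R \<Longrightarrow> b \<in> carrier R \<Longrightarrow> \<rho> (a \<oplus> b) \<le> \<rho> a + \<rho> b"
    and seminorm_smult: "a \<in> carrier R \<Longrightarrow> \<rho> (c \<odot> a) = cmod c * \<rho> a"
    and seminorm_mult: "a \<in> carrier R \<Longrightarrow> b \<in> carrier R \<Longrightarrow> \<rho> (a \<otimes> b) \<le> \<rho> a * \<rho> b"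
    and seminorm_cstar: "a \<in> carrier R \<Longrightarrow> \<rho> (adj R a \<otimes> a) = (\<rho> a)\<^sup>2"
  using rho unfolding cstar_seminorm_def by auto

lemma seminorm_zero: "\<rho> \<zero> = 0"
  using seminorm_smult[of \<zero> 0] by simp

lemma seminorm_uminus: "a \<in> carrier R \<Longrightarrow> \<rho> (\<ominus> a) = \<rho> a"
  using seminorm_smult[of a "-1"] by (simp add: smult_minus_1)

lemma seminorm_minus: "a \<in> carrier R \<Longrightarrow> b \<in> carrier R \<Longrightarrow> \<rho> (a \<ominus> b) \<le> \<rho> a + \<rho> b"
  using seminorm_add[of a "\<ominus> b"] by (simp add: a_minus_def seminorm_uminus)

lemma seminorm_minus_commute: "a \<in> carrier R \<Longrightarrow> b \<in> carrier R \<Longrightarrow> \<rho> (a \<ominus> b) = \<rho> (b \<ominus> a)"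
  using seminorm_uminus[of "b \<ominus> a"] by (simp add: minus_add a_minus_def a_comm)

lemma seminorm_triangle:
  "\<lbrakk>a \<in> carrier R; b \<in> carrier R; c \<in> carrier R\<rbrakk> \<Longrightarrow> \<rho> (a \<ominus> c) \<le> \<rho> (a \<ominus> b) + \<rho> (b \<ominus> c)"
proof -
  assume *: "a \<in> carrier R" "b \<in> carrier R" "c \<in> carrier R"
  then have "a \<ominus> c = (a \<ominus> b) \<oplus> (b \<ominus> c)"
    by (simp add: a_minus_def a_assoc r_neg1)
  then show ?thesis using seminorm_add[of "a \<ominus> b" "b \<ominus> c"] * by simp
qed

lemma seminorm_diff: "a \<in> carrier R \<Longrightarrow> b \<in> carrier R \<Longrightarrow> \<bar>\<rho> a - \<rho> b\<bar> \<le> \<rho> (a \<ominus> b)"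
proof -
  assume *: "a \<in> carrier R" "b \<in> carrier R"
  have "\<rho> a \<le> \<rho> (a \<ominus> b) + \<rho> b" "\<rho> b \<le> \<rho> (b \<ominus> a) + \<rho> a"
    using * seminorm_triangle[of a b \<zero>] seminorm_triangle[of b a \<zero>] by (simp_all add: a_minus_def)
  then show ?thesis using * seminorm_minus_commute[of a b] by simp
qed

text \<open>The C*-identity and submultiplicativity bound the square of \<open>\<rho> a\<close> by
  \<open>\<rho> (adj R a) * \<rho> a\<close>; cancel one factor and apply the same to the
  adjoint.\<close>

lemma seminorm_adj: "a \<in> carrier R \<Longrightarrow> \<rho> (adj R a) = \<rho> a"
proof -
  have *: "\<rho> a \<le> \<rho> (adj R a)" if a: "a \<in> carrier R" for a
  proof (cases "\<rho> a = 0")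
    case False
    have "\<rho> a * \<rho> a \<le> \<rho> (adj R a) * \<rho> a"
      using seminorm_cstar[OF a] seminorm_mult[of "adj R a" a] a by (simp add: power2_eq_square)
    then show ?thesis using False seminorm_nonneg[OF a] by simp
  qed (use seminorm_nonneg a in auto)
  assume "a \<in> carrier R"
  then show ?thesis using *[of a] *[of "adj R a"] by simp
qed

lemma seminorm_sum:
  "f \<in> I \<rightarrow> carrier R \<Longrightarrow> \<rho> (finsum R f I) \<le> (\<Sum>i\<in>I. \<rho> (f i))"
proof (induction I rule: infinite_finite_induct)
  case (insert i I)
  then have 1: "f \<in> I \<rightarrow> carrier R" "f i \<in> carrier R" by auto
  then show ?case using insert seminorm_add[of "f i" "finsum R f I"]
    by (subst finsum_insert) auto
qed (auto simp: seminorm_zero)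

text \<open>By the C*-identity \<open>\<rho> p\<close> equals its own square, so it is 0 or 1. Only
  seminorms are compared, because an expression in free generators is a projection merely up to
  relators.\<close>

lemma seminorm_projection_le_1:
  assumes "p \<in> carrier R" "\<rho> (adj R p \<otimes> p) = \<rho> p"
  shows "\<rho> p \<le> 1"
  using seminorm_cstar[OF assms(1)] assms(2)
  by (metis le_numeral_extra(1,4) mult_cancel_right1 power2_eq_square)

lemma seminorm_one_le_1: "\<rho> \<one> \<le> 1"
  by (rule seminorm_projection_le_1) auto

lemma seminorm_le_1I:
  assumes "a \<in> carrier R" "\<rho> (adj R a \<otimes> a) \<le> 1"
  shows "\<rho> a \<le> 1"
  using assms seminorm_cstar[OF assms(1)] abs_square_le_1[of "\<rho> a"] by simp

end
end

text \<open>Pointwise boundedness of the admissible seminorms keeps the real-valued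
  \<open>SUP\<close> in \<open>universal_seminorm\<close> from being an arbitrary value.\<close>

locale enveloping = star_alg R for R :: "('a, 'r) star_algebra_scheme" (structure) +
  fixes E :: "'a set"
  assumes E_subset: "E \<subseteq> carrier R"
    and seminorms_bounded:
      "a \<in> carrier R \<Longrightarrow> \<exists>K. \<forall>\<rho>. cstar_seminorm R \<rho> \<and> (\<forall>e\<in>E. \<rho> e = 0) \<longrightarrow> \<rho> a \<le> K"
begin

abbreviation u where "u \<equiv> universal_seminorm R E"
abbreviation Q where "Q \<equiv> envelope R E"

lemma universal_upper:
  assumes "cstar_seminorm R \<rho>" "\<forall>e\<in>E. \<rho> e = 0" "a \<in> carrier R"
  shows "\<rho> a \<le> u a"
proof -
  obtain K where "\<forall>\<rho>. cstar_seminorm R \<rho> \<and> (\<forall>e\<in>E. \<rho> e = 0) \<longrightarrow> \<rho> a \<le> K"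
    using seminorms_bounded[OF assms(3)] by auto
  then have "bdd_above ((\<lambda>\<rho>. \<rho> a) ` {\<rho>. cstar_seminorm R \<rho> \<and> (\<forall>e\<in>E. \<rho> e = 0)})"
    by (intro bdd_aboveI[of _ K]) auto
  then show ?thesis unfolding universal_seminorm_def
    using assms by (intro cSUP_upper2[of _ _ \<rho>]) auto
qed

text \<open>Provides a member of the index set of the supremum, which \<open>cSUP_least\<close>
  requires to be nonempty.\<close>

lemma zero_seminorm: "cstar_seminorm R (\<lambda>_. 0)"
  unfolding cstar_seminorm_def by auto

lemma universal_least:
  assumes "\<And>\<rho>. cstar_seminorm R \<rho> \<Longrightarrow> \<forall>e\<in>E. \<rho> e = 0 \<Longrightarrow> \<rho> a \<le> K"
  shows "u a \<le> K"
  unfolding universal_seminorm_def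
  by (rule cSUP_least) (use assms zero_seminorm in auto)

text \<open>The inequalities pass to the supremum because they bound every single seminorm. The two
  equalities need a bound in each direction: the C*-identity through a square root, homogeneity
  through scaling by \<open>inverse c\<close>.\<close>

lemma universal_cstar_seminorm: "cstar_seminorm R u"
proof -
  have nonneg: "0 \<le> u a" if "a \<in> carrier R" for a
    using universal_upper[OF zero_seminorm] that by auto
  have le: "u (c \<odot> a) \<le> cmod c * u a" if "a \<in> carrier R" for a c
  proof (rule universal_least)
    fix \<rho> assume *: "cstar_seminorm R \<rho>" "\<forall>e\<in>E. \<rho> e = 0"
    show "\<rho> (c \<odot> a) \<le> cmod c * u a"
      using universal_upper[OF * that] seminorm_smult[OF *(1) that] by (simp add: mult_left_mono)
  qed
  show ?thesis
    unfolding cstar_seminorm_def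
  proof (intro conjI ballI allI)
    fix a assume a: "a \<in> carrier R"
    show "0 \<le> u a" using nonneg a .
    show "u (adj R a \<otimes> a) = (u a)\<^sup>2"
    proof (rule antisym)
      show "u (adj R a \<otimes> a) \<le> (u a)\<^sup>2"
      proof (rule universal_least)
        fix \<rho> assume *: "cstar_seminorm R \<rho>" "\<forall>e\<in>E. \<rho> e = 0"
        show "\<rho> (adj R a \<otimes> a) \<le> (u a)\<^sup>2"
          using universal_upper[OF * a] seminorm_nonneg[OF *(1) a]
          by (simp add: seminorm_cstar[OF *(1) a] power_mono)
      qed
      have "u a \<le> sqrt (u (adj R a \<otimes> a))"
      proof (rule universal_least)
        fix \<rho> assume *: "cstar_seminorm R \<rho>" "\<forall>e\<in>E. \<rho> e = 0"
        show "\<rho> a \<le> sqrt (u (adj R a \<otimes> a))"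
          using universal_upper[OF *, of "adj R a \<otimes> a"] a seminorm_cstar[OF *(1) a]
          by (simp add: real_le_rsqrt)
      qed
      then have "(u a)\<^sup>2 \<le> (sqrt (u (adj R a \<otimes> a)))\<^sup>2"
        using nonneg[OF a] by (intro power_mono)
      then show "(u a)\<^sup>2 \<le> u (adj R a \<otimes> a)" using nonneg[of "adj R a \<otimes> a"] a by simp
    qed
    fix c
    show "u (c \<odot> a) = cmod c * u a"
    proof (cases "c = 0")
      case True
      then show ?thesis using le[OF a, of 0] nonneg[of "0 \<odot> a"] a by simp
    next
      case False
      have "u (inverse c \<odot> (c \<odot> a)) \<le> cmod (inverse c) * u (c \<odot> a)"
        using a by (intro le) auto
      then have "u a \<le> inverse (cmod c) * u (c \<odot> a)"
        using a False by (simp add: smult_smult norm_inverse)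
      then have "cmod c * u a \<le> u (c \<odot> a)" using False by (simp add: field_simps)
      then show ?thesis using le[OF a, of c] by simp
    qed
  next
    fix a b assume ab: "a \<in> carrier R" "b \<in> carrier R"
    show "u (a \<oplus> b) \<le> u a + u b"
    proof (rule universal_least)
      fix \<rho> assume *: "cstar_seminorm R \<rho>" "\<forall>e\<in>E. \<rho> e = 0"
      show "\<rho> (a \<oplus> b) \<le> u a + u b"
        using universal_upper[OF *] seminorm_add[OF *(1) ab] ab by (smt (verit))
    qed
    show "u (a \<otimes> b) \<le> u a * u b"
    proof (rule universal_least)
      fix \<rho> assume *: "cstar_seminorm R \<rho>" "\<forall>e\<in>E. \<rho> e = 0"
      have "\<rho> (a \<otimes> b) \<le> \<rho> a * \<rho> b" using seminorm_mult[OF *(1) ab] .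
      also have "\<dots> \<le> u a * u b"
        using ab universal_upper[OF *] nonneg seminorm_nonneg[OF *(1)] by (intro mult_mono) auto
      finally show "\<rho> (a \<otimes> b) \<le> u a * u b" .
    qed
  qed
qed

lemma universal_relator: "e \<in> E \<Longrightarrow> u e = 0"
  using universal_least[of e 0] seminorm_nonneg[OF universal_cstar_seminorm] E_subset
  by (metis antisym eq_iff subsetD)

lemmas u_rules =
  seminorm_nonneg[OF universal_cstar_seminorm]
  seminorm_add[OF universal_cstar_seminorm]
  seminorm_smult[OF universal_cstar_seminorm]
  seminorm_mult[OF universal_cstar_seminorm]
  seminorm_cstar[OF universal_cstar_seminorm]
  seminorm_zero[OF universal_cstar_seminorm]
  seminorm_uminus[OF universal_cstar_seminorm]
  seminorm_minus[OF universal_cstar_seminorm]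
  seminorm_minus_commute[OF universal_cstar_seminorm]
  seminorm_triangle[OF universal_cstar_seminorm]
  seminorm_diff[OF universal_cstar_seminorm]
  seminorm_adj[OF universal_cstar_seminorm]

lemmas u_nonneg = u_rules(1) and u_add = u_rules(2) and u_smult = u_rules(3) and u_mult = u_rules(4)
  and u_cstar = u_rules(5) and u_zero = u_rules(6) and u_uminus = u_rules(7) and u_minus = u_rules(8)
  and u_commute = u_rules(9) and u_triangle = u_rules(10) and u_diff = u_rules(11) and u_adj = u_rules(12)

end

section \<open>Arithmetic of Cauchy sequences modulo null sequences\<close>

context enveloping
begin

abbreviation C where "C \<equiv> cauchy_seqs R E"
abbreviation cls where "cls X \<equiv> null_rel R E `` {X}"
abbreviation emb where "emb \<equiv> envelope_emb R E"

lemma cauchy_carrier: "X \<in> C \<Longrightarrow> X n \<in> carrier R"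
  unfolding cauchy_seqs_def by auto

lemma cauchyD: "X \<in> C \<Longrightarrow> e > 0 \<Longrightarrow> \<exists>M. \<forall>m\<ge>M. \<forall>n\<ge>M. u (X m \<ominus> X n) < e"
  unfolding cauchy_seqs_def by auto

text \<open>A Lipschitz estimate against two given Cauchy sequences suffices; unary operations use
  the same sequence twice.\<close>

lemma cauchyI:
  assumes "\<And>n. W n \<in> carrier R" "X \<in> C" "Y \<in> C"
    and le: "\<And>m n. u (W m \<ominus> W n) \<le> K * (u (X m \<ominus> X n) + u (Y m \<ominus> Y n))"
  shows "W \<in> C"
  unfolding cauchy_seqs_def
proof (intro CollectI conjI allI impI)
  fix e :: real assume "e > 0"
  \<comment> \<open>Chosen so that \<open>(|K| + 1) * (d + d) = e\<close>; the added 1 keeps the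
    factor positive whatever \<open>K\<close> is.\<close>
  define d where "d = e / (2 * (\<bar>K\<bar> + 1))"
  have d: "d > 0" using \<open>e > 0\<close> by (simp add: d_def)
  obtain M N where M: "\<forall>m\<ge>M. \<forall>n\<ge>M. u (X m \<ominus> X n) < d" and N: "\<forall>m\<ge>N. \<forall>n\<ge>N. u (Y m \<ominus> Y n) < d"
    using cauchyD[OF assms(2) d] cauchyD[OF assms(3) d] by auto
  have "u (W m \<ominus> W n) < e" if "m \<ge> max M N" "n \<ge> max M N" for m n
  proof -
    have 0: "0 \<le> u (X m \<ominus> X n)" "0 \<le> u (Y m \<ominus> Y n)"
      using assms(2,3) by (simp_all add: u_nonneg cauchy_carrier)
    have "u (W m \<ominus> W n) \<le> K * (u (X m \<ominus> X n) + u (Y m \<ominus> Y n))" by (rule le)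
    also have "\<dots> \<le> (\<bar>K\<bar> + 1) * (u (X m \<ominus> X n) + u (Y m \<ominus> Y n))"
      using 0 by (intro mult_right_mono) auto
    also have "\<dots> < (\<bar>K\<bar> + 1) * (d + d)"
      using M N that by (intro mult_strict_left_mono add_strict_mono) auto
    also have "\<dots> = (2 * (\<bar>K\<bar> + 1)) * d" by (simp add: algebra_simps)
    also have "\<dots> = e" unfolding d_def by (rule nonzero_mult_div_cancel_left[OF _, of _ e, unfolded times_divide_eq_right[symmetric]]) auto
    finally show ?thesis .
  qed
  then show "\<exists>M. \<forall>m\<ge>M. \<forall>n\<ge>M. u (W m \<ominus> W n) < e" by blast
qed (use assms in auto)

lemma nullI:
  assumes "W \<in> C" "W' \<in> C" "(X, X') \<in> null_rel R E" "(Y, Y') \<in> null_rel R E"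
    and le: "\<And>n. u (W n \<ominus> W' n) \<le> K * (u (X n \<ominus> X' n) + u (Y n \<ominus> Y' n))"
  shows "(W, W') \<in> null_rel R E"
proof -
  have "(\<lambda>n. K * (u (X n \<ominus> X' n) + u (Y n \<ominus> Y' n))) \<longlonglongrightarrow> K * (0 + 0)"
    using assms unfolding null_rel_def by (intro tendsto_intros) auto
  then have lim: "(\<lambda>n. K * (u (X n \<ominus> X' n) + u (Y n \<ominus> Y' n))) \<longlonglongrightarrow> 0" by simp
  have "0 \<le> u (W n \<ominus> W' n)" for n
    by (intro u_nonneg minus_closed cauchy_carrier assms)
  then have "(\<lambda>n. u (W n \<ominus> W' n)) \<longlonglongrightarrow> 0"
    using le by (intro tendsto_sandwich[OF _ _ tendsto_const lim] always_eventually allI)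
  then show ?thesis using assms unfolding null_rel_def by auto
qed

lemma cauchy_const: "a \<in> carrier R \<Longrightarrow> (\<lambda>_. a) \<in> C"
  unfolding cauchy_seqs_def by (auto simp: a_minus_def r_neg u_zero)

lemma cauchy_norm_convergent: "X \<in> C \<Longrightarrow> convergent (\<lambda>n. u (X n))"
proof -
  assume X: "X \<in> C"
  have "Cauchy (\<lambda>n. u (X n))"
  proof (rule metric_CauchyI)
    fix e :: real assume "e > 0"
    then obtain M where "\<forall>m\<ge>M. \<forall>n\<ge>M. u (X m \<ominus> X n) < e" using cauchyD[OF X] by blast
    then show "\<exists>M. \<forall>m\<ge>M. \<forall>n\<ge>M. dist (u (X m)) (u (X n)) < e"
      using u_diff[OF cauchy_carrier[OF X] cauchy_carrier[OF X]]
      by (metis dist_real_def order_le_less_trans)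
  qed
  then show ?thesis by (simp add: Cauchy_convergent)
qed

lemma cauchy_bounded: "X \<in> C \<Longrightarrow> \<exists>K\<ge>0. \<forall>n. u (X n) \<le> K"
  using convergent_imp_Bseq[OF cauchy_norm_convergent] unfolding Bseq_def
  by (metis abs_le_D1 less_imp_le real_norm_def)

text \<open>Inserting the product of \<open>a\<close> and \<open>b'\<close> splits the difference so
  that only these two factors need a bound.\<close>

lemma mult_diff_le:
  assumes "a \<in> carrier R" "b \<in> carrier R" "a' \<in> carrier R" "b' \<in> carrier R" "u a \<le> K" "u b' \<le> K"
  shows "u (a \<otimes> b \<ominus> a' \<otimes> b') \<le> K * (u (a \<ominus> a') + u (b \<ominus> b'))"
proof -
  have "u (a \<otimes> b \<ominus> a' \<otimes> b') \<le> u (a \<otimes> b \<ominus> a \<otimes> b') + u (a \<otimes> b' \<ominus> a' \<otimes> b')"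
    using assms by (intro u_triangle) auto
  also have "a \<otimes> b \<ominus> a \<otimes> b' = a \<otimes> (b \<ominus> b')" using assms by (simp add: a_minus_def r_distr r_minus)
  also have "a \<otimes> b' \<ominus> a' \<otimes> b' = (a \<ominus> a') \<otimes> b'" using assms by (simp add: a_minus_def l_distr l_minus)
  also have "u (a \<otimes> (b \<ominus> b')) + u ((a \<ominus> a') \<otimes> b') \<le> u a * u (b \<ominus> b') + u (a \<ominus> a') * u b'"
    using assms by (intro add_mono u_mult) auto
  also have "\<dots> \<le> K * u (b \<ominus> b') + u (a \<ominus> a') * K"
    using assms by (intro add_mono mult_right_mono mult_left_mono u_nonneg) auto
  finally show ?thesis by (simp add: algebra_simps)
qed

lemma add_diff_le:
  assumes "a \<in> carrier R" "b \<in> carrier R" "a' \<in> carrier R" "b' \<in> carrier R"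
  shows "u ((a \<oplus> b) \<ominus> (a' \<oplus> b')) \<le> 1 * (u (a \<ominus> a') + u (b \<ominus> b'))"
proof -
  have "(a \<oplus> b) \<ominus> (a' \<oplus> b') = (a \<ominus> a') \<oplus> (b \<ominus> b')"
    using assms by (simp add: a_minus_def minus_add a_ac)
  then show ?thesis using u_add[of "a \<ominus> a'" "b \<ominus> b'"] assms by simp
qed

lemma smult_diff:
  "a \<in> carrier R \<Longrightarrow> a' \<in> carrier R \<Longrightarrow> u (c \<odot> a \<ominus> c \<odot> a') = cmod c * u (a \<ominus> a')"
proof -
  assume "a \<in> carrier R" "a' \<in> carrier R"
  moreover from this have "c \<odot> a \<ominus> c \<odot> a' = c \<odot> (a \<ominus> a')"
    using smult_smult[of a' c "-1"] smult_smult[of a' "-1" c]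
    by (simp add: a_minus_def smult_add_right smult_minus_1[symmetric])
  ultimately show ?thesis by (simp add: u_smult)
qed

lemma adj_diff:
  "a \<in> carrier R \<Longrightarrow> a' \<in> carrier R \<Longrightarrow> u (adj R a \<ominus> adj R a') = u (a \<ominus> a')"
  using u_adj[of "a \<ominus> a'"] by (simp add: a_minus_def adj_add adj_minus)

lemma cauchy_add [simp]: "X \<in> C \<Longrightarrow> Y \<in> C \<Longrightarrow> (\<lambda>n. X n \<oplus> Y n) \<in> C"
  by (rule cauchyI[of _ X Y 1]) (use add_diff_le in \<open>auto simp: cauchy_carrier\<close>)

lemma cauchy_smult [simp]: "X \<in> C \<Longrightarrow> (\<lambda>n. c \<odot> X n) \<in> C"
  by (rule cauchyI[of _ X X "cmod c"]) (auto simp: cauchy_carrier smult_diff mult_left_mono u_nonneg)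

lemma cauchy_adj [simp]: "X \<in> C \<Longrightarrow> (\<lambda>n. adj R (X n)) \<in> C"
  by (rule cauchyI[of _ X X 1]) (auto simp: cauchy_carrier adj_diff u_nonneg)

lemma cauchy_mult [simp]: "X \<in> C \<Longrightarrow> Y \<in> C \<Longrightarrow> (\<lambda>n. X n \<otimes> Y n) \<in> C"
proof -
  assume *: "X \<in> C" "Y \<in> C"
  obtain K L where "\<forall>n. u (X n) \<le> K" "\<forall>n. u (Y n) \<le> L" using * cauchy_bounded by metis
  then have "u (X n) \<le> max K L" "u (Y n) \<le> max K L" for n by (simp_all add: le_max_iff_disj)
  note b = this
  show ?thesis
    by (rule cauchyI[OF _ *, of _ "max K L"]) (intro mult_diff_le m_closed cauchy_carrier * b)+
qed

lemma cauchy_uminus [simp]: "X \<in> C \<Longrightarrow> (\<lambda>n. \<ominus> X n) \<in> C"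
  using cauchy_smult[of X "-1"] by (simp add: smult_minus_1 cauchy_carrier)

lemma cauchy_minus [simp]: "X \<in> C \<Longrightarrow> Y \<in> C \<Longrightarrow> (\<lambda>n. X n \<ominus> Y n) \<in> C"
  using cauchy_add[of X "\<lambda>n. \<ominus> Y n"] by (simp add: a_minus_def)

lemma equiv_null: "equiv C (null_rel R E)"
proof (rule equivI)
  show "null_rel R E \<subseteq> C \<times> C" unfolding null_rel_def by auto
  show "refl_on C (null_rel R E)"
    unfolding refl_on_def null_rel_def by (auto simp: a_minus_def r_neg u_zero cauchy_carrier)
  show "sym (null_rel R E)"
    unfolding sym_def null_rel_def by (auto simp: u_commute cauchy_carrier)
  show "trans (null_rel R E)"
  proof (rule transI)
    fix X Y Z assume *: "(X, Y) \<in> null_rel R E" "(Y, Z) \<in> null_rel R E"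
    then have "X \<in> C" "Y \<in> C" "Z \<in> C" unfolding null_rel_def by auto
    then show "(X, Z) \<in> null_rel R E"
      by (intro nullI[OF _ _ *, of X Z 1]) (auto intro!: u_triangle simp: cauchy_carrier)
  qed
qed

lemma cls_eqI: "X \<in> C \<Longrightarrow> Y \<in> C \<Longrightarrow> (\<lambda>n. u (X n \<ominus> Y n)) \<longlonglongrightarrow> 0 \<Longrightarrow> cls X = cls Y"
  by (rule equiv_class_eq[OF equiv_null]) (auto simp: null_rel_def)

lemma cls_self: "X \<in> C \<Longrightarrow> X \<in> cls X"
  using equiv_class_self[OF equiv_null] .

lemma Q_carrier: "carrier Q = cls ` C"
  unfolding envelope_def by (auto simp: quotient_def)

lemma Q_closed [simp]: "X \<in> C \<Longrightarrow> cls X \<in> carrier Q"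
  by (simp add: Q_carrier)

lemma Q_cases:
  assumes "a \<in> carrier Q"
  obtains X where "X \<in> C" "\<forall>n. X n \<in> carrier R" "a = cls X"
  using assms cauchy_carrier by (auto simp: Q_carrier)

lemma null_cauchy: "(X, Y) \<in> null_rel R E \<Longrightarrow> X \<in> C \<and> Y \<in> C"
  unfolding null_rel_def by auto

text \<open>The union over representatives in \<open>envelope\<close> is a single class as soon as
  the class of the termwise result does not depend on the representatives. The other operations are
  treated alike.\<close>

lemma Q_add [simp]:
  assumes "X \<in> C" "Y \<in> C" shows "cls X \<oplus>\<^bsub>Q\<^esub> cls Y = cls (\<lambda>n. X n \<oplus> Y n)"
proof -
  have "(\<lambda>X Y. cls (\<lambda>n. X n \<oplus> Y n)) respects2 (null_rel R E)"
  proof (rule congruent2I'; rule equiv_class_eq[OF equiv_null])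
    fix X X' Y Y' assume *: "(X, X') \<in> null_rel R E" "(Y, Y') \<in> null_rel R E"
    then have "X \<in> C" "X' \<in> C" "Y \<in> C" "Y' \<in> C" using null_cauchy by auto
    then show "(\<lambda>n. X n \<oplus> Y n, \<lambda>n. X' n \<oplus> Y' n) \<in> null_rel R E"
      by (intro nullI[OF _ _ *, of _ _ 1] add_diff_le cauchy_add cauchy_carrier)
  qed
  then show ?thesis using assms
    by (simp add: envelope_def UN_equiv_class2[OF equiv_null equiv_null])
qed

lemma Q_mult [simp]:
  assumes "X \<in> C" "Y \<in> C" shows "cls X \<otimes>\<^bsub>Q\<^esub> cls Y = cls (\<lambda>n. X n \<otimes> Y n)"
proof -
  have "(\<lambda>X Y. cls (\<lambda>n. X n \<otimes> Y n)) respects2 (null_rel R E)"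
  proof (rule congruent2I'; rule equiv_class_eq[OF equiv_null])
    fix X X' Y Y' assume *: "(X, X') \<in> null_rel R E" "(Y, Y') \<in> null_rel R E"
    then obtain K L where "\<forall>n. u (X n) \<le> K" "\<forall>n. u (Y' n) \<le> L"
      using cauchy_bounded null_cauchy by metis
    then have "u (X n) \<le> max K L" "u (Y' n) \<le> max K L" for n by (simp_all add: le_max_iff_disj)
    moreover have "X \<in> C" "X' \<in> C" "Y \<in> C" "Y' \<in> C" using null_cauchy * by auto
    ultimately show "(\<lambda>n. X n \<otimes> Y n, \<lambda>n. X' n \<otimes> Y' n) \<in> null_rel R E"
      by (intro nullI[OF _ _ *, of _ _ "max K L"] mult_diff_le cauchy_mult cauchy_carrier)
  qed
  then show ?thesis using assms
    by (simp add: envelope_def UN_equiv_class2[OF equiv_null equiv_null])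
qed

lemma Q_smult [simp]:
  assumes "X \<in> C" shows "c \<odot>\<^bsub>Q\<^esub> cls X = cls (\<lambda>n. c \<odot> X n)"
proof -
  have "(\<lambda>X. cls (\<lambda>n. c \<odot> X n)) respects (null_rel R E)"
  proof (rule congruentI; rule equiv_class_eq[OF equiv_null])
    fix X X' assume *: "(X, X') \<in> null_rel R E"
    then have "0 \<le> u (X n \<ominus> X' n)" for n using null_cauchy by (simp add: u_nonneg cauchy_carrier)
    then show "(\<lambda>n. c \<odot> X n, \<lambda>n. c \<odot> X' n) \<in> null_rel R E"
      using null_cauchy *
      by (intro nullI[OF _ _ * *, of _ _ "cmod c"])
         (auto simp: cauchy_carrier smult_diff intro!: mult_left_mono)
  qed
  then show ?thesis using assms
    by (simp add: envelope_def UN_equiv_class[OF equiv_null])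
qed

lemma Q_adj [simp]:
  assumes "X \<in> C" shows "adj Q (cls X) = cls (\<lambda>n. adj R (X n))"
proof -
  have "(\<lambda>X. cls (\<lambda>n. adj R (X n))) respects (null_rel R E)"
  proof (rule congruentI; rule equiv_class_eq[OF equiv_null])
    fix X X' assume *: "(X, X') \<in> null_rel R E"
    then have "0 \<le> u (X n \<ominus> X' n)" for n using null_cauchy by (simp add: u_nonneg cauchy_carrier)
    then show "(\<lambda>n. adj R (X n), \<lambda>n. adj R (X' n)) \<in> null_rel R E"
      using null_cauchy *
      by (intro nullI[OF _ _ * *, of _ _ 1])
         (auto simp: cauchy_carrier adj_diff)
  qed
  then show ?thesis using assms
    by (simp add: envelope_def UN_equiv_class[OF equiv_null])
qed

lemma cauchy_one [simp]: "(\<lambda>_. \<one>) \<in> C" and cauchy_zero [simp]: "(\<lambda>_. \<zero>) \<in> C"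
  by (simp_all add: cauchy_const)

lemma Q_one: "\<one>\<^bsub>Q\<^esub> = cls (\<lambda>_. \<one>)" and Q_zero: "\<zero>\<^bsub>Q\<^esub> = cls (\<lambda>_. \<zero>)"
  by (simp_all add: envelope_def)

lemma Q_star_alg: "star_alg Q"
proof -
  have "ring Q"
  proof (rule ringI)
    show "abelian_group Q"
    proof (rule abelian_groupI)
      fix a assume "a \<in> carrier Q"
      then obtain X where X: "X \<in> C" "\<forall>n. X n \<in> carrier R" "a = cls X" by (rule Q_cases)
      then show "\<exists>b\<in>carrier Q. b \<oplus>\<^bsub>Q\<^esub> a = \<zero>\<^bsub>Q\<^esub>"
        by (intro bexI[of _ "cls (\<lambda>n. \<ominus> X n)"]) (simp_all add: Q_zero l_neg)
    qed (auto elim!: Q_cases simp: Q_zero a_ac)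
    show "monoid Q"
      by (rule monoidI) (auto elim!: Q_cases simp: Q_one m_assoc)
  qed (auto elim!: Q_cases simp: l_distr r_distr)
  then show ?thesis
    by (intro star_alg.intro star_alg_axioms.intro)
       (auto elim!: Q_cases simp: smult_add_right smult_add_left smult_smult smult_mult_left
         smult_mult_right adj_add adj_mult adj_smult)
qed

interpretation Q: star_alg Q by (rule Q_star_alg)

lemma Q_uminus: "X \<in> C \<Longrightarrow> \<ominus>\<^bsub>Q\<^esub> cls X = cls (\<lambda>n. \<ominus> X n)"
  by (rule Q.minus_equality) (simp_all add: Q_zero cauchy_carrier l_neg)

lemma Q_minus: "X \<in> C \<Longrightarrow> Y \<in> C \<Longrightarrow> cls X \<ominus>\<^bsub>Q\<^esub> cls Y = cls (\<lambda>n. X n \<ominus> Y n)"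
  by (simp add: a_minus_def Q_uminus)

text \<open>The \<open>THE\<close> in \<open>cnorm\<close> is legitimate: by the reverse triangle
  inequality the seminorms of a Cauchy sequence converge, and equivalent sequences have the same
  limit.\<close>

lemma cnorm_tendsto:
  assumes X: "X \<in> C" shows "(\<lambda>n. u (X n)) \<longlonglongrightarrow> cnorm Q (cls X)"
proof -
  obtain r where r: "(\<lambda>n. u (X n)) \<longlonglongrightarrow> r"
    using cauchy_norm_convergent[OF X] unfolding convergent_def by auto
  have *: "(\<lambda>n. u (Y n)) \<longlonglongrightarrow> r" if "Y \<in> cls X" for Y
  proof -
    have Y: "Y \<in> C" "(\<lambda>n. u (X n \<ominus> Y n)) \<longlonglongrightarrow> 0" using that by (auto simp: null_rel_def)
    have "(\<lambda>n. u (X n) - u (Y n)) \<longlonglongrightarrow> 0"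
      by (rule Lim_null_comparison[OF _ Y(2)])
         (auto simp: u_diff cauchy_carrier X Y(1))
    from tendsto_diff[OF r this] show ?thesis by simp
  qed
  have "cnorm Q (cls X) = (THE r. \<forall>Y\<in>cls X. (\<lambda>n. u (Y n)) \<longlonglongrightarrow> r)"
    by (simp add: envelope_def)
  also have "\<dots> = r"
    using * cls_self[OF X] by (intro the_equality) (auto intro: LIMSEQ_unique)
  finally show ?thesis using r by simp
qed

lemma Q_cstar_seminorm: "cstar_seminorm Q (cnorm Q)"
  unfolding cstar_seminorm_def
proof (intro conjI ballI allI)
  fix a assume "a \<in> carrier Q"
  then obtain X where X: "X \<in> C" "\<forall>n. X n \<in> carrier R" and a: "a = cls X" by (rule Q_cases)
  note lim = cnorm_tendsto[OF X(1)]
  show "0 \<le> cnorm Q a"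
    unfolding a by (rule LIMSEQ_le_const[OF lim]) (auto simp: X u_nonneg)
  show "cnorm Q (c \<odot>\<^bsub>Q\<^esub> a) = cmod c * cnorm Q a" for c
    using X cnorm_tendsto[of "\<lambda>n. c \<odot> X n"] LIMSEQ_unique[OF tendsto_mult_left[OF lim, of "cmod c"]]
    by (simp add: a u_smult)
  show "cnorm Q (adj Q a \<otimes>\<^bsub>Q\<^esub> a) = (cnorm Q a)\<^sup>2"
    using X cnorm_tendsto[of "\<lambda>n. adj R (X n) \<otimes> X n"] LIMSEQ_unique[OF tendsto_power[OF lim, of 2]]
    by (simp add: a u_cstar)
  fix b assume "b \<in> carrier Q"
  then obtain Y where Y: "Y \<in> C" "\<forall>n. Y n \<in> carrier R" and b: "b = cls Y" by (rule Q_cases)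
  note lim' = cnorm_tendsto[OF Y(1)]
  show "cnorm Q (a \<oplus>\<^bsub>Q\<^esub> b) \<le> cnorm Q a + cnorm Q b"
    using X Y LIMSEQ_le[OF cnorm_tendsto[of "\<lambda>n. X n \<oplus> Y n"] tendsto_add[OF lim lim']]
    by (simp add: a b u_add)
  show "cnorm Q (a \<otimes>\<^bsub>Q\<^esub> b) \<le> cnorm Q a * cnorm Q b"
    using X Y LIMSEQ_le[OF cnorm_tendsto[of "\<lambda>n. X n \<otimes> Y n"] tendsto_mult[OF lim lim']]
    by (simp add: a b u_mult)
qed

lemma Q_cnorm_zero: "a \<in> carrier Q \<Longrightarrow> cnorm Q a = 0 \<Longrightarrow> a = \<zero>\<^bsub>Q\<^esub>"
proof (erule Q_cases)
  fix X assume X: "X \<in> C" "\<forall>n. X n \<in> carrier R" and a: "a = cls X" and "cnorm Q a = 0"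
  then have "(\<lambda>n. u (X n \<ominus> \<zero>)) \<longlonglongrightarrow> 0" using cnorm_tendsto[OF X(1)] by (simp add: a_minus_def)
  then show ?thesis unfolding a Q_zero using X by (intro cls_eqI) auto
qed

lemma emb_closed [simp]: "a \<in> carrier R \<Longrightarrow> emb a \<in> carrier Q"
  by (simp add: envelope_emb_def cauchy_const)

lemma emb_hom: "star_hom R Q emb"
  unfolding star_hom_def by (auto simp: envelope_emb_def Q_one cauchy_const)

lemma cnorm_emb: "a \<in> carrier R \<Longrightarrow> cnorm Q (emb a) = u a"
  using cnorm_tendsto[of "\<lambda>_. a"] by (simp add: envelope_emb_def cauchy_const LIMSEQ_const_iff)

lemma emb_tendsto:
  assumes X: "X \<in> C" shows "(\<lambda>n. cnorm Q (emb (X n) \<ominus>\<^bsub>Q\<^esub> cls X)) \<longlonglongrightarrow> 0"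
proof (rule LIMSEQ_I)
  fix e :: real assume "e > 0"
  \<comment> \<open>Half of \<open>e\<close>, since the strict Cauchy estimate becomes a weak
    inequality in the limit over \<open>m\<close>.\<close>
  then obtain M where M: "\<forall>m\<ge>M. \<forall>n\<ge>M. u (X m \<ominus> X n) < e/2"
    using cauchyD[OF X, of "e/2"] by auto
  have "norm (cnorm Q (emb (X n) \<ominus>\<^bsub>Q\<^esub> cls X) - 0) < e" if n: "n \<ge> M" for n
  proof -
    have "emb (X n) \<ominus>\<^bsub>Q\<^esub> cls X = cls (\<lambda>m. X n \<ominus> X m)"
      using X by (simp add: envelope_emb_def Q_minus cauchy_carrier cauchy_const[OF cauchy_carrier])
    moreover have "cnorm Q (cls (\<lambda>m. X n \<ominus> X m)) \<le> e/2"
    proof (rule LIMSEQ_le_const2[OF cnorm_tendsto])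
      show "\<exists>N. \<forall>m\<ge>N. u (X n \<ominus> X m) \<le> e/2" using M n by (meson less_imp_le)
    qed (use X cauchy_const[OF cauchy_carrier[OF X, of n]] in auto)
    moreover have "0 \<le> cnorm Q (emb (X n) \<ominus>\<^bsub>Q\<^esub> cls X)"
      using Q.seminorm_nonneg[OF Q_cstar_seminorm] X by (simp add: cauchy_carrier)
    ultimately show ?thesis using \<open>e > 0\<close> by simp
  qed
  then show "\<exists>M. \<forall>n\<ge>M. norm (cnorm Q (emb (X n) \<ominus>\<^bsub>Q\<^esub> cls X) - 0) < e" by blast
qed

end

text \<open>There is no completeness axiom. Where a limit has to be produced, as in
  \<open>cond_exp_ex\<close>, it is the class of an explicit Cauchy sequence in the free
  algebra.\<close>

locale cstar_alg = star_alg R for R :: "('a, 'r) cstar_algebra_scheme" (structure) +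
  assumes cnorm_seminorm: "cstar_seminorm R (cnorm R)"
    and cnorm_zeroD: "a \<in> carrier R \<Longrightarrow> cnorm R a = 0 \<Longrightarrow> a = \<zero>"
begin

lemmas cnorm_nonneg = seminorm_nonneg[OF cnorm_seminorm]
  and cnorm_add = seminorm_add[OF cnorm_seminorm]
  and cnorm_smult = seminorm_smult[OF cnorm_seminorm]
  and cnorm_mult = seminorm_mult[OF cnorm_seminorm]
  and cnorm_cstar = seminorm_cstar[OF cnorm_seminorm]
  and cnorm_zero = seminorm_zero[OF cnorm_seminorm]
  and cnorm_uminus = seminorm_uminus[OF cnorm_seminorm]
  and cnorm_commute = seminorm_minus_commute[OF cnorm_seminorm]
  and cnorm_triangle = seminorm_triangle[OF cnorm_seminorm]
  and cnorm_adj = seminorm_adj[OF cnorm_seminorm]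
  and cnorm_diff = seminorm_diff[OF cnorm_seminorm]

definition tends :: "(nat \<Rightarrow> 'a) \<Rightarrow> 'a \<Rightarrow> bool" where
  "tends X a \<longleftrightarrow> (\<forall>n. X n \<in> carrier R) \<and> a \<in> carrier R \<and> (\<lambda>n. cnorm R (X n \<ominus> a)) \<longlonglongrightarrow> 0"

lemma minus_eq_zeroD: "a \<in> carrier R \<Longrightarrow> b \<in> carrier R \<Longrightarrow> a \<ominus> b = \<zero> \<Longrightarrow> a = b"
  using minus_equality[of a "\<ominus> b"] by (simp add: a_minus_def)

lemma tendsI:
  assumes "\<And>n. X n \<in> carrier R" "a \<in> carrier R" "\<And>n. cnorm R (X n \<ominus> a) \<le> g n" "g \<longlonglongrightarrow> 0"
  shows "tends X a"
  unfolding tends_def using assms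
  by (auto intro!: tendsto_sandwich[OF _ _ tendsto_const, of _ _ _ g] always_eventually cnorm_nonneg)

lemma tends_unique: "tends X a \<Longrightarrow> tends X b \<Longrightarrow> a = b"
proof -
  assume *: "tends X a" "tends X b"
  then have ab: "\<And>n. X n \<in> carrier R" "a \<in> carrier R" "b \<in> carrier R" by (auto simp: tends_def)
  have "(\<lambda>n. cnorm R (X n \<ominus> a) + cnorm R (X n \<ominus> b)) \<longlonglongrightarrow> 0 + 0"
    using * unfolding tends_def by (intro tendsto_add) auto
  moreover have "cnorm R (a \<ominus> b) \<le> cnorm R (X n \<ominus> a) + cnorm R (X n \<ominus> b)" for n
    using cnorm_triangle[of a "X n" b] cnorm_commute[of a "X n"] ab by simp
  ultimately have "cnorm R (a \<ominus> b) \<le> 0"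
    by (intro LIMSEQ_le_const[of _ 0]) auto
  then have "cnorm R (a \<ominus> b) = 0" using cnorm_nonneg[of "a \<ominus> b"] ab by simp
  then show "a = b" using ab cnorm_zeroD minus_eq_zeroD by auto
qed

lemma tends_const: "a \<in> carrier R \<Longrightarrow> tends (\<lambda>_. a) a"
  by (simp add: tends_def a_minus_def r_neg cnorm_zero)

lemma tends_add: "tends X a \<Longrightarrow> tends Y b \<Longrightarrow> tends (\<lambda>n. X n \<oplus> Y n) (a \<oplus> b)"
proof -
  assume *: "tends X a" "tends Y b"
  then have ab: "\<And>n. X n \<in> carrier R" "\<And>n. Y n \<in> carrier R" "a \<in> carrier R" "b \<in> carrier R"
    by (auto simp: tends_def)
  have "(X n \<oplus> Y n) \<ominus> (a \<oplus> b) = (X n \<ominus> a) \<oplus> (Y n \<ominus> b)" for n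
    using ab by (simp add: a_minus_def minus_add a_ac)
  then have "cnorm R ((X n \<oplus> Y n) \<ominus> (a \<oplus> b)) \<le> cnorm R (X n \<ominus> a) + cnorm R (Y n \<ominus> b)" for n
    using ab by (simp add: cnorm_add)
  then show ?thesis using * ab
    by (intro tendsI[of _ _ "\<lambda>n. cnorm R (X n \<ominus> a) + cnorm R (Y n \<ominus> b)"])
       (auto simp: tends_def intro!: tendsto_add_zero)
qed

lemma tends_norm: "tends X a \<Longrightarrow> (\<lambda>n. cnorm R (X n)) \<longlonglongrightarrow> cnorm R a"
  unfolding tends_def
  by (elim conjE, rule LIM_zero_cancel, erule Lim_null_comparison[rotated])
     (auto intro!: always_eventually cnorm_diff)

lemma tends_mult: "tends X a \<Longrightarrow> tends Y b \<Longrightarrow> tends (\<lambda>n. X n \<otimes> Y n) (a \<otimes> b)"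
proof -
  assume *: "tends X a" "tends Y b"
  then have ab: "\<And>n. X n \<in> carrier R" "\<And>n. Y n \<in> carrier R" "a \<in> carrier R" "b \<in> carrier R"
    by (auto simp: tends_def)
  let ?g = "\<lambda>n. cnorm R (X n) * cnorm R (Y n \<ominus> b) + cnorm R (X n \<ominus> a) * cnorm R b"
  have "cnorm R (X n \<otimes> Y n \<ominus> a \<otimes> b) \<le> ?g n" for n
  proof -
    have "cnorm R (X n \<otimes> Y n \<ominus> a \<otimes> b) \<le> cnorm R (X n \<otimes> Y n \<ominus> X n \<otimes> b) + cnorm R (X n \<otimes> b \<ominus> a \<otimes> b)"
      using ab by (intro cnorm_triangle) auto
    also have "X n \<otimes> Y n \<ominus> X n \<otimes> b = X n \<otimes> (Y n \<ominus> b)"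
      using ab by (simp add: a_minus_def r_distr r_minus)
    also have "X n \<otimes> b \<ominus> a \<otimes> b = (X n \<ominus> a) \<otimes> b"
      using ab by (simp add: a_minus_def l_distr l_minus)
    also have "cnorm R (X n \<otimes> (Y n \<ominus> b)) + cnorm R ((X n \<ominus> a) \<otimes> b) \<le> ?g n"
      using ab by (intro add_mono cnorm_mult) auto
    finally show ?thesis .
  qed
  moreover have "?g \<longlonglongrightarrow> cnorm R a * 0 + 0 * cnorm R b"
    using * tends_norm[OF *(1)] unfolding tends_def by (intro tendsto_intros) auto
  ultimately show ?thesis using ab by (intro tendsI[of _ _ ?g]) auto
qed

lemma tends_smult: "tends X a \<Longrightarrow> tends (\<lambda>n. c \<odot> X n) (c \<odot> a)"
proof -
  assume *: "tends X a"
  then have ab: "\<And>n. X n \<in> carrier R" "a \<in> carrier R" by (auto simp: tends_def)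
  have "c \<odot> a = (c \<odot> \<one>) \<otimes> a" "c \<odot> X n = (c \<odot> \<one>) \<otimes> X n" for n
    using ab by (simp_all add: smult_mult_left)
  then show ?thesis using tends_mult[OF tends_const[of "c \<odot> \<one>"] *] by simp
qed

lemma tends_adj: "tends X a \<Longrightarrow> tends (\<lambda>n. adj R (X n)) (adj R a)"
proof -
  assume *: "tends X a"
  then have ab: "\<And>n. X n \<in> carrier R" "a \<in> carrier R" by (auto simp: tends_def)
  have "adj R (X n) \<ominus> adj R a = adj R (X n \<ominus> a)" for n
    using ab by (simp add: a_minus_def adj_add adj_minus)
  then show ?thesis using * ab by (simp add: tends_def cnorm_adj)
qed

text \<open>Approximation instead of sequences, so that closedness under limits needs only the
  triangle inequality.\<close>

definition cl :: "'a set \<Rightarrow> 'a set" where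
  "cl D = {a \<in> carrier R. \<forall>e>0. \<exists>d\<in>D. cnorm R (d \<ominus> a) < e}"

lemma clD: "a \<in> cl D \<Longrightarrow> D \<subseteq> carrier R \<Longrightarrow> \<exists>X. (\<forall>n. X n \<in> D) \<and> tends X a"
proof -
  assume a: "a \<in> cl D" and D: "D \<subseteq> carrier R"
  have "\<exists>d\<in>D. cnorm R (d \<ominus> a) < inverse (real (Suc n))" for n
    using a unfolding cl_def by auto
  then obtain X where X: "\<And>n. X n \<in> D" "\<And>n. cnorm R (X n \<ominus> a) < inverse (real (Suc n))" by metis
  have "tends X a"
    using X D a less_imp_le[OF X(2)] LIMSEQ_inverse_real_of_nat
    by (intro tendsI[of _ _ "\<lambda>n. inverse (real (Suc n))"]) (auto simp: cl_def)
  with X show ?thesis by auto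
qed

lemma clI: "(\<And>n. X n \<in> D) \<Longrightarrow> tends X a \<Longrightarrow> a \<in> cl D"
proof -
  assume X: "\<And>n. X n \<in> D" "tends X a"
  have "\<exists>d\<in>D. cnorm R (d \<ominus> a) < e" if "e > 0" for e
  proof -
    have "\<forall>\<^sub>F n in sequentially. cnorm R (X n \<ominus> a) < e"
      using X that unfolding tends_def by (intro order_tendstoD(2)) auto
    then show ?thesis using X(1) by (auto simp: eventually_sequentially)
  qed
  then show ?thesis using X unfolding cl_def tends_def by auto
qed

lemma cl_superset: "D \<subseteq> carrier R \<Longrightarrow> D \<subseteq> cl D"
  using clI[OF _ tends_const] by fastforce

lemma cl_closed:
  assumes D: "D \<subseteq> carrier R" "\<zero> \<in> D"
    "\<And>a b. a \<in> D \<Longrightarrow> b \<in> D \<Longrightarrow> a \<oplus> b \<in> D \<and> a \<otimes> b \<in> D"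
    "\<And>c a. a \<in> D \<Longrightarrow> c \<odot> a \<in> D" "\<And>a. a \<in> D \<Longrightarrow> adj R a \<in> D"
  shows "closed_star_subalgebra R (cl D)"
  unfolding closed_star_subalgebra_def
proof (intro conjI ballI allI impI)
  show "cl D \<subseteq> carrier R" by (auto simp: cl_def)
  show "\<zero> \<in> cl D" using cl_superset D by auto
  fix a assume "a \<in> cl D"
  from clD[OF this D(1)] obtain X where X: "\<And>n. X n \<in> D" "tends X a" by auto
  show "c \<odot> a \<in> cl D" for c by (rule clI[OF _ tends_smult[OF X(2)]]) (rule D X)+
  show "adj R a \<in> cl D" by (rule clI[OF _ tends_adj[OF X(2)]]) (rule D X)+
  fix b assume "b \<in> cl D"
  from clD[OF this D(1)] obtain Y where Y: "\<And>n. Y n \<in> D" "tends Y b" by auto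
  show "a \<oplus> b \<in> cl D" by (rule clI[OF _ tends_add[OF X(2) Y(2)]]) (use D(3) X(1) Y(1) in blast)
  show "a \<otimes> b \<in> cl D" by (rule clI[OF _ tends_mult[OF X(2) Y(2)]]) (use D(3) X(1) Y(1) in blast)
next
  fix X a assume a: "a \<in> carrier R" and *: "(\<forall>n::nat. X n \<in> cl D) \<and> (\<lambda>n. cnorm R (X n \<ominus> a)) \<longlonglongrightarrow> 0"
  show "a \<in> cl D"
    unfolding cl_def
  proof (intro CollectI conjI allI impI a)
    fix e :: real assume "e > 0"
    then have "\<forall>\<^sub>F n in sequentially. cnorm R (X n \<ominus> a) < e/2"
      using * by (intro order_tendstoD(2)) auto
    then obtain n where n: "cnorm R (X n \<ominus> a) < e/2" by (auto simp: eventually_sequentially)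
    have Xn: "X n \<in> carrier R" "\<forall>e>0. \<exists>d\<in>D. cnorm R (d \<ominus> X n) < e"
      using * by (auto simp: cl_def)
    then obtain d where d: "d \<in> D" "cnorm R (d \<ominus> X n) < e/2"
      using half_gt_zero[OF \<open>e > 0\<close>] by blast
    have "cnorm R (d \<ominus> a) \<le> cnorm R (d \<ominus> X n) + cnorm R (X n \<ominus> a)"
      using d(1) D(1) a Xn(1) by (intro cnorm_triangle) auto
    then show "\<exists>d\<in>D. cnorm R (d \<ominus> a) < e" using n d by (intro bexI[of _ d]) auto
  qed
qed

lemma generated_subset_cl:
  assumes "closed_star_subalgebra R D" "G \<subseteq> D"
  shows "generated_cstar_subalgebra R G \<subseteq> D"
  using assms unfolding generated_cstar_subalgebra_def by auto

lemma generated_closed: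
  assumes "G \<subseteq> carrier R"
  shows "closed_star_subalgebra R (generated_cstar_subalgebra R G)"
    and "G \<subseteq> generated_cstar_subalgebra R G"
proof -
  have "closed_star_subalgebra R (carrier R)" unfolding closed_star_subalgebra_def by auto
  then have 1: "generated_cstar_subalgebra R G \<subseteq> carrier R" using assms by (rule generated_subset_cl)
  let ?H = "generated_cstar_subalgebra R G"
  have mem: "a \<in> ?H \<longleftrightarrow> (\<forall>D. closed_star_subalgebra R D \<and> G \<subseteq> D \<longrightarrow> a \<in> D)" for a
    unfolding generated_cstar_subalgebra_def by simp
  show "closed_star_subalgebra R ?H"
    unfolding closed_star_subalgebra_def
  proof (intro conjI ballI allI impI)
    show "?H \<subseteq> carrier R" by (rule 1)
    show "\<zero> \<in> ?H" by (simp add: mem closed_star_subalgebra_def)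
    fix a b assume "a \<in> ?H" "b \<in> ?H"
    then show "a \<oplus> b \<in> ?H" "a \<otimes> b \<in> ?H" by (simp_all add: mem closed_star_subalgebra_def)
  next
    fix a c assume "a \<in> ?H"
    then show "c \<odot> a \<in> ?H" "adj R a \<in> ?H" by (simp_all add: mem closed_star_subalgebra_def)
  next
    fix X a assume a: "a \<in> carrier R" and X: "(\<forall>n::nat. X n \<in> ?H) \<and> (\<lambda>n. cnorm R (X n \<ominus> a)) \<longlonglongrightarrow> 0"
    show "a \<in> ?H"
      unfolding mem
    proof (intro allI impI)
      fix D assume D: "closed_star_subalgebra R D \<and> G \<subseteq> D"
      then have "\<forall>n. X n \<in> D" using X by (simp add: mem)
      then show "a \<in> D" using D X a unfolding closed_star_subalgebra_def by blast
    qed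
  qed
  show "G \<subseteq> generated_cstar_subalgebra R G"
    unfolding generated_cstar_subalgebra_def by auto
qed

end

context enveloping begin
lemma Q_cstar_alg: "cstar_alg Q"
  using Q_star_alg Q_cstar_seminorm Q_cnorm_zero
  by (simp add: cstar_alg_def cstar_alg_axioms_def)
end

text \<open>Images of relators have to vanish in the universal seminorm of the target, so they may
  be consequences of \<open>F\<close> instead of elements of \<open>F\<close>.\<close>

locale enveloping_hom = R: enveloping R E + S: enveloping S F
  for R :: "('a, 'r) star_algebra_scheme" and E :: "'a set"
    and S :: "('b, 's) star_algebra_scheme" and F :: "'b set" +
  fixes f :: "'a \<Rightarrow> 'b"
  assumes hom: "star_hom R S f" and relators: "\<And>e. e \<in> E \<Longrightarrow> universal_seminorm S F (f e) = 0"
begin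

sublocale f: star_alg_hom R S f by unfold_locales (rule hom)

text \<open>The pullback of the target seminorm vanishes on \<open>E\<close>, hence is one of the
  seminorms in the supremum on the source.\<close>

lemma contractive: "a \<in> carrier R \<Longrightarrow> S.u (f a) \<le> R.u a"
  using R.universal_upper[of "S.u \<circ> f" a] f.seminorm_comp[OF S.universal_cstar_seminorm] relators
  by simp

lemma hom_cauchy: "X \<in> R.C \<Longrightarrow> (\<lambda>n. f (X n)) \<in> S.C"
proof -
  assume X: "X \<in> R.C"
  then have c: "X n \<in> carrier R" for n by (rule R.cauchy_carrier)
  have "S.u (f (X m) \<ominus>\<^bsub>S\<^esub> f (X n)) \<le> R.u (X m \<ominus>\<^bsub>R\<^esub> X n)" for m n
    using contractive[of "X m \<ominus>\<^bsub>R\<^esub> X n"] c by (simp add: f.hom_minus)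
  then show ?thesis using R.cauchyD[OF X] c unfolding cauchy_seqs_def
    by (auto intro: order_le_less_trans; meson order_le_less_trans)
qed

lemma map_cls: "X \<in> R.C \<Longrightarrow> envelope_map S F f (R.cls X) = S.cls (\<lambda>n. f (X n))"
proof -
  assume X: "X \<in> R.C"
  have "(\<lambda>X. S.cls (\<lambda>n. f (X n))) respects (null_rel R E)"
  proof (rule congruentI; rule S.cls_eqI)
    fix X Y assume "(X, Y) \<in> null_rel R E"
    then have XY: "X \<in> R.C" "Y \<in> R.C" "(\<lambda>n. R.u (X n \<ominus>\<^bsub>R\<^esub> Y n)) \<longlonglongrightarrow> 0"
      by (auto simp: null_rel_def)
    show "(\<lambda>n. f (X n)) \<in> S.C" "(\<lambda>n. f (Y n)) \<in> S.C" using hom_cauchy XY by auto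
    have "S.u (f (X n) \<ominus>\<^bsub>S\<^esub> f (Y n)) \<le> R.u (X n \<ominus>\<^bsub>R\<^esub> Y n)" for n
      using contractive[of "X n \<ominus>\<^bsub>R\<^esub> Y n"] XY R.cauchy_carrier by (simp add: f.hom_minus)
    then show "(\<lambda>n. S.u (f (X n) \<ominus>\<^bsub>S\<^esub> f (Y n))) \<longlonglongrightarrow> 0"
      using XY by (intro tendsto_sandwich[OF _ _ tendsto_const XY(3)])
        (auto intro!: always_eventually S.u_nonneg simp: R.cauchy_carrier)
  qed
  then show ?thesis unfolding envelope_map_def using UN_equiv_class[OF R.equiv_null] X by auto
qed

lemma map_emb: "a \<in> carrier R \<Longrightarrow> envelope_map S F f (R.emb a) = S.emb (f a)"
  using map_cls[of "\<lambda>_. a"] by (simp add: envelope_emb_def R.cauchy_const)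

lemma map_hom: "star_hom R.Q S.Q (envelope_map S F f)"
  unfolding star_hom_def
  by (auto elim!: R.Q_cases simp: map_cls hom_cauchy f.hom_add f.hom_mult f.hom_smult f.hom_adj
     R.Q_one S.Q_one)

lemma map_cnorm: "a \<in> carrier R.Q \<Longrightarrow> cnorm S.Q (envelope_map S F f a) \<le> cnorm R.Q a"
proof (erule R.Q_cases)
  fix X assume X: "X \<in> R.C" "\<forall>n. X n \<in> carrier R" "a = R.cls X"
  show ?thesis
    using LIMSEQ_le[OF S.cnorm_tendsto[OF hom_cauchy[OF X(1)]] R.cnorm_tendsto[OF X(1)]] X
    by (auto simp: map_cls contractive)
qed

end

section \<open>The free star-algebra\<close>

definition word_delta :: "('n \<times> bool) list \<Rightarrow> 'n star_poly" where
  "word_delta w = (\<lambda>v. if v = w then 1 else 0)"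

definition word_adj :: "('n \<times> bool) list \<Rightarrow> ('n \<times> bool) list" where
  "word_adj w = map (\<lambda>(i, b). (i, \<not> b)) (rev w)"

lemma word_adj_word_adj [simp]: "word_adj (word_adj w) = w"
  by (simp add: word_adj_def rev_map comp_def case_prod_unfold)

lemma length_word_adj [simp]: "length (word_adj w) = length w"
  by (simp add: word_adj_def)

lemma take_word_adj: "take k (word_adj w) = word_adj (drop (length w - k) w)"
  and drop_word_adj: "drop k (word_adj w) = word_adj (take (length w - k) w)"
  by (simp_all add: word_adj_def take_map drop_map take_rev drop_rev)

abbreviation (input) "free \<equiv> free_star_algebra"

lemma free_simps:
  "carrier free = {p. finite {w. p w \<noteq> 0}}"
  "\<one>\<^bsub>free\<^esub> = word_delta []" "\<zero>\<^bsub>free\<^esub> = (\<lambda>w. 0)"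
  "p \<otimes>\<^bsub>free\<^esub> q = (\<lambda>w. \<Sum>k\<le>length w. p (take k w) * q (drop k w))"
  "p \<oplus>\<^bsub>free\<^esub> q = (\<lambda>w. p w + q w)"
  "c \<odot>\<^bsub>free\<^esub> p = (\<lambda>w. c * p w)"
  "adj free p = (\<lambda>w. cnj (p (word_adj w)))"
  by (simp_all add: free_star_algebra_def word_delta_def word_adj_def fun_eq_iff)

lemma free_closed:
  assumes "finite {w. p w \<noteq> 0}" "finite {w. q w \<noteq> (0::complex)}"
  shows "finite {w. p w + q w \<noteq> 0}" "finite {w. c * p w \<noteq> 0}" "finite {w. - p w \<noteq> 0}"
    and "finite {w. cnj (p (word_adj w)) \<noteq> 0}"
    and "finite {w. (\<Sum>k\<le>length w. p (take k w) * q (drop k w)) \<noteq> 0}"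
proof -
  show "finite {w. p w + q w \<noteq> 0}"
    by (rule finite_subset[OF _ finite_UnI[OF assms]]) auto
  show "finite {w. c * p w \<noteq> 0}" "finite {w. - p w \<noteq> 0}"
    by (rule finite_subset[OF _ assms(1)]; auto)+
  have "{w. cnj (p (word_adj w)) \<noteq> 0} \<subseteq> word_adj ` {w. p w \<noteq> 0}"
    by (auto intro!: image_eqI[of _ word_adj "word_adj _"])
  then show "finite {w. cnj (p (word_adj w)) \<noteq> 0}" using assms(1) finite_surj by blast
  have "{w. (\<Sum>k\<le>length w. p (take k w) * q (drop k w)) \<noteq> 0}
      \<subseteq> (\<lambda>(v, w). v @ w) ` ({w. p w \<noteq> 0} \<times> {w. q w \<noteq> 0})"
  proof
    fix w assume "w \<in> {w. (\<Sum>k\<le>length w. p (take k w) * q (drop k w)) \<noteq> 0}"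
    then obtain k where "p (take k w) * q (drop k w) \<noteq> 0"
      by (auto elim: sum.not_neutral_contains_not_neutral)
    then show "w \<in> (\<lambda>(v, w). v @ w) ` ({w. p w \<noteq> 0} \<times> {w. q w \<noteq> 0})"
      by (intro image_eqI[of _ _ "(take k w, drop k w)"]) auto
  qed
  then show "finite {w. (\<Sum>k\<le>length w. p (take k w) * q (drop k w)) \<noteq> 0}"
    using assms finite_subset by blast
qed

text \<open>Both sides sum over the ways of cutting a word at two places; the pair of cut positions
  \<open>k\<close> and \<open>j \<le> k\<close> becomes \<open>j\<close> together with the length
  \<open>k - j\<close> of the middle piece.\<close>

lemma free_mult_assoc:
  fixes p q r :: "'n star_poly"
  shows "(p \<otimes>\<^bsub>free\<^esub> q) \<otimes>\<^bsub>free\<^esub> r = p \<otimes>\<^bsub>free\<^esub> (q \<otimes>\<^bsub>free\<^esub> r)"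
proof
  fix w :: "('n \<times> bool) list"
  let ?n = "length w"
  have "((p \<otimes>\<^bsub>free\<^esub> q) \<otimes>\<^bsub>free\<^esub> r) w =
      (\<Sum>k\<le>?n. \<Sum>j\<le>k. p (take j w) * q (take (k - j) (drop j w)) * r (drop k w))"
    unfolding free_simps by (intro sum.cong refl) (simp add: sum_distrib_right drop_take min_def)
  also have "\<dots> = (\<Sum>(k, j)\<in>(SIGMA k:{..?n}. {..k}). p (take j w) * q (take (k - j) (drop j w)) * r (drop k w))"
    by (rule sum.Sigma) auto
  also have "\<dots> = (\<Sum>(j, i)\<in>(SIGMA j:{..?n}. {..?n - j}). p (take j w) * (q (take i (drop j w)) * r (drop i (drop j w))))"
    by (rule sum.reindex_bij_witness[of _ "\<lambda>(j, i). (i + j, j)" "\<lambda>(k, j). (j, k - j)"]) (auto simp: mult.assoc)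
  also have "\<dots> = (\<Sum>j\<le>?n. \<Sum>i\<le>?n - j. p (take j w) * (q (take i (drop j w)) * r (drop i (drop j w))))"
    by (rule sum.Sigma[symmetric]) auto
  also have "\<dots> = (p \<otimes>\<^bsub>free\<^esub> (q \<otimes>\<^bsub>free\<^esub> r)) w"
    unfolding free_simps by (simp add: sum_distrib_left)
  finally show "((p \<otimes>\<^bsub>free\<^esub> q) \<otimes>\<^bsub>free\<^esub> r) w = (p \<otimes>\<^bsub>free\<^esub> (q \<otimes>\<^bsub>free\<^esub> r)) w" .
qed

lemma free_mult_one:
  "word_delta [] \<otimes>\<^bsub>free\<^esub> p = p" "p \<otimes>\<^bsub>free\<^esub> word_delta [] = p"
proof -
  have "(\<Sum>k\<le>length w. word_delta [] (take k w) * p (drop k w)) = (\<Sum>k\<le>length w. if k = 0 then p w else 0)" for w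
    by (intro sum.cong refl) (auto simp: word_delta_def)
  then show "word_delta [] \<otimes>\<^bsub>free\<^esub> p = p" by (simp add: free_simps)
  have "(\<Sum>k\<le>length w. p (take k w) * word_delta [] (drop k w)) = (\<Sum>k\<le>length w. if k = length w then p w else 0)" for w
    by (intro sum.cong refl) (auto simp: word_delta_def)
  then show "p \<otimes>\<^bsub>free\<^esub> word_delta [] = p" by (simp add: free_simps)
qed

lemma free_adj_mult:
  fixes p q :: "'n star_poly"
  shows "adj free (p \<otimes>\<^bsub>free\<^esub> q) = adj free q \<otimes>\<^bsub>free\<^esub> adj free p"
proof
  fix w :: "('n \<times> bool) list"
  have "adj free (p \<otimes>\<^bsub>free\<^esub> q) w =
      (\<Sum>k\<le>length w. cnj (p (word_adj (drop (length w - k) w))) * cnj (q (word_adj (take (length w - k) w))))"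
    by (simp add: free_simps take_word_adj drop_word_adj)
  also have "\<dots> = (\<Sum>k\<le>length w. cnj (p (word_adj (drop k w))) * cnj (q (word_adj (take k w))))"
    by (rule sum.reindex_bij_witness[of _ "\<lambda>k. length w - k" "\<lambda>k. length w - k"]) auto
  finally show "adj free (p \<otimes>\<^bsub>free\<^esub> q) w = (adj free q \<otimes>\<^bsub>free\<^esub> adj free p) w"
    by (simp add: free_simps mult.commute)
qed

lemma free_star_alg: "star_alg (free :: 'n star_poly star_algebra)"
proof -
  have "ring (free :: 'n star_poly star_algebra)"
  proof (rule ringI)
    show "abelian_group (free :: 'n star_poly star_algebra)"
    proof (rule abelian_groupI)
      fix p :: "'n star_poly" assume "p \<in> carrier free"
      then show "\<exists>q\<in>carrier free. q \<oplus>\<^bsub>free\<^esub> p = \<zero>\<^bsub>free\<^esub>"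
        by (intro bexI[of _ "\<lambda>w. - p w"]) (auto simp: free_simps)
    qed (auto simp: free_simps free_closed add_ac)
    show "monoid (free :: 'n star_poly star_algebra)"
    proof (rule monoidI)
      fix p q :: "'n star_poly" assume "p \<in> carrier free" "q \<in> carrier free"
      then show "p \<otimes>\<^bsub>free\<^esub> q \<in> carrier free" by (simp add: free_simps free_closed)
    next
      fix p :: "'n star_poly"
      show "\<one>\<^bsub>free\<^esub> \<otimes>\<^bsub>free\<^esub> p = p" "p \<otimes>\<^bsub>free\<^esub> \<one>\<^bsub>free\<^esub> = p"
        using free_mult_one by (simp_all add: free_simps(2))
    next
      show "\<one>\<^bsub>free\<^esub> \<in> carrier (free :: 'n star_poly star_algebra)" by (simp add: free_simps word_delta_def)
    qed (rule free_mult_assoc)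
  qed (auto simp: free_simps sum.distrib algebra_simps)
  moreover have "star_alg_axioms (free :: 'n star_poly star_algebra)"
  proof
    fix p q :: "'n star_poly"
    show "adj free (p \<otimes>\<^bsub>free\<^esub> q) = adj free q \<otimes>\<^bsub>free\<^esub> adj free p" by (rule free_adj_mult)
  qed (auto simp: free_simps free_closed free_closed(4)[simplified] algebra_simps sum_distrib_left)
  ultimately show ?thesis by (simp add: star_alg_def)
qed

interpretation free: star_alg free_star_algebra by (rule free_star_alg)

lemma word_delta_closed [simp]: "word_delta w \<in> carrier free"
  by (simp add: free_simps word_delta_def)

lemma free_gen_delta: "free_gen i = word_delta [(i, False)]"
  and adj_free_gen: "adj free (free_gen i) = word_delta [(i, True)]"
proof -
  show *: "free_gen i = word_delta [(i, False)]" by (simp add: free_gen_def word_delta_def)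
  show "adj free (free_gen i) = word_delta [(i, True)]"
  proof
    fix w
    have "word_adj w = [(i, False)] \<longleftrightarrow> w = word_adj [(i, False)]" by (metis word_adj_word_adj)
    then show "adj free (free_gen i) w = word_delta [(i, True)] w"
      unfolding * by (simp add: free_simps word_delta_def word_adj_def)
  qed
qed

lemma free_gen_closed [simp]: "free_gen i \<in> carrier free"
  by (simp add: free_gen_delta)

text \<open>Among all cuts of a word, only the one after \<open>length v\<close> letters can match
  both factors.\<close>

lemma word_delta_append: "word_delta v \<otimes>\<^bsub>free\<^esub> word_delta w = word_delta (v @ w)"
proof
  fix x
  have "(\<Sum>k\<le>length x. word_delta v (take k x) * word_delta w (drop k x)) =
      (\<Sum>k\<le>length x. if k = length v then word_delta (v @ w) x else 0)"
  proof (intro sum.cong refl)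
    fix k assume k: "k \<in> {..length x}"
    have "take k x = v \<and> drop k x = w \<longleftrightarrow> k = length v \<and> x = v @ w"
    proof
      assume *: "take k x = v \<and> drop k x = w"
      then show "k = length v \<and> x = v @ w"
        using k append_take_drop_id[of k x] by (metis atMost_iff length_take min.absorb2)
    qed simp
    moreover have "word_delta v (take k x) * word_delta w (drop k x) =
        (if take k x = v \<and> drop k x = w then 1 else 0)"
      unfolding word_delta_def by ((cases "take k x = v"; cases "drop k x = w"; simp only: simp_thms if_True if_False mult_1 mult_zero_left mult_zero_right) | (cases "k = length v"; cases "x = v @ w"; simp only: simp_thms if_True if_False))
    moreover have "(if k = length v then word_delta (v @ w) x else 0) =
        (if k = length v \<and> x = v @ w then 1 else 0)"
      unfolding word_delta_def by ((cases "take k x = v"; cases "drop k x = w"; simp only: simp_thms if_True if_False mult_1 mult_zero_left mult_zero_right) | (cases "k = length v"; cases "x = v @ w"; simp only: simp_thms if_True if_False))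
    ultimately show "word_delta v (take k x) * word_delta w (drop k x) = (if k = length v then word_delta (v @ w) x else 0)"
      by presburger
  qed
  then show "(word_delta v \<otimes>\<^bsub>free\<^esub> word_delta w) x = word_delta (v @ w) x"
    by (auto simp: free_simps word_delta_def)
qed

lemma word_delta_Cons:
  "word_delta ((i, b) # w) = (if b then adj free (free_gen i) else free_gen i) \<otimes>\<^bsub>free\<^esub> word_delta w"
  by (simp add: free_gen_delta[of i] adj_free_gen[unfolded free_gen_delta] word_delta_append)

lemma adj_word_delta: "adj free (word_delta w) = word_delta (word_adj w)"
  by (auto simp: free_simps word_delta_def fun_eq_iff)

lemma free_induct [consumes 1, case_names zero delta add]:
  assumes p: "p \<in> carrier free" and zero: "P \<zero>\<^bsub>free\<^esub>"
    and delta: "\<And>c w. P (c \<odot>\<^bsub>free\<^esub> word_delta w)"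
    and add: "\<And>p q. p \<in> carrier free \<Longrightarrow> q \<in> carrier free \<Longrightarrow> P p \<Longrightarrow> P q \<Longrightarrow> P (p \<oplus>\<^bsub>free\<^esub> q)"
  shows "P p"
proof -
  \<comment> \<open>Induction over a finite superset of the support: the coefficient removed in a
    step may already be 0.\<close>
  have "finite S \<Longrightarrow> {w. p w \<noteq> 0} \<subseteq> S \<Longrightarrow> P p" for S p
  proof (induction S arbitrary: p rule: finite_induct)
    case empty
    then have "p = \<zero>\<^bsub>free\<^esub>" by (auto simp: free_simps)
    then show ?case using zero by simp
  next
    case (insert w S)
    have *: "p = (p w \<odot>\<^bsub>free\<^esub> word_delta w) \<oplus>\<^bsub>free\<^esub> p(w := 0)"
      by (auto simp: free_simps word_delta_def)
    have 2: "{v. (p(w := 0)) v \<noteq> 0} \<subseteq> S" using insert by auto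
    then have "p(w := 0) \<in> carrier free"
      using finite_subset[OF 2 insert(1)] by (simp add: free_simps)
    then have "P ((p w \<odot>\<^bsub>free\<^esub> word_delta w) \<oplus>\<^bsub>free\<^esub> p(w := 0))"
      by (intro add delta insert.IH[OF 2] free.smult_closed word_delta_closed)
    then show ?case unfolding *[symmetric] .
  qed
  then show ?thesis using p by (auto simp: free_simps)
qed

text \<open>The uniqueness half of freeness: words are products of generators and their adjoints,
  and every polynomial is a linear combination of words.\<close>

lemma star_hom_free_eqI:
  assumes f: "star_hom free R f" and g: "star_hom free R g" and R: "star_alg R"
    and gen: "\<And>i. f (free_gen i) = g (free_gen i)"
    and p: "p \<in> carrier free"
  shows "f p = g p"
proof -
  interpret R: star_alg R by (rule R)
  interpret f: star_alg_hom free R f by unfold_locales (rule f)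
  interpret g: star_alg_hom free R g by unfold_locales (rule g)
  have word: "f (word_delta w) = g (word_delta w)" for w
  proof (induction w)
    case Nil
    then show ?case using f.hom_one g.hom_one by (simp add: free_simps(2))
  next
    case (Cons a w)
    then show ?case
      by (cases a) (simp add: word_delta_Cons f.hom_mult g.hom_mult f.hom_adj g.hom_adj gen)
  qed
  show ?thesis using p
    by (induction rule: free_induct)
       (simp_all add: f.hom_smult g.hom_smult f.hom_add g.hom_add word)
qed

section \<open>Evaluation of polynomials at elements of a star-algebra\<close>

context star_alg
begin

context
  fixes t :: "'n \<Rightarrow> 'a" assumes t: "\<And>i. t i \<in> carrier R"
begin

lemma eval_word_closed [simp]: "eval_word R t w \<in> carrier R"
proof (induction w)
  case (Cons a w)
  then show ?case by (cases a) (simp add: t)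
qed simp

lemma eval_word_append: "eval_word R t (v @ w) = eval_word R t v \<otimes> eval_word R t w"
proof (induction v)
  case (Cons a v)
  then show ?case by (cases a) (simp add: m_assoc t)
qed simp

lemma eval_word_adj: "eval_word R t (word_adj w) = adj R (eval_word R t w)"
proof (induction w)
  case Nil
  then show ?case by (simp add: word_adj_def)
next
  case (Cons a w)
  have "word_adj (a # w) = word_adj w @ [(fst a, \<not> snd a)]"
    by (simp add: word_adj_def case_prod_unfold)
  with Cons show ?case by (cases a) (auto simp: eval_word_append adj_mult t)
qed

text \<open>Polynomials with different supports become comparable once their sums run over a common
  finite set.\<close>

lemma eval_poly_superset:
  assumes "finite W" "{w. p w \<noteq> 0} \<subseteq> W"
  shows "eval_poly R t p = (\<Oplus>w\<in>W. p w \<odot> eval_word R t w)"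
  unfolding eval_poly_def
  by (rule add.finprod_mono_neutral_cong_left) (use assms in auto)

lemma eval_poly_closed [simp]: "eval_poly R t p \<in> carrier R"
  unfolding eval_poly_def by (auto intro: finsum_closed)

lemma eval_poly_add:
  assumes "p \<in> carrier free" "q \<in> carrier free"
  shows "eval_poly R t (p \<oplus>\<^bsub>free\<^esub> q) = eval_poly R t p \<oplus> eval_poly R t q"
proof -
  let ?W = "{w. p w \<noteq> 0} \<union> {w. q w \<noteq> 0}"
  have W: "finite ?W" using assms by (auto simp: free_simps)
  have "eval_poly R t (p \<oplus>\<^bsub>free\<^esub> q) = (\<Oplus>w\<in>?W. p w \<odot> eval_word R t w \<oplus> q w \<odot> eval_word R t w)"
    by (subst eval_poly_superset[OF W]) (auto simp: free_simps smult_add_left)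
  also have "\<dots> = eval_poly R t p \<oplus> eval_poly R t q"
    by (subst finsum_addf) (auto simp: eval_poly_superset[OF W])
  finally show ?thesis .
qed

lemma eval_poly_delta: "eval_poly R t (c \<odot>\<^bsub>free\<^esub> word_delta w) = c \<odot> eval_word R t w"
proof -
  have "eval_poly R t (c \<odot>\<^bsub>free\<^esub> word_delta w) = (\<Oplus>v\<in>{w}. (c \<odot>\<^bsub>free\<^esub> word_delta w) v \<odot> eval_word R t v)"
    by (rule eval_poly_superset) (auto simp: free_simps word_delta_def)
  then show ?thesis by (simp add: free_simps word_delta_def)
qed

lemma eval_poly_zero: "eval_poly R t \<zero>\<^bsub>free\<^esub> = \<zero>"
  using eval_poly_delta[of 0 "[]"] by simp

text \<open>By bilinearity it is enough to treat two monomials, where multiplication is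
  concatenation; hence one induction inside the other.\<close>

lemma eval_poly_mult:
  assumes "p \<in> carrier free" "q \<in> carrier free"
  shows "eval_poly R t (p \<otimes>\<^bsub>free\<^esub> q) = eval_poly R t p \<otimes> eval_poly R t q"
  using assms(1)
proof (induction rule: free_induct)
  case zero
  then show ?case using assms by (simp add: eval_poly_zero)
next
  case (delta c v)
  show ?case using assms(2)
  proof (induction rule: free_induct)
    case zero
    then show ?case by (simp add: eval_poly_zero)
  next
    case (delta d w)
    have "(c \<odot>\<^bsub>free\<^esub> word_delta v) \<otimes>\<^bsub>free\<^esub> (d \<odot>\<^bsub>free\<^esub> word_delta w) = (c * d) \<odot>\<^bsub>free\<^esub> word_delta (v @ w)"
      by (simp add: free.smult_mult_left free.smult_mult_right free.smult_smult word_delta_append mult.commute)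
    then show ?case
      by (simp only: eval_poly_delta)
         (simp add: eval_word_append smult_mult_left smult_mult_right smult_smult mult.commute)
  next
    case (add p q)
    then show ?case by (simp add: free.r_distr eval_poly_add r_distr)
  qed
next
  case (add p p')
  then show ?case using assms by (simp add: free.l_distr eval_poly_add l_distr)
qed

lemma eval_poly_adj:
  assumes "p \<in> carrier free"
  shows "eval_poly R t (adj free p) = adj R (eval_poly R t p)"
  using assms
proof (induction rule: free_induct)
  case (delta c w)
  have "adj free (c \<odot>\<^bsub>free\<^esub> word_delta w) = cnj c \<odot>\<^bsub>free\<^esub> word_delta (word_adj w)"
    by (simp add: free.adj_smult adj_word_delta)
  then show ?case by (simp add: eval_poly_delta eval_word_adj adj_smult)
qed (simp_all add: eval_poly_zero eval_poly_add free.adj_add adj_add)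

lemma eval_poly_smult:
  assumes "p \<in> carrier free"
  shows "eval_poly R t (c \<odot>\<^bsub>free\<^esub> p) = c \<odot> eval_poly R t p"
  using assms
proof (induction rule: free_induct)
  case (delta d w)
  then show ?case by (simp add: free.smult_smult eval_poly_delta smult_smult)
qed (simp_all add: eval_poly_zero eval_poly_add free.smult_add_right smult_add_right)

lemma eval_poly_hom: "star_hom free R (eval_poly R t)"
  unfolding star_hom_def using eval_poly_delta[of 1 "[]"]
  by (auto simp: eval_poly_add eval_poly_mult eval_poly_adj eval_poly_smult free_simps(2))

lemma eval_poly_gen: "eval_poly R t (free_gen i) = t i"
  using eval_poly_delta[of 1 "[(i, False)]"] by (simp add: free_gen_delta t)

end
end

section \<open>Cuntz--Krieger families\<close>

text \<open>The relations live in a bare star-algebra, so one calculus serves the generators of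
  \<open>ck_algebra\<close>, the matrices in \<open>kernel_algebra\<close> and the family built from
  a conjugacy.\<close>

locale ck_family = star_alg R for R :: "('a, 'r) star_algebra_scheme" (structure) +
  fixes A :: "nat^'n::finite^'n" and s :: "'n \<Rightarrow> 'a"
  assumes A: "ck_matrix A"
    and s_closed [simp]: "s i \<in> carrier R"
    and partial_isometry: "s i \<otimes> adj R (s i) \<otimes> s i = s i"
    and orthogonal: "i \<noteq> j \<Longrightarrow> adj R (s i) \<otimes> s j = \<zero>"
    and source: "adj R (s i) \<otimes> s i = (\<Oplus>j\<in>UNIV. of_nat (A $ i $ j) \<odot> (s j \<otimes> adj R (s j)))"
    and total: "(\<Oplus>i\<in>UNIV. s i \<otimes> adj R (s i)) = \<one>"

lemma ck_relators_cases:
  assumes "e \<in> ck_relators A"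
  obtains
    (partial) i where "e = free_gen i \<otimes>\<^bsub>free\<^esub> adj free (free_gen i) \<otimes>\<^bsub>free\<^esub> free_gen i \<ominus>\<^bsub>free\<^esub> free_gen i"
  | (orth) i j where "i \<noteq> j" "e = adj free (free_gen i) \<otimes>\<^bsub>free\<^esub> free_gen j"
  | (source) i where "e = adj free (free_gen i) \<otimes>\<^bsub>free\<^esub> free_gen i \<ominus>\<^bsub>free\<^esub>
        (\<Oplus>\<^bsub>free\<^esub>j\<in>UNIV. of_nat (A $ i $ j) \<odot>\<^bsub>free\<^esub> (free_gen j \<otimes>\<^bsub>free\<^esub> adj free (free_gen j)))"
  | (total) "e = (\<Oplus>\<^bsub>free\<^esub>i\<in>UNIV. free_gen i \<otimes>\<^bsub>free\<^esub> adj free (free_gen i)) \<ominus>\<^bsub>free\<^esub> \<one>\<^bsub>free\<^esub>"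
  using assms unfolding ck_relators_def Let_def
  by (elim UnE CollectE exE conjE singletonE) (erule that(1) | erule(1) that(2) | erule that(3) | erule that(4))+

lemma ck_relators_intros:
  "free_gen i \<otimes>\<^bsub>free\<^esub> adj free (free_gen i) \<otimes>\<^bsub>free\<^esub> free_gen i \<ominus>\<^bsub>free\<^esub> free_gen i \<in> ck_relators A"
  "i \<noteq> j \<Longrightarrow> adj free (free_gen i) \<otimes>\<^bsub>free\<^esub> free_gen j \<in> ck_relators A"
  "adj free (free_gen i) \<otimes>\<^bsub>free\<^esub> free_gen i \<ominus>\<^bsub>free\<^esub>
        (\<Oplus>\<^bsub>free\<^esub>j\<in>UNIV. of_nat (A $ i $ j) \<odot>\<^bsub>free\<^esub> (free_gen j \<otimes>\<^bsub>free\<^esub> adj free (free_gen j))) \<in> ck_relators A"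
  "(\<Oplus>\<^bsub>free\<^esub>i\<in>UNIV. free_gen i \<otimes>\<^bsub>free\<^esub> adj free (free_gen i)) \<ominus>\<^bsub>free\<^esub> \<one>\<^bsub>free\<^esub> \<in> ck_relators A"
  unfolding ck_relators_def Let_def
  by ((rule UnI1, rule UnI1, rule UnI1, rule CollectI, rule exI, rule conjI, rule refl, rule TrueI)
    | (rule UnI1, rule UnI1, rule UnI2, rule CollectI, rule exI, rule exI, rule conjI, rule refl, assumption)
    | (rule UnI1, rule UnI2, rule CollectI, rule exI, rule conjI, rule refl, rule TrueI)
    | (rule UnI2, rule singletonI))+

lemma ck_relators_closed: "ck_relators A \<subseteq> carrier free"
  by (auto elim!: ck_relators_cases intro!: free.finsum_closed)

text \<open>In an admissible seminorm the adjoint of a generator times the generator behaves like a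
  projection, so generators, and then words, have seminorm at most 1. The resulting bound is
  independent of \<open>\<rho>\<close>.\<close>

lemma ck_seminorm_bounded:
  assumes rho: "cstar_seminorm free \<rho>" "\<forall>e\<in>ck_relators A. \<rho> e = 0" and p: "p \<in> carrier free"
  shows "\<rho> p \<le> (\<Sum>w | p w \<noteq> 0. cmod (p w))"
proof -
  note [simp] = rho(2)
  note rule = free.seminorm_le_1I[OF rho(1)]
  have gen: "\<rho> (free_gen i) \<le> 1" for i
  proof (rule rule)
    let ?s = "free_gen i" let ?p = "adj free ?s \<otimes>\<^bsub>free\<^esub> ?s"
    let ?e = "?s \<otimes>\<^bsub>free\<^esub> adj free ?s \<otimes>\<^bsub>free\<^esub> ?s \<ominus>\<^bsub>free\<^esub> ?s"
    \<comment> \<open>Multiplying the partial isometry relator by the adjoint generator shows that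
      \<open>?p\<close> is idempotent up to an element of seminorm 0.\<close>
    have "?p \<otimes>\<^bsub>free\<^esub> ?p \<ominus>\<^bsub>free\<^esub> ?p = adj free ?s \<otimes>\<^bsub>free\<^esub> ?e"
      by (simp add: free.m_assoc a_minus_def free.r_distr free.r_minus)
    moreover have "\<rho> (adj free ?s \<otimes>\<^bsub>free\<^esub> ?e) \<le> \<rho> (adj free ?s) * \<rho> ?e"
      by (rule free.seminorm_mult[OF rho(1)]) auto
    moreover have "\<rho> ?e = 0" using rho(2) ck_relators_intros(1) by blast
    ultimately have "\<bar>\<rho> (?p \<otimes>\<^bsub>free\<^esub> ?p) - \<rho> ?p\<bar> \<le> 0"
      using free.seminorm_diff[OF rho(1), of "?p \<otimes>\<^bsub>free\<^esub> ?p" ?p] by simp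
    then show "\<rho> ?p \<le> 1"
      by (intro free.seminorm_projection_le_1[OF rho(1)]) (auto simp: free.adj_mult)
  qed simp
  have word: "\<rho> (word_delta w) \<le> 1" for w
  proof (induction w)
    case Nil
    then show ?case using free.seminorm_one_le_1[OF rho(1)] by (simp add: free_simps(2))
  next
    case (Cons a w)
    obtain i b where a: "a = (i, b)" by (cases a)
    let ?g = "if b then adj free (free_gen i) else free_gen i"
    have "\<rho> ?g \<le> 1" using gen[of i] free.seminorm_adj[OF rho(1), of "free_gen i"] by simp
    then have "\<rho> ?g * \<rho> (word_delta w) \<le> 1 * 1"
      using Cons by (intro mult_mono) (auto intro: free.seminorm_nonneg[OF rho(1)])
    then show ?case
      using free.seminorm_mult[OF rho(1), of ?g "word_delta w"] by (cases b) (simp_all add: a word_delta_Cons)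
  qed
  \<comment> \<open>Evaluation at the generators is the identity by uniqueness; this rewrites
    \<open>p\<close> as a finite sum of monomials.\<close>
  have "eval_poly free free_gen p = id p"
    by (rule star_hom_free_eqI[OF free.eval_poly_hom[OF free_gen_closed] _ free_star_alg _ p])
       (auto simp: star_hom_def free.eval_poly_gen)
  moreover have *: "eval_word free free_gen w = word_delta w" for w
  proof (induction w)
    case (Cons a w)
    then show ?case by (cases a) (simp add: word_delta_Cons)
  qed (simp add: free_simps)
  have "eval_poly free free_gen p = (\<Oplus>\<^bsub>free\<^esub>w\<in>{w. p w \<noteq> 0}. p w \<odot>\<^bsub>free\<^esub> word_delta w)"
    unfolding eval_poly_def * ..
  ultimately have "p = (\<Oplus>\<^bsub>free\<^esub>w\<in>{w. p w \<noteq> 0}. p w \<odot>\<^bsub>free\<^esub> word_delta w)"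
    by (simp only: id_apply)
  then have "\<rho> p \<le> (\<Sum>w | p w \<noteq> 0. \<rho> (p w \<odot>\<^bsub>free\<^esub> word_delta w))"
    using free.seminorm_sum[OF rho(1), of "\<lambda>w. p w \<odot>\<^bsub>free\<^esub> word_delta w" "{w. p w \<noteq> 0}"] by simp
  also have "\<dots> \<le> (\<Sum>w | p w \<noteq> 0. cmod (p w))"
    by (intro sum_mono) (simp add: free.seminorm_smult[OF rho(1)] mult_left_le word)
  finally show ?thesis .
qed

interpretation O: enveloping free_star_algebra "ck_relators A" for A :: "nat^'n::finite^'n"
  using ck_relators_closed ck_seminorm_bounded by unfold_locales blast+

lemma ck_cstar_alg: "cstar_alg (ck_algebra A)" for A :: "nat^'n::finite^'n"
  unfolding ck_algebra_def by (rule O.Q_cstar_alg)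

interpretation O: cstar_alg "ck_algebra A" for A :: "nat^'n::finite^'n"
  by (rule ck_cstar_alg)

abbreviation ck_emb :: "nat^'n::finite^'n \<Rightarrow> 'n star_poly \<Rightarrow> 'n ck_elem" where
  "ck_emb A \<equiv> envelope_emb free_star_algebra (ck_relators A)"

lemma ck_emb_hom: "star_hom free (ck_algebra A) (ck_emb A)" for A :: "nat^'n::finite^'n"
  unfolding ck_algebra_def by (rule O.emb_hom)

interpretation emb: star_alg_hom free_star_algebra "ck_algebra A" "ck_emb A" for A :: "nat^'n::finite^'n"
  by unfold_locales (rule ck_emb_hom)

lemma ck_emb_gen: "ck_emb A (free_gen i) = ck_gen A i"
  by (simp add: ck_gen_def)

text \<open>A relator has universal seminorm 0, and only the zero class has norm 0.\<close>

lemma ck_emb_relator: "e \<in> ck_relators A \<Longrightarrow> ck_emb A e = \<zero>\<^bsub>ck_algebra A\<^esub>" for A :: "nat^'n::finite^'n"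
  by (rule O.cnorm_zeroD)
     (use O.universal_relator[of e A] O.cnorm_emb[of e A] ck_relators_closed[of A] in \<open>auto simp: ck_algebra_def\<close>)

lemma ck_gen_family:
  fixes A :: "nat^'n::finite^'n"
  assumes "ck_matrix A" shows "ck_family (ck_algebra A) A (ck_gen A)"
proof
  show "ck_matrix A" by fact
  have gen[simp]: "ck_gen A i \<in> carrier (ck_algebra A)" for i
    unfolding ck_emb_gen[symmetric] by simp
  show "ck_gen A i \<in> carrier (ck_algebra A)" for i by simp
  note hom = emb.hom_minus emb.hom_mult emb.hom_adj emb.hom_smult emb.hom_finsum emb.hom_one ck_emb_gen
    free.finsum_closed Pi_def
  fix i
  show "ck_gen A i \<otimes>\<^bsub>ck_algebra A\<^esub> adj (ck_algebra A) (ck_gen A i) \<otimes>\<^bsub>ck_algebra A\<^esub> ck_gen A i = ck_gen A i"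
    by (insert ck_emb_relator[OF ck_relators_intros(1)[of i A]], rule O.minus_eq_zeroD) (simp_all add: hom)
  show "adj (ck_algebra A) (ck_gen A i) \<otimes>\<^bsub>ck_algebra A\<^esub> ck_gen A j = \<zero>\<^bsub>ck_algebra A\<^esub>" if "i \<noteq> j" for j
    using ck_emb_relator[OF ck_relators_intros(2)[OF that, of A]] by (simp add: hom)
  show "adj (ck_algebra A) (ck_gen A i) \<otimes>\<^bsub>ck_algebra A\<^esub> ck_gen A i =
    (\<Oplus>\<^bsub>ck_algebra A\<^esub>j\<in>UNIV. of_nat (A $ i $ j) \<odot>\<^bsub>ck_algebra A\<^esub> (ck_gen A j \<otimes>\<^bsub>ck_algebra A\<^esub> adj (ck_algebra A) (ck_gen A j)))"
    by (insert ck_emb_relator[OF ck_relators_intros(3)[of i A]], rule O.minus_eq_zeroD) (simp_all add: hom O.finsum_closed)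
  show "(\<Oplus>\<^bsub>ck_algebra A\<^esub>i\<in>UNIV. ck_gen A i \<otimes>\<^bsub>ck_algebra A\<^esub> adj (ck_algebra A) (ck_gen A i)) = \<one>\<^bsub>ck_algebra A\<^esub>"
    by (insert ck_emb_relator[OF ck_relators_intros(4)[of A]], rule O.minus_eq_zeroD) (simp_all add: hom O.finsum_closed)
qed

section \<open>Words, cylinders and functions of finitely many coordinates\<close>

definition prefix :: "nat \<Rightarrow> (nat \<Rightarrow> 'n) \<Rightarrow> 'n list" where
  "prefix n x = map x [0..<n]"

lemma length_prefix [simp]: "length (prefix n x) = n"
  by (simp add: prefix_def)

lemma prefix_0 [simp]: "prefix 0 x = []"
  by (simp add: prefix_def)

lemma prefix_Suc: "prefix (Suc n) x = x 0 # prefix n (shift x)"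
  by (simp add: prefix_def shift_def upt_conv_Cons map_Suc_upt[symmetric] comp_def del: upt_Suc)

lemma prefix_1: "prefix (Suc 0) x = [x 0]"
  by (simp add: prefix_Suc)

lemma prefix_eq_iff: "prefix n x = prefix n y \<longleftrightarrow> (\<forall>k<n. x k = y k)"
  by (auto simp: prefix_def)

lemma prefix_eq_mono: "prefix n x = prefix n y \<Longrightarrow> m \<le> n \<Longrightarrow> prefix m x = prefix m y"
  by (auto simp: prefix_eq_iff)

lemma shift_case_nat [simp]: "shift (case_nat i x) = x"
  by (simp add: shift_def)

lemma case_nat_shift [simp]: "case_nat (x 0) (shift x) = x"
  by (auto simp: shift_def fun_eq_iff split: nat.split)

lemma shift_eqD: "shift x = y \<Longrightarrow> x = case_nat (x 0) y"
  by (metis case_nat_shift)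

lemma shift_in_shift_space: "x \<in> shift_space A \<Longrightarrow> shift x \<in> shift_space A"
  by (auto simp: shift_space_def shift_def)

lemma case_nat_in_shift_space: "case_nat i x \<in> shift_space A \<longleftrightarrow> A $ i $ x 0 = 1 \<and> x \<in> shift_space A"
proof -
  have "(\<forall>n. P n) \<longleftrightarrow> P 0 \<and> (\<forall>n. P (Suc n))" for P by (metis not0_implies_Suc)
  from this[of "\<lambda>n. A $ case_nat i x n $ case_nat i x (Suc n) = 1"] show ?thesis
    by (simp add: shift_space_def)
qed

lemma shift_space_0: "x \<in> shift_space A \<Longrightarrow> A $ x 0 $ shift x 0 = 1"
  by (auto simp: shift_space_def shift_def)

lemma admissible_Cons:
  "admissible_word A (i # \<alpha>) \<longleftrightarrow> (\<alpha> \<noteq> [] \<longrightarrow> A $ i $ hd \<alpha> = 1) \<and> admissible_word A \<alpha>"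
proof -
  have "(\<forall>n. P n) \<longleftrightarrow> P 0 \<and> (\<forall>n. P (Suc n))" for P by (metis not0_implies_Suc)
  from this[of "\<lambda>n. Suc n < length (i # \<alpha>) \<longrightarrow> A $ ((i # \<alpha>) ! n) $ ((i # \<alpha>) ! Suc n) = 1"] show ?thesis
    by (cases \<alpha>) (simp_all add: admissible_word_def)
qed

lemma admissible_prefix: "x \<in> shift_space A \<Longrightarrow> admissible_word A (prefix n x)"
  by (auto simp: admissible_word_def prefix_def shift_space_def)

lemma ck_matrix_cases: "ck_matrix A \<Longrightarrow> A $ i $ j = 0 \<or> A $ i $ j = 1"
  by (auto simp: ck_matrix_def)

text \<open>As no row of the matrix is zero, \<open>nxt\<close> picks a successor of each letter,
  and iterating it starts an infinite path anywhere; the word itself is then prepended letter by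
  letter.\<close>

lemma admissible_extend:
  assumes A: "ck_matrix A" and "admissible_word A \<alpha>"
  shows "\<exists>x\<in>shift_space A. prefix (length \<alpha>) x = \<alpha>"
proof -
  obtain nxt where nxt: "\<And>i. A $ i $ nxt i = 1"
    using A unfolding ck_matrix_def by (metis insertE singletonD)
  have letter: "\<exists>x\<in>shift_space A. x 0 = i" for i
    by (rule bexI[of _ "\<lambda>n. (nxt ^^ n) i"]) (auto simp: shift_space_def nxt)
  show ?thesis using assms(2)
  proof (induction \<alpha>)
    case Nil
    then show ?case using letter by auto
  next
    case (Cons i \<alpha>)
    show ?case
    proof (cases "\<alpha> = []")
      case True
      then show ?thesis using letter[of i] by (auto simp: prefix_Suc)
    next
      case False
      obtain x where x: "x \<in> shift_space A" "prefix (length \<alpha>) x = \<alpha>"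
        using Cons by (auto simp: admissible_Cons)
      obtain j \<beta> where "\<alpha> = j # \<beta>" using False by (cases \<alpha>) auto
      then have "x 0 = hd \<alpha>" using x by (auto simp: prefix_Suc)
      then show ?thesis using x Cons.prems False
        by (intro bexI[of _ "case_nat i x"]) (auto simp: prefix_Suc case_nat_in_shift_space admissible_Cons)
    qed
  qed
qed

definition rep :: "nat^'n^'n \<Rightarrow> 'n list \<Rightarrow> nat \<Rightarrow> 'n" where
  "rep A \<alpha> = (SOME x. x \<in> shift_space A \<and> prefix (length \<alpha>) x = \<alpha>)"

lemma rep:
  assumes "ck_matrix A" "admissible_word A \<alpha>"
  shows "rep A \<alpha> \<in> shift_space A" "prefix (length \<alpha>) (rep A \<alpha>) = \<alpha>"
  using someI_ex[of "\<lambda>x. x \<in> shift_space A \<and> prefix (length \<alpha>) x = \<alpha>"]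
    admissible_extend[OF assms] unfolding rep_def by auto

text \<open>By compactness (\<open>local_level\<close>) the functions that satisfy this for some
  \<open>n\<close> are the locally constant ones.\<close>

definition level :: "nat^'n^'n \<Rightarrow> nat \<Rightarrow> ((nat \<Rightarrow> 'n) \<Rightarrow> 'b) \<Rightarrow> bool" where
  "level A n f \<longleftrightarrow> (\<forall>x\<in>shift_space A. \<forall>y\<in>shift_space A. prefix n x = prefix n y \<longrightarrow> f x = f y)"

lemma levelD: "level A n f \<Longrightarrow> x \<in> shift_space A \<Longrightarrow> y \<in> shift_space A \<Longrightarrow> prefix n x = prefix n y \<Longrightarrow> f x = f y"
  unfolding level_def by blast

lemma level_mono: "level A n f \<Longrightarrow> n \<le> m \<Longrightarrow> level A m f"
  unfolding level_def using prefix_eq_mono by blast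

lemma level_compose: "level A n f \<Longrightarrow> level A n (\<lambda>x. g (f x))"
  unfolding level_def by metis

lemma level_shift: "level A n f \<Longrightarrow> level A (Suc n) (\<lambda>x. f (shift x))"
  unfolding level_def by (auto simp: prefix_Suc shift_in_shift_space)

definition sword :: "('a, 'r) star_algebra_scheme \<Rightarrow> ('n \<Rightarrow> 'a) \<Rightarrow> 'n list \<Rightarrow> 'a" where
  "sword R s \<alpha> = foldr (\<lambda>i a. s i \<otimes>\<^bsub>R\<^esub> a) \<alpha> \<one>\<^bsub>R\<^esub>"

definition sproj :: "('a, 'r) star_algebra_scheme \<Rightarrow> ('n \<Rightarrow> 'a) \<Rightarrow> 'n list \<Rightarrow> 'a" where
  "sproj R s \<alpha> = sword R s \<alpha> \<otimes>\<^bsub>R\<^esub> adj R (sword R s \<alpha>)"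

definition words :: "nat \<Rightarrow> 'n list set" where
  "words n = {\<alpha>. length \<alpha> = n}"

lemma mem_words: "\<alpha> \<in> words n \<longleftrightarrow> length \<alpha> = n"
  by (simp add: words_def)

lemma finite_words [simp]: "finite (words n :: 'n::finite list set)"
  using finite_lists_length_eq[of "UNIV :: 'n set" n] by (simp add: words_def)

lemma words_0 [simp]: "words 0 = {[]}"
  by (auto simp: words_def)

lemma words_Suc: "words (Suc n) = (\<Union>i. (#) i ` words n)"
  by (auto simp: words_def length_Suc_conv)

lemma words_Suc': "words (Suc n) = (\<Union>i. (\<lambda>\<alpha>. \<alpha> @ [i]) ` words n)"
  by (auto simp: words_def length_Suc_conv_rev)

text \<open>The element of a Cuntz--Krieger family \<open>s\<close> that corresponds to a function on the shift space
  depending on the first \<open>n\<close> coordinates only. The junk value of \<open>rep\<close> at an inadmissible word is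
  harmless because \<open>sproj\<close> vanishes there.\<close>

definition diag :: "('a, 'r) star_algebra_scheme \<Rightarrow> nat^'n^'n \<Rightarrow> ('n \<Rightarrow> 'a) \<Rightarrow> nat \<Rightarrow>
    ((nat \<Rightarrow> 'n) \<Rightarrow> complex) \<Rightarrow> 'a" where
  "diag R A s n f = (\<Oplus>\<^bsub>R\<^esub>\<alpha>\<in>words n. f (rep A \<alpha>) \<odot>\<^bsub>R\<^esub> sproj R s \<alpha>)"

definition gen_sum :: "('a, 'r) star_algebra_scheme \<Rightarrow> ('n::finite \<Rightarrow> 'a) \<Rightarrow> 'a" where
  "gen_sum R s = (\<Oplus>\<^bsub>R\<^esub>i\<in>UNIV. s i)"

lemma (in star_alg) sword_closed: "(\<And>i. s i \<in> carrier R) \<Longrightarrow> sword R s \<alpha> \<in> carrier R"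
  by (induction \<alpha>) (auto simp: sword_def)

lemma (in star_alg) sproj_closed: "(\<And>i. s i \<in> carrier R) \<Longrightarrow> sproj R s \<alpha> \<in> carrier R"
  by (simp add: sproj_def sword_closed)

lemma (in star_alg) diag_closed: "(\<And>i. s i \<in> carrier R) \<Longrightarrow> diag R A s n f \<in> carrier R"
  unfolding diag_def by (intro finsum_closed) (auto simp: sproj_closed)

lemma (in star_alg) gen_sum_closed: "(\<And>i. s i \<in> carrier R) \<Longrightarrow> gen_sum R s \<in> carrier R"
  unfolding gen_sum_def by (intro finsum_closed) auto

context star_alg_hom
begin

context
  fixes s :: "'n::finite \<Rightarrow> 'a" assumes s: "\<And>i. s i \<in> carrier R"
begin

lemma hom_sword: "f (sword R s \<alpha>) = sword S (\<lambda>i. f (s i)) \<alpha>"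
proof (induction \<alpha>)
  case (Cons i \<alpha>)
  then show ?case using R.sword_closed[of s \<alpha>] s by (simp add: sword_def hom_mult)
qed (simp add: sword_def)

lemma hom_sproj: "f (sproj R s \<alpha>) = sproj S (\<lambda>i. f (s i)) \<alpha>"
  unfolding sproj_def by (simp add: hom_mult hom_adj hom_sword R.sword_closed s)

text \<open>Being an expression in the family, \<open>diag\<close> is carried to the same expression
  in the image family. This is how one formula is read in the free algebra, in
  \<open>ck_algebra\<close> and on the groupoid.\<close>

lemma hom_diag: "f (diag R A s n g) = diag S A (\<lambda>i. f (s i)) n g"
  unfolding diag_def by (subst hom_finsum) (auto simp: hom_sproj hom_smult R.sproj_closed s)

lemma hom_gen_sum: "f (gen_sum R s) = gen_sum S (\<lambda>i. f (s i))"
  unfolding gen_sum_def by (subst hom_finsum) (auto simp: s)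

end
end

section \<open>Calculus in a Cuntz--Krieger family\<close>

context ck_family
begin

abbreviation "sw \<equiv> sword R s"
abbreviation "pr \<equiv> sproj R s"
abbreviation "D \<equiv> diag R A s"
abbreviation "S \<equiv> gen_sum R s"

lemma sw_closed [simp]: "sw \<alpha> \<in> carrier R" and pr_closed [simp]: "pr \<alpha> \<in> carrier R"
  and D_closed [simp]: "D n f \<in> carrier R" and S_closed [simp]: "S \<in> carrier R"
  by (simp_all add: sword_closed sproj_closed diag_closed gen_sum_closed)

lemma sw_Nil [simp]: "sw [] = \<one>" and sw_Cons: "sw (i # \<alpha>) = s i \<otimes> sw \<alpha>"
  by (simp_all add: sword_def)

lemma sw_snoc: "sw (\<alpha> @ [j]) = sw \<alpha> \<otimes> s j"
  by (induction \<alpha>) (simp_all add: sw_Cons m_assoc)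

lemma range_times_s: "s i \<otimes> (adj R (s i) \<otimes> s j) = (if i = j then s j else \<zero>)"
  using partial_isometry[of i] orthogonal[of i j] by (cases "i = j") (simp_all add: m_assoc)

lemma entry: "A $ i $ j = 0 \<or> A $ i $ j = 1"
  using A by (rule ck_matrix_cases)

text \<open>After the source projection is expanded by the relation \<open>source\<close>, only the
  range projection of \<open>s j\<close> itself acts nontrivially on \<open>s j\<close>.\<close>

lemma source_times_s: "(adj R (s i) \<otimes> s i) \<otimes> s j = of_nat (A $ i $ j) \<odot> s j"
proof -
  have "(adj R (s i) \<otimes> s i) \<otimes> s j = (\<Oplus>k\<in>UNIV. of_nat (A $ i $ k) \<odot> (s k \<otimes> adj R (s k)) \<otimes> s j)"
    unfolding source by (rule finsum_ldistr) auto
  also have "\<dots> = (\<Oplus>k\<in>UNIV. if k = j then of_nat (A $ i $ j) \<odot> s j else \<zero>)"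
    by (rule finsum_cong') (auto simp: smult_mult_left m_assoc range_times_s)
  also have "\<dots> = of_nat (A $ i $ j) \<odot> s j"
    by (subst finsum_single[of _ j]) auto
  finally show ?thesis .
qed

lemma s_times_source: "x \<in> carrier R \<Longrightarrow> s i \<otimes> (adj R (s i) \<otimes> (s i \<otimes> x)) = s i \<otimes> x"
  using partial_isometry[of i] by (simp add: m_assoc[symmetric])

lemma source_times_sw:
  "\<alpha> \<noteq> [] \<Longrightarrow> adj R (s i) \<otimes> (s i \<otimes> sw \<alpha>) = of_nat (A $ i $ hd \<alpha>) \<odot> sw \<alpha>"
proof (cases \<alpha>)
  case (Cons j \<beta>)
  have "adj R (s i) \<otimes> (s i \<otimes> sw \<alpha>) = ((adj R (s i) \<otimes> s i) \<otimes> s j) \<otimes> sw \<beta>"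
    by (simp add: Cons sw_Cons m_assoc)
  then show ?thesis unfolding source_times_s by (simp add: Cons sw_Cons smult_mult_left)
qed simp

text \<open>Inserting the source projection of \<open>s i\<close> costs the factor
  \<open>A $ i $ hd \<alpha>\<close>; a forbidden transition therefore annihilates the word.\<close>

lemma s_times_sw: "\<alpha> \<noteq> [] \<Longrightarrow> s i \<otimes> sw \<alpha> = of_nat (A $ i $ hd \<alpha>) \<odot> (s i \<otimes> sw \<alpha>)"
  using s_times_source[of "sw \<alpha>" i] source_times_sw[of \<alpha> i] by (simp add: smult_mult_right)

lemma sw_nonadmissible: "\<not> admissible_word A \<alpha> \<Longrightarrow> sw \<alpha> = \<zero>"
proof (induction \<alpha>)
  case Nil
  then show ?case by (simp add: admissible_word_def)
next
  case (Cons i \<alpha>)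
  show ?case
  proof (cases "admissible_word A \<alpha>")
    case True
    with Cons.prems have "\<alpha> \<noteq> []" "A $ i $ hd \<alpha> = 0" using entry[of i "hd \<alpha>"]
      by (auto simp: admissible_Cons)
    then show ?thesis using s_times_sw[of \<alpha> i] by (simp add: sw_Cons)
  qed (use Cons in \<open>simp add: sw_Cons\<close>)
qed

lemma pr_nonadmissible: "\<not> admissible_word A \<alpha> \<Longrightarrow> pr \<alpha> = \<zero>"
  by (simp add: sproj_def sw_nonadmissible)

text \<open>Words are partial isometries: the source projection of the first letter acts on a
  nonempty remainder as a scalar, so the induction hypothesis applies; for a single letter this is
  \<open>partial_isometry\<close>.\<close>

lemma pr_times_sw: "pr \<alpha> \<otimes> sw \<alpha> = sw \<alpha>"
proof (induction \<alpha>)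
  case Nil
  then show ?case by (simp add: sproj_def)
next
  case (Cons i \<alpha>)
  have "pr (i # \<alpha>) \<otimes> sw (i # \<alpha>) = s i \<otimes> (sw \<alpha> \<otimes> (adj R (sw \<alpha>) \<otimes> (adj R (s i) \<otimes> (s i \<otimes> sw \<alpha>))))"
    by (simp add: sproj_def sw_Cons m_assoc adj_mult)
  also have "\<dots> = s i \<otimes> sw \<alpha>"
  proof (cases "\<alpha> = []")
    case True
    then show ?thesis using partial_isometry[of i] by (simp add: m_assoc)
  next
    case False
    have "s i \<otimes> (sw \<alpha> \<otimes> (adj R (sw \<alpha>) \<otimes> (adj R (s i) \<otimes> (s i \<otimes> sw \<alpha>)))) =
        of_nat (A $ i $ hd \<alpha>) \<odot> (s i \<otimes> (pr \<alpha> \<otimes> sw \<alpha>))"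
      using False by (simp add: source_times_sw smult_mult_right sproj_def m_assoc)
    then show ?thesis using Cons s_times_sw[OF False, of i] by simp
  qed
  finally show ?case by (simp add: sw_Cons)
qed

lemma adj_pr [simp]: "adj R (pr \<alpha>) = pr \<alpha>"
  by (simp add: sproj_def adj_mult)

lemma pr_idem: "pr \<alpha> \<otimes> pr \<alpha> = pr \<alpha>"
  using pr_times_sw[of \<alpha>] by (simp add: sproj_def m_assoc[symmetric])

text \<open>Equal first letters are stripped at the cost of a scalar, and the first pair of
  different letters is killed by \<open>orthogonal\<close>.\<close>

lemma adj_sw_sw: "length \<alpha> = length \<beta> \<Longrightarrow> \<alpha> \<noteq> \<beta> \<Longrightarrow> adj R (sw \<alpha>) \<otimes> sw \<beta> = \<zero>"
proof (induction \<alpha> arbitrary: \<beta>)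
  case (Cons i \<alpha>)
  then obtain j \<gamma> where \<beta>: "\<beta> = j # \<gamma>" "length \<gamma> = length \<alpha>" by (cases \<beta>) auto
  have *: "adj R (sw (i # \<alpha>)) \<otimes> sw \<beta> = adj R (sw \<alpha>) \<otimes> (adj R (s i) \<otimes> (s j \<otimes> sw \<gamma>))"
    by (simp add: \<beta> sw_Cons adj_mult m_assoc)
  show ?case
  proof (cases "i = j")
    case True
    with Cons.prems \<beta> have "\<alpha> \<noteq> \<gamma>" "\<gamma> \<noteq> []" by auto
    then show ?thesis unfolding * using True Cons.IH[of \<gamma>] \<beta>(2)
      by (simp add: source_times_sw smult_mult_right)
  next
    case False
    have "adj R (s i) \<otimes> (s j \<otimes> sw \<gamma>) = (adj R (s i) \<otimes> s j) \<otimes> sw \<gamma>" by (simp add: m_assoc)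
    then show ?thesis unfolding * by (simp add: orthogonal[OF False])
  qed
qed auto

lemma pr_orth: "length \<alpha> = length \<beta> \<Longrightarrow> \<alpha> \<noteq> \<beta> \<Longrightarrow> pr \<alpha> \<otimes> pr \<beta> = \<zero>"
proof -
  assume "length \<alpha> = length \<beta>" "\<alpha> \<noteq> \<beta>"
  then have "sw \<alpha> \<otimes> (adj R (sw \<alpha>) \<otimes> sw \<beta>) \<otimes> adj R (sw \<beta>) = \<zero>" by (simp add: adj_sw_sw)
  then show ?thesis by (simp add: sproj_def m_assoc)
qed

lemma pr_Cons: "pr (i # \<alpha>) = s i \<otimes> pr \<alpha> \<otimes> adj R (s i)"
  by (simp add: sproj_def sw_Cons adj_mult m_assoc)

text \<open>For nonempty \<open>\<alpha>\<close> the source projection acts on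
  \<open>pr \<alpha>\<close> from the left as a scalar; both are self-adjoint, so taking adjoints
  gives the same scalar on the right.\<close>

lemma s_pr_source: "s i \<otimes> (pr \<alpha> \<otimes> (adj R (s i) \<otimes> s i)) = s i \<otimes> pr \<alpha>"
proof (cases "\<alpha> = []")
  case True
  then show ?thesis using partial_isometry[of i] by (simp add: sproj_def m_assoc)
next
  case False
  let ?a = "of_nat (A $ i $ hd \<alpha>) :: complex"
  have 1: "(adj R (s i) \<otimes> s i) \<otimes> pr \<alpha> = ?a \<odot> pr \<alpha>"
    using source_times_sw[OF False, of i]
    by (simp add: sproj_def m_assoc[symmetric] smult_mult_left)
  have "adj R ((adj R (s i) \<otimes> s i) \<otimes> pr \<alpha>) = ?a \<odot> pr \<alpha>"
    unfolding 1 by (simp add: adj_smult)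
  then have 2: "pr \<alpha> \<otimes> (adj R (s i) \<otimes> s i) = ?a \<odot> pr \<alpha>" by (simp add: adj_mult)
  have "s i \<otimes> pr \<alpha> = s i \<otimes> ((adj R (s i) \<otimes> s i) \<otimes> pr \<alpha>)"
    using s_times_source[of "pr \<alpha>" i] by (simp add: m_assoc)
  then show ?thesis unfolding 1 2 by simp
qed

lemma source_pr: "\<alpha> \<noteq> [] \<Longrightarrow> adj R (s i) \<otimes> (s i \<otimes> pr \<alpha>) = of_nat (A $ i $ hd \<alpha>) \<odot> pr \<alpha>"
  using source_times_sw[of \<alpha> i] by (simp add: sproj_def m_assoc[symmetric] smult_mult_left)

lemma pr_Cons_times_s: "pr (j # \<alpha>) \<otimes> s i = (if i = j then s i \<otimes> pr \<alpha> else \<zero>)"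
proof (cases "i = j")
  case True
  then show ?thesis using s_pr_source[of i \<alpha>] by (simp add: pr_Cons m_assoc)
next
  case False
  have "pr (j # \<alpha>) \<otimes> s i = s j \<otimes> pr \<alpha> \<otimes> (adj R (s j) \<otimes> s i)" by (simp add: pr_Cons m_assoc)
  then show ?thesis using False by (simp add: orthogonal)
qed

lemma s_pr_nonadmissible: "\<not> admissible_word A (i # \<alpha>) \<Longrightarrow> s i \<otimes> pr \<alpha> = \<zero>"
  using sw_nonadmissible[of "i # \<alpha>"] by (simp add: sproj_def sw_Cons m_assoc[symmetric])

lemma finsum_words_Suc:
  assumes "\<And>\<alpha>. g \<alpha> \<in> carrier R"
  shows "(\<Oplus>\<alpha>\<in>words (Suc n). g \<alpha>) = (\<Oplus>i\<in>UNIV. \<Oplus>\<alpha>\<in>words n. g ((i::'n) # \<alpha>))"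
proof -
  have "(\<Oplus>\<alpha>\<in>words (Suc n). g \<alpha>) = (\<Oplus>i\<in>UNIV. \<Oplus>\<alpha>\<in>(#) (i::'n) ` words n. g \<alpha>)"
    unfolding words_Suc by (rule add.finprod_UN_disjoint) (auto simp: pairwise_def disjnt_def assms)
  also have "\<dots> = (\<Oplus>i\<in>UNIV. \<Oplus>\<alpha>\<in>words n. g (i # \<alpha>))"
    by (intro finsum_cong' refl finsum_reindex) (auto simp: assms intro!: finsum_closed)
  finally show ?thesis .
qed

lemma finsum_words_snoc:
  assumes "\<And>\<alpha>. g \<alpha> \<in> carrier R"
  shows "(\<Oplus>\<alpha>\<in>words (Suc n). g \<alpha>) = (\<Oplus>i\<in>UNIV. \<Oplus>\<alpha>\<in>words n. g (\<alpha> @ [i::'n]))"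
proof -
  have "(\<Oplus>\<alpha>\<in>words (Suc n). g \<alpha>) = (\<Oplus>i\<in>UNIV. \<Oplus>\<alpha>\<in>(\<lambda>\<alpha>. \<alpha> @ [i::'n]) ` words n. g \<alpha>)"
    unfolding words_Suc' by (rule add.finprod_UN_disjoint) (auto simp: pairwise_def disjnt_def assms)
  also have "\<dots> = (\<Oplus>i\<in>UNIV. \<Oplus>\<alpha>\<in>words n. g (\<alpha> @ [i]))"
    by (intro finsum_cong' refl finsum_reindex) (auto simp: assms inj_on_def intro!: finsum_closed)
  finally show ?thesis .
qed

lemma D_cong: "(\<And>x. x \<in> shift_space A \<Longrightarrow> f x = g x) \<Longrightarrow> D n f = D n g"
  unfolding diag_def
proof (intro finsum_cong' refl)
  fix \<alpha> :: "'n list" assume *: "\<And>x. x \<in> shift_space A \<Longrightarrow> f x = g x" and "\<alpha> \<in> words n"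
  show "f (rep A \<alpha>) \<odot> pr \<alpha> = g (rep A \<alpha>) \<odot> pr \<alpha>"
    by (cases "admissible_word A \<alpha>") (simp_all add: * rep A pr_nonadmissible)
qed auto

lemma D_add: "D n (\<lambda>x. f x + g x) = D n f \<oplus> D n g"
  unfolding diag_def by (subst finsum_addf[symmetric]) (auto simp: smult_add_left)

lemma D_smult: "D n (\<lambda>x. c * f x) = c \<odot> D n f"
  unfolding diag_def by (subst finsum_smult) (auto simp: smult_smult)

lemma D_zero: "D n (\<lambda>x. 0) = \<zero>"
  unfolding diag_def by (rule add.finprod_one_eqI) auto

lemma D_sum: "finite I \<Longrightarrow> D n (\<lambda>x. \<Sum>i\<in>I. f i x) = (\<Oplus>i\<in>I. D n (f i))"
  by (induction I rule: finite_induct) (simp_all add: D_zero D_add)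

lemma D_adj: "adj R (D n f) = D n (\<lambda>x. cnj (f x))"
  unfolding diag_def by (subst finsum_adj) (auto simp: adj_smult)

text \<open>Both factors are sampled at the same representatives \<open>rep A \<alpha>\<close>, so
  orthogonality and idempotence of the projections yield the pointwise product without reference to
  levels.\<close>

lemma D_mult: "D n f \<otimes> D n g = D n (\<lambda>x. f x * g x)"
proof -
  have "D n f \<otimes> D n g = (\<Oplus>\<alpha>\<in>words n. (f (rep A \<alpha>) \<odot> pr \<alpha>) \<otimes> D n g)"
    unfolding diag_def[of _ _ _ _ f] by (rule finsum_ldistr) auto
  also have "\<dots> = (\<Oplus>\<alpha>\<in>words n. (f (rep A \<alpha>) * g (rep A \<alpha>)) \<odot> pr \<alpha>)"
  proof (intro finsum_cong' refl)
    fix \<alpha> :: "'n list" assume \<alpha>: "\<alpha> \<in> words n"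
    have "(f (rep A \<alpha>) \<odot> pr \<alpha>) \<otimes> D n g =
        (\<Oplus>\<beta>\<in>words n. (f (rep A \<alpha>) \<odot> pr \<alpha>) \<otimes> (g (rep A \<beta>) \<odot> pr \<beta>))"
      unfolding diag_def by (rule finsum_rdistr) auto
    also have "\<dots> = (f (rep A \<alpha>) \<odot> pr \<alpha>) \<otimes> (g (rep A \<alpha>) \<odot> pr \<alpha>)"
      using \<alpha> by (intro finsum_single) (auto simp: mem_words smult_mult_left smult_mult_right pr_orth)
    finally show "(f (rep A \<alpha>) \<odot> pr \<alpha>) \<otimes> D n g = (f (rep A \<alpha>) * g (rep A \<alpha>)) \<odot> pr \<alpha>"
      by (simp add: smult_mult_left smult_mult_right pr_idem smult_smult mult.commute)
  qed auto
  finally show ?thesis by (simp add: diag_def)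
qed

text \<open>The points \<open>shift (rep A (i # \<alpha>))\<close> and \<open>rep A \<alpha>\<close>
  may differ, but both begin with \<open>\<alpha>\<close>; if \<open>i # \<alpha>\<close> is
  inadmissible, the operator factor is zero.\<close>

lemma s_smult_pr_level:
  assumes "level A n f" "\<alpha> \<in> words n"
  shows "f (shift (rep A (i # \<alpha>))) \<odot> (s i \<otimes> pr \<alpha>) = f (rep A \<alpha>) \<odot> (s i \<otimes> pr \<alpha>)"
proof (cases "admissible_word A (i # \<alpha>)")
  case True
  then have 2: "admissible_word A \<alpha>" by (simp add: admissible_Cons)
  have "f (shift (rep A (i # \<alpha>))) = f (rep A \<alpha>)"
    using rep[OF A True] rep[OF A 2] assms(2)
    by (intro levelD[OF assms(1)]) (auto simp: prefix_Suc shift_in_shift_space mem_words)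
  then show ?thesis by simp
qed (simp add: s_pr_nonadmissible)

text \<open>The covariance relation: multiplication by \<open>s i\<close> on the right keeps only
  cylinders beginning with \<open>i\<close>, and \<open>pr (i # \<alpha>)\<close> passes through it
  as \<open>pr \<alpha>\<close>.\<close>

lemma D_shift_times_s:
  assumes "level A n f"
  shows "D (Suc n) (\<lambda>x. f (shift x)) \<otimes> s i = s i \<otimes> D n f"
proof -
  have "D (Suc n) (\<lambda>x. f (shift x)) \<otimes> s i =
      (\<Oplus>\<gamma>\<in>words (Suc n). (f (shift (rep A \<gamma>)) \<odot> pr \<gamma>) \<otimes> s i)"
    unfolding diag_def by (rule finsum_ldistr) auto
  also have "\<dots> = (\<Oplus>j\<in>UNIV. \<Oplus>\<alpha>\<in>words n. (f (shift (rep A (j # \<alpha>))) \<odot> pr (j # \<alpha>)) \<otimes> s i)"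
    by (rule finsum_words_Suc) auto
  also have "\<dots> = (\<Oplus>j\<in>UNIV. if j = i then (\<Oplus>\<alpha>\<in>words n. f (rep A \<alpha>) \<odot> (s i \<otimes> pr \<alpha>)) else \<zero>)"
  proof (intro finsum_cong' refl)
    fix j
    show "(\<Oplus>\<alpha>\<in>words n. (f (shift (rep A (j # \<alpha>))) \<odot> pr (j # \<alpha>)) \<otimes> s i) =
        (if j = i then (\<Oplus>\<alpha>\<in>words n. f (rep A \<alpha>) \<odot> (s i \<otimes> pr \<alpha>)) else \<zero>)"
    proof (cases "j = i")
      case True
      then show ?thesis using s_smult_pr_level[OF assms]
        by (auto simp: smult_mult_left pr_Cons_times_s intro!: finsum_cong')
    next
      case False
      then show ?thesis
        by (auto simp: smult_mult_left pr_Cons_times_s intro!: add.finprod_one_eqI)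
    qed
  qed (auto intro!: finsum_closed)
  also have "\<dots> = (\<Oplus>\<alpha>\<in>words n. f (rep A \<alpha>) \<odot> (s i \<otimes> pr \<alpha>))"
    by (subst finsum_single[of _ i]) (auto intro!: finsum_closed)
  also have "\<dots> = (\<Oplus>\<alpha>\<in>words n. s i \<otimes> (f (rep A \<alpha>) \<odot> pr \<alpha>))"
    by (simp add: smult_mult_right)
  also have "\<dots> = s i \<otimes> D n f"
    unfolding diag_def by (rule finsum_rdistr[symmetric]) auto
  finally show ?thesis .
qed

lemma D_shift_times_S:
  assumes "level A n f" shows "D (Suc n) (\<lambda>x. f (shift x)) \<otimes> S = S \<otimes> D n f"
proof -
  have "D (Suc n) (\<lambda>x. f (shift x)) \<otimes> S = (\<Oplus>i\<in>UNIV. D (Suc n) (\<lambda>x. f (shift x)) \<otimes> s i)"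
    unfolding gen_sum_def by (rule finsum_rdistr) auto
  also have "\<dots> = (\<Oplus>i\<in>UNIV. s i \<otimes> D n f)" by (simp add: D_shift_times_s[OF assms])
  also have "\<dots> = S \<otimes> D n f" unfolding gen_sum_def by (rule finsum_ldistr[symmetric]) auto
  finally show ?thesis .
qed

text \<open>Covariance moves \<open>D n f\<close> out of each summand as composition with the shift,
  leaving the sum of the range projections, which is the unit.\<close>

lemma phi_D:
  assumes "level A n f"
  shows "(\<Oplus>i\<in>UNIV. s i \<otimes> D n f \<otimes> adj R (s i)) = D (Suc n) (\<lambda>x. f (shift x))"
proof -
  have "(\<Oplus>i\<in>UNIV. s i \<otimes> D n f \<otimes> adj R (s i)) =
     (\<Oplus>i\<in>UNIV. D (Suc n) (\<lambda>x. f (shift x)) \<otimes> (s i \<otimes> adj R (s i)))"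
    by (simp add: D_shift_times_s[OF assms, symmetric] m_assoc)
  also have "\<dots> = D (Suc n) (\<lambda>x. f (shift x)) \<otimes> (\<Oplus>i\<in>UNIV. s i \<otimes> adj R (s i))"
    by (rule finsum_rdistr[symmetric]) auto
  finally show ?thesis by (simp add: total)
qed

text \<open>Induction through \<open>phi_D\<close> for the constant function 1: conjugating the unit
  by all generators and summing gives the unit back.\<close>

lemma D_one: "D n (\<lambda>x. 1) = \<one>"
proof (induction n)
  case 0
  then show ?case by (simp add: diag_def sproj_def)
next
  case (Suc n)
  then show ?case using phi_D[of n "\<lambda>x. 1"] total by (simp add: level_def)
qed

text \<open>Summing \<open>pr (\<alpha> @ [j])\<close> over the last letter gives back
  \<open>pr \<alpha>\<close>, by \<open>total\<close> inserted in the middle.\<close>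

lemma D_Suc:
  assumes "level A n f" shows "D (Suc n) f = D n f"
proof -
  have "D (Suc n) f = (\<Oplus>j\<in>UNIV. \<Oplus>\<alpha>\<in>words n. f (rep A (\<alpha> @ [j])) \<odot> pr (\<alpha> @ [j]))"
    unfolding diag_def by (rule finsum_words_snoc) auto
  also have "\<dots> = (\<Oplus>j\<in>UNIV. \<Oplus>\<alpha>\<in>words n. f (rep A \<alpha>) \<odot> pr (\<alpha> @ [j]))"
  proof (intro finsum_cong' refl)
    fix j and \<alpha> :: "'n list" assume \<alpha>: "\<alpha> \<in> words n"
    show "f (rep A (\<alpha> @ [j])) \<odot> pr (\<alpha> @ [j]) = f (rep A \<alpha>) \<odot> pr (\<alpha> @ [j])"
    proof (cases "admissible_word A (\<alpha> @ [j])")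
      case True
      have 2: "admissible_word A \<alpha>"
        using True by (auto simp: admissible_word_def nth_append split: if_splits)
      have "prefix n (rep A (\<alpha> @ [j])) = \<alpha>"
        using rep(2)[OF A True] \<alpha> by (simp add: prefix_def mem_words)
      then have "f (rep A (\<alpha> @ [j])) = f (rep A \<alpha>)"
        using rep[OF A True] rep[OF A 2] \<alpha>
        by (intro levelD[OF assms]) (auto simp: mem_words)
      then show ?thesis by simp
    qed (simp add: pr_nonadmissible)
  qed (auto intro!: finsum_closed)
  also have "\<dots> = (\<Oplus>\<alpha>\<in>words n. \<Oplus>j\<in>UNIV. f (rep A \<alpha>) \<odot> pr (\<alpha> @ [j]))"
    by (rule finsum_swap) auto
  also have "\<dots> = D n f"
    unfolding diag_def
  proof (intro finsum_cong' refl)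
    fix \<alpha> :: "'n list"
    have "(\<Oplus>j\<in>UNIV. pr (\<alpha> @ [j])) = (\<Oplus>j\<in>UNIV. sw \<alpha> \<otimes> (s j \<otimes> adj R (s j)) \<otimes> adj R (sw \<alpha>))"
      by (simp add: sproj_def sw_snoc adj_mult m_assoc)
    also have "\<dots> = (\<Oplus>j\<in>UNIV. sw \<alpha> \<otimes> (s j \<otimes> adj R (s j))) \<otimes> adj R (sw \<alpha>)"
      by (rule finsum_ldistr[symmetric]) auto
    also have "(\<Oplus>j\<in>UNIV. sw \<alpha> \<otimes> (s j \<otimes> adj R (s j))) = sw \<alpha> \<otimes> (\<Oplus>j\<in>UNIV. s j \<otimes> adj R (s j))"
      by (rule finsum_rdistr[symmetric]) auto
    finally have "(\<Oplus>j\<in>UNIV. pr (\<alpha> @ [j])) = pr \<alpha>" by (simp add: total sproj_def)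
    then show "(\<Oplus>j\<in>UNIV. f (rep A \<alpha>) \<odot> pr (\<alpha> @ [j])) = f (rep A \<alpha>) \<odot> pr \<alpha>"
      by (subst finsum_smult[symmetric]) auto
  qed auto
  finally show ?thesis .
qed

lemma D_level:
  assumes "level A n f" "n \<le> m" shows "D m f = D n f"
  using assms(2)
proof (induction m rule: dec_induct)
  case (step m)
  then show ?case using D_Suc[of m f] level_mono[of A n f m] assms(1) by auto
qed simp

lemma D_prefix: "D (length \<alpha>) (\<lambda>x. of_bool (prefix (length \<alpha>) x = \<alpha>)) = pr \<alpha>"
proof -
  have "of_bool (prefix (length \<alpha>) (rep A \<beta>) = \<alpha>) \<odot> pr \<beta> = (if \<beta> = \<alpha> then pr \<alpha> else \<zero>)"
    if "\<beta> \<in> words (length \<alpha>)" for \<beta>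
    using that rep(2)[OF A, of \<beta>]
    by (cases "admissible_word A \<beta>") (auto simp: pr_nonadmissible mem_words)
  then have "D (length \<alpha>) (\<lambda>x. of_bool (prefix (length \<alpha>) x = \<alpha>)) =
      (\<Oplus>\<beta>\<in>words (length \<alpha>). if \<beta> = \<alpha> then pr \<alpha> else \<zero>)"
    unfolding diag_def by (intro finsum_cong') auto
  also have "\<dots> = pr \<alpha>" by (subst finsum_single[of _ \<alpha>]) (auto simp: mem_words)
  finally show ?thesis .
qed

lemma pr_times_S: "pr (i # \<alpha>) \<otimes> S = s i \<otimes> pr \<alpha>"
proof -
  have "pr (i # \<alpha>) \<otimes> S = (\<Oplus>j\<in>UNIV. pr (i # \<alpha>) \<otimes> s j)"
    unfolding gen_sum_def by (rule finsum_rdistr) auto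
  also have "\<dots> = s i \<otimes> pr \<alpha>" by (subst finsum_single[of _ i]) (auto simp: pr_Cons_times_s)
  finally show ?thesis .
qed

lemma pr_S_S_pr:
  assumes "length \<alpha> = length \<beta>"
  shows "(pr (i # \<alpha>) \<otimes> S) \<otimes> adj R (pr (j # \<beta>) \<otimes> S) = (if \<alpha> = \<beta> then s i \<otimes> pr \<alpha> \<otimes> adj R (s j) else \<zero>)"
proof -
  have "(pr (i # \<alpha>) \<otimes> S) \<otimes> adj R (pr (j # \<beta>) \<otimes> S) = s i \<otimes> (pr \<alpha> \<otimes> pr \<beta>) \<otimes> adj R (s j)"
    by (simp add: pr_times_S adj_mult m_assoc)
  then show ?thesis using assms by (simp add: pr_idem pr_orth)
qed

text \<open>One letter is enough to select a single generator from the sum. For the empty word the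
  equation would say that \<open>S\<close> is a coisometry, which fails in general.\<close>

lemma pr_S_S_pr_same: "\<alpha> \<noteq> [] \<Longrightarrow> (pr \<alpha> \<otimes> S) \<otimes> adj R (pr \<alpha> \<otimes> S) = pr \<alpha>"
  by (cases \<alpha>) (simp_all add: pr_S_S_pr pr_Cons[symmetric])

text \<open>The product vanishes off the diagonal of the double sum because a point \<open>x\<close> with
  \<open>f x \<noteq> 0\<close> is determined, up to its first \<open>Suc n\<close> letters, by the letters \<open>1, \<dots>, n\<close>.\<close>

lemma D_S_range:
  assumes inj: "\<And>x y. x \<in> shift_space A \<Longrightarrow> y \<in> shift_space A \<Longrightarrow> f x \<noteq> 0 \<Longrightarrow> f y \<noteq> 0 \<Longrightarrow>
      prefix n (shift x) = prefix n (shift y) \<Longrightarrow> x 0 = y 0"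
  shows "(D (Suc n) f \<otimes> S) \<otimes> adj R (D (Suc n) f \<otimes> S) = D (Suc n) (\<lambda>x. f x * cnj (f x))"
proof -
  let ?v = "\<lambda>\<gamma>. f (rep A \<gamma>) \<odot> (pr \<gamma> \<otimes> S)"
  have T: "D (Suc n) f \<otimes> S = (\<Oplus>\<gamma>\<in>words (Suc n). ?v \<gamma>)"
    unfolding diag_def by (subst finsum_ldistr) (auto simp: smult_mult_left)
  have zero: "?v \<gamma> \<otimes> adj R (?v \<delta>) = \<zero>" if ne: "\<gamma> \<in> words (Suc n)" "\<delta> \<in> words (Suc n)" "\<gamma> \<noteq> \<delta>" for \<gamma> \<delta>
  proof -
    obtain i \<alpha> j \<beta> where g: "\<gamma> = i # \<alpha>" "\<delta> = j # \<beta>" "length \<alpha> = n" "length \<beta> = n"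
      using ne(1,2) by (cases \<gamma>; cases \<delta>) (auto simp: mem_words)
    show ?thesis
    proof (cases "admissible_word A \<gamma> \<and> admissible_word A \<delta>")
      case True
      have *: "f (rep A \<gamma>) = 0 \<or> f (rep A \<delta>) = 0" if "\<alpha> = \<beta>"
      proof (rule ccontr)
        assume c: "\<not> ?thesis"
        have "rep A \<gamma> 0 = i" "rep A \<delta> 0 = j" "prefix n (shift (rep A \<gamma>)) = \<alpha>" "prefix n (shift (rep A \<delta>)) = \<beta>"
          using True rep(2)[OF A, of \<gamma>] rep(2)[OF A, of \<delta>] g by (auto simp: prefix_Suc)
        then have "i = j" using inj[of "rep A \<gamma>" "rep A \<delta>"] c True rep(1)[OF A] that by auto
        then show False using ne(3) that g by simp
      qed
      have "?v \<gamma> \<otimes> adj R (?v \<delta>) = (f (rep A \<gamma>) * cnj (f (rep A \<delta>))) \<odot> ((pr \<gamma> \<otimes> S) \<otimes> adj R (pr \<delta> \<otimes> S))"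
        by (simp add: smult_mult_left smult_mult_right adj_smult smult_smult mult.commute)
      then show ?thesis using * g by (auto simp: pr_S_S_pr)
    qed (auto simp: pr_nonadmissible)
  qed
  have "(D (Suc n) f \<otimes> S) \<otimes> adj R (D (Suc n) f \<otimes> S) =
      (\<Oplus>\<gamma>\<in>words (Suc n). ?v \<gamma>) \<otimes> (\<Oplus>\<delta>\<in>words (Suc n). adj R (?v \<delta>))"
    unfolding T by (subst finsum_adj) auto
  also have "\<dots> = (\<Oplus>\<gamma>\<in>words (Suc n). ?v \<gamma> \<otimes> (\<Oplus>\<delta>\<in>words (Suc n). adj R (?v \<delta>)))"
    by (rule finsum_ldistr) (auto intro!: finsum_closed)
  also have "\<dots> = (\<Oplus>\<gamma>\<in>words (Suc n). (f (rep A \<gamma>) * cnj (f (rep A \<gamma>))) \<odot> pr \<gamma>)"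
  proof (intro finsum_cong' refl)
    fix \<gamma> :: "'n list" assume \<gamma>: "\<gamma> \<in> words (Suc n)"
    have "?v \<gamma> \<otimes> (\<Oplus>\<delta>\<in>words (Suc n). adj R (?v \<delta>)) = (\<Oplus>\<delta>\<in>words (Suc n). ?v \<gamma> \<otimes> adj R (?v \<delta>))"
      by (rule finsum_rdistr) auto
    also have "\<dots> = ?v \<gamma> \<otimes> adj R (?v \<gamma>)"
      using \<gamma> zero by (intro finsum_single) auto
    also have "\<dots> = (f (rep A \<gamma>) * cnj (f (rep A \<gamma>))) \<odot> ((pr \<gamma> \<otimes> S) \<otimes> adj R (pr \<gamma> \<otimes> S))"
      by (simp add: smult_mult_left smult_mult_right adj_smult smult_smult mult.commute)
    also have "(pr \<gamma> \<otimes> S) \<otimes> adj R (pr \<gamma> \<otimes> S) = pr \<gamma>"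
      using \<gamma> by (intro pr_S_S_pr_same) (auto simp: mem_words)
    finally show "?v \<gamma> \<otimes> (\<Oplus>\<delta>\<in>words (Suc n). adj R (?v \<delta>)) = (f (rep A \<gamma>) * cnj (f (rep A \<gamma>))) \<odot> pr \<gamma>" .
  qed auto
  finally show ?thesis by (simp add: diag_def)
qed

text \<open>The transfer operator of the shift: a sum over the preimages \<open>case_nat i x\<close>
  of \<open>x\<close>, where the matrix entry discards illegal first letters.\<close>

definition transfer :: "((nat \<Rightarrow> 'n) \<Rightarrow> complex) \<Rightarrow> (nat \<Rightarrow> 'n) \<Rightarrow> complex" where
  "transfer f x = (\<Sum>i\<in>UNIV. of_nat (A $ i $ x 0) * f (case_nat i x))"

text \<open>Compression by \<open>S\<close> realizes the transfer operator, because cross terms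
  between different generators vanish. With \<open>n > 0\<close> the entry
  \<open>A $ i $ hd \<alpha>\<close> can be read off a word of length \<open>n\<close>.\<close>

lemma S_D_S:
  assumes f: "level A (Suc n) f" and n: "n > 0"
  shows "adj R S \<otimes> (D (Suc n) f \<otimes> S) = D n (transfer f)"
proof -
  have S_s: "adj R S \<otimes> s i = adj R (s i) \<otimes> s i" for i
  proof -
    have "adj R S \<otimes> s i = (\<Oplus>j\<in>UNIV. adj R (s j)) \<otimes> s i"
      unfolding gen_sum_def by (subst finsum_adj) auto
    also have "\<dots> = (\<Oplus>j\<in>UNIV. adj R (s j) \<otimes> s i)" by (rule finsum_ldistr) auto
    also have "\<dots> = adj R (s i) \<otimes> s i" by (rule finsum_single) (auto simp: orthogonal)
    finally show ?thesis .
  qed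
  have summand: "adj R S \<otimes> (f (rep A (i # \<alpha>)) \<odot> pr (i # \<alpha>) \<otimes> S) =
      (f (rep A (i # \<alpha>)) * of_nat (A $ i $ hd \<alpha>)) \<odot> pr \<alpha>" if "\<alpha> \<in> words n" for i \<alpha>
  proof -
    have "adj R S \<otimes> (f (rep A (i # \<alpha>)) \<odot> pr (i # \<alpha>) \<otimes> S) = f (rep A (i # \<alpha>)) \<odot> (adj R S \<otimes> s i \<otimes> pr \<alpha>)"
      by (simp add: smult_mult_left smult_mult_right pr_times_S m_assoc)
    also have "adj R S \<otimes> s i \<otimes> pr \<alpha> = of_nat (A $ i $ hd \<alpha>) \<odot> pr \<alpha>"
      unfolding S_s using that n by (simp add: m_assoc) (subst source_pr, auto simp: mem_words)
    finally show ?thesis by (simp add: smult_smult)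
  qed
  have "D (Suc n) f \<otimes> S = (\<Oplus>\<gamma>\<in>words (Suc n). f (rep A \<gamma>) \<odot> pr \<gamma> \<otimes> S)"
    unfolding diag_def by (rule finsum_ldistr) auto
  then have "adj R S \<otimes> (D (Suc n) f \<otimes> S) = (\<Oplus>\<gamma>\<in>words (Suc n). adj R S \<otimes> (f (rep A \<gamma>) \<odot> pr \<gamma> \<otimes> S))"
    by (simp add: finsum_rdistr)
  also have "\<dots> = (\<Oplus>i\<in>UNIV. \<Oplus>\<alpha>\<in>words n. adj R S \<otimes> (f (rep A (i # \<alpha>)) \<odot> pr (i # \<alpha>) \<otimes> S))"
    by (rule finsum_words_Suc) auto
  also have "\<dots> = (\<Oplus>i\<in>UNIV. \<Oplus>\<alpha>\<in>words n. (f (rep A (i # \<alpha>)) * of_nat (A $ i $ hd \<alpha>)) \<odot> pr \<alpha>)"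
    by (intro finsum_cong' refl summand) (auto intro!: finsum_closed)
  also have "\<dots> = (\<Oplus>\<alpha>\<in>words n. \<Oplus>i\<in>UNIV. (f (rep A (i # \<alpha>)) * of_nat (A $ i $ hd \<alpha>)) \<odot> pr \<alpha>)"
    by (rule finsum_swap) auto
  also have "\<dots> = (\<Oplus>\<alpha>\<in>words n. transfer f (rep A \<alpha>) \<odot> pr \<alpha>)"
  proof (intro finsum_cong' refl)
    fix \<alpha> :: "'n list" assume \<alpha>: "\<alpha> \<in> words n"
    show "(\<Oplus>i\<in>UNIV. (f (rep A (i # \<alpha>)) * of_nat (A $ i $ hd \<alpha>)) \<odot> pr \<alpha>) = transfer f (rep A \<alpha>) \<odot> pr \<alpha>"
    proof (cases "admissible_word A \<alpha>")
      case True
      note r = rep[OF A True]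
      have "\<alpha> \<noteq> []" using \<alpha> n by (auto simp: mem_words)
      then have 0: "rep A \<alpha> 0 = hd \<alpha>" using r(2) by (cases \<alpha>) (auto simp: prefix_Suc)
      have "f (rep A (i # \<alpha>)) * of_nat (A $ i $ hd \<alpha>) = of_nat (A $ i $ rep A \<alpha> 0) * f (case_nat i (rep A \<alpha>))" for i
      proof (cases "A $ i $ hd \<alpha> = 1")
        case a: True
        then have ad: "admissible_word A (i # \<alpha>)" using True by (simp add: admissible_Cons)
        have "f (rep A (i # \<alpha>)) = f (case_nat i (rep A \<alpha>))"
        proof (rule levelD[OF f])
          show "case_nat i (rep A \<alpha>) \<in> shift_space A" using a r(1) 0 by (simp add: case_nat_in_shift_space)
          show "prefix (Suc n) (rep A (i # \<alpha>)) = prefix (Suc n) (case_nat i (rep A \<alpha>))"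
            using rep(2)[OF A ad] r(2) \<alpha> by (simp add: mem_words) (simp add: prefix_Suc)
        qed (rule rep(1)[OF A ad])
        then show ?thesis using 0 by simp
      qed (use entry[of i "hd \<alpha>"] 0 in auto)
      then show ?thesis unfolding transfer_def by (simp add: finsum_smult_left)
    qed (simp add: pr_nonadmissible)
  qed (auto intro!: finsum_closed)
  finally show ?thesis by (simp add: diag_def)
qed

text \<open>A function with values in \<open>[-1, 1]\<close> is the real part of a function with values in the unit
  circle, and the latter corresponds to a unitary.\<close>

lemma D_norm_le:
  assumes rho: "cstar_seminorm R \<rho>" and f: "\<And>x. x \<in> shift_space A \<Longrightarrow> cmod (f x) \<le> M"
  shows "\<rho> (D n f) \<le> M"
proof -
  have real: "\<rho> (D n (\<lambda>x. complex_of_real (g x))) \<le> 1"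
    if g: "\<And>x. x \<in> shift_space A \<Longrightarrow> \<bar>g x\<bar> \<le> 1" for g :: "(nat \<Rightarrow> 'n) \<Rightarrow> real"
  proof -
    define v where "v x = Complex (g x) (sqrt (1 - (g x)\<^sup>2))" for x
    have v: "cnj (v x) * v x = 1" if "x \<in> shift_space A" for x
    proof -
      have "(g x)\<^sup>2 \<le> 1" using g[OF that] by (simp add: abs_square_le_1)
      then show ?thesis by (simp add: v_def complex_eq_iff power2_eq_square)
    qed
    have u: "adj R (D n v) \<otimes> D n v = \<one>"
      unfolding D_adj D_mult using D_cong[of "\<lambda>x. cnj (v x) * v x" "\<lambda>x. 1"] v D_one by simp
    have 1: "\<rho> (D n v) \<le> 1"
      by (rule seminorm_le_1I[OF rho]) (simp_all add: u seminorm_one_le_1[OF rho])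
    have "D n (\<lambda>x. complex_of_real (g x)) = D n (\<lambda>x. (1/2) * (v x + cnj (v x)))"
      by (rule D_cong) (simp add: v_def complex_eq_iff)
    also have "\<dots> = (1/2) \<odot> (D n v \<oplus> adj R (D n v))" by (simp only: D_smult D_add D_adj)
    finally have "\<rho> (D n (\<lambda>x. complex_of_real (g x))) = (1/2) * \<rho> (D n v \<oplus> adj R (D n v))"
      by (simp add: seminorm_smult[OF rho])
    also have "\<dots> \<le> (1/2) * (\<rho> (D n v) + \<rho> (adj R (D n v)))"
      by (intro mult_left_mono seminorm_add[OF rho]) auto
    finally show ?thesis using 1 by (simp add: seminorm_adj[OF rho])
  qed
  \<comment> \<open>By the C*-identity the complex case reduces to the real function of squared
    moduli.\<close>
  have unit: "\<rho> (D n g) \<le> 1" if g: "\<And>x. x \<in> shift_space A \<Longrightarrow> cmod (g x) \<le> 1" for g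
  proof (rule seminorm_le_1I[OF rho])
    have "adj R (D n g) \<otimes> D n g = D n (\<lambda>x. complex_of_real ((cmod (g x))\<^sup>2))"
      unfolding D_adj D_mult by (rule D_cong) (simp add: complex_norm_square[symmetric] mult.commute)
    moreover have "\<rho> (D n (\<lambda>x. complex_of_real ((cmod (g x))\<^sup>2))) \<le> 1"
      by (rule real) (use g in \<open>auto simp: abs_square_le_1\<close>)
    ultimately show "\<rho> (adj R (D n g) \<otimes> D n g) \<le> 1" by simp
  qed simp
  obtain x0 where "x0 \<in> shift_space A"
    using admissible_extend[OF A, of "[]"] by (auto simp: admissible_word_def)
  then have M: "M \<ge> 0" using f norm_ge_zero order_trans by blast
  show ?thesis
  proof (rule field_le_epsilon)
    fix e :: real assume "e > 0"
    \<comment> \<open>Adding \<open>e\<close> makes the scaling constant positive even if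
      \<open>M\<close> is 0.\<close>
    define c where "c = M + e"
    have c: "c > 0" using M \<open>e > 0\<close> by (simp add: c_def)
    have "\<rho> (D n (\<lambda>x. f x / c)) \<le> 1"
    proof (rule unit)
      fix x assume "x \<in> shift_space A"
      then have "cmod (f x) \<le> c" using f \<open>e > 0\<close> by (fastforce simp: c_def)
      then show "cmod (f x / c) \<le> 1" using c by (simp add: norm_divide)
    qed
    moreover have "D n f = c \<odot> D n (\<lambda>x. f x / c)"
      unfolding D_smult[symmetric] using c by (intro D_cong) auto
    ultimately show "\<rho> (D n f) \<le> M + e"
      using c by (simp add: seminorm_smult[OF rho] c_def[symmetric] mult_left_le)
  qed
qed

end

section \<open>Families induced by a conjugacy\<close>

text \<open>The last two assumptions are uniform continuity of the homeomorphism and of its inverse,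
  in terms of prefixes; compactness supplies them in \<open>continuous_level\<close>.\<close>

locale shift_homeo =
  fixes A :: "nat^'n::finite^'n" and B :: "nat^'m::finite^'m"
    and h :: "(nat \<Rightarrow> 'n) \<Rightarrow> nat \<Rightarrow> 'm" and k :: "(nat \<Rightarrow> 'm) \<Rightarrow> nat \<Rightarrow> 'n"
  assumes mat_A: "ck_matrix A" and mat_B: "ck_matrix B"
    and h_in: "x \<in> shift_space A \<Longrightarrow> h x \<in> shift_space B"
    and k_in: "y \<in> shift_space B \<Longrightarrow> k y \<in> shift_space A"
    and kh: "x \<in> shift_space A \<Longrightarrow> k (h x) = x"
    and hk: "y \<in> shift_space B \<Longrightarrow> h (k y) = y"
    and h_unif: "\<exists>n. level A n (\<lambda>x. prefix m (h x))"
    and k_unif: "\<exists>n. level B n (\<lambda>y. prefix m (k y))"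
begin

lemma homeo_sym: "shift_homeo B A k h"
  by unfold_locales (auto simp: mat_A mat_B h_in k_in kh hk intro: h_unif k_unif)

lemma level_comp: "level A n f \<Longrightarrow> \<exists>m. level B m (\<lambda>y. f (k y))"
  using k_unif[of n] unfolding level_def by (metis k_in)

end

locale shift_conj = shift_homeo A B h k
  for A :: "nat^'n::finite^'n" and B :: "nat^'m::finite^'m"
    and h :: "(nat \<Rightarrow> 'n) \<Rightarrow> nat \<Rightarrow> 'm" and k :: "(nat \<Rightarrow> 'm) \<Rightarrow> nat \<Rightarrow> 'n" +
  assumes h_shift: "x \<in> shift_space A \<Longrightarrow> h (shift x) = shift (h x)"
begin

lemma k_shift: "y \<in> shift_space B \<Longrightarrow> k (shift y) = shift (k y)"
  by (metis h_shift hk k_in kh shift_in_shift_space)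

lemma sym: "shift_conj B A k h"
  by (intro shift_conj.intro shift_conj_axioms.intro homeo_sym k_shift)

text \<open>The conditions serve three later steps: positivity for \<open>S_D_S\<close>, the level
  of the letter functions, and the injectivity that \<open>D_S_range\<close> asks for.\<close>

definition good_level :: "nat \<Rightarrow> bool" where
  "good_level n \<longleftrightarrow> n > 0 \<and> level B n (\<lambda>y. k y 0) \<and>
     (\<forall>y\<in>shift_space B. \<forall>z\<in>shift_space B. k y 0 = k z 0 \<longrightarrow>
        prefix n (shift y) = prefix n (shift z) \<longrightarrow> y 0 = z 0)"

text \<open>If \<open>shift y\<close> and \<open>shift z\<close> agree to depth \<open>n1\<close>,
  then \<open>shift (k y)\<close> and \<open>shift (k z)\<close> agree in \<open>m\<close> letters.
  With equal first letters, \<open>k y\<close> and \<open>k z\<close> also agree to depth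
  \<open>m\<close>, and this determines the first letter of \<open>h (k y) = y\<close>.\<close>

lemma ex_good_level: "\<exists>n. good_level n"
proof -
  obtain n0 where n0: "level B n0 (\<lambda>y. prefix 1 (k y))" using k_unif by blast
  obtain m where m: "level A m (\<lambda>x. prefix 1 (h x))" using h_unif by blast
  obtain n1 where n1: "level B n1 (\<lambda>y. prefix m (k y))" using k_unif by blast
  define n where "n = Suc (max n0 n1)"
  have "level B n (\<lambda>y. prefix 1 (k y))" using level_mono[OF n0, of n] by (simp add: n_def)
  from level_compose[OF this, of hd] have "level B n (\<lambda>y. k y 0)" by (simp add: prefix_1)
  moreover have "y 0 = z 0" if yz: "y \<in> shift_space B" "z \<in> shift_space B" and 0: "k y 0 = k z 0"
      and pre: "prefix n (shift y) = prefix n (shift z)" for y z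
  proof -
    have "level B n (\<lambda>y. prefix m (k y))" using level_mono[OF n1, of n] by (simp add: n_def)
    then have "prefix m (k (shift y)) = prefix m (k (shift z))"
      by (rule levelD) (use yz pre in \<open>auto intro: shift_in_shift_space\<close>)
    then have "prefix m (shift (k y)) = prefix m (shift (k z))" by (simp add: k_shift yz)
    then have "prefix (Suc m) (k y) = prefix (Suc m) (k z)" using 0 by (simp add: prefix_Suc)
    then have "prefix m (k y) = prefix m (k z)" by (rule prefix_eq_mono) simp
    then have "prefix 1 (h (k y)) = prefix 1 (h (k z))"
      by (rule levelD[OF m k_in k_in, OF yz])
    then show ?thesis using yz by (simp add: hk prefix_1)
  qed
  ultimately show ?thesis unfolding good_level_def by (intro exI[of _ n]) (auto simp: n_def)
qed

definition conj_level :: nat where "conj_level = (SOME n. good_level n)"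

lemma conj_level:
  "conj_level > 0" "level B conj_level (\<lambda>y. k y 0)"
  "\<lbrakk>y \<in> shift_space B; z \<in> shift_space B; k y 0 = k z 0;
    prefix conj_level (shift y) = prefix conj_level (shift z)\<rbrakk> \<Longrightarrow> y 0 = z 0"
proof -
  have good: "good_level conj_level" unfolding conj_level_def by (rule someI_ex[OF ex_good_level])
  then show "conj_level > 0" "level B conj_level (\<lambda>y. k y 0)" unfolding good_level_def by blast+
  show "y 0 = z 0" if "y \<in> shift_space B" "z \<in> shift_space B" "k y 0 = k z 0"
    "prefix conj_level (shift y) = prefix conj_level (shift z)"
    using good that unfolding good_level_def by blast
qed

end

text \<open>\<open>R\<close> and \<open>s\<close> stay arbitrary, so that the construction can be
  applied a second time to the family it produces, with \<open>h\<close> and \<open>k\<close>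
  exchanged.\<close>

locale ck_conj = ck_family R B s + shift_conj A B h k
  for R :: "('a, 'r) star_algebra_scheme" (structure)
    and B :: "nat^'m::finite^'m" and s :: "'m \<Rightarrow> 'a"
    and A :: "nat^'n::finite^'n" and h :: "(nat \<Rightarrow> 'n) \<Rightarrow> nat \<Rightarrow> 'm" and k :: "(nat \<Rightarrow> 'm) \<Rightarrow> nat \<Rightarrow> 'n"
begin

definition letter :: "'n \<Rightarrow> (nat \<Rightarrow> 'm) \<Rightarrow> complex" where
  "letter i y = of_bool (k y 0 = i)"

text \<open>Since \<open>s\<^sub>i = s\<^sub>i s\<^sub>i\<^sup>* s\<close> for the sum \<open>s\<close> of the generators, an isomorphism that is composition with
  \<open>k\<close> on the diagonal and preserves \<open>s\<close> has to map \<open>s\<^sub>i\<close> to the following element.\<close>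

definition t :: "'n \<Rightarrow> 'a" where
  "t i = D (Suc conj_level) (letter i) \<otimes> S"

lemma t_closed [simp]: "t i \<in> carrier R"
  by (simp add: t_def)

lemma level_letter: "level B conj_level (letter i)"
  unfolding letter_def by (rule level_compose[OF conj_level(2)])

lemma D_letter: "m \<ge> conj_level \<Longrightarrow> D m (letter i) = D (Suc conj_level) (letter i)"
  using D_level[OF level_letter, of m] D_level[OF level_letter, of "Suc conj_level"] by simp

text \<open>The range formula \<open>D_S_range\<close> applies because \<open>conj_level\<close>
  makes \<open>y 0\<close> a function of \<open>k y 0\<close> and of a prefix of
  \<open>shift y\<close>.\<close>

lemma t_adj: "t i \<otimes> adj R (t i) = D (Suc conj_level) (letter i)"
proof -
  have "t i \<otimes> adj R (t i) = D (Suc conj_level) (\<lambda>x. letter i x * cnj (letter i x))"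
    unfolding t_def by (rule D_S_range) (use conj_level(3) in \<open>auto simp: letter_def split: if_splits\<close>)
  also have "\<dots> = D (Suc conj_level) (letter i)" by (rule D_cong) (simp add: letter_def)
  finally show ?thesis .
qed

lemma D_letter_t: "D (Suc conj_level) (letter i) \<otimes> t i = t i"
proof -
  have "D (Suc conj_level) (letter i) \<otimes> D (Suc conj_level) (letter i) = D (Suc conj_level) (letter i)"
    unfolding D_mult by (rule D_cong) (simp add: letter_def)
  then show ?thesis unfolding t_def by (simp add: m_assoc[symmetric])
qed

lemma adj_t_t: "adj R (t i) \<otimes> t j = adj R S \<otimes> (D (Suc conj_level) (\<lambda>x. letter i x * letter j x) \<otimes> S)"
proof -
  have "adj R (D (Suc conj_level) (letter i)) = D (Suc conj_level) (letter i)"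
    unfolding D_adj by (rule D_cong) (simp add: letter_def)
  then have "adj R (t i) \<otimes> t j = adj R S \<otimes> ((D (Suc conj_level) (letter i) \<otimes> D (Suc conj_level) (letter j)) \<otimes> S)"
    unfolding t_def by (simp add: adj_mult m_assoc)
  then show ?thesis by (simp add: D_mult)
qed

text \<open>Preimages of \<open>y\<close> under the shift correspond through \<open>k\<close> to
  preimages of \<open>k y\<close>. The one with first letter \<open>i\<close> exists exactly if
  \<open>A $ i $ k y 0 = 1\<close>, and its image under \<open>h\<close> then begins with the only
  letter \<open>j\<close> that contributes.\<close>

lemma transfer_letter: "y \<in> shift_space B \<Longrightarrow> transfer (letter i) y = of_nat (A $ i $ k y 0)"
proof -
  assume y: "y \<in> shift_space B"
  have pt: "of_nat (B $ j $ y 0) * letter i (case_nat j y) =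
      (if A $ i $ k y 0 = 1 \<and> j = h (case_nat i (k y)) 0 then 1 else 0)" for j
  proof (cases "B $ j $ y 0 = 1")
    case True
    then have z: "case_nat j y \<in> shift_space B" using y by (simp add: case_nat_in_shift_space)
    then have sz: "shift (k (case_nat j y)) = k y" using k_shift[OF z] by simp
    have "k (case_nat j y) 0 = i \<longleftrightarrow> A $ i $ k y 0 = 1 \<and> j = h (case_nat i (k y)) 0"
    proof
      assume i: "k (case_nat j y) 0 = i"
      then have "k (case_nat j y) = case_nat i (k y)" using shift_eqD[OF sz] by simp
      then show "A $ i $ k y 0 = 1 \<and> j = h (case_nat i (k y)) 0"
        using hk[OF z] shift_space_0[OF k_in[OF z]] i sz by (metis old.nat.simps(4))
    next
      assume *: "A $ i $ k y 0 = 1 \<and> j = h (case_nat i (k y)) 0"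
      then have x: "case_nat i (k y) \<in> shift_space A" using k_in[OF y] by (simp add: case_nat_in_shift_space)
      have "shift (h (case_nat i (k y))) = y" using h_shift[OF x] hk[OF y] by simp
      then have "h (case_nat i (k y)) = case_nat j y" using * shift_eqD by metis
      then show "k (case_nat j y) 0 = i" using kh[OF x] by (metis old.nat.simps(4))
    qed
    then show ?thesis using True by (simp add: letter_def)
  next
    case False
    have "\<not> (A $ i $ k y 0 = 1 \<and> j = h (case_nat i (k y)) 0)"
    proof
      assume *: "A $ i $ k y 0 = 1 \<and> j = h (case_nat i (k y)) 0"
      then have x: "case_nat i (k y) \<in> shift_space A" using k_in[OF y] by (simp add: case_nat_in_shift_space)
      have "shift (h (case_nat i (k y))) = y" using h_shift[OF x] hk[OF y] by simp
      then have "B $ j $ y 0 = 1" using shift_space_0[OF h_in[OF x]] * by simp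
      with False show False by simp
    qed
    then show ?thesis using False entry[of j "y 0"] by auto
  qed
  show ?thesis
  proof (cases "A $ i $ k y 0 = 1")
    case True
    then show ?thesis unfolding transfer_def pt by simp
  next
    case False
    then show ?thesis unfolding transfer_def pt using ck_matrix_cases[OF mat_A, of i "k y 0"] by simp
  qed
qed

text \<open>The range projections are the letter projections, which partition the unit; the source
  relation is the transfer operator applied to a letter function.\<close>

lemma conj_family: "ck_family R A t"
proof
  show "ck_matrix A" by (rule mat_A)
  fix i
  show "t i \<in> carrier R" by simp
  show "t i \<otimes> adj R (t i) \<otimes> t i = t i" by (simp add: t_adj D_letter_t)
  show "adj R (t i) \<otimes> t j = \<zero>" if "i \<noteq> j" for j
  proof -
    have "D (Suc conj_level) (\<lambda>x. letter i x * letter j x) = D (Suc conj_level) (\<lambda>x. 0)"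
      using that by (intro D_cong) (auto simp: letter_def)
    then show ?thesis by (simp add: adj_t_t D_zero)
  qed
  have lev: "level B conj_level (\<lambda>y. of_nat (A $ i $ k y 0) :: complex)"
    by (rule level_compose[OF conj_level(2)])
  have "adj R (t i) \<otimes> t i = adj R S \<otimes> (D (Suc conj_level) (letter i) \<otimes> S)"
    unfolding adj_t_t by (subst D_cong[of _ "letter i"]) (auto simp: letter_def)
  also have "\<dots> = D conj_level (transfer (letter i))"
    by (rule S_D_S[OF level_mono[OF level_letter] conj_level(1)]) simp
  also have "\<dots> = D conj_level (\<lambda>y. of_nat (A $ i $ k y 0))"
    by (rule D_cong) (rule transfer_letter)
  also have "\<dots> = D (Suc conj_level) (\<lambda>y. of_nat (A $ i $ k y 0))"
    by (rule D_Suc[OF lev, symmetric])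
  also have "\<dots> = D (Suc conj_level) (\<lambda>y. \<Sum>j\<in>UNIV. of_nat (A $ i $ j) * letter j y)"
    by (rule D_cong) (simp add: letter_def if_distrib cong: if_cong)
  also have "\<dots> = (\<Oplus>j\<in>UNIV. of_nat (A $ i $ j) \<odot> (t j \<otimes> adj R (t j)))"
    by (subst D_sum) (simp_all add: D_smult t_adj)
  finally show "adj R (t i) \<otimes> t i = (\<Oplus>j\<in>UNIV. of_nat (A $ i $ j) \<odot> (t j \<otimes> adj R (t j)))" .
next
  have "(\<Oplus>i\<in>UNIV. t i \<otimes> adj R (t i)) = D (Suc conj_level) (\<lambda>y. \<Sum>i\<in>UNIV. letter i y)"
    by (simp add: t_adj D_sum)
  also have "\<dots> = D (Suc conj_level) (\<lambda>y. 1)" by (rule D_cong) (simp add: letter_def)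
  finally show "(\<Oplus>i\<in>UNIV. t i \<otimes> adj R (t i)) = \<one>" by (simp add: D_one)
qed

text \<open>The letter projections add up to the unit. Compatibility with \<open>ck_tau\<close> will
  come from this.\<close>

lemma conj_gen_sum: "gen_sum R t = S"
proof -
  have "gen_sum R t = (\<Oplus>i\<in>UNIV. D (Suc conj_level) (letter i)) \<otimes> S"
    unfolding gen_sum_def[of R t] t_def by (rule finsum_ldistr[symmetric]) auto
  also have "(\<Oplus>i\<in>UNIV. D (Suc conj_level) (letter i)) = D (Suc conj_level) (\<lambda>y. \<Sum>i\<in>UNIV. letter i y)"
    by (simp add: D_sum)
  also have "\<dots> = D (Suc conj_level) (\<lambda>y. 1)" by (rule D_cong) (simp add: letter_def)
  finally show ?thesis by (simp add: D_one)
qed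

interpretation T: ck_family R A t by (rule conj_family)

text \<open>Conjugating by \<open>t i\<close> composes with the shift and multiplies by the letter
  function, which prepends \<open>i\<close> to the prefix of \<open>k y\<close>. The claim covers
  all large \<open>m\<close>, so that finitely many words can later share one level.\<close>

lemma conj_sproj: "\<exists>M. \<forall>m\<ge>M. level B m (\<lambda>y. prefix (length \<alpha>) (k y)) \<and>
    T.pr \<alpha> = D m (\<lambda>y. of_bool (prefix (length \<alpha>) (k y) = \<alpha>))"
proof (induction \<alpha>)
  case Nil
  then show ?case by (auto simp: sproj_def D_one level_def)
next
  case (Cons i \<alpha>)
  then obtain M where M: "\<And>m. m \<ge> M \<Longrightarrow> level B m (\<lambda>y. prefix (length \<alpha>) (k y))"
    "\<And>m. m \<ge> M \<Longrightarrow> T.pr \<alpha> = D m (\<lambda>y. of_bool (prefix (length \<alpha>) (k y) = \<alpha>))" by blast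
  let ?g = "\<lambda>y. of_bool (prefix (length \<alpha>) (k y) = \<alpha>) :: complex"
  obtain M' where M': "level B M' (\<lambda>y. prefix (length (i # \<alpha>)) (k y))" using k_unif by blast
  have "level B m (\<lambda>y. prefix (length (i # \<alpha>)) (k y)) \<and>
      T.pr (i # \<alpha>) = D m (\<lambda>y. of_bool (prefix (length (i # \<alpha>)) (k y) = i # \<alpha>))"
    if m: "m \<ge> Suc (max (max M M') conj_level)" for m
  proof
    show lev: "level B m (\<lambda>y. prefix (length (i # \<alpha>)) (k y))"
      by (rule level_mono[OF M']) (use m in auto)
    obtain n where n: "m = Suc n" "n \<ge> M" "n \<ge> conj_level" using m by (cases m) auto
    have g: "level B n ?g" by (rule level_compose[OF M(1)[OF n(2)]])
    have chi: "D (Suc conj_level) (letter i) = D m (letter i)" using D_letter[of m i] m by simp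
    have ad: "adj R (D m (letter i)) = D m (letter i)" unfolding D_adj by (rule D_cong) (simp add: letter_def)
    have "T.pr (i # \<alpha>) = t i \<otimes> D n ?g \<otimes> adj R (t i)" using M(2)[OF n(2)] by (simp add: T.pr_Cons)
    also have "t i \<otimes> D n ?g = D m (letter i) \<otimes> (S \<otimes> D n ?g)" by (simp add: t_def chi m_assoc)
    also have "S \<otimes> D n ?g = D m (\<lambda>y. ?g (shift y)) \<otimes> S"
      using D_shift_times_S[OF g] n by simp
    also have "D m (letter i) \<otimes> (D m (\<lambda>y. ?g (shift y)) \<otimes> S) = D m (\<lambda>y. ?g (shift y)) \<otimes> t i"
      unfolding t_def chi by (simp add: m_assoc[symmetric] D_mult mult.commute)
    also have "\<dots> \<otimes> adj R (t i) = D m (\<lambda>y. ?g (shift y)) \<otimes> D m (letter i)"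
      by (simp add: m_assoc t_adj chi)
    also have "\<dots> = D m (\<lambda>y. of_bool (prefix (length (i # \<alpha>)) (k y) = i # \<alpha>))"
      unfolding D_mult by (rule D_cong) (auto simp: letter_def prefix_Suc k_shift)
    finally show "T.pr (i # \<alpha>) = D m (\<lambda>y. of_bool (prefix (length (i # \<alpha>)) (k y) = i # \<alpha>))" .
  qed
  then show ?case by blast
qed

lemma conj_diag:
  assumes f: "level A n f"
  shows "\<exists>M. \<forall>m\<ge>M. T.D n f = D m (\<lambda>y. f (k y))"
proof -
  obtain M where M: "\<And>\<alpha> m. m \<ge> M \<alpha> \<Longrightarrow> T.pr \<alpha> = D m (\<lambda>y. of_bool (prefix (length \<alpha>) (k y) = \<alpha>))"
    using conj_sproj by metis
  \<comment> \<open>One level that works for all words of length \<open>n\<close> at once.\<close>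
  define N where "N = Max (M ` words n)"
  have "T.D n f = D m (\<lambda>y. f (k y))" if "m \<ge> N" for m
  proof -
    have *: "m \<ge> M \<alpha>" if "\<alpha> \<in> words n" for \<alpha>
    proof -
      have "M \<alpha> \<le> N" unfolding N_def by (rule Max_ge) (use that in auto)
      then show ?thesis using \<open>m \<ge> N\<close> by simp
    qed
    have "T.D n f = (\<Oplus>\<alpha>\<in>words n. D m (\<lambda>y. f (rep A \<alpha>) * of_bool (prefix (length \<alpha>) (k y) = \<alpha>)))"
      unfolding diag_def[of R A] by (intro finsum_cong') (simp_all only: M[OF *] D_smult, auto)
    also have "\<dots> = D m (\<lambda>y. \<Sum>\<alpha>\<in>words n. f (rep A \<alpha>) * of_bool (prefix (length \<alpha>) (k y) = \<alpha>))"
      by (rule D_sum[symmetric]) simp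
    also have "\<dots> = D m (\<lambda>y. f (k y))"
    proof (rule D_cong)
      fix y assume y: "y \<in> shift_space B"
      let ?\<alpha> = "prefix n (k y)"
      note ad = admissible_prefix[OF k_in[OF y], of n]
      have "(\<Sum>\<alpha>\<in>words n. f (rep A \<alpha>) * of_bool (prefix (length \<alpha>) (k y) = \<alpha>)) =
          (\<Sum>\<alpha>\<in>words n. if \<alpha> = ?\<alpha> then f (rep A ?\<alpha>) else 0)"
        by (intro sum.cong) (auto simp: mem_words)
      also have "\<dots> = f (rep A ?\<alpha>)" by (subst sum.delta) (auto simp: mem_words)
      also have "\<dots> = f (k y)"
        using rep[OF mat_A ad] k_in[OF y] by (intro levelD[OF f]) auto
      finally show "(\<Sum>\<alpha>\<in>words n. f (rep A \<alpha>) * of_bool (prefix (length \<alpha>) (k y) = \<alpha>)) = f (k y)" .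
    qed
    finally show ?thesis .
  qed
  then show ?thesis by blast
qed

text \<open>The letter function of the reverse construction, composed with \<open>k\<close>, is the
  indicator of \<open>y 0 = j\<close>, that is \<open>pr [j]\<close>. As the sum of the family is
  still \<open>S\<close>, the result is \<open>pr [j]\<close> times \<open>S\<close>, which is
  \<open>s j\<close>.\<close>

lemma conj_conj: "ck_conj.t R A t h = s"
proof
  interpret U: ck_conj R A t B k h
    by (intro ck_conj.intro conj_family sym)
  fix j
  have "level B 1 (\<lambda>y. of_bool (y 0 = j) :: complex)" by (simp add: level_def prefix_1)
  note lev = level_mono[OF this]
  have "level A (Suc U.conj_level) (U.letter j)" by (rule level_mono[OF U.level_letter]) simp
  then obtain M where M: "\<And>m. m \<ge> M \<Longrightarrow> T.D (Suc U.conj_level) (U.letter j) = D m (\<lambda>y. U.letter j (k y))"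
    using conj_diag by blast
  have "T.D (Suc U.conj_level) (U.letter j) = D (Suc M) (\<lambda>y. U.letter j (k y))" by (rule M) simp
  also have "\<dots> = D (Suc M) (\<lambda>y. of_bool (y 0 = j))"
    by (rule D_cong) (simp add: U.letter_def hk)
  also have "\<dots> = D 1 (\<lambda>y. of_bool (y 0 = j))"
    by (rule D_level) (simp_all add: level_def prefix_1)
  also have "\<dots> = pr [j]" using D_prefix[of "[j]"] by (simp add: prefix_1)
  finally have "U.t j = pr [j] \<otimes> S" by (simp add: U.t_def conj_gen_sum)
  then show "U.t j = s j" using pr_times_S[of j "[]"] by (simp add: sproj_def[of _ _ "[]"])
qed

end

section \<open>The regular representation of the groupoid\<close>

lemma funpow_shift: "(shift ^^ k) x = (\<lambda>n. x (n + k))"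
  by (induction k arbitrary: x) (auto simp: shift_def fun_eq_iff)

lemma shift_funpow_in: "x \<in> shift_space A \<Longrightarrow> (shift ^^ k) x \<in> shift_space A"
  by (auto simp: funpow_shift shift_space_def)

lemma groupoid_iff: "(x, n, y) \<in> ck_groupoid A \<longleftrightarrow> x \<in> shift_space A \<and> y \<in> shift_space A \<and>
    (\<exists>k l. n = int k - int l \<and> (shift ^^ k) x = (shift ^^ l) y)"
  by (simp add: ck_groupoid_def)

lemma groupoid_unit: "x \<in> shift_space A \<Longrightarrow> (x, 0, x) \<in> ck_groupoid A"
  unfolding groupoid_iff by (auto intro!: exI[of _ 0])

lemma groupoid_inv: "(x, n, y) \<in> ck_groupoid A \<Longrightarrow> (y, - n, x) \<in> ck_groupoid A"
  unfolding groupoid_iff by (metis minus_diff_eq)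

text \<open>Shifting the first tail equation by \<open>k'\<close> and the second by \<open>l\<close>
  makes both pass through the same shift of \<open>y\<close>.\<close>

lemma groupoid_mult:
  assumes "(x, n, y) \<in> ck_groupoid A" "(y, m, z) \<in> ck_groupoid A"
  shows "(x, n + m, z) \<in> ck_groupoid A"
proof -
  obtain k l k' l' where 1: "n = int k - int l" "(shift ^^ k) x = (shift ^^ l) y"
    "m = int k' - int l'" "(shift ^^ k') y = (shift ^^ l') z"
    using assms unfolding groupoid_iff by blast
  have "(shift ^^ (k' + k)) x = (shift ^^ (k' + l)) y" by (simp add: funpow_add 1)
  also have "\<dots> = (shift ^^ (l + k')) y" by (simp add: add.commute)
  also have "\<dots> = (shift ^^ (l + l')) z" by (simp add: funpow_add 1)
  finally have eq: "(shift ^^ (k' + k)) x = (shift ^^ (l + l')) z" .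
  have "n + m = int (k' + k) - int (l + l')" using 1 by simp
  then show ?thesis using eq assms unfolding groupoid_iff by blast
qed

lemma groupoid_minus: "(x, a - b, y) \<in> ck_groupoid A \<Longrightarrow> (y, b - c, z) \<in> ck_groupoid A \<Longrightarrow> (x, a - c, z) \<in> ck_groupoid A"
  using groupoid_mult[of x "a - b" y A "b - c" z] by simp

lemma ginv_ginv [simp]: "ginv (ginv \<gamma>) = \<gamma>"
  by (cases \<gamma>) simp

lemma unit_space_iff: "(x, n, y) \<in> unit_space A \<longleftrightarrow> x \<in> shift_space A \<and> n = 0 \<and> x = y"
  by (auto simp: unit_space_def gunit_def)

text \<open>A function on the groupoid is regarded as a matrix whose rows and columns are indexed by pairs
  \<open>(x, a)\<close>; convolution then becomes multiplication of matrices.\<close>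

type_synonym 'n index = "(nat \<Rightarrow> 'n) \<times> int"

definition ker :: "('n arrow \<Rightarrow> complex) \<Rightarrow> 'n index \<Rightarrow> 'n index \<Rightarrow> complex" where
  "ker f i j = f (fst i, snd i - snd j, fst j)"

lemma ker_eqI:
  fixes f g :: "'n arrow \<Rightarrow> complex"
  shows "(\<And>i j. ker f i j = ker g i j) \<Longrightarrow> f = g"
proof
  fix \<gamma> :: "'n arrow" assume *: "\<And>i j. ker f i j = ker g i j"
  obtain x n y where "\<gamma> = (x, n, y)" by (cases \<gamma>)
  then show "f \<gamma> = g \<gamma>" using *[of "(x, n)" "(y, 0)"] by (simp add: ker_def)
qed

definition act :: "('n arrow \<Rightarrow> complex) \<Rightarrow> ('n index \<Rightarrow> complex) \<Rightarrow> 'n index \<Rightarrow> complex" where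
  "act f \<xi> i = (\<Sum>j | \<xi> j \<noteq> 0. ker f i j * \<xi> j)"

text \<open>Finiteness of rows and columns is all that the star-algebra axioms require, so they are checked
  on this algebra, which contains the continuous functions with compact support.\<close>

definition kernel_algebra :: "nat^'n^'n \<Rightarrow> ('n arrow \<Rightarrow> complex) star_algebra" where
  "kernel_algebra A = (convolution_algebra A)\<lparr>carrier := {f. (\<forall>\<gamma>. \<gamma> \<notin> ck_groupoid A \<longrightarrow> f \<gamma> = 0) \<and>
     (\<forall>j. finite {i. ker f i j \<noteq> 0}) \<and> (\<forall>i. finite {j. ker f i j \<noteq> 0})}\<rparr>"

lemma act_superset:
  assumes "finite J" "{j. \<xi> j \<noteq> 0} \<subseteq> J"
  shows "act f \<xi> i = (\<Sum>j\<in>J. ker f i j * \<xi> j)"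
  unfolding act_def by (rule sum.mono_neutral_left) (use assms in auto)

lemma kernel_simps:
  "f \<oplus>\<^bsub>kernel_algebra A\<^esub> g = (\<lambda>\<gamma>. f \<gamma> + g \<gamma>)"
  "c \<odot>\<^bsub>kernel_algebra A\<^esub> f = (\<lambda>\<gamma>. c * f \<gamma>)"
  "\<zero>\<^bsub>kernel_algebra A\<^esub> = (\<lambda>\<gamma>. 0)"
  "\<one>\<^bsub>kernel_algebra A\<^esub> = indicator (unit_space A)"
  "adj (kernel_algebra A) f = (\<lambda>\<gamma>. cnj (f (ginv \<gamma>)))"
  by (simp_all add: kernel_algebra_def convolution_algebra_def)

lemma convolution_simps:
  "f \<oplus>\<^bsub>convolution_algebra A\<^esub> g = (\<lambda>\<gamma>. f \<gamma> + g \<gamma>)"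
  "c \<odot>\<^bsub>convolution_algebra A\<^esub> f = (\<lambda>\<gamma>. c * f \<gamma>)"
  "\<zero>\<^bsub>convolution_algebra A\<^esub> = (\<lambda>\<gamma>. 0)"
  "\<one>\<^bsub>convolution_algebra A\<^esub> = indicator (unit_space A)"
  "adj (convolution_algebra A) f = (\<lambda>\<gamma>. cnj (f (ginv \<gamma>)))"
  by (simp_all add: convolution_algebra_def)

lemma ker_simps [simp]:
  "ker (\<lambda>\<gamma>. f \<gamma> + g \<gamma>) i j = ker f i j + ker g i j"
  "ker (\<lambda>\<gamma>. c * f \<gamma>) i j = c * ker f i j"
  "ker (\<lambda>\<gamma>. - f \<gamma>) i j = - ker f i j"
  "ker (\<lambda>\<gamma>. 0) i j = 0"
  "ker (\<lambda>\<gamma>. cnj (f (ginv \<gamma>))) i j = cnj (ker f j i)"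
  by (simp_all add: ker_def)

lemma ker_one: "ker (indicator (unit_space A)) i j = (if i = j \<and> fst i \<in> shift_space A then 1 else 0)"
  by (auto simp: ker_def indicator_def unit_space_iff prod_eq_iff)

lemma kernel_carrierD:
  assumes "f \<in> carrier (kernel_algebra A)"
  shows "\<gamma> \<notin> ck_groupoid A \<Longrightarrow> f \<gamma> = 0" "finite {i. ker f i j \<noteq> 0}" "finite {j. ker f i j \<noteq> 0}"
proof -
  have "(\<forall>\<gamma>. \<gamma> \<notin> ck_groupoid A \<longrightarrow> f \<gamma> = 0) \<and>
     (\<forall>j. finite {i. ker f i j \<noteq> 0}) \<and> (\<forall>i. finite {j. ker f i j \<noteq> 0})"
    using assms by (simp add: kernel_algebra_def del: split_paired_All)
  then show "\<gamma> \<notin> ck_groupoid A \<Longrightarrow> f \<gamma> = 0" "finite {i. ker f i j \<noteq> 0}" "finite {j. ker f i j \<noteq> 0}"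
    by blast+
qed

lemma kernel_carrierI:
  assumes "\<And>\<gamma>. \<gamma> \<notin> ck_groupoid A \<Longrightarrow> f \<gamma> = 0" "\<And>j. finite {i. ker f i j \<noteq> 0}" "\<And>i. finite {j. ker f i j \<noteq> 0}"
  shows "f \<in> carrier (kernel_algebra A)"
  using assms by (auto simp: kernel_algebra_def)

lemma ker_outside:
  "f \<in> carrier (kernel_algebra A) \<Longrightarrow> ker f i j \<noteq> 0 \<Longrightarrow> (fst i, snd i - snd j, fst j) \<in> ck_groupoid A"
  using kernel_carrierD(1)[of f A "(fst i, snd i - snd j, fst j)"] by (auto simp: ker_def)

text \<open>An arrow \<open>(x, a - b, w)\<close> in the range fibre corresponds to the intermediate
  index \<open>(w, b)\<close>. The two sums run over the supports of different factors, so only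
  their nonzero terms are matched.\<close>

lemma kernel_mult:
  assumes f: "f \<in> carrier (kernel_algebra A)" and g: "g \<in> carrier (kernel_algebra A)"
  shows "ker (f \<otimes>\<^bsub>kernel_algebra A\<^esub> g) i l = act f (\<lambda>j. ker g j l) i"
proof -
  obtain x a where i: "i = (x, a)" by (cases i)
  obtain z c where l: "l = (z, c)" by (cases l)
  let ?S = "{\<alpha>. \<alpha> \<in> ck_groupoid A \<and> grange \<alpha> = gunit x \<and> f \<alpha> \<noteq> 0}"
  let ?T = "{j. ker g j l \<noteq> 0}"
  let ?G = "\<lambda>\<alpha>. f \<alpha> * g (gmult (ginv \<alpha>) (x, a - c, z))"
  let ?H = "\<lambda>j. ker f i j * ker g j l"
  have "?S \<subseteq> (\<lambda>j. (x, a - snd j, fst j)) ` {j. ker f i j \<noteq> 0}"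
  proof
    fix \<alpha> assume "\<alpha> \<in> ?S"
    moreover obtain x' m w where \<alpha>: "\<alpha> = (x', m, w)" by (cases \<alpha>)
    ultimately show "\<alpha> \<in> (\<lambda>j. (x, a - snd j, fst j)) ` {j. ker f i j \<noteq> 0}"
      by (intro image_eqI[of _ _ "(w, a - m)"]) (auto simp: ker_def i gunit_def)
  qed
  then have finS: "finite ?S" using kernel_carrierD(3)[OF f] finite_surj by blast
  have "(f \<otimes>\<^bsub>kernel_algebra A\<^esub> g) (x, a - c, z) = sum ?G ?S"
    by (simp add: kernel_algebra_def convolution_algebra_def)
  also have "\<dots> = sum ?H ?T"
  proof (rule sum.reindex_bij_witness_not_neutral[where S' = "{\<alpha>\<in>?S. ?G \<alpha> = 0}" and T' = "{j\<in>?T. ?H j = 0}"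
        and i = "\<lambda>j. (x, a - snd j, fst j)" and j = "\<lambda>\<alpha>. (snd (snd \<alpha>), a - fst (snd \<alpha>))"])
    show "finite {\<alpha>\<in>?S. ?G \<alpha> = 0}" "finite {j\<in>?T. ?H j = 0}"
      by (rule finite_subset[OF _ finS]; auto) (rule finite_subset[OF _ kernel_carrierD(2)[OF g, of l]]; auto)
  next
    fix \<alpha> assume \<alpha>: "\<alpha> \<in> ?S"
    obtain m w where "\<alpha> = (x, m, w)" using \<alpha> by (cases \<alpha>) (auto simp: gunit_def)
    then show "?H (snd (snd \<alpha>), a - fst (snd \<alpha>)) = ?G \<alpha>"
      by (simp add: ker_def i l algebra_simps)
  next
    fix \<alpha> assume \<alpha>: "\<alpha> \<in> ?S - {\<alpha>\<in>?S. ?G \<alpha> = 0}"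
    obtain m w where "\<alpha> = (x, m, w)" using \<alpha> by (cases \<alpha>) (auto simp: gunit_def)
    then show "(x, a - snd (snd (snd \<alpha>), a - fst (snd \<alpha>)), fst (snd (snd \<alpha>), a - fst (snd \<alpha>))) = \<alpha>"
      "(snd (snd \<alpha>), a - fst (snd \<alpha>)) \<in> ?T - {j\<in>?T. ?H j = 0}"
      using \<alpha> by (auto simp: ker_def i l algebra_simps)
  next
    fix j assume j: "j \<in> ?T - {j\<in>?T. ?H j = 0}"
    obtain w b where [simp]: "j = (w, b)" by (cases j)
    show "(snd (snd (x, a - snd j, fst j)), a - fst (snd (x, a - snd j, fst j))) = j" by simp
    have "f (x, a - b, w) \<noteq> 0" using j by (auto simp: ker_def i)
    then have "(x, a - b, w) \<in> ck_groupoid A" using kernel_carrierD(1)[OF f] by blast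
    then show "(x, a - snd j, fst j) \<in> ?S - {\<alpha>\<in>?S. ?G \<alpha> = 0}"
      using j by (auto simp: ker_def i l gunit_def algebra_simps)
  qed auto
  finally show ?thesis by (simp add: ker_def[of "f \<otimes>\<^bsub>kernel_algebra A\<^esub> g"] i l act_def)
qed

lemma act_finite:
  assumes f: "f \<in> carrier (kernel_algebra A)" and \<xi>: "finite {j. \<xi> j \<noteq> 0}"
  shows "finite {i. act f \<xi> i \<noteq> 0}"
proof (rule finite_subset)
  show "{i. act f \<xi> i \<noteq> 0} \<subseteq> (\<Union>j\<in>{j. \<xi> j \<noteq> 0}. {i. ker f i j \<noteq> 0})"
    unfolding act_def by (auto elim!: sum.not_neutral_contains_not_neutral)
  show "finite (\<Union>j\<in>{j. \<xi> j \<noteq> 0}. {i. ker f i j \<noteq> 0})" using assms kernel_carrierD(2)[OF f] by auto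
qed

lemma act_mult:
  assumes f: "f \<in> carrier (kernel_algebra A)" and g: "g \<in> carrier (kernel_algebra A)"
    and \<xi>: "finite {j. \<xi> j \<noteq> 0}"
  shows "act (f \<otimes>\<^bsub>kernel_algebra A\<^esub> g) \<xi> = act f (act g \<xi>)"
proof
  fix i
  let ?L = "{l. \<xi> l \<noteq> 0}" let ?J = "\<Union>l\<in>?L. {j. ker g j l \<noteq> 0}"
  have J: "finite ?J" using \<xi> kernel_carrierD(2)[OF g] by auto
  have "act (f \<otimes>\<^bsub>kernel_algebra A\<^esub> g) \<xi> i = (\<Sum>l\<in>?L. (\<Sum>j\<in>?J. ker f i j * ker g j l) * \<xi> l)"
    unfolding act_def[of "f \<otimes>\<^bsub>kernel_algebra A\<^esub> g"] kernel_mult[OF f g]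
    by (intro sum.cong refl arg_cong2[of _ _ _ _ "(*)"] act_superset[OF J]) auto
  also have "\<dots> = (\<Sum>l\<in>?L. \<Sum>j\<in>?J. ker f i j * (ker g j l * \<xi> l))"
    by (simp add: sum_distrib_right mult.assoc)
  also have "\<dots> = (\<Sum>j\<in>?J. \<Sum>l\<in>?L. ker f i j * (ker g j l * \<xi> l))"
    by (rule sum.swap)
  also have "\<dots> = (\<Sum>j\<in>?J. ker f i j * act g \<xi> j)" by (simp add: act_def sum_distrib_left)
  also have "\<dots> = act f (act g \<xi>) i"
    by (rule act_superset[OF J, symmetric])
       (auto simp: act_def elim!: sum.not_neutral_contains_not_neutral)
  finally show "act (f \<otimes>\<^bsub>kernel_algebra A\<^esub> g) \<xi> i = act f (act g \<xi>) i" .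
qed

lemma kernel_adj_mult:
  assumes f: "f \<in> carrier (kernel_algebra A)" and g: "g \<in> carrier (kernel_algebra A)"
    and f': "adj (kernel_algebra A) f \<in> carrier (kernel_algebra A)"
    and g': "adj (kernel_algebra A) g \<in> carrier (kernel_algebra A)"
  shows "adj (kernel_algebra A) (f \<otimes>\<^bsub>kernel_algebra A\<^esub> g) =
     adj (kernel_algebra A) g \<otimes>\<^bsub>kernel_algebra A\<^esub> adj (kernel_algebra A) f"
proof (rule ker_eqI)
  fix i l
  let ?J = "{j. ker g j i \<noteq> 0} \<union> {j. ker f l j \<noteq> 0}"
  have J: "finite ?J" using kernel_carrierD[OF f] kernel_carrierD[OF g] by auto
  have "ker (adj (kernel_algebra A) (f \<otimes>\<^bsub>kernel_algebra A\<^esub> g)) i l = cnj (act f (\<lambda>j. ker g j i) l)"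
    by (simp only: kernel_simps(5) ker_simps kernel_mult[OF f g])
  also have "act f (\<lambda>j. ker g j i) l = (\<Sum>j\<in>?J. ker f l j * ker g j i)"
    by (rule act_superset[OF J]) auto
  also have "cnj \<dots> = (\<Sum>j\<in>?J. ker (adj (kernel_algebra A) g) i j * ker (adj (kernel_algebra A) f) j l)"
    by (simp add: kernel_simps mult.commute)
  also have "\<dots> = act (adj (kernel_algebra A) g) (\<lambda>j. ker (adj (kernel_algebra A) f) j l) i"
    by (rule act_superset[OF J, symmetric]) (auto simp: kernel_simps)
  finally show "ker (adj (kernel_algebra A) (f \<otimes>\<^bsub>kernel_algebra A\<^esub> g)) i l =
      ker (adj (kernel_algebra A) g \<otimes>\<^bsub>kernel_algebra A\<^esub> adj (kernel_algebra A) f) i l"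
    by (simp only: kernel_mult[OF g' f'])
qed

lemma kernel_adj_closed:
  "f \<in> carrier (kernel_algebra A) \<Longrightarrow> adj (kernel_algebra A) f \<in> carrier (kernel_algebra A)"
proof (rule kernel_carrierI)
  fix \<gamma> assume f: "f \<in> carrier (kernel_algebra A)" and \<gamma>: "\<gamma> \<notin> ck_groupoid A"
  obtain x n y where g: "\<gamma> = (x, n, y)" by (cases \<gamma>)
  then have "(y, - n, x) \<notin> ck_groupoid A" using \<gamma> groupoid_inv[of y "- n" x A] by auto
  then show "adj (kernel_algebra A) f \<gamma> = 0" using kernel_carrierD(1)[OF f] by (simp add: g kernel_simps)
qed (simp_all add: kernel_simps kernel_carrierD)

text \<open>Finite columns come from \<open>act_finite\<close>; the rows of a product are the
  columns of its adjoint, which is again a product.\<close>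

lemma kernel_mult_closed:
  assumes f: "f \<in> carrier (kernel_algebra A)" and g: "g \<in> carrier (kernel_algebra A)"
  shows "f \<otimes>\<^bsub>kernel_algebra A\<^esub> g \<in> carrier (kernel_algebra A)"
proof (rule kernel_carrierI)
  note fin = act_finite[OF _ kernel_carrierD(2)]
  show "finite {i. ker (f \<otimes>\<^bsub>kernel_algebra A\<^esub> g) i j \<noteq> 0}" for j
    unfolding kernel_mult[OF f g] by (rule fin[OF f g])
  note f' = kernel_adj_closed[OF f] and g' = kernel_adj_closed[OF g]
  have "ker (f \<otimes>\<^bsub>kernel_algebra A\<^esub> g) i j =
     cnj (ker (adj (kernel_algebra A) (f \<otimes>\<^bsub>kernel_algebra A\<^esub> g)) j i)" for i j
    by (simp add: kernel_simps)
  then show "finite {j. ker (f \<otimes>\<^bsub>kernel_algebra A\<^esub> g) i j \<noteq> 0}" for i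
    unfolding kernel_adj_mult[OF f g f' g'] kernel_mult[OF g' f'] using fin[OF g' f'] by simp
  fix \<gamma> assume \<gamma>: "\<gamma> \<notin> ck_groupoid A"
  obtain x n y where xy: "\<gamma> = (x, n, y)" by (cases \<gamma>)
  have "ker (f \<otimes>\<^bsub>kernel_algebra A\<^esub> g) (x, n) (y, 0) = 0"
    unfolding kernel_mult[OF f g] act_def
  proof (rule sum.neutral, rule ballI)
    fix j
    show "ker f (x, n) j * ker g j (y, 0) = 0"
    proof (rule ccontr)
      assume "\<not> ?thesis"
      then have "(x, n - snd j, fst j) \<in> ck_groupoid A" "(fst j, snd j - 0, y) \<in> ck_groupoid A"
        using ker_outside[OF f, of "(x, n)" j] ker_outside[OF g, of j "(y, 0)"] by auto
      then have "(x, n - 0, y) \<in> ck_groupoid A" by (rule groupoid_minus)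
      then show False using \<gamma> xy by simp
    qed
  qed
  then show "(f \<otimes>\<^bsub>kernel_algebra A\<^esub> g) \<gamma> = 0" by (simp add: ker_def xy)
qed

lemma act_add: "finite {j. \<xi> j \<noteq> 0} \<Longrightarrow> finite {j. \<eta> j \<noteq> 0} \<Longrightarrow> act f (\<lambda>j. \<xi> j + \<eta> j) i = act f \<xi> i + act f \<eta> i"
  by (subst (1 2 3) act_superset[of "{j. \<xi> j \<noteq> 0} \<union> {j. \<eta> j \<noteq> 0}"]) (auto simp: sum.distrib algebra_simps)

lemma act_add_left: "act (\<lambda>\<gamma>. f \<gamma> + g \<gamma>) \<xi> i = act f \<xi> i + act g \<xi> i"
  by (simp add: act_def sum.distrib algebra_simps)

lemma act_smult: "finite {j. \<xi> j \<noteq> 0} \<Longrightarrow> act f (\<lambda>j. c * \<xi> j) i = c * act f \<xi> i"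
  by (subst (1 2) act_superset[of "{j. \<xi> j \<noteq> 0}"]) (auto simp: sum_distrib_left algebra_simps)

lemma act_smult_left: "act (\<lambda>\<gamma>. c * f \<gamma>) \<xi> i = c * act f \<xi> i"
  by (simp add: act_def sum_distrib_left mult.assoc)

lemma act_delta: "act f (\<lambda>j. if j = l then c else 0) i = ker f i l * c"
  by (subst act_superset[of "{l}"]) auto

lemma kernel_add_closed:
  assumes "f \<in> carrier (kernel_algebra A)" "g \<in> carrier (kernel_algebra A)"
  shows "(\<lambda>\<gamma>. f \<gamma> + g \<gamma>) \<in> carrier (kernel_algebra A)" "(\<lambda>\<gamma>. c * f \<gamma>) \<in> carrier (kernel_algebra A)"
proof -
  have "finite {i. ker f i j + ker g i j \<noteq> 0}" for j
    by (rule finite_subset[OF _ finite_UnI[OF kernel_carrierD(2)[OF assms(1), of j] kernel_carrierD(2)[OF assms(2), of j]]]) auto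
  moreover have "finite {j. ker f i j + ker g i j \<noteq> 0}" for i
    by (rule finite_subset[OF _ finite_UnI[OF kernel_carrierD(3)[OF assms(1), of i] kernel_carrierD(3)[OF assms(2), of i]]]) auto
  ultimately show "(\<lambda>\<gamma>. f \<gamma> + g \<gamma>) \<in> carrier (kernel_algebra A)"
    using assms by (intro kernel_carrierI) (simp_all add: kernel_carrierD(1))
  have "finite {i. c * ker f i j \<noteq> 0}" for j
    by (rule finite_subset[OF _ kernel_carrierD(2)[OF assms(1), of j]]) auto
  moreover have "finite {j. c * ker f i j \<noteq> 0}" for i
    by (rule finite_subset[OF _ kernel_carrierD(3)[OF assms(1), of i]]) auto
  ultimately show "(\<lambda>\<gamma>. c * f \<gamma>) \<in> carrier (kernel_algebra A)"
    using assms by (intro kernel_carrierI) (simp_all add: kernel_carrierD(1))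
qed

lemma kernel_one_closed: "indicator (unit_space A) \<in> carrier (kernel_algebra A)"
proof (rule kernel_carrierI)
  fix \<gamma> assume "\<gamma> \<notin> ck_groupoid A"
  then show "indicator (unit_space A) \<gamma> = (0 :: complex)"
    using groupoid_unit by (auto simp: indicator_def unit_space_def gunit_def)
next
  show "finite {i. ker (indicator (unit_space A)) i j \<noteq> 0}" for j
    by (rule finite_subset[of _ "{j}"]) (auto simp: ker_one)
  show "finite {j. ker (indicator (unit_space A)) i j \<noteq> 0}" for i
    by (rule finite_subset[of _ "{i}"]) (auto simp: ker_one)
qed

lemma kernel_one_mult:
  assumes f: "f \<in> carrier (kernel_algebra A)"
  shows "\<one>\<^bsub>kernel_algebra A\<^esub> \<otimes>\<^bsub>kernel_algebra A\<^esub> f = f" "f \<otimes>\<^bsub>kernel_algebra A\<^esub> \<one>\<^bsub>kernel_algebra A\<^esub> = f"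
proof -
  note one = kernel_one_closed[of A]
  show "\<one>\<^bsub>kernel_algebra A\<^esub> \<otimes>\<^bsub>kernel_algebra A\<^esub> f = f"
  proof (rule ker_eqI)
    fix i l
    have "ker (\<one>\<^bsub>kernel_algebra A\<^esub> \<otimes>\<^bsub>kernel_algebra A\<^esub> f) i l = (\<Sum>j | ker f j l \<noteq> 0. if j = i then ker f i l else 0)"
      unfolding kernel_simps(4) kernel_mult[OF one f] act_def
    proof (rule sum.cong[OF refl])
      fix j assume "j \<in> {j. ker f j l \<noteq> 0}"
      then have "fst j \<in> shift_space A" using ker_outside[OF f, of j l] by (auto simp: groupoid_iff)
      then show "ker (indicator (unit_space A)) i j * ker f j l = (if j = i then ker f i l else 0)"
        by (auto simp: ker_one)
    qed
    also have "\<dots> = ker f i l" using kernel_carrierD(2)[OF f] by (subst sum.delta) auto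
    finally show "ker (\<one>\<^bsub>kernel_algebra A\<^esub> \<otimes>\<^bsub>kernel_algebra A\<^esub> f) i l = ker f i l" .
  qed
  show "f \<otimes>\<^bsub>kernel_algebra A\<^esub> \<one>\<^bsub>kernel_algebra A\<^esub> = f"
  proof (rule ker_eqI)
    fix i l
    have "(\<lambda>j. ker (indicator (unit_space A)) j l) = (\<lambda>j. if j = l then (if fst l \<in> shift_space A then 1 else 0) else 0)"
      by (auto simp: ker_one fun_eq_iff)
    then have "ker (f \<otimes>\<^bsub>kernel_algebra A\<^esub> \<one>\<^bsub>kernel_algebra A\<^esub>) i l = ker f i l * (if fst l \<in> shift_space A then 1 else 0)"
      unfolding kernel_simps(4) kernel_mult[OF f one] by (simp only: act_delta)
    also have "\<dots> = ker f i l" using ker_outside[OF f, of i l] by (auto simp: groupoid_iff)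
    finally show "ker (f \<otimes>\<^bsub>kernel_algebra A\<^esub> \<one>\<^bsub>kernel_algebra A\<^esub>) i l = ker f i l" .
  qed
qed

lemma kernel_star_alg: "star_alg (kernel_algebra A)"
proof -
  let ?K = "kernel_algebra A"
  have add: "f \<oplus>\<^bsub>?K\<^esub> g \<in> carrier ?K" "c \<odot>\<^bsub>?K\<^esub> f \<in> carrier ?K" if "f \<in> carrier ?K" "g \<in> carrier ?K" for f g c
    using kernel_add_closed[OF that] by (simp_all add: kernel_simps)
  have dist: "(f \<oplus>\<^bsub>?K\<^esub> g) \<otimes>\<^bsub>?K\<^esub> k = f \<otimes>\<^bsub>?K\<^esub> k \<oplus>\<^bsub>?K\<^esub> g \<otimes>\<^bsub>?K\<^esub> k"
    "k \<otimes>\<^bsub>?K\<^esub> (f \<oplus>\<^bsub>?K\<^esub> g) = k \<otimes>\<^bsub>?K\<^esub> f \<oplus>\<^bsub>?K\<^esub> k \<otimes>\<^bsub>?K\<^esub> g"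
    if K: "f \<in> carrier ?K" "g \<in> carrier ?K" "k \<in> carrier ?K" for f g k
  proof -
    note fin = kernel_carrierD(2)[OF K(1)] kernel_carrierD(2)[OF K(2)]
    show "(f \<oplus>\<^bsub>?K\<^esub> g) \<otimes>\<^bsub>?K\<^esub> k = f \<otimes>\<^bsub>?K\<^esub> k \<oplus>\<^bsub>?K\<^esub> g \<otimes>\<^bsub>?K\<^esub> k"
      by (rule ker_eqI)
         (simp add: kernel_mult add K kernel_simps(1) kernel_add_closed act_add_left)
    show "k \<otimes>\<^bsub>?K\<^esub> (f \<oplus>\<^bsub>?K\<^esub> g) = k \<otimes>\<^bsub>?K\<^esub> f \<oplus>\<^bsub>?K\<^esub> k \<otimes>\<^bsub>?K\<^esub> g"
      by (rule ker_eqI)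
         (simp add: kernel_mult K kernel_simps(1) kernel_add_closed act_add fin)
  qed
  have smult: "(c \<odot>\<^bsub>?K\<^esub> f) \<otimes>\<^bsub>?K\<^esub> g = c \<odot>\<^bsub>?K\<^esub> (f \<otimes>\<^bsub>?K\<^esub> g)"
    "f \<otimes>\<^bsub>?K\<^esub> (c \<odot>\<^bsub>?K\<^esub> g) = c \<odot>\<^bsub>?K\<^esub> (f \<otimes>\<^bsub>?K\<^esub> g)"
    if K: "f \<in> carrier ?K" "g \<in> carrier ?K" for f g c
    by (rule ker_eqI; simp add: kernel_mult K kernel_simps(2) kernel_add_closed(2)[OF K(1) K(1)]
        kernel_add_closed(2)[OF K(2) K(2)] act_smult_left act_smult
        kernel_carrierD(2)[OF K(2)])+
  have "ring ?K"
  proof (rule ringI)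
    show "abelian_group ?K"
    proof (rule abelian_groupI)
      fix f assume "f \<in> carrier ?K"
      then show "\<exists>g\<in>carrier ?K. g \<oplus>\<^bsub>?K\<^esub> f = \<zero>\<^bsub>?K\<^esub>"
        using kernel_add_closed(2)[of f A f "-1"]
        by (intro bexI[of _ "\<lambda>\<gamma>. -1 * f \<gamma>"]) (auto simp: kernel_simps)
    next
      show "\<zero>\<^bsub>?K\<^esub> \<in> carrier ?K" by (rule kernel_carrierI) (simp_all add: kernel_simps)
    qed (auto simp: add, auto simp: kernel_simps add_ac)
    show "monoid ?K"
    proof (rule monoidI)
      fix f g k assume K: "f \<in> carrier ?K" "g \<in> carrier ?K" "k \<in> carrier ?K"
      note fg = kernel_mult_closed[OF K(1,2)] and gk = kernel_mult_closed[OF K(2,3)]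
      show "f \<otimes>\<^bsub>?K\<^esub> g \<otimes>\<^bsub>?K\<^esub> k = f \<otimes>\<^bsub>?K\<^esub> (g \<otimes>\<^bsub>?K\<^esub> k)"
      proof (rule ker_eqI)
        fix i l
        have "ker (f \<otimes>\<^bsub>?K\<^esub> g \<otimes>\<^bsub>?K\<^esub> k) i l = act f (act g (\<lambda>j. ker k j l)) i"
          unfolding kernel_mult[OF fg K(3)] by (subst act_mult[OF K(1,2) kernel_carrierD(2)[OF K(3)]]) simp
        also have "act g (\<lambda>j. ker k j l) = (\<lambda>j. ker (g \<otimes>\<^bsub>?K\<^esub> k) j l)"
          by (simp add: kernel_mult[OF K(2,3)])
        finally show "ker (f \<otimes>\<^bsub>?K\<^esub> g \<otimes>\<^bsub>?K\<^esub> k) i l = ker (f \<otimes>\<^bsub>?K\<^esub> (g \<otimes>\<^bsub>?K\<^esub> k)) i l"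
          by (simp only: kernel_mult[OF K(1) gk])
      qed
    next
      show "\<one>\<^bsub>?K\<^esub> \<in> carrier ?K" by (simp add: kernel_simps kernel_one_closed)
    qed (auto intro: kernel_mult_closed kernel_one_mult)
  qed (auto simp: dist)
  then show ?thesis
    by (intro star_alg.intro star_alg_axioms.intro)
       (simp_all add: add smult kernel_adj_mult kernel_adj_closed, simp_all add: kernel_simps algebra_simps)
qed

interpretation K: star_alg "kernel_algebra A" for A
  by (rule kernel_star_alg)

section \<open>The operator norm in the regular representation\<close>

definition vnorm :: "('n index \<Rightarrow> complex) \<Rightarrow> real" where
  "vnorm \<xi> = L2_set (\<lambda>i. cmod (\<xi> i)) {i. \<xi> i \<noteq> 0}"

definition inner_prod :: "('n index \<Rightarrow> complex) \<Rightarrow> ('n index \<Rightarrow> complex) \<Rightarrow> complex" where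
  "inner_prod \<xi> \<eta> = (\<Sum>i | \<xi> i \<noteq> 0. \<xi> i * cnj (\<eta> i))"

lemma vnorm_superset:
  assumes "finite J" "{j. \<xi> j \<noteq> 0} \<subseteq> J"
  shows "vnorm \<xi> = L2_set (\<lambda>i. cmod (\<xi> i)) J"
  unfolding vnorm_def L2_set_def
  by (rule arg_cong[of _ _ sqrt], rule sum.mono_neutral_left) (use assms in auto)

lemma vnorm_nonneg: "0 \<le> vnorm \<xi>"
  by (simp add: vnorm_def)

lemma inner_prod_superset:
  assumes "finite J" "{j. \<xi> j \<noteq> 0} \<subseteq> J \<or> {j. \<eta> j \<noteq> 0} \<subseteq> J" "finite {j. \<xi> j \<noteq> 0}"
  shows "inner_prod \<xi> \<eta> = (\<Sum>i\<in>J. \<xi> i * cnj (\<eta> i))"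
proof -
  have "inner_prod \<xi> \<eta> = (\<Sum>i\<in>J \<union> {j. \<xi> j \<noteq> 0}. \<xi> i * cnj (\<eta> i))"
    unfolding inner_prod_def by (rule sum.mono_neutral_left) (use assms in auto)
  also have "\<dots> = (\<Sum>i\<in>J. \<xi> i * cnj (\<eta> i))"
    by (rule sum.mono_neutral_right) (use assms in auto)
  finally show ?thesis .
qed

lemma inner_prod_self: "inner_prod \<xi> \<xi> = complex_of_real ((vnorm \<xi>)\<^sup>2)"
  unfolding inner_prod_def vnorm_def L2_set_def
  by (simp add: sum_nonneg complex_norm_square[symmetric] flip: of_real_sum of_real_power)

lemma inner_prod_le:
  assumes "finite {i. \<xi> i \<noteq> 0}" "finite {i. \<eta> i \<noteq> 0}"
  shows "cmod (inner_prod \<xi> \<eta>) \<le> vnorm \<xi> * vnorm \<eta>"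
proof -
  let ?J = "{i. \<xi> i \<noteq> 0} \<union> {i. \<eta> i \<noteq> 0}"
  have "inner_prod \<xi> \<eta> = (\<Sum>i\<in>?J. \<xi> i * cnj (\<eta> i))"
    by (rule inner_prod_superset) (use assms in auto)
  also have "cmod \<dots> \<le> (\<Sum>i\<in>?J. \<bar>cmod (\<xi> i)\<bar> * \<bar>cmod (\<eta> i)\<bar>)"
    by (rule order_trans[OF norm_sum]) (simp add: norm_mult)
  also have "\<dots> \<le> L2_set (\<lambda>i. cmod (\<xi> i)) ?J * L2_set (\<lambda>i. cmod (\<eta> i)) ?J"
    by (rule L2_set_mult_ineq)
  also have "\<dots> = vnorm \<xi> * vnorm \<eta>"
    using assms vnorm_superset[of ?J \<xi>] vnorm_superset[of ?J \<eta>] by simp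
  finally show ?thesis .
qed

lemma inner_prod_adj:
  assumes f: "f \<in> carrier (kernel_algebra A)"
    and "finite {i. \<xi> i \<noteq> 0}" "finite {i. \<eta> i \<noteq> 0}"
  shows "inner_prod (act f \<xi>) \<eta> = inner_prod \<xi> (act (adj (kernel_algebra A) f) \<eta>)"
proof -
  let ?J = "{i. \<xi> i \<noteq> 0}" and ?I = "{i. \<eta> i \<noteq> 0}"
  have "inner_prod (act f \<xi>) \<eta> = (\<Sum>i\<in>?I. act f \<xi> i * cnj (\<eta> i))"
    by (rule inner_prod_superset) (use assms act_finite[OF f] in auto)
  also have "\<dots> = (\<Sum>i\<in>?I. \<Sum>j\<in>?J. ker f i j * \<xi> j * cnj (\<eta> i))"
    by (simp add: act_def sum_distrib_right)
  also have "\<dots> = (\<Sum>j\<in>?J. \<Sum>i\<in>?I. ker f i j * \<xi> j * cnj (\<eta> i))"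
    by (rule sum.swap)
  also have "\<dots> = (\<Sum>j\<in>?J. \<xi> j * cnj (act (adj (kernel_algebra A) f) \<eta> j))"
    by (simp add: act_def kernel_simps sum_distrib_left mult_ac)
  finally show ?thesis by (simp add: inner_prod_def)
qed

definition bounded_by :: "('n arrow \<Rightarrow> complex) \<Rightarrow> real \<Rightarrow> bool" where
  "bounded_by f K \<longleftrightarrow> 0 \<le> K \<and> (\<forall>\<xi>. finite {i. \<xi> i \<noteq> 0} \<longrightarrow> vnorm (act f \<xi>) \<le> K * vnorm \<xi>)"

text \<open>Meaningful only if some bound exists, since the infimum over the empty set is
  unspecified; hence the recurring assumption \<open>bounded_by f K\<close>.\<close>

definition reg_norm :: "('n arrow \<Rightarrow> complex) \<Rightarrow> real" where
  "reg_norm f = Inf {K. bounded_by f K}"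

lemma reg_norm_le: "bounded_by f K \<Longrightarrow> reg_norm f \<le> K"
  unfolding reg_norm_def by (rule cInf_lower) (auto simp: bounded_by_def intro!: bdd_belowI[of _ 0])

text \<open>The infimum is attained: for a vector of positive norm, every bound dominates the same
  quotient of norms.\<close>

lemma reg_norm_bounded:
  assumes "bounded_by f K" shows "bounded_by f (reg_norm f)"
proof -
  have 0: "0 \<le> reg_norm f"
    unfolding reg_norm_def by (rule cInf_greatest) (use assms in \<open>auto simp: bounded_by_def\<close>)
  have "vnorm (act f \<xi>) \<le> reg_norm f * vnorm \<xi>" if \<xi>: "finite {i. \<xi> i \<noteq> 0}" for \<xi>
  proof (cases "vnorm \<xi> = 0")
    case True
    then show ?thesis using assms \<xi> by (auto simp: bounded_by_def)
  next
    case False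
    then have pos: "vnorm \<xi> > 0" using vnorm_nonneg[of \<xi>] by simp
    have "vnorm (act f \<xi>) / vnorm \<xi> \<le> reg_norm f"
      unfolding reg_norm_def
      by (rule cInf_greatest) (use assms pos \<xi> in \<open>auto simp: bounded_by_def pos_divide_le_eq\<close>)
    then show ?thesis using pos by (simp add: pos_divide_le_eq)
  qed
  with 0 show ?thesis by (simp add: bounded_by_def)
qed

lemma vnorm_add:
  assumes "finite {i. \<xi> i \<noteq> 0}" "finite {i. \<eta> i \<noteq> 0}"
  shows "vnorm (\<lambda>i. \<xi> i + \<eta> i) \<le> vnorm \<xi> + vnorm \<eta>"
proof -
  let ?J = "{i. \<xi> i \<noteq> 0} \<union> {i. \<eta> i \<noteq> 0}"
  have J: "finite ?J" using assms by simp
  have "vnorm (\<lambda>i. \<xi> i + \<eta> i) = L2_set (\<lambda>i. cmod (\<xi> i + \<eta> i)) ?J"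
    by (rule vnorm_superset[OF J]) auto
  also have "\<dots> \<le> L2_set (\<lambda>i. cmod (\<xi> i) + cmod (\<eta> i)) ?J"
    by (rule L2_set_mono) (auto intro: norm_triangle_ineq)
  also have "\<dots> \<le> L2_set (\<lambda>i. cmod (\<xi> i)) ?J + L2_set (\<lambda>i. cmod (\<eta> i)) ?J"
    by (rule L2_set_triangle_ineq)
  also have "\<dots> = vnorm \<xi> + vnorm \<eta>"
    using vnorm_superset[OF J, of \<xi>] vnorm_superset[OF J, of \<eta>] by auto
  finally show ?thesis .
qed

lemma vnorm_smult:
  assumes "finite {i. \<xi> i \<noteq> 0}" shows "vnorm (\<lambda>i. c * \<xi> i) = cmod c * vnorm \<xi>"
  using vnorm_superset[OF assms, of "\<lambda>i. c * \<xi> i"] vnorm_superset[OF assms, of \<xi>]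
  by (auto simp: norm_mult L2_set_right_distrib)

lemma bounded_by_add:
  assumes f: "f \<in> carrier (kernel_algebra A)" and g: "g \<in> carrier (kernel_algebra A)"
    and "bounded_by f K" "bounded_by g L"
  shows "bounded_by (\<lambda>\<gamma>. f \<gamma> + g \<gamma>) (K + L)"
  unfolding bounded_by_def
proof (intro conjI allI impI)
  show "0 \<le> K + L" using assms by (auto simp: bounded_by_def)
  fix \<xi> :: "'a index \<Rightarrow> complex" assume \<xi>: "finite {i. \<xi> i \<noteq> 0}"
  have "vnorm (act (\<lambda>\<gamma>. f \<gamma> + g \<gamma>) \<xi>) = vnorm (\<lambda>i. act f \<xi> i + act g \<xi> i)"
    by (simp add: act_add_left[abs_def])
  also have "\<dots> \<le> vnorm (act f \<xi>) + vnorm (act g \<xi>)"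
    by (rule vnorm_add[OF act_finite[OF f \<xi>] act_finite[OF g \<xi>]])
  also have "\<dots> \<le> (K + L) * vnorm \<xi>"
    using assms(3,4) \<xi> unfolding bounded_by_def by (simp add: distrib_right add_mono)
  finally show "vnorm (act (\<lambda>\<gamma>. f \<gamma> + g \<gamma>) \<xi>) \<le> (K + L) * vnorm \<xi>" .
qed

lemma bounded_by_smult:
  assumes f: "f \<in> carrier (kernel_algebra A)" and "bounded_by f K"
  shows "bounded_by (\<lambda>\<gamma>. c * f \<gamma>) (cmod c * K)"
  using assms unfolding bounded_by_def
  by (auto simp: act_smult_left[abs_def] vnorm_smult[OF act_finite[OF f]] mult.assoc intro!: mult_left_mono)

lemma bounded_by_mult:
  assumes f: "f \<in> carrier (kernel_algebra A)" and g: "g \<in> carrier (kernel_algebra A)"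
    and K: "bounded_by f K" and L: "bounded_by g L"
  shows "bounded_by (f \<otimes>\<^bsub>kernel_algebra A\<^esub> g) (K * L)"
  unfolding bounded_by_def
proof (intro conjI allI impI)
  show "0 \<le> K * L" using assms by (auto simp: bounded_by_def)
  fix \<xi> :: "'a index \<Rightarrow> complex" assume \<xi>: "finite {i. \<xi> i \<noteq> 0}"
  have "vnorm (act (f \<otimes>\<^bsub>kernel_algebra A\<^esub> g) \<xi>) = vnorm (act f (act g \<xi>))"
    by (simp add: act_mult[OF f g \<xi>])
  also have "\<dots> \<le> K * vnorm (act g \<xi>)" using K act_finite[OF g \<xi>] by (simp add: bounded_by_def)
  also have "\<dots> \<le> K * (L * vnorm \<xi>)" using K L \<xi> by (intro mult_left_mono) (auto simp: bounded_by_def)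
  finally show "vnorm (act (f \<otimes>\<^bsub>kernel_algebra A\<^esub> g) \<xi>) \<le> K * L * vnorm \<xi>" by simp
qed

text \<open>The squared norm of \<open>act f \<xi>\<close> is the inner product of
  \<open>\<xi>\<close> with its image under the adjoint of \<open>f\<close> times \<open>f\<close>;
  Cauchy--Schwarz then gives the nontrivial half of the C*-identity.\<close>

lemma bounded_by_sqrt:
  assumes f: "f \<in> carrier (kernel_algebra A)"
    and K: "bounded_by (adj (kernel_algebra A) f \<otimes>\<^bsub>kernel_algebra A\<^esub> f) K"
  shows "bounded_by f (sqrt K)"
  unfolding bounded_by_def
proof (intro conjI allI impI)
  show K0: "0 \<le> sqrt K" using K by (auto simp: bounded_by_def)
  fix \<xi> :: "'a index \<Rightarrow> complex" assume \<xi>: "finite {i. \<xi> i \<noteq> 0}"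
  note f' = kernel_adj_closed[OF f]
  let ?g = "adj (kernel_algebra A) f \<otimes>\<^bsub>kernel_algebra A\<^esub> f"
  have "complex_of_real ((vnorm (act f \<xi>))\<^sup>2) = inner_prod \<xi> (act ?g \<xi>)"
    unfolding inner_prod_self[symmetric] act_mult[OF f' f \<xi>]
    by (rule inner_prod_adj[OF f \<xi> act_finite[OF f \<xi>]])
  then have "(vnorm (act f \<xi>))\<^sup>2 = cmod (inner_prod \<xi> (act ?g \<xi>))"
    by (metis abs_of_nonneg norm_of_real zero_le_power2)
  also have "\<dots> \<le> vnorm \<xi> * vnorm (act ?g \<xi>)"
    by (rule inner_prod_le[OF \<xi> act_finite[OF kernel_mult_closed[OF f' f] \<xi>]])
  also have "\<dots> \<le> vnorm \<xi> * (K * vnorm \<xi>)"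
    using K \<xi> by (intro mult_left_mono vnorm_nonneg) (auto simp: bounded_by_def)
  also have "\<dots> = (sqrt K * vnorm \<xi>)\<^sup>2"
    using K by (simp add: bounded_by_def power_mult_distrib power2_eq_square)
  finally show "vnorm (act f \<xi>) \<le> sqrt K * vnorm \<xi>"
    by (rule power2_le_imp_le) (intro mult_nonneg_nonneg K0 vnorm_nonneg)
qed

text \<open>Moving the adjoint across the inner product bounds the squared norm of
  \<open>?\<eta>\<close> by \<open>K\<close> times the norms of \<open>\<xi>\<close> and of
  \<open>?\<eta>\<close>; one factor cancels.\<close>

lemma bounded_by_adj:
  assumes f: "f \<in> carrier (kernel_algebra A)" and K: "bounded_by f K"
  shows "bounded_by (adj (kernel_algebra A) f) K"
  unfolding bounded_by_def
proof (intro conjI allI impI)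
  show K0: "0 \<le> K" using K by (auto simp: bounded_by_def)
  fix \<xi> :: "'a index \<Rightarrow> complex" assume \<xi>: "finite {i. \<xi> i \<noteq> 0}"
  note f' = kernel_adj_closed[OF f]
  let ?\<eta> = "act (adj (kernel_algebra A) f) \<xi>"
  note \<eta> = act_finite[OF f' \<xi>]
  have "complex_of_real ((vnorm ?\<eta>)\<^sup>2) = inner_prod \<xi> (act f ?\<eta>)"
    unfolding inner_prod_self[symmetric] using inner_prod_adj[OF f' \<xi> \<eta>] K.adj_adj[OF f] by simp
  then have "(vnorm ?\<eta>)\<^sup>2 = cmod (inner_prod \<xi> (act f ?\<eta>))"
    by (metis abs_of_nonneg norm_of_real zero_le_power2)
  also have "\<dots> \<le> vnorm \<xi> * vnorm (act f ?\<eta>)"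
    by (rule inner_prod_le[OF \<xi> act_finite[OF f \<eta>]])
  also have "\<dots> \<le> vnorm \<xi> * (K * vnorm ?\<eta>)"
    using K \<eta> by (intro mult_left_mono vnorm_nonneg) (auto simp: bounded_by_def)
  finally have "vnorm ?\<eta> * vnorm ?\<eta> \<le> (K * vnorm \<xi>) * vnorm ?\<eta>"
    by (simp add: power2_eq_square mult_ac)
  then show "vnorm ?\<eta> \<le> K * vnorm \<xi>"
    using vnorm_nonneg[of ?\<eta>] vnorm_nonneg[of \<xi>] K0
    by (cases "vnorm ?\<eta> = 0") (auto simp: mult_le_cancel_right)
qed

text \<open>The image of the unit vector at \<open>(y, 0)\<close> has the value of \<open>f\<close>
  at \<open>(x, n, y)\<close> among its coordinates.\<close>

lemma value_le_reg_norm: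
  assumes "f \<in> carrier (kernel_algebra A)" "bounded_by f K" shows "cmod (f \<gamma>) \<le> reg_norm f"
proof -
  obtain x n y where g: "\<gamma> = (x, n, y)" by (cases \<gamma>)
  let ?d = "\<lambda>j. if j = (y, 0::int) then 1 else 0 :: complex"
  have d: "finite {j. ?d j \<noteq> 0}" by simp
  have val: "act f ?d (x, n) = f \<gamma>" by (simp add: act_delta g ker_def)
  have vd: "vnorm ?d = 1" using vnorm_superset[of "{(y, 0)}" ?d] by (simp add: L2_set_def)
  have le: "vnorm (act f ?d) \<le> reg_norm f"
    using reg_norm_bounded[OF assms(2)] d vd unfolding bounded_by_def by fastforce
  show ?thesis
  proof (cases "f \<gamma> = 0")
    case True
    then show ?thesis using reg_norm_bounded[OF assms(2)] by (simp add: bounded_by_def)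
  next
    case False
    then have "cmod (act f ?d (x, n)) \<le> vnorm (act f ?d)"
      using act_finite[OF assms(1) d] unfolding vnorm_def by (intro member_le_L2_set) (auto simp: val)
    then show ?thesis using le val by simp
  qed
qed

text \<open>Both algebras share their operations, so products of functions of compact support are
  estimated in \<open>kernel_algebra\<close>, where the matrix calculus is available.\<close>

lemma reg_norm_seminorm:
  assumes C: "carrier (convolution_algebra A) \<subseteq> carrier (kernel_algebra A)" "\<And>f. f \<in> carrier (convolution_algebra A) \<Longrightarrow> \<exists>K. bounded_by f K"
  shows "cstar_seminorm (convolution_algebra A) reg_norm"
proof -
  have ops: "f \<oplus>\<^bsub>convolution_algebra A\<^esub> g = f \<oplus>\<^bsub>kernel_algebra A\<^esub> g" "f \<otimes>\<^bsub>convolution_algebra A\<^esub> g = f \<otimes>\<^bsub>kernel_algebra A\<^esub> g"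
    "c \<odot>\<^bsub>convolution_algebra A\<^esub> f = c \<odot>\<^bsub>kernel_algebra A\<^esub> f" "adj (convolution_algebra A) f = adj (kernel_algebra A) f" for f g c
    by (simp_all add: kernel_algebra_def)
  have bd: "bounded_by f (reg_norm f)" if "f \<in> carrier (convolution_algebra A)" for f
    using C(2)[OF that] reg_norm_bounded by blast
  have nonneg: "0 \<le> reg_norm f" if "f \<in> carrier (convolution_algebra A)" for f using bd[OF that] by (simp add: bounded_by_def)
  have K: "f \<in> carrier (kernel_algebra A)" if "f \<in> carrier (convolution_algebra A)" for f using C(1) that by auto
  show ?thesis
    unfolding cstar_seminorm_def ops
  proof (intro conjI ballI allI)
    fix f assume f: "f \<in> carrier (convolution_algebra A)"
    show "0 \<le> reg_norm f" by (rule nonneg[OF f])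
    show "reg_norm (c \<odot>\<^bsub>kernel_algebra A\<^esub> f) = cmod c * reg_norm f" for c
    proof (rule antisym)
      have b: "bounded_by (\<lambda>\<gamma>. c * f \<gamma>) (cmod c * reg_norm f)"
        by (rule bounded_by_smult[OF K[OF f] bd[OF f]])
      then show "reg_norm (c \<odot>\<^bsub>kernel_algebra A\<^esub> f) \<le> cmod c * reg_norm f"
        unfolding kernel_simps by (rule reg_norm_le)
      show "cmod c * reg_norm f \<le> reg_norm (c \<odot>\<^bsub>kernel_algebra A\<^esub> f)"
      proof (cases "c = 0")
        case True
        then show ?thesis using reg_norm_bounded[OF b] by (simp add: kernel_simps bounded_by_def)
      next
        case False
        have "bounded_by (\<lambda>\<gamma>. inverse c * (c * f \<gamma>)) (cmod (inverse c) * reg_norm (\<lambda>\<gamma>. c * f \<gamma>))"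
          by (rule bounded_by_smult[OF kernel_add_closed(2) reg_norm_bounded[OF b]]) (rule K[OF f])+
        moreover have "(\<lambda>\<gamma>. inverse c * (c * f \<gamma>)) = f" using False by (simp add: mult.assoc[symmetric])
        ultimately have "reg_norm f \<le> inverse (cmod c) * reg_norm (\<lambda>\<gamma>. c * f \<gamma>)"
          by (auto simp: norm_inverse dest!: reg_norm_le)
        then show ?thesis using False by (simp add: kernel_simps field_simps)
      qed
    qed
    show "reg_norm (adj (kernel_algebra A) f \<otimes>\<^bsub>kernel_algebra A\<^esub> f) = (reg_norm f)\<^sup>2"
    proof (rule antisym)
      note b = bounded_by_mult[OF kernel_adj_closed[OF K[OF f]] K[OF f] bounded_by_adj[OF K[OF f] bd[OF f]] bd[OF f]]
      then show "reg_norm (adj (kernel_algebra A) f \<otimes>\<^bsub>kernel_algebra A\<^esub> f) \<le> (reg_norm f)\<^sup>2"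
        unfolding power2_eq_square by (rule reg_norm_le)
      have "reg_norm f \<le> sqrt (reg_norm (adj (kernel_algebra A) f \<otimes>\<^bsub>kernel_algebra A\<^esub> f))"
        by (rule reg_norm_le[OF bounded_by_sqrt[OF K[OF f] reg_norm_bounded[OF b]]])
      then have "(reg_norm f)\<^sup>2 \<le> (sqrt (reg_norm (adj (kernel_algebra A) f \<otimes>\<^bsub>kernel_algebra A\<^esub> f)))\<^sup>2"
        by (rule power_mono[OF _ nonneg[OF f]])
      then show "(reg_norm f)\<^sup>2 \<le> reg_norm (adj (kernel_algebra A) f \<otimes>\<^bsub>kernel_algebra A\<^esub> f)"
        using reg_norm_bounded[OF b] by (simp add: bounded_by_def)
    qed
    fix g assume g: "g \<in> carrier (convolution_algebra A)"
    show "reg_norm (f \<oplus>\<^bsub>kernel_algebra A\<^esub> g) \<le> reg_norm f + reg_norm g"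
      unfolding kernel_simps by (rule reg_norm_le[OF bounded_by_add[OF K[OF f] K[OF g] bd[OF f] bd[OF g]]])
    show "reg_norm (f \<otimes>\<^bsub>kernel_algebra A\<^esub> g) \<le> reg_norm f * reg_norm g"
      by (rule reg_norm_le[OF bounded_by_mult[OF K[OF f] K[OF g] bd[OF f] bd[OF g]]])
  qed
qed

section \<open>The topology of the shift space and of the groupoid\<close>

lemma topspace_shift [simp]: "topspace (shift_topology A) = shift_space A"
  by (simp add: shift_topology_def)

lemma openin_product_prefix:
  "openin (product_topology (\<lambda>_. discrete_topology UNIV) UNIV) T \<longleftrightarrow>
     (\<forall>x\<in>T. \<exists>m. \<forall>y. prefix m y = prefix m x \<longrightarrow> y \<in> T)" (is "openin ?P T \<longleftrightarrow> ?R")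
proof
  assume T: "openin ?P T"
  show ?R
  proof
    fix x assume "x \<in> T"
    then obtain U where U: "finite {i. U i \<noteq> UNIV}" "x \<in> Pi\<^sub>E UNIV U" "Pi\<^sub>E UNIV U \<subseteq> T"
      using T unfolding openin_product_topology_alt by auto
    \<comment> \<open>One more than the largest restricted coordinate; inserting 0 keeps
      \<open>Max\<close> defined when no coordinate is restricted.\<close>
    define m where "m = Suc (Max (insert 0 {i. U i \<noteq> UNIV}))"
    have m: "i < m" if "U i \<noteq> UNIV" for i
      using Max_ge[of "insert 0 {i. U i \<noteq> UNIV}" i] that U(1) by (simp add: m_def less_Suc_eq_le)
    have "y \<in> T" if y: "prefix m y = prefix m x" for y
    proof -
      have "y i \<in> U i" for i
        using m[of i] y U(2) by (cases "U i = UNIV") (auto simp: prefix_eq_iff PiE_def)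
      then show ?thesis using U(3) by (auto simp: PiE_def)
    qed
    then show "\<exists>m. \<forall>y. prefix m y = prefix m x \<longrightarrow> y \<in> T" by blast
  qed
next
  assume R: ?R
  show "openin ?P T"
    unfolding openin_product_topology_alt
  proof
    fix x assume "x \<in> T"
    then obtain m where m: "\<And>y. prefix m y = prefix m x \<Longrightarrow> y \<in> T" using R by blast
    let ?U = "\<lambda>i. if i < m then {x i} else UNIV"
    have "finite {i. ?U i \<noteq> UNIV}" by (rule finite_subset[of _ "{..<m}"]) auto
    moreover have "Pi\<^sub>E UNIV ?U \<subseteq> T"
    proof
      fix y assume "y \<in> Pi\<^sub>E UNIV ?U"
      then have "y i \<in> ?U i" for i by (auto simp: PiE_def Pi_def)
      then have "prefix m y = prefix m x" unfolding prefix_eq_iff by (metis singletonD)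
      then show "y \<in> T" by (rule m)
    qed
    moreover have "x \<in> Pi\<^sub>E UNIV ?U" by auto
    ultimately show "\<exists>U. finite {i \<in> UNIV. U i \<noteq> topspace (discrete_topology UNIV)} \<and>
        (\<forall>i\<in>UNIV. openin (discrete_topology UNIV) (U i)) \<and> x \<in> Pi\<^sub>E UNIV U \<and> Pi\<^sub>E UNIV U \<subseteq> T"
      by (intro exI[of _ ?U]) simp
  qed
qed

lemma openin_shift_iff:
  "openin (shift_topology A) U \<longleftrightarrow> U \<subseteq> shift_space A \<and>
     (\<forall>x\<in>U. \<exists>m. \<forall>y\<in>shift_space A. prefix m y = prefix m x \<longrightarrow> y \<in> U)"
proof
  assume "openin (shift_topology A) U"
  then show "U \<subseteq> shift_space A \<and> (\<forall>x\<in>U. \<exists>m. \<forall>y\<in>shift_space A. prefix m y = prefix m x \<longrightarrow> y \<in> U)"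
    unfolding shift_topology_def openin_subtopology openin_product_prefix by blast
next
  assume *: "U \<subseteq> shift_space A \<and> (\<forall>x\<in>U. \<exists>m. \<forall>y\<in>shift_space A. prefix m y = prefix m x \<longrightarrow> y \<in> U)"
  \<comment> \<open>The union of all cylinders of the full product, centred at points of
    \<open>U\<close>, whose trace on the shift space lies in \<open>U\<close>.\<close>
  let ?T = "{y. \<exists>x\<in>U. \<exists>m. prefix m y = prefix m x \<and> (\<forall>z\<in>shift_space A. prefix m z = prefix m x \<longrightarrow> z \<in> U)}"
  have "U = ?T \<inter> shift_space A"
  proof (rule antisym; rule subsetI)
    fix x assume x: "x \<in> U"
    then obtain m where "\<forall>y\<in>shift_space A. prefix m y = prefix m x \<longrightarrow> y \<in> U" using * by blast
    then show "x \<in> ?T \<inter> shift_space A" using x * by blast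
  qed blast
  moreover have "openin (product_topology (\<lambda>_. discrete_topology UNIV) UNIV) ?T"
    unfolding openin_product_prefix
  proof
    fix y assume "y \<in> ?T"
    then obtain x m where "x \<in> U" "prefix m y = prefix m x" "\<forall>z\<in>shift_space A. prefix m z = prefix m x \<longrightarrow> z \<in> U"
      by blast
    then show "\<exists>m. \<forall>z. prefix m z = prefix m y \<longrightarrow> z \<in> ?T" by (intro exI[of _ m]) auto
  qed
  ultimately show "openin (shift_topology A) U"
    unfolding shift_topology_def openin_subtopology by blast
qed

text \<open>Tychonoff together with closedness of the shift space: a forbidden transition at
  position \<open>n\<close> is visible in the first \<open>n + 2\<close> letters.\<close>

lemma compact_space_shift: "compact_space (shift_topology A)" for A :: "nat^'n::finite^'n"
proof -
  let ?P = "product_topology (\<lambda>_. discrete_topology UNIV) UNIV :: (nat \<Rightarrow> 'n) topology"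
  have "compact_space ?P" by (simp add: compact_space_product_topology compact_space_discrete_topology)
  moreover have "closedin ?P (shift_space A)"
    unfolding closedin_def
  proof
    show "openin ?P (topspace ?P - shift_space A)"
      unfolding openin_product_prefix
    proof
      fix x assume "x \<in> topspace ?P - shift_space A"
      then obtain n where n: "A $ x n $ x (Suc n) \<noteq> 1" by (auto simp: shift_space_def)
      have "y \<in> topspace ?P - shift_space A" if "prefix (Suc (Suc n)) y = prefix (Suc (Suc n)) x" for y
      proof -
        have "y n = x n" "y (Suc n) = x (Suc n)" using that by (auto simp: prefix_eq_iff)
        moreover have "A $ y n $ y (Suc n) = 1" if "y \<in> shift_space A" using that by (simp add: shift_space_def)
        ultimately have "y \<notin> shift_space A" using n by metis
        then show ?thesis by simp
      qed
      then show "\<exists>m. \<forall>y. prefix m y = prefix m x \<longrightarrow> y \<in> topspace ?P - shift_space A" by blast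
    qed
  qed auto
  ultimately show ?thesis
    unfolding shift_topology_def by (simp add: closedin_compact_space compact_space_subtopology)
qed

lemma compactin_shift_clopen:
  fixes A :: "nat^'n::finite^'n"
  assumes "K \<subseteq> shift_space A" "level A n (\<lambda>x. x \<in> K)"
  shows "compactin (shift_topology A) K" "openin (shift_topology A) K"
proof -
  show "openin (shift_topology A) K"
    unfolding openin_shift_iff using assms unfolding level_def by blast
  have "openin (shift_topology A) (shift_space A - K)"
    unfolding openin_shift_iff using assms unfolding level_def by blast
  then have "closedin (shift_topology A) K" using assms by (simp add: closedin_def)
  then show "compactin (shift_topology A) K" using compact_space_shift closedin_compact_space by blast
qed

definition glue :: "'n list \<Rightarrow> (nat \<Rightarrow> 'n) \<Rightarrow> nat \<Rightarrow> 'n" where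
  "glue \<beta> z n = (if n < length \<beta> then \<beta> ! n else z (n - length \<beta>))"

lemma prefix_glue: "prefix (length \<beta>) (glue \<beta> z) = \<beta>"
  by (rule nth_equalityI) (auto simp: prefix_def glue_def)

lemma shift_glue: "(shift ^^ length \<beta>) (glue \<beta> z) = z"
  by (simp add: funpow_shift glue_def fun_eq_iff)

lemma glue_prefix: "glue (prefix k x) ((shift ^^ k) x) = x"
  by (auto simp: funpow_shift glue_def fun_eq_iff prefix_def)

text \<open>Only the transition at the seam involves both parts, and it depends on \<open>z\<close>
  through \<open>z 0\<close> alone.\<close>

lemma glue_cong: "glue \<beta> z \<in> shift_space A \<Longrightarrow> z' \<in> shift_space A \<Longrightarrow> z' 0 = z 0 \<Longrightarrow> glue \<beta> z' \<in> shift_space A"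
  unfolding shift_space_def
proof (intro CollectI allI)
  fix n assume *: "glue \<beta> z \<in> {x. \<forall>n. A $ x n $ x (Suc n) = 1}" "z' \<in> {x. \<forall>n. A $ x n $ x (Suc n) = 1}" "z' 0 = z 0"
  consider "Suc n < length \<beta>" | "Suc n = length \<beta>" | "n \<ge> length \<beta>" by linarith
  then show "A $ glue \<beta> z' n $ glue \<beta> z' (Suc n) = 1"
  proof cases
    case 1
    then show ?thesis using *(1)[simplified, rule_format, of n] by (simp add: glue_def)
  next
    case 2
    then show ?thesis using *(1)[simplified, rule_format, of n] *(3) by (auto simp: glue_def)
  next
    case 3
    then show ?thesis using *(2) by (simp add: glue_def Suc_diff_le)
  qed
qed

text \<open>The compact open bisections that generate the topology of the groupoid.\<close>

definition cyl :: "nat^'n^'n \<Rightarrow> 'n list \<Rightarrow> 'n list \<Rightarrow> 'n arrow set" where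
  "cyl A \<alpha> \<beta> = {(x, int (length \<alpha>) - int (length \<beta>), y) | x y. x \<in> shift_space A \<and> y \<in> shift_space A \<and>
     prefix (length \<alpha>) x = \<alpha> \<and> prefix (length \<beta>) y = \<beta> \<and> (shift ^^ length \<alpha>) x = (shift ^^ length \<beta>) y}"

lemma cyl_iff: "(x, n, y) \<in> cyl A \<alpha> \<beta> \<longleftrightarrow> n = int (length \<alpha>) - int (length \<beta>) \<and>
    x \<in> shift_space A \<and> y \<in> shift_space A \<and> prefix (length \<alpha>) x = \<alpha> \<and> prefix (length \<beta>) y = \<beta> \<and>
    (shift ^^ length \<alpha>) x = (shift ^^ length \<beta>) y"
  by (auto simp: cyl_def)

lemma cyl_groupoid: "cyl A \<alpha> \<beta> \<subseteq> ck_groupoid A"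
  by (auto simp: cyl_def groupoid_iff) blast

lemma cyl_source: "(x, n, y) \<in> cyl A \<alpha> \<beta> \<Longrightarrow> x = glue \<alpha> ((shift ^^ length \<beta>) y)"
  and cyl_range: "(x, n, y) \<in> cyl A \<alpha> \<beta> \<Longrightarrow> y = glue \<beta> ((shift ^^ length \<alpha>) x)"
  using glue_prefix[of "length \<alpha>" x] glue_prefix[of "length \<beta>" y] by (auto simp: cyl_iff)

text \<open>Cylinders around an arrow fix its integer component, so the property is a predicate of
  the two end points.\<close>

definition near :: "nat^'n^'n \<Rightarrow> 'n arrow \<Rightarrow> ((nat \<Rightarrow> 'n) \<Rightarrow> (nat \<Rightarrow> 'n) \<Rightarrow> bool) \<Rightarrow> bool" where
  "near A \<gamma> P \<longleftrightarrow> (\<exists>k l. \<gamma> \<in> cyl A (prefix k (fst \<gamma>)) (prefix l (snd (snd \<gamma>))) \<and>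
     (\<forall>x y. (x, fst (snd \<gamma>), y) \<in> cyl A (prefix k (fst \<gamma>)) (prefix l (snd (snd \<gamma>))) \<longrightarrow> P x y))"

text \<open>Lengthening both words by \<open>j\<close> letters along the arrow keeps the difference
  of lengths. Of the tail equation of a nearby arrow, the first \<open>j\<close> coordinates are
  forced by the longer words.\<close>

lemma cyl_mono:
  assumes "(x, n, y) \<in> cyl A (prefix k x) (prefix l y)"
  shows "(x, n, y) \<in> cyl A (prefix (k + j) x) (prefix (l + j) y)"
    and "(x', m, y') \<in> cyl A (prefix (k + j) x) (prefix (l + j) y) \<Longrightarrow> (x', m, y') \<in> cyl A (prefix k x) (prefix l y)"
proof -
  have eq: "x (i + k) = y (i + l)" for i using assms by (auto simp: cyl_iff funpow_shift fun_eq_iff)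
  show "(x, n, y) \<in> cyl A (prefix (k + j) x) (prefix (l + j) y)"
    using assms eq by (simp add: cyl_iff funpow_shift fun_eq_iff) (metis add.assoc add.commute)
  assume *: "(x', m, y') \<in> cyl A (prefix (k + j) x) (prefix (l + j) y)"
  have "x' (i + k) = y' (i + l)" for i
  proof (cases "i < j")
    case True
    then show ?thesis using * eq[of i] by (auto simp: cyl_iff prefix_eq_iff)
  next
    case False
    then obtain d where "i = d + j" by (metis add.commute le_add_diff_inverse not_less)
    moreover have "x' (d + (k + j)) = y' (d + (l + j))" using * by (auto simp: cyl_iff funpow_shift dest: fun_cong[of _ _ d])
    ultimately show ?thesis by (simp add: ac_simps)
  qed
  then show "(x', m, y') \<in> cyl A (prefix k x) (prefix l y)"
    using * prefix_eq_mono[of "k + j" x' x k] prefix_eq_mono[of "l + j" y' y l]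
    by (simp add: cyl_iff funpow_shift fun_eq_iff)
qed

lemma groupoid_in_cyl: "(x, n, y) \<in> ck_groupoid A \<Longrightarrow> \<exists>k l. (x, n, y) \<in> cyl A (prefix k x) (prefix l y)"
  by (auto simp: groupoid_iff cyl_iff)

lemma near_large:
  assumes "near A (x, n, y) P"
  obtains k l where "k \<ge> K" "l \<ge> K" "(x, n, y) \<in> cyl A (prefix k x) (prefix l y)"
    "\<forall>x' y'. (x', n, y') \<in> cyl A (prefix k x) (prefix l y) \<longrightarrow> P x' y'"
proof -
  obtain k l where kl: "(x, n, y) \<in> cyl A (prefix k x) (prefix l y)"
    "\<And>x' y'. (x', n, y') \<in> cyl A (prefix k x) (prefix l y) \<Longrightarrow> P x' y'"
    using assms unfolding near_def by auto
  show thesis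
  proof (rule that)
    show "K \<le> k + K" "K \<le> l + K" by auto
    show "(x, n, y) \<in> cyl A (prefix (k + K) x) (prefix (l + K) y)" by (rule cyl_mono(1)[OF kl(1)])
    show "\<forall>x' y'. (x', n, y') \<in> cyl A (prefix (k + K) x) (prefix (l + K) y) \<longrightarrow> P x' y'"
      using kl(2) cyl_mono(2)[OF kl(1)] by blast
  qed
qed

lemma nearI:
  "(x, n, y) \<in> cyl A (prefix k x) (prefix l y) \<Longrightarrow>
    (\<And>x' y'. (x', n, y') \<in> cyl A (prefix k x) (prefix l y) \<Longrightarrow> P x' y') \<Longrightarrow> near A (x, n, y) P"
  unfolding near_def by auto

lemma near_mono: "near A \<gamma> P \<Longrightarrow> (\<And>x y. P x y \<Longrightarrow> Q x y) \<Longrightarrow> near A \<gamma> Q"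
  unfolding near_def by blast

lemma near_prefix:
  assumes "(x, n, y) \<in> ck_groupoid A"
  shows "near A (x, n, y) (\<lambda>x' y'. (x', n, y') \<in> ck_groupoid A \<and> prefix m x' = prefix m x \<and> prefix m y' = prefix m y)"
proof -
  obtain k l where "(x, n, y) \<in> cyl A (prefix k x) (prefix l y)" using groupoid_in_cyl assms by blast
  then have *: "(x, n, y) \<in> cyl A (prefix (k + m) x) (prefix (l + m) y)" by (rule cyl_mono(1))
  show ?thesis
  proof (rule nearI[OF *])
    fix x' y' assume c: "(x', n, y') \<in> cyl A (prefix (k + m) x) (prefix (l + m) y)"
    then have "(x', n, y') \<in> ck_groupoid A" using cyl_groupoid by blast
    moreover have "prefix m x' = prefix m x" "prefix m y' = prefix m y"
      using c by (auto simp: cyl_iff prefix_eq_iff)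
    ultimately show "(x', n, y') \<in> ck_groupoid A \<and> prefix m x' = prefix m x \<and> prefix m y' = prefix m y" by blast
  qed
qed

text \<open>Cylinders around the same arrow have the same length difference, hence are nested; the
  one with the longer words lies in both.\<close>

lemma near_conj:
  assumes P: "near A (x, n, y) P" and Q: "near A (x, n, y) Q"
  shows "near A (x, n, y) (\<lambda>x' y'. P x' y' \<and> Q x' y')"
proof -
  obtain k l where kl: "(x, n, y) \<in> cyl A (prefix k x) (prefix l y)"
    "\<And>x' y'. (x', n, y') \<in> cyl A (prefix k x) (prefix l y) \<Longrightarrow> P x' y'"
    using P unfolding near_def by auto
  obtain k' l' where kl': "k' \<ge> k" "l' \<ge> k" "(x, n, y) \<in> cyl A (prefix k' x) (prefix l' y)"
    "\<forall>x' y'. (x', n, y') \<in> cyl A (prefix k' x) (prefix l' y) \<longrightarrow> Q x' y'"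
    by (rule near_large[OF Q, of k])
  have "int k - int l = int k' - int l'" using kl(1) kl'(3) by (auto simp: cyl_iff)
  then have j: "k' = k + (k' - k)" "l' = l + (k' - k)" using kl'(1) by linarith+
  show ?thesis
    proof (rule nearI[OF kl'(3)])
    fix x' y' assume c: "(x', n, y') \<in> cyl A (prefix k' x) (prefix l' y)"
    then have "(x', n, y') \<in> cyl A (prefix k x) (prefix l y)"
      using cyl_mono(2)[OF kl(1), of x' n y' "k' - k"] j by metis
    then show "P x' y' \<and> Q x' y'" using kl(2) kl'(4) c by blast
  qed
qed

text \<open>A cylinder is a basic bisection between the two sets of points whose initial word can be
  exchanged for the other one.\<close>

lemma openin_cyl: "openin (groupoid_topology A) (cyl A \<alpha> \<beta>)"
proof -
  let ?k = "length \<alpha>" and ?l = "length \<beta>"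
  define U where "U \<gamma> \<delta> = {x \<in> shift_space A. prefix (length \<gamma>) x = \<gamma> \<and> glue \<delta> ((shift ^^ length \<gamma>) x) \<in> shift_space A}"
    for \<gamma> \<delta> :: "'a list"
  have op: "openin (shift_topology A) (U \<gamma> \<delta>)" for \<gamma> \<delta>
    unfolding openin_shift_iff
  proof (intro conjI ballI)
    fix x assume x: "x \<in> U \<gamma> \<delta>"
    \<comment> \<open>One letter beyond the word decides whether the exchanged word may be followed
      by the remaining tail.\<close>
    have "y \<in> U \<gamma> \<delta>" if y: "y \<in> shift_space A" "prefix (Suc (length \<gamma>)) y = prefix (Suc (length \<gamma>)) x" for y
    proof -
      have "prefix (length \<gamma>) y = \<gamma>" using x prefix_eq_mono[OF y(2), of "length \<gamma>"] by (simp add: U_def)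
      moreover have "glue \<delta> ((shift ^^ length \<gamma>) y) \<in> shift_space A"
      proof (rule glue_cong)
        show "glue \<delta> ((shift ^^ length \<gamma>) x) \<in> shift_space A" using x by (simp add: U_def)
        show "(shift ^^ length \<gamma>) y \<in> shift_space A" by (rule shift_funpow_in[OF y(1)])
        show "(shift ^^ length \<gamma>) y 0 = (shift ^^ length \<gamma>) x 0"
          using y(2) by (simp add: funpow_shift prefix_eq_iff)
      qed
      ultimately show ?thesis using y by (simp add: U_def)
    qed
    then show "\<exists>m. \<forall>y\<in>shift_space A. prefix m y = prefix m x \<longrightarrow> y \<in> U \<gamma> \<delta>" by blast
  qed (auto simp: U_def)
  have inj: "inj_on (shift ^^ length \<gamma>) (U \<gamma> \<delta>)" for \<gamma> \<delta>
    by (rule inj_onI) (metis (mono_tags, lifting) U_def glue_prefix mem_Collect_eq)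
  have img: "(shift ^^ length \<gamma>) ` U \<gamma> \<delta> \<subseteq> (shift ^^ length \<delta>) ` U \<delta> \<gamma>" for \<gamma> \<delta>
  proof
    fix z assume "z \<in> (shift ^^ length \<gamma>) ` U \<gamma> \<delta>"
    then obtain x where x: "x \<in> U \<gamma> \<delta>" "z = (shift ^^ length \<gamma>) x" by auto
    then have "glue \<gamma> z = x" using glue_prefix[of "length \<gamma>" x] by (simp add: U_def)
    then have "glue \<delta> z \<in> U \<delta> \<gamma>" using x by (simp add: U_def prefix_glue shift_glue)
    then show "z \<in> (shift ^^ length \<delta>) ` U \<delta> \<gamma>" by (rule rev_image_eqI) (simp add: shift_glue)
  qed
  have "cyl A \<alpha> \<beta> = basic_bisection (U \<alpha> \<beta>) ?k ?l (U \<beta> \<alpha>)"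
  proof (intro Set.set_eqI iffI)
    fix \<gamma> assume g: "\<gamma> \<in> cyl A \<alpha> \<beta>"
    obtain x n y where xy: "\<gamma> = (x, n, y)" by (cases \<gamma>)
    have "x \<in> U \<alpha> \<beta>" "y \<in> U \<beta> \<alpha>"
      using g cyl_source[of x n y A \<alpha> \<beta>] cyl_range[of x n y A \<alpha> \<beta>] by (auto simp: xy U_def cyl_iff)
    then show "\<gamma> \<in> basic_bisection (U \<alpha> \<beta>) ?k ?l (U \<beta> \<alpha>)"
      using g by (auto simp: xy cyl_iff basic_bisection_def)
  qed (auto simp: basic_bisection_def cyl_iff U_def)
  then show ?thesis
    unfolding groupoid_topology_def using op inj img
    by (intro topology_generated_by_Basis) blast
qed

text \<open>Cylinders are a neighbourhood base. Unions and finite intersections respect the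
  condition by \<open>near_mono\<close> and \<open>near_conj\<close>, and a basic bisection contains
  a cylinder with sufficiently long words around each of its arrows.\<close>

lemma openin_groupoid_iff:
  "openin (groupoid_topology A) W \<longleftrightarrow> W \<subseteq> ck_groupoid A \<and>
     (\<forall>x n y. (x, n, y) \<in> W \<longrightarrow> near A (x, n, y) (\<lambda>x' y'. (x', n, y') \<in> W))"
proof
  assume "openin (groupoid_topology A) W"
  then have "generate_topology_on {basic_bisection U k l V | U k l V.
        openin (shift_topology A) U \<and> openin (shift_topology A) V \<and>
        inj_on (shift ^^ k) U \<and> inj_on (shift ^^ l) V \<and>
        (shift ^^ k) ` U = (shift ^^ l) ` V} W"
    unfolding groupoid_topology_def by (rule openin_topology_generated_by)
  then show "W \<subseteq> ck_groupoid A \<and> (\<forall>x n y. (x, n, y) \<in> W \<longrightarrow> near A (x, n, y) (\<lambda>x' y'. (x', n, y') \<in> W))"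
  proof induction
    case (Int a b)
    then show ?case by (auto intro: near_conj)
  next
    case (UN K)
    show ?case
    proof (intro conjI allI impI)
      show "\<Union>K \<subseteq> ck_groupoid A" using UN by blast
      fix x n y assume "(x, n, y) \<in> \<Union>K"
      then obtain k where "k \<in> K" "(x, n, y) \<in> k" by blast
      then show "near A (x, n, y) (\<lambda>x' y'. (x', n, y') \<in> \<Union>K)"
        using UN by (blast intro: near_mono)
    qed
  next
    case (Basis s)
    then obtain U k l V where s: "s = basic_bisection U k l V" "openin (shift_topology A) U" "openin (shift_topology A) V"
      by blast
    have sub: "s \<subseteq> ck_groupoid A"
    proof -
      have "U \<subseteq> shift_space A" "V \<subseteq> shift_space A" using s unfolding openin_shift_iff by blast+
      then show ?thesis unfolding s(1) basic_bisection_def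
        by (auto simp: groupoid_iff subset_iff; blast)
    qed
    show ?case
    proof (intro conjI allI impI sub)
      fix x n y assume xy: "(x, n, y) \<in> s"
      then have *: "x \<in> U" "y \<in> V" "n = int k - int l" "(shift ^^ k) x = (shift ^^ l) y"
        by (auto simp: s(1) basic_bisection_def)
      obtain m1 where m1: "\<And>z. z \<in> shift_space A \<Longrightarrow> prefix m1 z = prefix m1 x \<Longrightarrow> z \<in> U"
        using s(2) * unfolding openin_shift_iff by blast
      obtain m2 where m2: "\<And>z. z \<in> shift_space A \<Longrightarrow> prefix m2 z = prefix m2 y \<Longrightarrow> z \<in> V"
        using s(3) * unfolding openin_shift_iff by blast
      have c: "(x, n, y) \<in> cyl A (prefix k x) (prefix l y)"
        using * xy sub by (auto simp: cyl_iff groupoid_iff)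
      show "near A (x, n, y) (\<lambda>x' y'. (x', n, y') \<in> s)"
      proof (rule nearI[OF cyl_mono(1)[OF c, of "m1 + m2"]])
        fix x' y' assume a: "(x', n, y') \<in> cyl A (prefix (k + (m1 + m2)) x) (prefix (l + (m1 + m2)) y)"
        then have b: "(x', n, y') \<in> cyl A (prefix k x) (prefix l y)" by (rule cyl_mono(2)[OF c])
        have "x' \<in> U" by (rule m1) (use a in \<open>auto simp: cyl_iff prefix_eq_iff\<close>)
        moreover have "y' \<in> V" by (rule m2) (use a in \<open>auto simp: cyl_iff prefix_eq_iff\<close>)
        ultimately show "(x', n, y') \<in> s" using b by (auto simp: s(1) basic_bisection_def cyl_iff)
      qed
    qed
  qed auto
next
  assume *: "W \<subseteq> ck_groupoid A \<and> (\<forall>x n y. (x, n, y) \<in> W \<longrightarrow> near A (x, n, y) (\<lambda>x' y'. (x', n, y') \<in> W))"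
  show "openin (groupoid_topology A) W"
    unfolding openin_subopen[of _ W]
  proof
    fix \<gamma> assume "\<gamma> \<in> W"
    moreover obtain x n y where g: "\<gamma> = (x, n, y)" by (cases \<gamma>)
    ultimately have "near A (x, n, y) (\<lambda>x' y'. (x', n, y') \<in> W)" using * by blast
    then obtain k l where kl: "(x, n, y) \<in> cyl A (prefix k x) (prefix l y)"
      "\<forall>x' y'. (x', n, y') \<in> cyl A (prefix k x) (prefix l y) \<longrightarrow> (x', n, y') \<in> W"
      by (rule near_large[of A x n y _ 0]) blast
    have "cyl A (prefix k x) (prefix l y) \<subseteq> W"
    proof
      fix \<delta> assume d: "\<delta> \<in> cyl A (prefix k x) (prefix l y)"
      moreover obtain x' m y' where "\<delta> = (x', m, y')" by (cases \<delta>)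
      ultimately show "\<delta> \<in> W" using kl by (auto simp: cyl_iff)
    qed
    then show "\<exists>T. openin (groupoid_topology A) T \<and> \<gamma> \<in> T \<and> T \<subseteq> W"
      using kl(1) openin_cyl g by blast
  qed
qed

lemma topspace_groupoid [simp]: "topspace (groupoid_topology A) = ck_groupoid A"
proof (rule antisym)
  show "topspace (groupoid_topology A) \<subseteq> ck_groupoid A"
    using openin_topspace[of "groupoid_topology A"] unfolding openin_groupoid_iff by blast
  have "openin (groupoid_topology A) (ck_groupoid A)"
    unfolding openin_groupoid_iff by (auto intro: near_mono[OF near_prefix])
  then show "ck_groupoid A \<subseteq> topspace (groupoid_topology A)" by (rule openin_subset)
qed

text \<open>If words and integer fit, an arrow outside must violate the tail equation at some
  coordinate, and this violation persists nearby; otherwise the misfit itself persists.\<close>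

lemma closedin_cyl: "closedin (groupoid_topology A) (cyl A \<alpha> \<beta>)"
proof -
  have "openin (groupoid_topology A) (ck_groupoid A - cyl A \<alpha> \<beta>)"
    unfolding openin_groupoid_iff
  proof (intro conjI allI impI)
    fix x n y assume *: "(x, n, y) \<in> ck_groupoid A - cyl A \<alpha> \<beta>"
    then have G: "(x, n, y) \<in> ck_groupoid A" by simp
    then have X: "x \<in> shift_space A" "y \<in> shift_space A" by (auto simp: groupoid_iff)
    \<comment> \<open>Large enough to cover both words and the offset of either shift in the tail
      equation.\<close>
    define m0 where "m0 = length \<alpha> + length \<beta>"
    have "\<exists>m. \<forall>x' y'. prefix m x' = prefix m x \<and> prefix m y' = prefix m y \<longrightarrow> (x', n, y') \<notin> cyl A \<alpha> \<beta>"
    proof (cases "n = int (length \<alpha>) - int (length \<beta>) \<and> prefix (length \<alpha>) x = \<alpha> \<and> prefix (length \<beta>) y = \<beta>")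
      case True
      then have "(shift ^^ length \<alpha>) x \<noteq> (shift ^^ length \<beta>) y" using * X by (auto simp: cyl_iff)
      then obtain i where i: "x (i + length \<alpha>) \<noteq> y (i + length \<beta>)" by (auto simp: funpow_shift)
      have "(x', n, y') \<notin> cyl A \<alpha> \<beta>"
        if "prefix (Suc (i + m0)) x' = prefix (Suc (i + m0)) x \<and> prefix (Suc (i + m0)) y' = prefix (Suc (i + m0)) y" for x' y'
      proof -
        have "x' (i + length \<alpha>) = x (i + length \<alpha>)" "y' (i + length \<beta>) = y (i + length \<beta>)"
          using that by (auto simp: prefix_eq_iff m0_def)
        then show ?thesis using i by (auto simp: cyl_iff funpow_shift dest: fun_cong[of _ _ i])
      qed
      then show ?thesis by blast
    next
      case False
      have "(x', n, y') \<notin> cyl A \<alpha> \<beta>" if "prefix m0 x' = prefix m0 x \<and> prefix m0 y' = prefix m0 y" for x' y'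
        using False that prefix_eq_mono[of m0 x' x "length \<alpha>"] prefix_eq_mono[of m0 y' y "length \<beta>"]
        by (auto simp: cyl_iff m0_def)
      then show ?thesis by blast
    qed
    then obtain m where m: "\<And>x' y'. prefix m x' = prefix m x \<and> prefix m y' = prefix m y \<Longrightarrow> (x', n, y') \<notin> cyl A \<alpha> \<beta>"
      by blast
    show "near A (x, n, y) (\<lambda>x' y'. (x', n, y') \<in> ck_groupoid A - cyl A \<alpha> \<beta>)"
      by (rule near_mono[OF near_prefix[OF G, of m]]) (use m in blast)
  qed auto
  then show ?thesis using cyl_groupoid by (auto simp: closedin_def)
qed

text \<open>An arrow in the cylinder is determined by its range \<open>x\<close>, so the cylinder is
  the continuous image of a compact open set of points under \<open>?g\<close>.\<close>

lemma compactin_cyl: "compactin (groupoid_topology A) (cyl A \<alpha> \<beta>)" for A :: "nat^'n::finite^'n"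
proof -
  let ?k = "length \<alpha>" and ?l = "length \<beta>"
  let ?w = "\<lambda>x. glue \<beta> ((shift ^^ ?k) x)"
  let ?g = "\<lambda>x. (x, int ?k - int ?l, ?w x)"
  let ?K = "{x \<in> shift_space A. prefix ?k x = \<alpha> \<and> ?w x \<in> shift_space A}"
  have img: "?g ` ?K = cyl A \<alpha> \<beta>"
  proof (intro Set.set_eqI iffI)
    fix \<gamma> assume g: "\<gamma> \<in> cyl A \<alpha> \<beta>"
    obtain x n y where xy: "\<gamma> = (x, n, y)" by (cases \<gamma>)
    show "\<gamma> \<in> ?g ` ?K"
      using g cyl_range[of x n y A \<alpha> \<beta>] by (intro image_eqI[of _ _ x]) (auto simp: xy cyl_iff)
  qed (auto simp: cyl_iff prefix_glue shift_glue)
  have memK: "x' \<in> ?K" if "x \<in> ?K" "x' \<in> shift_space A" "prefix (Suc ?k) x' = prefix (Suc ?k) x" for x x'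
  proof -
    have "prefix ?k x' = \<alpha>" using that prefix_eq_mono[OF that(3), of ?k] by simp
    moreover have "?w x' \<in> shift_space A"
    proof (rule glue_cong)
      show "?w x \<in> shift_space A" using that by simp
      show "(shift ^^ ?k) x' \<in> shift_space A" by (rule shift_funpow_in[OF that(2)])
      show "(shift ^^ ?k) x' 0 = (shift ^^ ?k) x 0"
        using that(3) by (simp add: funpow_shift prefix_eq_iff)
    qed
    ultimately show ?thesis using that by simp
  qed
  have lev: "level A (Suc ?k) (\<lambda>x. x \<in> ?K)"
    unfolding level_def
  proof (intro ballI impI)
    fix x y assume xy: "x \<in> shift_space A" "y \<in> shift_space A" "prefix (Suc ?k) x = prefix (Suc ?k) y"
    show "(x \<in> ?K) = (y \<in> ?K)"
    proof
      assume "x \<in> ?K" from memK[OF this xy(2) xy(3)[symmetric]] show "y \<in> ?K" .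
    next
      assume "y \<in> ?K" from memK[OF this xy(1,3)] show "x \<in> ?K" .
    qed
  qed
  note K = compactin_shift_clopen[OF _ lev]
  have "continuous_map (subtopology (shift_topology A) ?K) (groupoid_topology A) ?g"
    unfolding continuous_map_def
  proof (intro conjI allI impI)
    show "?g \<in> topspace (subtopology (shift_topology A) ?K) \<rightarrow> topspace (groupoid_topology A)"
      using img cyl_groupoid by fastforce
    fix W assume W: "openin (groupoid_topology A) W"
    let ?V = "{x \<in> topspace (subtopology (shift_topology A) ?K). ?g x \<in> W}"
    have "openin (shift_topology A) ?V"
      unfolding openin_shift_iff
    proof (intro conjI ballI)
      fix x assume x: "x \<in> ?V"
      then have xK: "x \<in> ?K" and nr: "near A (?g x) (\<lambda>x' y'. (x', int ?k - int ?l, y') \<in> W)"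
        using W unfolding openin_groupoid_iff by auto
      obtain k' l' where k': "k' \<ge> ?k + ?l" "l' \<ge> ?k + ?l" "?g x \<in> cyl A (prefix k' x) (prefix l' (?w x))"
        "\<forall>x' y'. (x', int ?k - int ?l, y') \<in> cyl A (prefix k' x) (prefix l' (?w x)) \<longrightarrow> (x', int ?k - int ?l, y') \<in> W"
        by (rule near_large[OF nr, of "?k + ?l"])
      have kl: "int ?k - int ?l = int k' - int l'" using k'(3) by (simp add: cyl_iff)
      \<comment> \<open>Agreement up to index \<open>k'\<close> inclusive reaches the letter after
        \<open>\<alpha>\<close>, on which membership in \<open>?K\<close> depends, even if
        \<open>k' = ?k\<close>.\<close>
      have "x' \<in> ?V" if x': "x' \<in> shift_space A" "prefix (Suc k') x' = prefix (Suc k') x" for x'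
      proof -
        have agree: "x' i = x i" if "i \<le> k'" for i using x'(2) that by (auto simp: prefix_eq_iff)
        have K': "x' \<in> ?K" by (rule memK[OF xK x'(1)]) (use agree k'(1) in \<open>auto simp: prefix_eq_iff\<close>)
        have "prefix k' x' = prefix k' x" using agree by (auto simp: prefix_eq_iff)
        moreover have "prefix l' (?w x') = prefix l' (?w x)"
          using agree kl k'(1) by (auto simp: prefix_eq_iff glue_def funpow_shift)
        moreover have "(shift ^^ k') x' = (shift ^^ l') (?w x')"
        proof
          fix i
          have "i + l' - ?l + ?k = i + k'" using kl k'(1) by linarith
          moreover have "\<not> i + l' < ?l" using kl k'(1) by linarith
          ultimately show "(shift ^^ k') x' i = (shift ^^ l') (?w x') i"
            by (simp add: funpow_shift glue_def)
        qed
        ultimately have "?g x' \<in> W" using K' kl by (intro k'(4)[rule_format]) (auto simp: cyl_iff)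
        then show ?thesis using K' by auto
      qed
      then show "\<exists>m. \<forall>y\<in>shift_space A. prefix m y = prefix m x \<longrightarrow> y \<in> ?V" by blast
    qed auto
    then show "openin (subtopology (shift_topology A) ?K) ?V"
      using K(2) by (subst openin_open_subtopology) auto
  qed
  then have "compactin (groupoid_topology A) (?g ` ?K)"
    using K(1) by (intro image_compactin[where X = "subtopology (shift_topology A) ?K"]) (auto simp: compactin_subtopology)
  then show ?thesis unfolding img .
qed

section \<open>Continuous functions with compact support\<close>

definition loc_const :: "nat^'n^'n \<Rightarrow> ('n arrow \<Rightarrow> 'b) \<Rightarrow> bool" where
  "loc_const A f \<longleftrightarrow> (\<forall>x n y. (x, n, y) \<in> ck_groupoid A \<longrightarrow> near A (x, n, y) (\<lambda>x' y'. f (x', n, y') = f (x, n, y)))"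

lemma loc_const_continuous: "loc_const A f \<Longrightarrow> continuous_map (groupoid_topology A) euclidean f"
proof -
  assume f: "loc_const A f"
  show ?thesis
    unfolding continuous_map_def
  proof (intro conjI allI impI)
    fix U
    show "openin (groupoid_topology A) {\<gamma> \<in> topspace (groupoid_topology A). f \<gamma> \<in> U}"
      unfolding openin_groupoid_iff
    proof (intro conjI allI impI)
      fix x n y assume *: "(x, n, y) \<in> {\<gamma> \<in> topspace (groupoid_topology A). f \<gamma> \<in> U}"
      then have G: "(x, n, y) \<in> ck_groupoid A" by simp
      have "near A (x, n, y) (\<lambda>x' y'. f (x', n, y') = f (x, n, y) \<and> ((x', n, y') \<in> ck_groupoid A \<and>
          prefix 0 x' = prefix 0 x \<and> prefix 0 y' = prefix 0 y))"
        by (rule near_conj[OF _ near_prefix[OF G]]) (use f G in \<open>auto simp: loc_const_def\<close>)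
      then show "near A (x, n, y) (\<lambda>x' y'. (x', n, y') \<in> {\<gamma> \<in> topspace (groupoid_topology A). f \<gamma> \<in> U})"
        by (rule near_mono) (use * in auto)
    qed auto
  qed auto
qed

lemma loc_const_compose2:
  assumes "loc_const A f" "loc_const A g" shows "loc_const A (\<lambda>\<gamma>. q (f \<gamma>) (g \<gamma>))"
  unfolding loc_const_def
proof (intro allI impI)
  fix x n y assume G: "(x, n, y) \<in> ck_groupoid A"
  have "near A (x, n, y) (\<lambda>x' y'. f (x', n, y') = f (x, n, y) \<and> g (x', n, y') = g (x, n, y))"
    by (rule near_conj) (use assms G in \<open>auto simp: loc_const_def\<close>)
  then show "near A (x, n, y) (\<lambda>x' y'. q (f (x', n, y')) (g (x', n, y')) = q (f (x, n, y)) (g (x, n, y)))"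
    by (rule near_mono) auto
qed

lemma loc_const_level:
  assumes "level A m \<phi>" shows "loc_const A (\<lambda>(x, n, y). \<phi> x)" "loc_const A (\<lambda>(x, n, y). \<phi> y)"
proof -
  have *: "near A (x, n, y) (\<lambda>x' y'. \<phi> x' = \<phi> x)" "near A (x, n, y) (\<lambda>x' y'. \<phi> y' = \<phi> y)"
    if G: "(x, n, y) \<in> ck_groupoid A" for x n y
    by (rule near_mono[OF near_prefix[OF G, of m]]; use G in \<open>auto simp: groupoid_iff intro: levelD[OF assms]\<close>)+
  show "loc_const A (\<lambda>(x, n, y). \<phi> x)" "loc_const A (\<lambda>(x, n, y). \<phi> y)"
    unfolding loc_const_def using * by auto
qed

lemma loc_const_clopen:
  assumes "openin (groupoid_topology A) U" "closedin (groupoid_topology A) U"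
  shows "loc_const A (\<lambda>\<gamma>. \<gamma> \<in> U)"
  unfolding loc_const_def
proof (intro allI impI)
  fix x n y assume G: "(x, n, y) \<in> ck_groupoid A"
  have o: "openin (groupoid_topology A) (ck_groupoid A - U)" using assms(2) by (simp add: closedin_def)
  show "near A (x, n, y) (\<lambda>x' y'. ((x', n, y') \<in> U) = ((x, n, y) \<in> U))"
  proof (cases "(x, n, y) \<in> U")
    case True
    then have "near A (x, n, y) (\<lambda>x' y'. (x', n, y') \<in> U)" using assms(1) unfolding openin_groupoid_iff by blast
    then show ?thesis by (rule near_mono) (use True in auto)
  next
    case False
    then have "near A (x, n, y) (\<lambda>x' y'. (x', n, y') \<in> ck_groupoid A - U)" using o G unfolding openin_groupoid_iff by blast
    then show ?thesis by (rule near_mono) (use False in auto)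
  qed
qed

text \<open>The unit space is clopen: around a unit the cylinder of two empty words consists of
  units, different end points differ at some coordinate, and a nonzero integer stays nonzero
  nearby.\<close>

lemma loc_const_units: "loc_const A (\<lambda>\<gamma>. \<gamma> \<in> unit_space A)"
  unfolding loc_const_def
proof (intro allI impI)
  fix x n y assume G: "(x, n, y) \<in> ck_groupoid A"
  show "near A (x, n, y) (\<lambda>x' y'. ((x', n, y') \<in> unit_space A) = ((x, n, y) \<in> unit_space A))"
  proof (cases "n = 0 \<and> x \<noteq> y")
    case True
    then obtain i where i: "x i \<noteq> y i" by auto
    show ?thesis
    proof (rule near_mono[OF near_prefix[OF G, of "Suc i"]])
      fix x' y' assume "(x', n, y') \<in> ck_groupoid A \<and> prefix (Suc i) x' = prefix (Suc i) x \<and> prefix (Suc i) y' = prefix (Suc i) y"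
      then have "x' i = x i" "y' i = y i" by (auto simp: prefix_eq_iff)
      then show "((x', n, y') \<in> unit_space A) = ((x, n, y) \<in> unit_space A)"
        using True i by (auto simp: unit_space_iff)
    qed
  next
    case False
    show ?thesis
    proof (cases "n = 0")
      case True
      then have "(x, n, y) \<in> cyl A (prefix 0 x) (prefix 0 y)" using False G by (auto simp: cyl_iff groupoid_iff)
      then show ?thesis by (rule nearI) (use True False G in \<open>auto simp: cyl_iff unit_space_iff groupoid_iff\<close>)
    next
      case f: False
      show ?thesis by (rule near_mono[OF near_prefix[OF G, of 0]]) (use f in \<open>auto simp: unit_space_iff\<close>)
    qed
  qed
qed

text \<open>Useful where only the lengths of the words in a support are known; over a finite
  alphabet it is a finite union of cylinders.\<close>

definition tail_set :: "nat^'n^'n \<Rightarrow> nat \<times> nat \<Rightarrow> 'n arrow set" where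
  "tail_set A = (\<lambda>(k, l). {(x, int k - int l, y) | x y. x \<in> shift_space A \<and> y \<in> shift_space A \<and> (shift ^^ k) x = (shift ^^ l) y})"

lemma tail_set_iff: "(x, n, y) \<in> tail_set A (k, l) \<longleftrightarrow> n = int k - int l \<and> x \<in> shift_space A \<and> y \<in> shift_space A \<and> (shift ^^ k) x = (shift ^^ l) y"
  by (auto simp: tail_set_def)

lemma tail_set_cyl: "tail_set A (k, l) = (\<Union>p\<in>words k \<times> words l. cyl A (fst p) (snd p))"
proof (intro Set.set_eqI)
  fix \<gamma> :: "'a arrow"
  obtain x n y where "\<gamma> = (x, n, y)" by (cases \<gamma>)
  then show "\<gamma> \<in> tail_set A (k, l) \<longleftrightarrow> \<gamma> \<in> (\<Union>p\<in>words k \<times> words l. cyl A (fst p) (snd p))"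
    by (force simp: tail_set_iff cyl_iff mem_words)
qed

abbreviation Cc :: "nat^'n^'n \<Rightarrow> ('n arrow \<Rightarrow> complex) set" where
  "Cc A \<equiv> carrier (convolution_algebra A)"

text \<open>Cylinders are open and cover the groupoid, so compactness selects finitely many;
  conversely a finite union of cylinders is compact and closed, hence contains the closed
  support.\<close>

lemma Cc_iff:
  fixes A :: "nat^'n::finite^'n"
  shows "f \<in> Cc A \<longleftrightarrow> (\<forall>\<gamma>. \<gamma> \<notin> ck_groupoid A \<longrightarrow> f \<gamma> = 0) \<and> continuous_map (groupoid_topology A) euclidean f \<and>
     (\<exists>P. finite P \<and> {\<gamma>. f \<gamma> \<noteq> 0} \<subseteq> (\<Union>p\<in>P. cyl A (fst p) (snd p)))" (is "_ \<longleftrightarrow> ?R")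
proof
  assume f: "f \<in> Cc A"
  then have f': "\<forall>\<gamma>. \<gamma> \<notin> ck_groupoid A \<longrightarrow> f \<gamma> = 0" "continuous_map (groupoid_topology A) euclidean f"
    "compactin (groupoid_topology A) (groupoid_topology A closure_of {\<gamma>. f \<gamma> \<noteq> 0})"
    by (simp_all add: convolution_algebra_def del: split_paired_All)
  let ?\<U> = "range (\<lambda>p. cyl A (fst p) (snd p))"
  have "topspace (groupoid_topology A) \<subseteq> \<Union>?\<U>"
  proof
    fix \<gamma> assume "\<gamma> \<in> topspace (groupoid_topology A)"
    moreover obtain x n y where "\<gamma> = (x, n, y)" by (cases \<gamma>)
    ultimately obtain k l where "\<gamma> \<in> cyl A (prefix k x) (prefix l y)" using groupoid_in_cyl[of x n y A] by auto
    moreover have "cyl A (prefix k x) (prefix l y) \<in> ?\<U>"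
      by (rule image_eqI[of _ _ "(prefix k x, prefix l y)"]) auto
    ultimately show "\<gamma> \<in> \<Union>?\<U>" by blast
  qed
  from order_trans[OF closure_of_subset_topspace this]
  have cover: "groupoid_topology A closure_of {\<gamma>. f \<gamma> \<noteq> 0} \<subseteq> \<Union>?\<U>" .
  have op: "openin (groupoid_topology A) U" if "U \<in> ?\<U>" for U using that openin_cyl by auto
  obtain \<F> where F: "finite \<F>" "\<F> \<subseteq> ?\<U>" "groupoid_topology A closure_of {\<gamma>. f \<gamma> \<noteq> 0} \<subseteq> \<Union>\<F>"
    using compactinD[OF f'(3) op cover] by auto
  obtain P where P: "finite P" "\<F> = (\<lambda>p. cyl A (fst p) (snd p)) ` P"
    using finite_subset_image[OF F(1,2)] by metis
  have "{\<gamma>. f \<gamma> \<noteq> 0} \<subseteq> topspace (groupoid_topology A)" using f'(1) by auto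
  from order_trans[OF closure_of_subset[OF this] F(3)]
  have "{\<gamma>. f \<gamma> \<noteq> 0} \<subseteq> (\<Union>p\<in>P. cyl A (fst p) (snd p))" unfolding P(2) .
  with P(1) f'(1,2) show ?R by (intro conjI exI[of _ P]) 
next
  assume R: ?R
  then obtain P where P: "finite P" "{\<gamma>. f \<gamma> \<noteq> 0} \<subseteq> (\<Union>p\<in>P. cyl A (fst p) (snd p))" by blast
  let ?K = "\<Union>p\<in>P. cyl A (fst p) (snd p)"
  have "closedin (groupoid_topology A) ?K" using P closedin_cyl by (intro closedin_Union) auto
  then have "groupoid_topology A closure_of {\<gamma>. f \<gamma> \<noteq> 0} \<subseteq> ?K" using P by (intro closure_of_minimal)
  moreover have "compactin (groupoid_topology A) ?K" using P compactin_cyl by (intro compactin_Union) auto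
  ultimately have "compactin (groupoid_topology A) (groupoid_topology A closure_of {\<gamma>. f \<gamma> \<noteq> 0})"
    by (rule closed_compactin[rotated 2, OF closedin_closure_of, rotated])
  then show "f \<in> Cc A" using R by (simp add: convolution_algebra_def del: split_paired_All)
qed

lemma continuous_map_mult:
  fixes f :: "'a \<Rightarrow> 'b::real_normed_algebra"
  shows "continuous_map X euclidean f \<Longrightarrow> continuous_map X euclidean g \<Longrightarrow> continuous_map X euclidean (\<lambda>x. f x * g x)"
  by (simp add: continuous_map_atin tendsto_mult)

lemma Cc_outside: "f \<in> Cc A \<Longrightarrow> \<gamma> \<notin> ck_groupoid A \<Longrightarrow> f \<gamma> = 0" for A :: "nat^'n::finite^'n"
  unfolding Cc_iff by blast

lemma Cc_continuous: "f \<in> Cc A \<Longrightarrow> continuous_map (groupoid_topology A) euclidean f" for A :: "nat^'n::finite^'n"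
  unfolding Cc_iff by blast

lemma Cc_add:
  fixes A :: "nat^'n::finite^'n"
  assumes f: "f \<in> Cc A" and g: "g \<in> Cc A" shows "(\<lambda>\<gamma>. f \<gamma> + g \<gamma>) \<in> Cc A"
proof -
  obtain P Q where "finite P" "{\<gamma>. f \<gamma> \<noteq> 0} \<subseteq> (\<Union>p\<in>P. cyl A (fst p) (snd p))"
    "finite Q" "{\<gamma>. g \<gamma> \<noteq> 0} \<subseteq> (\<Union>p\<in>Q. cyl A (fst p) (snd p))"
    using f g unfolding Cc_iff by blast
  moreover have "{\<gamma>. f \<gamma> + g \<gamma> \<noteq> 0} \<subseteq> {\<gamma>. f \<gamma> \<noteq> 0} \<union> {\<gamma>. g \<gamma> \<noteq> 0}" by auto
  ultimately have "finite (P \<union> Q) \<and> {\<gamma>. f \<gamma> + g \<gamma> \<noteq> 0} \<subseteq> (\<Union>p\<in>P \<union> Q. cyl A (fst p) (snd p))" by blast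
  moreover have "f \<gamma> + g \<gamma> = 0" if "\<gamma> \<notin> ck_groupoid A" for \<gamma>
    using Cc_outside[OF f that] Cc_outside[OF g that] by simp
  ultimately show ?thesis
    unfolding Cc_iff using continuous_map_add[OF Cc_continuous[OF f] Cc_continuous[OF g]] by blast
qed

lemma Cc_mult_continuous:
  fixes A :: "nat^'n::finite^'n"
  assumes f: "f \<in> Cc A" and g: "continuous_map (groupoid_topology A) euclidean g"
  shows "(\<lambda>\<gamma>. g \<gamma> * f \<gamma>) \<in> Cc A"
proof -
  obtain P where "finite P" "{\<gamma>. f \<gamma> \<noteq> 0} \<subseteq> (\<Union>p\<in>P. cyl A (fst p) (snd p))"
    using f unfolding Cc_iff by blast
  moreover have "{\<gamma>. g \<gamma> * f \<gamma> \<noteq> 0} \<subseteq> {\<gamma>. f \<gamma> \<noteq> 0}" by auto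
  moreover have "g \<gamma> * f \<gamma> = 0" if "\<gamma> \<notin> ck_groupoid A" for \<gamma>
    using Cc_outside[OF f that] by simp
  ultimately show ?thesis
    unfolding Cc_iff using continuous_map_mult[OF g Cc_continuous[OF f]] by blast
qed

lemma Cc_smult: "f \<in> Cc A \<Longrightarrow> (\<lambda>\<gamma>. c * f \<gamma>) \<in> Cc A" for A :: "nat^'n::finite^'n"
  using Cc_mult_continuous[of f A "\<lambda>_. c"] by simp

lemma Cc_zero: "(\<lambda>\<gamma>. 0) \<in> Cc A" for A :: "nat^'n::finite^'n"
  unfolding Cc_iff by auto

lemma Cc_restrict:
  fixes A :: "nat^'n::finite^'n"
  assumes f: "f \<in> Cc A" and U: "openin (groupoid_topology A) U" "closedin (groupoid_topology A) U"
  shows "(\<lambda>\<gamma>. if \<gamma> \<in> U then f \<gamma> else 0) \<in> Cc A" "(\<lambda>\<gamma>. if \<gamma> \<in> U then 0 else f \<gamma>) \<in> Cc A"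
proof -
  have "loc_const A (\<lambda>\<gamma>. of_bool (\<gamma> \<in> U) :: complex)" "loc_const A (\<lambda>\<gamma>. of_bool (\<gamma> \<notin> U) :: complex)"
    using loc_const_compose2[OF loc_const_clopen[OF U] loc_const_clopen[OF U], of "\<lambda>a b. of_bool a"]
      loc_const_compose2[OF loc_const_clopen[OF U] loc_const_clopen[OF U], of "\<lambda>a b. of_bool (\<not> a)"] by auto
  then have "(\<lambda>\<gamma>. of_bool (\<gamma> \<in> U) * f \<gamma>) \<in> Cc A" "(\<lambda>\<gamma>. of_bool (\<gamma> \<notin> U) * f \<gamma>) \<in> Cc A"
    using f by (auto intro!: Cc_mult_continuous loc_const_continuous)
  moreover have "(\<lambda>\<gamma>. of_bool (\<gamma> \<in> U) * f \<gamma>) = (\<lambda>\<gamma>. if \<gamma> \<in> U then f \<gamma> else 0)"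
    "(\<lambda>\<gamma>. of_bool (\<gamma> \<notin> U) * f \<gamma>) = (\<lambda>\<gamma>. if \<gamma> \<in> U then 0 else f \<gamma>)" by (auto simp: fun_eq_iff)
  ultimately show "(\<lambda>\<gamma>. if \<gamma> \<in> U then f \<gamma> else 0) \<in> Cc A" "(\<lambda>\<gamma>. if \<gamma> \<in> U then 0 else f \<gamma>) \<in> Cc A"
    by simp_all
qed

text \<open>Cylinders are clopen, so a function splits into its restriction to one of them and a
  remainder supported in the others. This reduces claims about compact support to a single
  bisection.\<close>

lemma Cc_induct [consumes 1, case_names single add]:
  fixes A :: "nat^'n::finite^'n"
  assumes f: "f \<in> Cc A"
    and single: "\<And>f \<alpha> \<beta>. f \<in> Cc A \<Longrightarrow> {\<gamma>. f \<gamma> \<noteq> 0} \<subseteq> cyl A \<alpha> \<beta> \<Longrightarrow> P f"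
    and add: "\<And>f g. f \<in> Cc A \<Longrightarrow> g \<in> Cc A \<Longrightarrow> P f \<Longrightarrow> P g \<Longrightarrow> P (\<lambda>\<gamma>. f \<gamma> + g \<gamma>)"
  shows "P f"
proof -
  have "finite Z \<Longrightarrow> f \<in> Cc A \<Longrightarrow> {\<gamma>. f \<gamma> \<noteq> 0} \<subseteq> (\<Union>p\<in>Z. cyl A (fst p) (snd p)) \<Longrightarrow> P f" for Z f
  proof (induction Z arbitrary: f rule: finite_induct)
    case empty
    then show ?case by (intro single[of f "[]" "[]"]) auto
  next
    case (insert p Z)
    let ?U = "cyl A (fst p) (snd p)"
    let ?f1 = "\<lambda>\<gamma>. if \<gamma> \<in> ?U then f \<gamma> else 0" and ?f2 = "\<lambda>\<gamma>. if \<gamma> \<in> ?U then 0 else f \<gamma>"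
    note c = Cc_restrict[OF insert.prems(1) openin_cyl closedin_cyl, of "fst p" "snd p"]
    have "P ?f1" by (rule single[OF c(1), of "fst p" "snd p"]) (auto split: if_splits)
    moreover have "P ?f2" by (rule insert.IH[OF c(2)]) (use insert.prems(2) in \<open>auto split: if_splits\<close>)
    ultimately have "P (\<lambda>\<gamma>. ?f1 \<gamma> + ?f2 \<gamma>)" by (intro add c)
    moreover have "(\<lambda>\<gamma>. ?f1 \<gamma> + ?f2 \<gamma>) = f" by auto
    ultimately show ?case by simp
  qed
  then show ?thesis using f unfolding Cc_iff by blast
qed

lemma act_single:
  assumes "finite {j. \<xi> j \<noteq> 0}" "\<And>j. ker f i j \<noteq> 0 \<Longrightarrow> j = j0"
  shows "act f \<xi> i = ker f i j0 * \<xi> j0"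
proof -
  have "act f \<xi> i = (\<Sum>j\<in>insert j0 {j. \<xi> j \<noteq> 0}. ker f i j * \<xi> j)"
    by (rule act_superset) (use assms in auto)
  also have "\<dots> = (\<Sum>j\<in>{j0}. ker f i j * \<xi> j)"
    by (rule sum.mono_neutral_right) (use assms in auto)
  finally show ?thesis by simp
qed

text \<open>On a cylinder, range and source determine each other. A function supported there has at
  most one nonzero matrix entry per row and per column, at the position computed here and in
  \<open>cyl_col\<close>.\<close>

definition cyl_row :: "'n list \<Rightarrow> 'n list \<Rightarrow> 'n index \<Rightarrow> 'n index" where
  "cyl_row \<alpha> \<beta> i = (glue \<beta> ((shift ^^ length \<alpha>) (fst i)), snd i - (int (length \<alpha>) - int (length \<beta>)))"

definition cyl_col :: "'n list \<Rightarrow> 'n list \<Rightarrow> 'n index \<Rightarrow> 'n index" where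
  "cyl_col \<alpha> \<beta> j = (glue \<alpha> ((shift ^^ length \<beta>) (fst j)), snd j + (int (length \<alpha>) - int (length \<beta>)))"

lemma cyl_row_col:
  assumes "{\<gamma>. f \<gamma> \<noteq> 0} \<subseteq> cyl A \<alpha> \<beta>" "ker f i j \<noteq> 0"
  shows "j = cyl_row \<alpha> \<beta> i" "i = cyl_col \<alpha> \<beta> j"
proof -
  have c: "(fst i, snd i - snd j, fst j) \<in> cyl A \<alpha> \<beta>" using assms by (auto simp: ker_def)
  show "j = cyl_row \<alpha> \<beta> i" using c cyl_range[OF c]
    by (auto simp: cyl_row_def prod_eq_iff cyl_iff)
  show "i = cyl_col \<alpha> \<beta> j" using c cyl_source[OF c]
    by (auto simp: cyl_col_def prod_eq_iff cyl_iff)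
qed

lemma Cc_single_value:
  fixes A :: "nat^'n::finite^'n"
  assumes f: "f \<in> Cc A" and supp: "{\<gamma>. f \<gamma> \<noteq> 0} \<subseteq> cyl A \<alpha> \<beta>"
  shows "\<exists>M>0. \<forall>\<gamma>. cmod (f \<gamma>) \<le> M"
proof -
  have "compactin euclidean (f ` cyl A \<alpha> \<beta>)"
    by (rule image_compactin[OF compactin_cyl Cc_continuous[OF f]])
  then have "bounded (f ` cyl A \<alpha> \<beta>)" by (simp add: compact_imp_bounded)
  then obtain M where M: "M > 0" "\<And>z. z \<in> f ` cyl A \<alpha> \<beta> \<Longrightarrow> cmod z \<le> M"
    unfolding bounded_pos by blast
  have "cmod (f \<gamma>) \<le> M" for \<gamma>
  proof (cases "f \<gamma> = 0")
    case True
    then show ?thesis using M(1) by simp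
  next
    case False
    then have "\<gamma> \<in> cyl A \<alpha> \<beta>" using supp by blast
    then show ?thesis using M(2) by blast
  qed
  then show ?thesis using M(1) by blast
qed

lemma single_kernel:
  assumes "\<And>\<gamma>. \<gamma> \<notin> ck_groupoid A \<Longrightarrow> f \<gamma> = 0" and supp: "{\<gamma>. f \<gamma> \<noteq> 0} \<subseteq> cyl A \<alpha> \<beta>"
  shows "f \<in> carrier (kernel_algebra A)"
proof (rule kernel_carrierI)
  show "finite {i. ker f i j \<noteq> 0}" for j
    by (rule finite_subset[of _ "{cyl_col \<alpha> \<beta> j}"], blast dest: cyl_row_col(2)[OF supp], simp)
  show "finite {j. ker f i j \<noteq> 0}" for i
    by (rule finite_subset[of _ "{cyl_row \<alpha> \<beta> i}"], blast dest: cyl_row_col(1)[OF supp], simp)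
qed (rule assms(1))

text \<open>The matrix is a weighted partial permutation: it moves coordinates injectively and
  enlarges each by a factor of at most \<open>M\<close>.\<close>

lemma single_bounded:
  assumes supp: "{\<gamma>. f \<gamma> \<noteq> 0} \<subseteq> cyl A \<alpha> \<beta>" and M: "M > 0" "\<And>\<gamma>. cmod (f \<gamma>) \<le> M"
  shows "bounded_by f M"
  unfolding bounded_by_def
proof (intro conjI allI impI)
  show "0 \<le> M" using M by simp
  fix \<xi> :: "'a index \<Rightarrow> complex" assume \<xi>: "finite {i. \<xi> i \<noteq> 0}"
  let ?s = "cyl_row \<alpha> \<beta>" and ?I = "{i. act f \<xi> i \<noteq> 0}"
  have act: "act f \<xi> i = ker f i (?s i) * \<xi> (?s i)" for i
    by (rule act_single[OF \<xi> cyl_row_col(1)[OF supp]])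
  have inj: "inj_on ?s ?I"
  proof (rule inj_onI)
    fix i j assume "i \<in> ?I" "j \<in> ?I" "?s i = ?s j"
    then show "i = j" using cyl_row_col(2)[OF supp, of i "?s i"] cyl_row_col(2)[OF supp, of j "?s j"] act[of i] act[of j] by auto
  qed
  have sub: "?s ` ?I \<subseteq> {j. \<xi> j \<noteq> 0}" using act by auto
  have "(\<Sum>i\<in>?I. (cmod (act f \<xi> i))\<^sup>2) \<le> (\<Sum>i\<in>?I. M\<^sup>2 * (cmod (\<xi> (?s i)))\<^sup>2)"
  proof (rule sum_mono)
    fix i
    have "cmod (ker f i (?s i)) \<le> M" using M(2) by (simp add: ker_def)
    then show "(cmod (act f \<xi> i))\<^sup>2 \<le> M\<^sup>2 * (cmod (\<xi> (?s i)))\<^sup>2"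
      unfolding act norm_mult power_mult_distrib by (intro mult_right_mono power_mono) auto
  qed
  also have "\<dots> = M\<^sup>2 * (\<Sum>j\<in>?s ` ?I. (cmod (\<xi> j))\<^sup>2)"
    by (simp add: sum_distrib_left sum.reindex[OF inj])
  also have "\<dots> \<le> M\<^sup>2 * (\<Sum>j | \<xi> j \<noteq> 0. (cmod (\<xi> j))\<^sup>2)"
    by (intro mult_left_mono sum_mono2[OF \<xi> sub]) auto
  finally have "sqrt (\<Sum>i\<in>?I. (cmod (act f \<xi> i))\<^sup>2) \<le> sqrt (M\<^sup>2 * (\<Sum>j | \<xi> j \<noteq> 0. (cmod (\<xi> j))\<^sup>2))"
    by (rule real_sqrt_le_mono)
  also have "\<dots> = M * sqrt (\<Sum>j | \<xi> j \<noteq> 0. (cmod (\<xi> j))\<^sup>2)" using M(1) by (simp add: real_sqrt_mult)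
  finally show "vnorm (act f \<xi>) \<le> M * vnorm \<xi>" by (simp add: vnorm_def L2_set_def)
qed

lemma Cc_kernel_bounded:
  fixes A :: "nat^'n::finite^'n"
  assumes "f \<in> Cc A" shows "f \<in> carrier (kernel_algebra A) \<and> (\<exists>K. bounded_by f K)"
  using assms
proof (induction rule: Cc_induct)
  case (single f \<alpha> \<beta>)
  obtain M where "M > 0" "\<And>\<gamma>. cmod (f \<gamma>) \<le> M" using Cc_single_value[OF single] by blast
  then have "bounded_by f M" by (rule single_bounded[OF single(2)])
  moreover have "f \<in> carrier (kernel_algebra A)"
    by (rule single_kernel[OF Cc_outside[OF single(1)] single(2)])
  ultimately show ?case by blast
next
  case (add f g)
  then show ?case using kernel_add_closed(1)[of f A g] bounded_by_add[of f A g] by blast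
qed

lemma Cc_kernel: "f \<in> Cc A \<Longrightarrow> f \<in> carrier (kernel_algebra A)" for A :: "nat^'n::finite^'n"
  using Cc_kernel_bounded by blast

lemma convolution_reg_norm: "cstar_seminorm (convolution_algebra A) reg_norm" for A :: "nat^'n::finite^'n"
  by (rule reg_norm_seminorm) (use Cc_kernel_bounded in blast)+

lemma indicator_cyl_Cc: "indicator (cyl A \<alpha> \<beta>) \<in> Cc A" for A :: "nat^'n::finite^'n"
proof -
  have "loc_const A (\<lambda>\<gamma>. \<gamma> \<in> cyl A \<alpha> \<beta>)" by (rule loc_const_clopen[OF openin_cyl closedin_cyl])
  from loc_const_compose2[OF this this, where q = "\<lambda>a b. of_bool a"]
  have "loc_const A (\<lambda>\<gamma>. of_bool (\<gamma> \<in> cyl A \<alpha> \<beta>) :: complex)" .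
  moreover have "(\<lambda>\<gamma>. of_bool (\<gamma> \<in> cyl A \<alpha> \<beta>)) = (indicator (cyl A \<alpha> \<beta>) :: _ \<Rightarrow> complex)"
    by (auto simp: indicator_def fun_eq_iff)
  ultimately have "continuous_map (groupoid_topology A) euclidean (indicator (cyl A \<alpha> \<beta>) :: _ \<Rightarrow> complex)"
    using loc_const_continuous by metis
  moreover have "{\<gamma>. (indicator (cyl A \<alpha> \<beta>) \<gamma> :: complex) \<noteq> 0} \<subseteq> (\<Union>p\<in>{(\<alpha>, \<beta>)}. cyl A (fst p) (snd p))"
    by (auto simp: indicator_def)
  moreover have "(indicator (cyl A \<alpha> \<beta>) \<gamma> :: complex) = 0" if "\<gamma> \<notin> ck_groupoid A" for \<gamma>
    using that cyl_groupoid[of A \<alpha> \<beta>] by (auto simp: indicator_def)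
  moreover have "finite {(\<alpha>, \<beta>)}" by simp
  ultimately show ?thesis unfolding Cc_iff by blast
qed

text \<open>A function of modulus \<open>1\<close> on a compact open bisection is a partial isometry, whose initial
  projection is the indicator function of a compact open set of units.\<close>

lemma unimodular_seminorm_le_1:
  fixes A :: "nat^'n::finite^'n"
  assumes v: "v \<in> Cc A" and supp: "{\<gamma>. v \<gamma> \<noteq> 0} \<subseteq> cyl A \<alpha> \<beta>"
    and uni: "\<And>\<gamma>. \<gamma> \<in> cyl A \<alpha> \<beta> \<Longrightarrow> cmod (v \<gamma>) = 1"
    and rho: "cstar_seminorm (convolution_algebra A) \<rho>"
  shows "\<rho> v \<le> 1"
proof -
  let ?l = "length \<beta>"
  \<comment> \<open>The sources of the arrows in the cylinder; \<open>e\<close> is the indicator of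
    the corresponding units and turns out to be the initial projection of \<open>v\<close>.\<close>
  define Y where "Y = {y \<in> shift_space A. prefix ?l y = \<beta> \<and> glue \<alpha> ((shift ^^ ?l) y) \<in> shift_space A}"
  define e where "e = (\<lambda>\<gamma>. of_bool (\<gamma> \<in> unit_space A \<and> snd (snd \<gamma>) \<in> Y) :: complex)"
  have levY: "level A (Suc ?l) (\<lambda>y. y \<in> Y)"
  proof -
    have *: "y' \<in> Y" if y: "y \<in> Y" "y' \<in> shift_space A" "prefix (Suc ?l) y' = prefix (Suc ?l) y" for y y'
    proof -
      have "glue \<alpha> ((shift ^^ ?l) y') \<in> shift_space A"
      proof (rule glue_cong)
        show "glue \<alpha> ((shift ^^ ?l) y) \<in> shift_space A" using y by (simp add: Y_def)
        show "(shift ^^ ?l) y' \<in> shift_space A" by (rule shift_funpow_in[OF y(2)])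
        show "(shift ^^ ?l) y' 0 = (shift ^^ ?l) y 0" using y(3) by (simp add: funpow_shift prefix_eq_iff)
      qed
      then show ?thesis using y prefix_eq_mono[OF y(3), of ?l] by (simp add: Y_def)
    qed
    show ?thesis unfolding level_def
    proof (intro ballI impI)
      fix x y assume xy: "x \<in> shift_space A" "y \<in> shift_space A" "prefix (Suc ?l) x = prefix (Suc ?l) y"
      show "(x \<in> Y) = (y \<in> Y)"
      proof
        assume "x \<in> Y" from *[OF this xy(2) xy(3)[symmetric]] show "y \<in> Y" .
      next
        assume "y \<in> Y" from *[OF this xy(1,3)] show "x \<in> Y" .
      qed
    qed
  qed
  have "loc_const A (\<lambda>\<gamma>. of_bool (\<gamma> \<in> unit_space A \<and> (case \<gamma> of (x, n, y) \<Rightarrow> y \<in> Y)) :: complex)"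
    using loc_const_compose2[OF loc_const_units loc_const_level(2)[OF levY], of "\<lambda>a b. of_bool (a \<and> b)"] .
  then have "loc_const A e" unfolding e_def by (simp add: case_prod_beta)
  moreover have "{\<gamma>. e \<gamma> \<noteq> 0} \<subseteq> (\<Union>p\<in>{([], [])}. cyl A (fst p) (snd p))"
    by (auto simp: e_def unit_space_iff cyl_iff)
  moreover have "e \<gamma> = 0" if "\<gamma> \<notin> ck_groupoid A" for \<gamma>
    using that groupoid_unit[of _ A] by (auto simp: e_def unit_space_def gunit_def)
  moreover have "finite {([], []) :: 'n list \<times> 'n list}" by simp
  ultimately have e: "e \<in> Cc A" unfolding Cc_iff using loc_const_continuous by blast
  have ker_e: "ker e i l = (if i = l \<and> fst l \<in> Y then 1 else 0)" for i l
    by (auto simp: e_def ker_def unit_space_iff prod_eq_iff Y_def)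
  note vK = Cc_kernel[OF v] and eK = Cc_kernel[OF e]
  have ve: "adj (convolution_algebra A) v \<otimes>\<^bsub>convolution_algebra A\<^esub> v = e"
  proof -
    have "adj (kernel_algebra A) v \<otimes>\<^bsub>kernel_algebra A\<^esub> v = e"
    proof (rule ker_eqI)
      fix i l
      let ?j = "cyl_col \<alpha> \<beta> l"
      have col: "(\<lambda>j. ker v j l) = (\<lambda>j. if j = ?j then ker v ?j l else 0)"
      proof
        fix j
        show "ker v j l = (if j = ?j then ker v ?j l else 0)"
          using cyl_row_col(2)[OF supp, of j l] by (cases "j = ?j") auto
      qed
      have "ker (adj (kernel_algebra A) v \<otimes>\<^bsub>kernel_algebra A\<^esub> v) i l = cnj (ker v ?j i) * ker v ?j l"
        unfolding kernel_mult[OF kernel_adj_closed[OF vK] vK]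
        by (subst col) (simp add: act_delta kernel_simps)
      also have "\<dots> = ker e i l"
      proof (cases "ker v ?j l = 0")
        case True
        have "fst l \<notin> Y"
        proof
          assume Y: "fst l \<in> Y"
          then have "(fst ?j, snd ?j - snd l, fst l) \<in> cyl A \<alpha> \<beta>"
            by (simp add: cyl_col_def cyl_iff Y_def prefix_glue shift_glue)
          from uni[OF this] True show False by (simp add: ker_def)
        qed
        then show ?thesis using True ker_e by auto
      next
        case False
        then have c: "(fst ?j, snd ?j - snd l, fst l) \<in> cyl A \<alpha> \<beta>" using supp by (auto simp: ker_def)
        then have "fst l \<in> Y" by (auto simp: cyl_iff Y_def cyl_col_def)
        moreover have "cnj (ker v ?j l) * ker v ?j l = 1"
          using uni[OF c] complex_norm_square[of "ker v ?j l"] by (simp add: ker_def mult.commute)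
        moreover have "ker v ?j i = 0" if "i \<noteq> l"
          using cyl_row_col(1)[OF supp, of ?j i] cyl_row_col(1)[OF supp False] that by auto
        ultimately show ?thesis by (cases "i = l") (simp_all add: ker_e)
      qed
      finally show "ker (adj (kernel_algebra A) v \<otimes>\<^bsub>kernel_algebra A\<^esub> v) i l = ker e i l" .
    qed
    then show ?thesis by (simp add: kernel_algebra_def)
  qed
  have ee: "adj (convolution_algebra A) e \<otimes>\<^bsub>convolution_algebra A\<^esub> e = e"
  proof -
    have "adj (kernel_algebra A) e \<otimes>\<^bsub>kernel_algebra A\<^esub> e = e"
    proof (rule ker_eqI)
      fix i l
      have col: "(\<lambda>j. ker e j l) = (\<lambda>j. if j = l then ker e l l else 0)" by (auto simp: ker_e fun_eq_iff)
      show "ker (adj (kernel_algebra A) e \<otimes>\<^bsub>kernel_algebra A\<^esub> e) i l = ker e i l"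
        unfolding kernel_mult[OF kernel_adj_closed[OF eK] eK]
        by (subst col) (auto simp: act_delta kernel_simps ker_e)
    qed
    then show ?thesis by (simp add: kernel_algebra_def)
  qed
  have cstar: "\<rho> (adj (convolution_algebra A) f \<otimes>\<^bsub>convolution_algebra A\<^esub> f) = (\<rho> f)\<^sup>2" "0 \<le> \<rho> f"
    if "f \<in> Cc A" for f using rho that unfolding cstar_seminorm_def by blast+
  have "\<rho> e = (\<rho> e)\<^sup>2" using cstar(1)[OF e] ee by simp
  then have "\<rho> e \<le> 1" by (metis le_numeral_extra(1,4) mult_cancel_right1 power2_eq_square)
  then have "(\<rho> v)\<^sup>2 \<le> 1" using cstar(1)[OF v] ve by simp
  then show ?thesis using cstar(2)[OF v] by (simp add: abs_square_le_1)
qed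

text \<open>Real and imaginary part of \<open>f\<close>, divided by \<open>M\<close>, are averages
  of two functions of modulus 1 on the cylinder. These have seminorm at most 1 in every C*-seminorm,
  whence the uniform bound \<open>2 * M\<close>.\<close>

lemma Cc_seminorm_bounded:
  fixes A :: "nat^'n::finite^'n"
  assumes "f \<in> Cc A" shows "\<exists>K. \<forall>\<rho>. cstar_seminorm (convolution_algebra A) \<rho> \<longrightarrow> \<rho> f \<le> K"
  using assms
proof (induction rule: Cc_induct)
  case (single f \<alpha> \<beta>)
  obtain M where M: "M > 0" "\<And>\<gamma>. cmod (f \<gamma>) \<le> M" using Cc_single_value[OF single] by blast
  \<comment> \<open>\<open>c = 1\<close> selects the real part of \<open>z\<close>,
    \<open>c = - \<i>\<close> the imaginary part, and \<open>s\<close> is the sign of the square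
    root; the two signs average to \<open>Re (c * z) / M\<close>.\<close>
  define w where "w c s z = complex_of_real (Re (c * z) / M) + \<i> * complex_of_real (s * sqrt (1 - (Re (c * z) / M)\<^sup>2))"
    for c z :: complex and s :: real
  define v where "v c s = (\<lambda>\<gamma>. w c s (f \<gamma>) * indicator (cyl A \<alpha> \<beta>) \<gamma>)" for c s
  have vC: "v c s \<in> Cc A" for c s
  proof -
    have "continuous_on UNIV (w c s)" unfolding w_def by (intro continuous_intros) (use M in auto)
    then have "continuous_map euclidean euclidean (w c s)" by simp
    then have "continuous_map (groupoid_topology A) euclidean (w c s \<circ> f)"
      by (rule continuous_map_compose[OF Cc_continuous[OF single(1)]])
    from Cc_mult_continuous[OF indicator_cyl_Cc this] show ?thesis by (simp add: v_def comp_def)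
  qed
  have wnorm: "cmod (w c s z) = 1" if "cmod c = 1" "\<bar>s\<bar> = 1" "cmod z \<le> M" for c s z
  proof -
    have "\<bar>Re (c * z)\<bar> \<le> M" using abs_Re_le_cmod[of "c * z"] that by (simp add: norm_mult)
    then have "(Re (c * z) / M)\<^sup>2 \<le> 1" using M(1) by (simp add: abs_square_le_1)
    moreover have "s\<^sup>2 = 1" using that by (metis one_power2 power2_abs)
    ultimately have "(cmod (w c s z))\<^sup>2 = 1"
      unfolding cmod_power2 by (simp add: w_def power_mult_distrib)
    then show ?thesis by (metis abs_norm_cancel abs_square_eq_1 power2_abs)
  qed
  have le1: "\<rho> (v c s) \<le> 1" if "cmod c = 1" "\<bar>s\<bar> = 1" "cstar_seminorm (convolution_algebra A) \<rho>" for \<rho> c s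
    by (rule unimodular_seminorm_le_1[OF vC _ _ that(3)])
       (use wnorm[OF that(1,2)] M in \<open>auto simp: v_def indicator_def\<close>)
  have f_eq: "f = (\<lambda>\<gamma>. complex_of_real (M/2) * (v 1 1 \<gamma> + v 1 (-1) \<gamma>) + (\<i> * complex_of_real (M/2)) * (v (-\<i>) 1 \<gamma> + v (-\<i>) (-1) \<gamma>))"
  proof
    fix \<gamma>
    show "f \<gamma> = complex_of_real (M/2) * (v 1 1 \<gamma> + v 1 (-1) \<gamma>) + (\<i> * complex_of_real (M/2)) * (v (-\<i>) 1 \<gamma> + v (-\<i>) (-1) \<gamma>)"
      using single(2) M(1) by (cases "\<gamma> \<in> cyl A \<alpha> \<beta>") (auto simp: v_def w_def indicator_def complex_eq_iff)
  qed
  have "\<rho> f \<le> 2 * M" if rho: "cstar_seminorm (convolution_algebra A) \<rho>" for \<rho>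
  proof -
    have add: "\<rho> (\<lambda>\<gamma>. g \<gamma> + g' \<gamma>) \<le> \<rho> g + \<rho> g'" if "g \<in> Cc A" "g' \<in> Cc A" for g g'
      using rho that unfolding cstar_seminorm_def convolution_simps by blast
    have sm: "\<rho> (\<lambda>\<gamma>. c * g \<gamma>) = cmod c * \<rho> g" if "g \<in> Cc A" for g c
      using rho that unfolding cstar_seminorm_def convolution_simps by blast
    have pair: "\<rho> (\<lambda>\<gamma>. v c 1 \<gamma> + v c (-1) \<gamma>) \<le> 2" if "cmod c = 1" for c
      using add[OF vC vC, of c 1 c "-1"] le1[OF that _ rho, of 1] le1[OF that _ rho, of "-1"] by simp
    have "\<rho> f \<le> \<rho> (\<lambda>\<gamma>. complex_of_real (M/2) * (v 1 1 \<gamma> + v 1 (-1) \<gamma>)) +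
        \<rho> (\<lambda>\<gamma>. (\<i> * complex_of_real (M/2)) * (v (-\<i>) 1 \<gamma> + v (-\<i>) (-1) \<gamma>))"
      by (subst f_eq) (intro add Cc_smult Cc_add vC)
    also have "\<dots> = (M/2) * \<rho> (\<lambda>\<gamma>. v 1 1 \<gamma> + v 1 (-1) \<gamma>) + (M/2) * \<rho> (\<lambda>\<gamma>. v (-\<i>) 1 \<gamma> + v (-\<i>) (-1) \<gamma>)"
      using M(1) by (simp only: sm[OF Cc_add[OF vC vC]]) (simp add: norm_mult)
    also have "\<dots> \<le> (M/2) * 2 + (M/2) * 2"
      using M(1) pair[of 1] pair[of "-\<i>"] by (intro add_mono mult_left_mono) auto
    finally show ?thesis by simp
  qed
  then show ?case by blast
next
  case (add f g)
  then obtain K L where KL: "\<And>\<rho>. cstar_seminorm (convolution_algebra A) \<rho> \<Longrightarrow> \<rho> f \<le> K"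
    "\<And>\<rho>. cstar_seminorm (convolution_algebra A) \<rho> \<Longrightarrow> \<rho> g \<le> L" by blast
  have "\<rho> (\<lambda>\<gamma>. f \<gamma> + g \<gamma>) \<le> K + L" if rho: "cstar_seminorm (convolution_algebra A) \<rho>" for \<rho>
  proof -
    have "\<rho> (\<lambda>\<gamma>. f \<gamma> + g \<gamma>) \<le> \<rho> f + \<rho> g"
      using rho add unfolding cstar_seminorm_def convolution_simps by blast
    then show ?thesis using KL[OF rho] by simp
  qed
  then show ?case by blast
qed

section \<open>The universal norm on functions of compact support\<close>

abbreviation conv_norm :: "nat^'n::finite^'n \<Rightarrow> ('n arrow \<Rightarrow> complex) \<Rightarrow> real" where
  "conv_norm A \<equiv> universal_seminorm (convolution_algebra A) {}"

lemma conv_norm_upper: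
  fixes A :: "nat^'n::finite^'n"
  assumes "f \<in> Cc A" "cstar_seminorm (convolution_algebra A) \<rho>" shows "\<rho> f \<le> conv_norm A f"
proof -
  obtain K where "\<forall>\<rho>. cstar_seminorm (convolution_algebra A) \<rho> \<longrightarrow> \<rho> f \<le> K" using Cc_seminorm_bounded[OF assms(1)] by blast
  then have "bdd_above ((\<lambda>\<rho>. \<rho> f) ` {\<rho>. cstar_seminorm (convolution_algebra A) \<rho> \<and> (\<forall>e\<in>{}. \<rho> e = 0)})"
    by (intro bdd_aboveI[of _ K]) auto
  then show ?thesis unfolding universal_seminorm_def
    using assms(2) by (intro cSUP_upper2[of _ _ \<rho>]) auto
qed

lemma conv_norm_least:
  fixes A :: "nat^'n::finite^'n"
  assumes "\<And>\<rho>. cstar_seminorm (convolution_algebra A) \<rho> \<Longrightarrow> \<rho> f \<le> K" shows "conv_norm A f \<le> K"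
  unfolding universal_seminorm_def
  by (rule cSUP_least) (use assms convolution_reg_norm in auto)

text \<open>The regular representation is one of the seminorms in the supremum, and it already
  dominates each value.\<close>

lemma value_le_conv_norm: "f \<in> Cc A \<Longrightarrow> cmod (f \<gamma>) \<le> conv_norm A f" for A :: "nat^'n::finite^'n"
proof -
  assume f: "f \<in> Cc A"
  then obtain K where "f \<in> carrier (kernel_algebra A)" "bounded_by f K" using Cc_kernel_bounded by blast
  then show ?thesis using value_le_reg_norm[of f A K \<gamma>] conv_norm_upper[OF f convolution_reg_norm] by linarith
qed

text \<open>The ring laws are established for \<open>kernel_algebra\<close>, not for
  \<open>convolution_algebra\<close>, so the additive inverse is computed from its definite
  description.\<close>

lemma conv_minus:
  fixes A :: "nat^'n::finite^'n"
  assumes f: "f \<in> Cc A" and g: "g \<in> Cc A"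
  shows "f \<ominus>\<^bsub>convolution_algebra A\<^esub> g = (\<lambda>\<gamma>. f \<gamma> - g \<gamma>)"
proof -
  have "\<ominus>\<^bsub>convolution_algebra A\<^esub> g = (THE y. y \<in> Cc A \<and> (\<lambda>\<gamma>. g \<gamma> + y \<gamma>) = (\<lambda>\<gamma>. 0) \<and> (\<lambda>\<gamma>. y \<gamma> + g \<gamma>) = (\<lambda>\<gamma>. 0))"
    by (simp add: a_inv_def m_inv_def convolution_simps)
  also have "\<dots> = (\<lambda>\<gamma>. - g \<gamma>)"
  proof (rule the_equality)
    show "(\<lambda>\<gamma>. - g \<gamma>) \<in> Cc A \<and> (\<lambda>\<gamma>. g \<gamma> + - g \<gamma>) = (\<lambda>\<gamma>. 0) \<and> (\<lambda>\<gamma>. - g \<gamma> + g \<gamma>) = (\<lambda>\<gamma>. 0)"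
      using Cc_smult[OF g, of "-1"] by simp
    fix y assume "y \<in> Cc A \<and> (\<lambda>\<gamma>. g \<gamma> + y \<gamma>) = (\<lambda>\<gamma>. 0) \<and> (\<lambda>\<gamma>. y \<gamma> + g \<gamma>) = (\<lambda>\<gamma>. 0)"
    then have "y \<gamma> + g \<gamma> = 0" for \<gamma> by (meson fun_cong)
    then show "y = (\<lambda>\<gamma>. - g \<gamma>)" by (auto simp: fun_eq_iff eq_neg_iff_add_eq_0)
  qed
  finally show ?thesis by (simp add: a_minus_def convolution_simps)
qed

lemma Cc_minus: "f \<in> Cc A \<Longrightarrow> g \<in> Cc A \<Longrightarrow> (\<lambda>\<gamma>. f \<gamma> - g \<gamma>) \<in> Cc A" for A :: "nat^'n::finite^'n"
  using Cc_add[of f A "\<lambda>\<gamma>. -1 * g \<gamma>"] Cc_smult[of g A "-1"] by simp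

section \<open>The generators of the groupoid algebra\<close>

lemma groupoid_gen_cyl: "groupoid_gen A i = indicator (cyl A [i] [])"
proof -
  have "{(x, 1, shift x) | x. x \<in> shift_space A \<and> x 0 = i} = cyl A [i] []"
    by (auto simp: cyl_def prefix_1 shift_in_shift_space)
  then show ?thesis by (simp add: groupoid_gen_def)
qed

lemma groupoid_gen_Cc: "groupoid_gen A i \<in> Cc A" for A :: "nat^'n::finite^'n"
  unfolding groupoid_gen_cyl by (rule indicator_cyl_Cc)

lemma groupoid_gen_kernel [simp]: "groupoid_gen A i \<in> carrier (kernel_algebra A)" for A :: "nat^'n::finite^'n"
  by (rule Cc_kernel[OF groupoid_gen_Cc])

lemma ker_gen: "ker (groupoid_gen A i) (x, a) (w, b) =
    (if x \<in> shift_space A \<and> x 0 = i \<and> w = shift x \<and> b = a - 1 then 1 else 0)"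
  by (auto simp: ker_def groupoid_gen_cyl indicator_def cyl_iff prefix_1 shift_in_shift_space)

text \<open>Row \<open>x\<close> of the generator has its only nonzero entry at the shifted point,
  so left multiplication is composition with the shift on the range side.\<close>

lemma gen_mult:
  fixes A :: "nat^'n::finite^'n"
  assumes f: "f \<in> carrier (kernel_algebra A)"
  shows "(groupoid_gen A i \<otimes>\<^bsub>kernel_algebra A\<^esub> f) (x, n, y) =
    (if x \<in> shift_space A \<and> x 0 = i then f (shift x, n - 1, y) else 0)"
proof -
  have "ker (groupoid_gen A i \<otimes>\<^bsub>kernel_algebra A\<^esub> f) (x, n) (y, 0) =
      ker (groupoid_gen A i) (x, n) (shift x, n - 1) * ker f (shift x, n - 1) (y, 0)"
    unfolding kernel_mult[OF groupoid_gen_kernel f]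
    by (rule act_single[OF kernel_carrierD(2)[OF f]]) (auto simp: ker_gen split: if_splits prod.splits)
  then show ?thesis by (simp add: ker_gen) (simp add: ker_def)
qed

lemma adj_gen_mult:
  fixes A :: "nat^'n::finite^'n"
  assumes f: "f \<in> carrier (kernel_algebra A)"
  shows "(adj (kernel_algebra A) (groupoid_gen A i) \<otimes>\<^bsub>kernel_algebra A\<^esub> f) (x, n, y) =
    (if case_nat i x \<in> shift_space A then f (case_nat i x, n + 1, y) else 0)"
proof -
  let ?g = "adj (kernel_algebra A) (groupoid_gen A i)"
  have kg: "ker ?g (x, a) (w, b) = (if case_nat i x \<in> shift_space A \<and> w = case_nat i x \<and> b = a + 1 then 1 else 0)" for a w b
    unfolding kernel_simps ker_simps ker_gen using shift_eqD[of w x] by auto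
  have "ker (?g \<otimes>\<^bsub>kernel_algebra A\<^esub> f) (x, n) (y, 0) =
      ker ?g (x, n) (case_nat i x, n + 1) * ker f (case_nat i x, n + 1) (y, 0)"
    unfolding kernel_mult[OF kernel_adj_closed[OF groupoid_gen_kernel] f]
    by (rule act_single[OF kernel_carrierD(2)[OF f]]) (auto simp: kg split: if_splits prod.splits)
  then show ?thesis by (simp add: kg) (simp add: ker_def)
qed

text \<open>A neighbourhood of the arrow from \<open>shift x\<close> on which \<open>f\<close> is
  constant is pulled back to a neighbourhood of \<open>(x, n, y)\<close> by prepending
  \<open>i\<close> to the range word.\<close>

lemma gen_mult_loc_const:
  fixes A :: "nat^'n::finite^'n"
  assumes f: "f \<in> Cc A" "loc_const A f"
  shows "groupoid_gen A i \<otimes>\<^bsub>kernel_algebra A\<^esub> f \<in> Cc A \<and> loc_const A (groupoid_gen A i \<otimes>\<^bsub>kernel_algebra A\<^esub> f)"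
proof -
  let ?g = "groupoid_gen A i \<otimes>\<^bsub>kernel_algebra A\<^esub> f"
  note fK = Cc_kernel[OF f(1)]
  note gm = gen_mult[OF fK]
  have lc: "loc_const A ?g"
    unfolding loc_const_def
  proof (intro allI impI)
    fix x n y assume G: "(x, n, y) \<in> ck_groupoid A"
    then have x: "x \<in> shift_space A" by (simp add: groupoid_iff)
    show "near A (x, n, y) (\<lambda>x' y'. ?g (x', n, y') = ?g (x, n, y))"
    proof (cases "x 0 = i")
      case True
      have "(shift x, -1, x) \<in> ck_groupoid A"
      proof -
        have "\<exists>k l. (-1::int) = int k - int l \<and> (shift ^^ k) (shift x) = (shift ^^ l) x"
          by (rule exI[of _ 0], rule exI[of _ 1]) simp
        then show ?thesis using x by (simp add: groupoid_iff shift_in_shift_space)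
      qed
      from groupoid_mult[OF this G] have "(shift x, n - 1, y) \<in> ck_groupoid A" by simp
      then have "near A (shift x, n - 1, y) (\<lambda>x' y'. f (x', n - 1, y') = f (shift x, n - 1, y))"
        using f(2) unfolding loc_const_def by blast
      then obtain k l where kl: "(shift x, n - 1, y) \<in> cyl A (prefix k (shift x)) (prefix l y)"
        "\<forall>x' y'. (x', n - 1, y') \<in> cyl A (prefix k (shift x)) (prefix l y) \<longrightarrow> f (x', n - 1, y') = f (shift x, n - 1, y)"
        by (rule near_large[of A "shift x" "n - 1" y _ 0]) blast
      have c: "(x, n, y) \<in> cyl A (prefix (Suc k) x) (prefix l y)"
        using kl(1) x by (auto simp: cyl_iff funpow_shift shift_def)
      show ?thesis
      proof (rule nearI[OF c])
        fix x' y' assume c': "(x', n, y') \<in> cyl A (prefix (Suc k) x) (prefix l y)"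
        then have "(shift x', n - 1, y') \<in> cyl A (prefix k (shift x)) (prefix l y)"
          by (auto simp: cyl_iff prefix_Suc shift_in_shift_space) (auto simp: funpow_shift shift_def)
        moreover have "x' 0 = x 0" "x' \<in> shift_space A" using c' by (auto simp: cyl_iff prefix_Suc)
        ultimately show "?g (x', n, y') = ?g (x, n, y)" using kl(2) x True by (simp add: gm)
      qed
    next
      case False
      show ?thesis
        by (rule near_mono[OF near_prefix[OF G, of "Suc 0"]]) (use False in \<open>simp add: gm prefix_1\<close>)
    qed
  qed
  obtain P where P: "finite P" "{\<gamma>. f \<gamma> \<noteq> 0} \<subseteq> (\<Union>p\<in>P. cyl A (fst p) (snd p))" using f unfolding Cc_iff by blast
  have "{\<gamma>. ?g \<gamma> \<noteq> 0} \<subseteq> (\<Union>p\<in>(\<lambda>p. (i # fst p, snd p)) ` P. cyl A (fst p) (snd p))"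
  proof
    fix \<gamma> assume "\<gamma> \<in> {\<gamma>. ?g \<gamma> \<noteq> 0}"
    moreover obtain x n y where xy: "\<gamma> = (x, n, y)" by (cases \<gamma>)
    ultimately have x: "x \<in> shift_space A" "x 0 = i" "f (shift x, n - 1, y) \<noteq> 0" by (auto simp: gm split: if_splits)
    then obtain p where "p \<in> P" "(shift x, n - 1, y) \<in> cyl A (fst p) (snd p)" using P(2) by blast
    moreover from this have "(x, n, y) \<in> cyl A (i # fst p) (snd p)"
      using x by (auto simp: cyl_iff prefix_Suc) (auto simp: funpow_shift shift_def)
    ultimately show "\<gamma> \<in> (\<Union>p\<in>(\<lambda>p. (i # fst p, snd p)) ` P. cyl A (fst p) (snd p))" using xy by auto
  qed
  moreover have "finite ((\<lambda>p. (i # fst p, snd p)) ` P)" using P by simp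
  moreover have "?g \<gamma> = 0" if "\<gamma> \<notin> ck_groupoid A" for \<gamma>
    using kernel_carrierD(1)[OF kernel_mult_closed[OF groupoid_gen_kernel fK] that] .
  ultimately show ?thesis using lc loc_const_continuous[OF lc] unfolding Cc_iff by blast
qed

lemma adj_gen_mult_loc_const:
  fixes A :: "nat^'n::finite^'n"
  assumes f: "f \<in> Cc A" "loc_const A f"
  shows "adj (kernel_algebra A) (groupoid_gen A i) \<otimes>\<^bsub>kernel_algebra A\<^esub> f \<in> Cc A \<and>
    loc_const A (adj (kernel_algebra A) (groupoid_gen A i) \<otimes>\<^bsub>kernel_algebra A\<^esub> f)"
proof -
  let ?g = "adj (kernel_algebra A) (groupoid_gen A i) \<otimes>\<^bsub>kernel_algebra A\<^esub> f"
  note fK = Cc_kernel[OF f(1)]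
  note gm = adj_gen_mult[OF fK]
  have lc: "loc_const A ?g"
    unfolding loc_const_def
  proof (intro allI impI)
    fix x n y assume G: "(x, n, y) \<in> ck_groupoid A"
    then have x: "x \<in> shift_space A" by (simp add: groupoid_iff)
    show "near A (x, n, y) (\<lambda>x' y'. ?g (x', n, y') = ?g (x, n, y))"
    proof (cases "case_nat i x \<in> shift_space A")
      case True
      have "(case_nat i x, 1, x) \<in> ck_groupoid A"
      proof -
        have "\<exists>k l. (1::int) = int k - int l \<and> (shift ^^ k) (case_nat i x) = (shift ^^ l) x"
          by (rule exI[of _ 1], rule exI[of _ 0]) simp
        then show ?thesis using x True by (simp add: groupoid_iff)
      qed
      from groupoid_mult[OF this G] have "(case_nat i x, n + 1, y) \<in> ck_groupoid A" by (simp add: add.commute)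
      then have "near A (case_nat i x, n + 1, y) (\<lambda>x' y'. f (x', n + 1, y') = f (case_nat i x, n + 1, y))"
        using f(2) unfolding loc_const_def by blast
      \<comment> \<open>Two letters, so that one remains after \<open>i\<close> is removed:
        \<open>x 0\<close> decides whether \<open>i\<close> may be prepended.\<close>
      then obtain k l where k: "k \<ge> 2" and kl: "(case_nat i x, n + 1, y) \<in> cyl A (prefix k (case_nat i x)) (prefix l y)"
        "\<forall>x' y'. (x', n + 1, y') \<in> cyl A (prefix k (case_nat i x)) (prefix l y) \<longrightarrow> f (x', n + 1, y') = f (case_nat i x, n + 1, y)"
        by (rule near_large[of A "case_nat i x" "n + 1" y _ 2]) blast
      obtain k1 where k1: "k = Suc (Suc k1)" using k by (metis add_2_eq_Suc le_add_diff_inverse)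
      have sh: "(shift ^^ Suc (Suc k1)) (case_nat i z) = (shift ^^ Suc k1) z" for z
        by (simp only: funpow_Suc_right o_apply shift_case_nat)
      have c: "(x, n, y) \<in> cyl A (prefix (Suc k1) x) (prefix l y)"
        using kl(1) x unfolding k1 cyl_iff length_prefix sh by auto
      show ?thesis
      proof (rule nearI[OF c])
        fix x' y' assume c': "(x', n, y') \<in> cyl A (prefix (Suc k1) x) (prefix l y)"
        then have x': "x' 0 = x 0" "x' \<in> shift_space A" by (auto simp: cyl_iff prefix_Suc)
        then have ix: "case_nat i x' \<in> shift_space A" using True by (simp add: case_nat_in_shift_space)
        then have "(case_nat i x', n + 1, y') \<in> cyl A (prefix k (case_nat i x)) (prefix l y)"
          using c' unfolding k1 cyl_iff length_prefix sh by (auto simp: prefix_Suc[of "Suc k1"])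
        then show "?g (x', n, y') = ?g (x, n, y)" using kl(2) ix True by (simp add: gm)
      qed
    next
      case False
      show ?thesis
        by (rule near_mono[OF near_prefix[OF G, of "Suc 0"]])
           (use False x in \<open>auto simp: gm prefix_1 case_nat_in_shift_space groupoid_iff\<close>)
    qed
  qed
  obtain P where P: "finite P" "{\<gamma>. f \<gamma> \<noteq> 0} \<subseteq> (\<Union>p\<in>P. cyl A (fst p) (snd p))" using f unfolding Cc_iff by blast
  \<comment> \<open>A letter is added on the source side instead of removing one on the range side,
    which also works when the range word is empty.\<close>
  let ?Q = "\<Union>p\<in>P. (words (length (fst p)) :: 'n list set) \<times> (words (Suc (length (snd p))) :: 'n list set)"
  have "{\<gamma>. ?g \<gamma> \<noteq> 0} \<subseteq> (\<Union>p\<in>?Q. cyl A (fst p) (snd p))"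
  proof
    fix \<gamma> assume g: "\<gamma> \<in> {\<gamma>. ?g \<gamma> \<noteq> 0}"
    obtain x n y where xy: "\<gamma> = (x, n, y)" by (cases \<gamma>)
    have x: "case_nat i x \<in> shift_space A" "f (case_nat i x, n + 1, y) \<noteq> 0" using g by (auto simp: xy gm split: if_splits)
    then obtain p where p: "p \<in> P" "(case_nat i x, n + 1, y) \<in> cyl A (fst p) (snd p)" using P(2) by blast
    let ?k = "length (fst p)" and ?l = "length (snd p)"
    have "shift ((shift ^^ ?k) (case_nat i x)) = shift ((shift ^^ ?l) y)" using p by (auto simp: cyl_iff)
    then have "(shift ^^ ?k) x = (shift ^^ Suc ?l) y" by (simp add: funpow_shift) (simp add: shift_def)
    then have "(x, n, y) \<in> tail_set A (?k, Suc ?l)"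
      using p x by (auto simp: tail_set_iff cyl_iff case_nat_in_shift_space)
    then show "\<gamma> \<in> (\<Union>p\<in>?Q. cyl A (fst p) (snd p))" unfolding tail_set_cyl using p(1) xy by blast
  qed
  moreover have "finite ?Q" using P by simp
  moreover have "?g \<gamma> = 0" if "\<gamma> \<notin> ck_groupoid A" for \<gamma>
    using kernel_carrierD(1)[OF kernel_mult_closed[OF kernel_adj_closed[OF groupoid_gen_kernel] fK] that] .
  ultimately show ?thesis using lc loc_const_continuous[OF lc] unfolding Cc_iff by blast
qed

abbreviation keval :: "nat^'n::finite^'n \<Rightarrow> 'n star_poly \<Rightarrow> 'n arrow \<Rightarrow> complex" where
  "keval A \<equiv> eval_poly (kernel_algebra A) (groupoid_gen A)"

text \<open>Words grow by one letter on the left, so the two preceding closure lemmas keep all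
  products of generators continuous with compact support.\<close>

lemma eval_word_Cc:
  fixes A :: "nat^'n::finite^'n"
  shows "eval_word (kernel_algebra A) (groupoid_gen A) w \<in> Cc A \<and>
    loc_const A (eval_word (kernel_algebra A) (groupoid_gen A) w)"
proof (induction w)
  case Nil
  have "unit_space A = cyl A [] []" by (auto simp: unit_space_def gunit_def cyl_def)
  then have "indicator (unit_space A) = (indicator (cyl A [] []) :: _ \<Rightarrow> complex)" by simp
  moreover have "loc_const A (indicator (unit_space A) :: _ \<Rightarrow> complex)"
    using loc_const_compose2[OF loc_const_units loc_const_units, of A "\<lambda>a b. if a then 1 else 0"]
    by (simp add: indicator_def[abs_def] of_bool_def)
  ultimately show ?case using indicator_cyl_Cc[of A "[]" "[]"] by (simp add: kernel_simps)
next
  case (Cons a w)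
  then show ?case
    by (cases a) (auto dest: gen_mult_loc_const adj_gen_mult_loc_const)
qed

lemma keval_hom: "star_hom free_star_algebra (kernel_algebra A) (keval A)" for A :: "nat^'n::finite^'n"
  by (rule K.eval_poly_hom) simp

interpretation keval: star_alg_hom free_star_algebra "kernel_algebra A" "keval A" for A :: "nat^'n::finite^'n"
  by (intro star_alg_hom.intro star_alg_hom_axioms.intro free_star_alg kernel_star_alg keval_hom)

lemma loc_const_zero: "loc_const A (\<lambda>\<gamma>. c)"
  unfolding loc_const_def by (auto intro: near_mono[OF near_prefix])

lemma keval_Cc:
  fixes A :: "nat^'n::finite^'n"
  assumes "p \<in> carrier free_star_algebra"
  shows "keval A p \<in> Cc A \<and> loc_const A (keval A p)"
  using assms
proof (induction rule: free_induct)
  case zero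
  then show ?case unfolding keval.hom_zero by (simp add: kernel_simps Cc_zero loc_const_zero)
next
  case (delta c w)
  have "keval A (c \<odot>\<^bsub>free_star_algebra\<^esub> word_delta w) = (\<lambda>\<gamma>. c * eval_word (kernel_algebra A) (groupoid_gen A) w \<gamma>)"
    by (subst K.eval_poly_delta) (simp_all add: kernel_simps)
  then show ?case using eval_word_Cc[of A w] Cc_smult[of _ A c]
    loc_const_compose2[of A "eval_word (kernel_algebra A) (groupoid_gen A) w"
      "eval_word (kernel_algebra A) (groupoid_gen A) w" "\<lambda>a b. c * a"] by simp
next
  case (add p q)
  then show ?case unfolding keval.hom_add[OF add(1,2)] kernel_simps
    using Cc_add loc_const_compose2[of A _ _ "(+)"] by blast
qed

lemma conv_abelian_monoid: "abelian_monoid (convolution_algebra A)" for A :: "nat^'n::finite^'n"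
  by (rule abelian_monoidI) (use Cc_add Cc_zero in \<open>auto simp: convolution_simps add_ac\<close>)

interpretation Conv: abelian_monoid "convolution_algebra A" for A :: "nat^'n::finite^'n"
  by (rule conv_abelian_monoid)

text \<open>The two algebras have the same operations but different carriers, on which
  \<open>finsum\<close> depends; the sums are therefore compared by induction.\<close>

lemma conv_eval_poly:
  fixes A :: "nat^'n::finite^'n"
  assumes p: "p \<in> carrier free_star_algebra"
  shows "eval_poly (convolution_algebra A) (groupoid_gen A) p = keval A p"
proof -
  have w: "eval_word (convolution_algebra A) (groupoid_gen A) w = eval_word (kernel_algebra A) (groupoid_gen A) w" for w
  proof (induction w)
    case (Cons a w)
    then show ?case by (cases a) (simp add: kernel_algebra_def)
  qed (simp add: kernel_algebra_def)
  have fs: "finite I \<Longrightarrow> finsum (convolution_algebra A) g I = finsum (kernel_algebra A) g I"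
    if "\<And>v. g v \<in> Cc A" for g :: "('n \<times> bool) list \<Rightarrow> _" and I
  proof (induction I rule: finite_induct)
    case (insert v I)
    have "finsum (convolution_algebra A) g (insert v I) = g v \<oplus>\<^bsub>convolution_algebra A\<^esub> finsum (convolution_algebra A) g I"
      by (rule Conv.finsum_insert) (use insert that in auto)
    moreover have "finsum (kernel_algebra A) g (insert v I) = g v \<oplus>\<^bsub>kernel_algebra A\<^esub> finsum (kernel_algebra A) g I"
      by (rule K.finsum_insert) (use insert Cc_kernel[OF that] in auto)
    ultimately show ?case using insert by (simp add: kernel_simps convolution_simps)
  qed (simp_all add: kernel_simps convolution_simps)
  have fin: "finite {w. p w \<noteq> 0}" using p by (simp add: free_simps)
  have cl: "p w \<odot>\<^bsub>convolution_algebra A\<^esub> eval_word (convolution_algebra A) (groupoid_gen A) w \<in> Cc A" for w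
    unfolding w convolution_simps by (rule Cc_smult) (use eval_word_Cc in blast)
  have "eval_poly (convolution_algebra A) (groupoid_gen A) p =
      finsum (kernel_algebra A) (\<lambda>w. p w \<odot>\<^bsub>convolution_algebra A\<^esub> eval_word (convolution_algebra A) (groupoid_gen A) w) {w. p w \<noteq> 0}"
    unfolding eval_poly_def by (rule fs[OF cl fin])
  then show ?thesis unfolding eval_poly_def[of "kernel_algebra A"] w by (simp add: kernel_simps convolution_simps)
qed

section \<open>The Cuntz--Krieger algebra as functions on the groupoid\<close>

lemma kernel_finsum:
  assumes "finite I" "\<And>i. i \<in> I \<Longrightarrow> g i \<in> carrier (kernel_algebra A)"
  shows "finsum (kernel_algebra A) g I = (\<lambda>\<gamma>. \<Sum>i\<in>I. g i \<gamma>)"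
  using assms
proof (induction I rule: finite_induct)
  case (insert i I)
  have "finsum (kernel_algebra A) g (insert i I) = g i \<oplus>\<^bsub>kernel_algebra A\<^esub> finsum (kernel_algebra A) g I"
    by (rule K.finsum_insert) (use insert in auto)
  then show ?case using insert by (simp add: kernel_simps)
qed (simp add: kernel_simps)

lemma case_nat_shift_0: "x 0 = i \<Longrightarrow> case_nat i (shift x) = x"
  using case_nat_shift[of x] by simp

lemma groupoid_gen_apply:
  "groupoid_gen A i (x, n, y) = (if x \<in> shift_space A \<and> x 0 = i \<and> n = 1 \<and> y = shift x then 1 else 0)"
  using ker_gen[of A i x n y 0] by (auto simp: ker_def)

lemma letter_tail_eq:
  assumes "x \<in> shift_space A \<and> x 0 = i"
  shows "y \<in> shift_space A \<and> y 0 = i \<and> - (n - 1) = 1 \<and> shift x = shift y \<longleftrightarrow> n = (0::int) \<and> y = x"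
proof
  assume *: "y \<in> shift_space A \<and> y 0 = i \<and> - (n - 1) = 1 \<and> shift x = shift y"
  then have "y = x" using assms case_nat_shift_0[of x i] case_nat_shift_0[of y i] by metis
  then show "n = 0 \<and> y = x" using * by simp
qed (use assms in simp)

lemma groupoid_gen_range:
  fixes A :: "nat^'n::finite^'n"
  shows "(groupoid_gen A i \<otimes>\<^bsub>kernel_algebra A\<^esub> adj (kernel_algebra A) (groupoid_gen A i)) (x, n, y) =
    (if x \<in> shift_space A \<and> x 0 = i \<and> n = 0 \<and> y = x then 1 else 0)"
proof -
  have "(groupoid_gen A i \<otimes>\<^bsub>kernel_algebra A\<^esub> adj (kernel_algebra A) (groupoid_gen A i)) (x, n, y) =
      (if x \<in> shift_space A \<and> x 0 = i then cnj (groupoid_gen A i (y, - (n - 1), shift x)) else 0)"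
    by (subst gen_mult[OF kernel_adj_closed[OF groupoid_gen_kernel]]) (simp add: kernel_simps)
  also have "\<dots> = (if x \<in> shift_space A \<and> x 0 = i \<and> n = 0 \<and> y = x then 1 else 0)"
  proof (cases "x \<in> shift_space A \<and> x 0 = i")
    case True
    then have iff: "y \<in> shift_space A \<and> y 0 = i \<and> - (n - 1) = 1 \<and> shift x = shift y \<longleftrightarrow> n = 0 \<and> y = x"
      by (rule letter_tail_eq)
    show ?thesis unfolding groupoid_gen_apply iff using True by simp
  qed auto
  finally show ?thesis .
qed

text \<open>All relations are checked at a single arrow, where multiplication by a generator or its
  adjoint is explicit.\<close>

lemma groupoid_gen_family:
  fixes A :: "nat^'n::finite^'n"
  assumes "ck_matrix A" shows "ck_family (kernel_algebra A) A (groupoid_gen A)"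
proof
  let ?s = "groupoid_gen A" and ?K = "kernel_algebra A"
  show "ck_matrix A" by fact
  show s: "?s i \<in> carrier ?K" for i by simp
  note s' = kernel_adj_closed[OF s]
  have ss: "adj ?K (?s i) \<otimes>\<^bsub>?K\<^esub> ?s j \<in> carrier ?K" "?s i \<otimes>\<^bsub>?K\<^esub> adj ?K (?s j) \<in> carrier ?K" for i j
    by (intro kernel_mult_closed s s')+
  fix i
  have "?s i \<otimes>\<^bsub>?K\<^esub> (adj ?K (?s i) \<otimes>\<^bsub>?K\<^esub> ?s i) = ?s i"
  proof (rule ext)
    fix \<gamma> :: "'n arrow"
    obtain x n y where "\<gamma> = (x, n, y)" by (cases \<gamma>)
    then show "(?s i \<otimes>\<^bsub>?K\<^esub> (adj ?K (?s i) \<otimes>\<^bsub>?K\<^esub> ?s i)) \<gamma> = ?s i \<gamma>"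
      by (auto simp: gen_mult[OF ss(1)] adj_gen_mult[OF s] case_nat_shift_0 groupoid_gen_apply)
  qed
  then show "?s i \<otimes>\<^bsub>?K\<^esub> adj ?K (?s i) \<otimes>\<^bsub>?K\<^esub> ?s i = ?s i" by (simp add: K.m_assoc s s')
  show "adj ?K (?s i) \<otimes>\<^bsub>?K\<^esub> ?s j = \<zero>\<^bsub>?K\<^esub>" if "i \<noteq> j" for j
  proof (rule ext)
    fix \<gamma> :: "'n arrow"
    obtain x n y where "\<gamma> = (x, n, y)" by (cases \<gamma>)
    then show "(adj ?K (?s i) \<otimes>\<^bsub>?K\<^esub> ?s j) \<gamma> = \<zero>\<^bsub>?K\<^esub> \<gamma>"
      using that by (simp add: adj_gen_mult[OF s] groupoid_gen_apply) (simp add: kernel_simps)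
  qed
  show "adj ?K (?s i) \<otimes>\<^bsub>?K\<^esub> ?s i = (\<Oplus>\<^bsub>?K\<^esub>j\<in>UNIV. of_nat (A $ i $ j) \<odot>\<^bsub>?K\<^esub> (?s j \<otimes>\<^bsub>?K\<^esub> adj ?K (?s j)))"
  proof (rule ext)
    fix \<gamma> :: "'n arrow"
    obtain x n y where xy: "\<gamma> = (x, n, y)" by (cases \<gamma>)
    have "(\<Oplus>\<^bsub>?K\<^esub>j\<in>UNIV. of_nat (A $ i $ j) \<odot>\<^bsub>?K\<^esub> (?s j \<otimes>\<^bsub>?K\<^esub> adj ?K (?s j))) \<gamma> =
        (\<Sum>j\<in>UNIV. of_nat (A $ i $ j) * (?s j \<otimes>\<^bsub>?K\<^esub> adj ?K (?s j)) \<gamma>)"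
      by (subst kernel_finsum) (simp_all add: ss K.smult_closed, simp add: kernel_simps)
    also have "\<dots> = (\<Sum>j\<in>UNIV. if j = x 0 then (if x \<in> shift_space A \<and> n = 0 \<and> y = x then of_nat (A $ i $ x 0) else 0) else 0)"
      unfolding xy groupoid_gen_range by (rule sum.cong) auto
    also have "\<dots> = (if x \<in> shift_space A \<and> n = 0 \<and> y = x then of_nat (A $ i $ x 0) else 0)"
      by (subst sum.delta) auto
    also have "\<dots> = (adj ?K (?s i) \<otimes>\<^bsub>?K\<^esub> ?s i) \<gamma>"
      using ck_matrix_cases[OF assms, of i "x 0"]
      by (auto simp: xy adj_gen_mult[OF s] groupoid_gen_apply case_nat_in_shift_space)
    finally show "(adj ?K (?s i) \<otimes>\<^bsub>?K\<^esub> ?s i) \<gamma> =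
        (\<Oplus>\<^bsub>?K\<^esub>j\<in>UNIV. of_nat (A $ i $ j) \<odot>\<^bsub>?K\<^esub> (?s j \<otimes>\<^bsub>?K\<^esub> adj ?K (?s j))) \<gamma>" by simp
  qed
  show "(\<Oplus>\<^bsub>?K\<^esub>i\<in>UNIV. ?s i \<otimes>\<^bsub>?K\<^esub> adj ?K (?s i)) = \<one>\<^bsub>?K\<^esub>"
  proof (rule ext)
    fix \<gamma> :: "'n arrow"
    obtain x n y where xy: "\<gamma> = (x, n, y)" by (cases \<gamma>)
    have "(\<Oplus>\<^bsub>?K\<^esub>i\<in>UNIV. ?s i \<otimes>\<^bsub>?K\<^esub> adj ?K (?s i)) \<gamma> = (\<Sum>i\<in>UNIV. (?s i \<otimes>\<^bsub>?K\<^esub> adj ?K (?s i)) \<gamma>)"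
      by (subst kernel_finsum) (simp_all add: ss)
    also have "\<dots> = (\<Sum>j\<in>UNIV. if j = x 0 then (if x \<in> shift_space A \<and> n = 0 \<and> y = x then 1 else 0) else 0)"
      unfolding xy groupoid_gen_range by (rule sum.cong) auto
    also have "\<dots> = (if x \<in> shift_space A \<and> n = 0 \<and> y = x then 1 else 0)" by (subst sum.delta) auto
    finally show "(\<Oplus>\<^bsub>?K\<^esub>i\<in>UNIV. ?s i \<otimes>\<^bsub>?K\<^esub> adj ?K (?s i)) \<gamma> = \<one>\<^bsub>?K\<^esub> \<gamma>"
      by (auto simp: kernel_simps xy indicator_def unit_space_iff)
  qed
qed

lemma diag_kernel_mult:
  assumes d: "d \<in> carrier (kernel_algebra A)" "\<And>x n y. d (x, n, y) \<noteq> 0 \<Longrightarrow> n = 0 \<and> y = x"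
    and g: "g \<in> carrier (kernel_algebra A)"
  shows "(d \<otimes>\<^bsub>kernel_algebra A\<^esub> g) (x, n, y) = d (x, 0, x) * g (x, n, y)"
proof -
  have "ker (d \<otimes>\<^bsub>kernel_algebra A\<^esub> g) (x, n) (y, 0) = ker d (x, n) (x, n) * ker g (x, n) (y, 0)"
    unfolding kernel_mult[OF d(1) g]
    by (rule act_single[OF kernel_carrierD(2)[OF g]]) (use d(2) in \<open>fastforce simp: ker_def\<close>)
  then show ?thesis by (simp add: ker_def)
qed

lemma (in ck_family) eval_relator:
  assumes "e \<in> ck_relators A" shows "eval_poly R s e = \<zero>"
proof -
  interpret ev: star_alg_hom free_star_algebra R "eval_poly R s"
    by (intro star_alg_hom.intro star_alg_hom_axioms.intro free_star_alg star_alg_axioms eval_poly_hom s_closed)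
  have gen: "eval_poly R s (free_gen i) = s i" for i by (rule eval_poly_gen) simp
  note hom = ev.hom_minus ev.hom_mult ev.hom_adj ev.hom_smult ev.hom_finsum gen free.finsum_closed Pi_def
  have z: "a \<ominus> a = \<zero>" if "a \<in> carrier R" for a
    using that by (simp add: a_minus_def r_neg)
  note src = source and tot = total
  show ?thesis using assms
  proof (cases rule: ck_relators_cases)
    case (partial i)
    then show ?thesis by (simp add: hom partial_isometry z)
  next
    case (orth i j)
    then show ?thesis by (simp add: hom orthogonal)
  next
    case (source i)
    then show ?thesis by (simp add: hom src z finsum_closed)
  next
    case total
    then show ?thesis by (simp add: hom tot z)
  qed
qed

locale ck_mat =
  fixes A :: "nat^'n::finite^'n"
  assumes mat: "ck_matrix A"
begin

sublocale G: ck_family "kernel_algebra A" A "groupoid_gen A" by (rule groupoid_gen_family[OF mat])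

sublocale CK: ck_family "ck_algebra A" A "ck_gen A" by (rule ck_gen_family[OF mat])

lemma groupoid_proj: "G.pr \<alpha> (x, n, y) = (if x \<in> shift_space A \<and> n = 0 \<and> y = x \<and> prefix (length \<alpha>) x = \<alpha> then 1 else 0)"
proof (induction \<alpha> arbitrary: x n y)
  case Nil
  have "G.pr [] = \<one>\<^bsub>kernel_algebra A\<^esub>" by (simp add: sproj_def)
  then show ?case by (auto simp: kernel_simps indicator_def unit_space_iff)
next
  case (Cons i \<alpha>)
  let ?s = "groupoid_gen A i"
  note s' = kernel_adj_closed[OF groupoid_gen_kernel]
  have dm: "(G.pr \<alpha> \<otimes>\<^bsub>kernel_algebra A\<^esub> adj (kernel_algebra A) ?s) (x', n', y') =
      G.pr \<alpha> (x', 0, x') * adj (kernel_algebra A) ?s (x', n', y')" for x' n' y'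
    by (rule diag_kernel_mult[OF G.pr_closed _ s']) (simp add: Cons split: if_splits)
  have "G.pr (i # \<alpha>) (x, n, y) = (?s \<otimes>\<^bsub>kernel_algebra A\<^esub> (G.pr \<alpha> \<otimes>\<^bsub>kernel_algebra A\<^esub> adj (kernel_algebra A) ?s)) (x, n, y)"
    by (simp add: G.pr_Cons K.m_assoc s')
  also have "\<dots> = (if x \<in> shift_space A \<and> x 0 = i then
      G.pr \<alpha> (shift x, 0, shift x) * adj (kernel_algebra A) ?s (shift x, n - 1, y) else 0)"
    by (simp only: gen_mult[OF kernel_mult_closed[OF G.pr_closed s']] dm)
  also have "\<dots> = (if x \<in> shift_space A \<and> n = 0 \<and> y = x \<and> prefix (length (i # \<alpha>)) x = i # \<alpha> then 1 else 0)"
  proof (cases "x \<in> shift_space A \<and> x 0 = i")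
    case True
    then have iff: "y \<in> shift_space A \<and> y 0 = i \<and> - (n - 1) = 1 \<and> shift x = shift y \<longleftrightarrow> n = 0 \<and> y = x"
      by (rule letter_tail_eq)
    have "adj (kernel_algebra A) ?s (shift x, n - 1, y) = (if n = 0 \<and> y = x then 1 else 0)"
      unfolding kernel_simps ginv.simps groupoid_gen_apply iff by simp
    then show ?thesis using True by (auto simp: Cons prefix_Suc shift_in_shift_space)
  qed (auto simp: prefix_Suc)
  finally show ?case .
qed

lemma groupoid_diag:
  assumes f: "level A n f"
  shows "G.D n f (x, m, y) = (if x \<in> shift_space A \<and> m = 0 \<and> y = x then f x else 0)"
proof -
  have "G.D n f (x, m, y) = (\<Sum>\<alpha>\<in>words n. f (rep A \<alpha>) * G.pr \<alpha> (x, m, y))"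
    unfolding diag_def by (subst kernel_finsum) (auto, simp add: kernel_simps)
  also have "\<dots> = (\<Sum>\<alpha>\<in>words n. if \<alpha> = prefix n x then (if x \<in> shift_space A \<and> m = 0 \<and> y = x then f x else 0) else 0)"
  proof (rule sum.cong[OF refl])
    fix \<alpha> :: "'n list" assume \<alpha>: "\<alpha> \<in> words n"
    have "f (rep A \<alpha>) = f x" if "x \<in> shift_space A" "\<alpha> = prefix n x"
    proof -
      have "admissible_word A \<alpha>" using that admissible_prefix by simp
      from rep[OF mat this] show ?thesis using that by (intro levelD[OF f]) auto
    qed
    then show "f (rep A \<alpha>) * G.pr \<alpha> (x, m, y) = (if \<alpha> = prefix n x then (if x \<in> shift_space A \<and> m = 0 \<and> y = x then f x else 0) else 0)"
      using \<alpha> by (auto simp: groupoid_proj mem_words)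
  qed
  also have "\<dots> = (if x \<in> shift_space A \<and> m = 0 \<and> y = x then f x else 0)"
    by (subst sum.delta) (auto simp: mem_words)
  finally show ?thesis .
qed

text \<open>Every C*-seminorm on the functions pulls back to one on the free algebra that kills the
  relators.\<close>

lemma keval_contractive:
  assumes p: "p \<in> carrier free_star_algebra"
  shows "conv_norm A (keval A p) \<le> O.u A p"
proof (rule conv_norm_least)
  fix \<rho> assume rho: "cstar_seminorm (convolution_algebra A) \<rho>"
  have C: "keval A q \<in> Cc A" if "q \<in> carrier free_star_algebra" for q using keval_Cc[OF that] ..
  have ops: "f \<oplus>\<^bsub>kernel_algebra A\<^esub> g = f \<oplus>\<^bsub>convolution_algebra A\<^esub> g"
    "f \<otimes>\<^bsub>kernel_algebra A\<^esub> g = f \<otimes>\<^bsub>convolution_algebra A\<^esub> g"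
    "c \<odot>\<^bsub>kernel_algebra A\<^esub> f = c \<odot>\<^bsub>convolution_algebra A\<^esub> f"
    "adj (kernel_algebra A) f = adj (convolution_algebra A) f" for f g c
    by (simp_all add: kernel_algebra_def)
  have "cstar_seminorm free_star_algebra (\<rho> \<circ> keval A)"
    using rho C unfolding cstar_seminorm_def o_apply
    by (auto simp: keval.hom_add keval.hom_mult keval.hom_smult keval.hom_adj ops)
  moreover have "(\<rho> \<circ> keval A) e = 0" if "e \<in> ck_relators A" for e
  proof -
    \<comment> \<open>The zero function has seminorm 0 by homogeneity; the general seminorm lemmas
      presuppose \<open>star_alg\<close>, which is not established for
      \<open>convolution_algebra\<close>.\<close>
    have "\<rho> (0 \<odot>\<^bsub>convolution_algebra A\<^esub> (\<lambda>\<gamma>. 0)) = cmod 0 * \<rho> (\<lambda>\<gamma>. 0)"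
      using rho Cc_zero unfolding cstar_seminorm_def by blast
    then show ?thesis using G.eval_relator[OF that] by (simp add: kernel_simps convolution_simps)
  qed
  ultimately show "\<rho> (keval A p) \<le> O.u A p"
    using O.universal_upper[of "\<rho> \<circ> keval A" A p] p by simp
qed

lemma keval_diff:
  assumes "p \<in> carrier free_star_algebra" "q \<in> carrier free_star_algebra"
  shows "conv_norm A (\<lambda>\<gamma>. keval A p \<gamma> - keval A q \<gamma>) \<le> O.u A (p \<ominus>\<^bsub>free_star_algebra\<^esub> q)"
    and "cmod (keval A p \<gamma> - keval A q \<gamma>) \<le> O.u A (p \<ominus>\<^bsub>free_star_algebra\<^esub> q)"
proof -
  have m: "f \<ominus>\<^bsub>kernel_algebra A\<^esub> g = (\<lambda>\<gamma>. f \<gamma> - g \<gamma>)" if "f \<in> carrier (kernel_algebra A)" "g \<in> carrier (kernel_algebra A)" for f g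
    using that by (simp add: a_minus_def K.smult_minus_1[symmetric] kernel_simps)
  have *: "keval A (p \<ominus>\<^bsub>free_star_algebra\<^esub> q) = (\<lambda>\<gamma>. keval A p \<gamma> - keval A q \<gamma>)"
    using assms by (simp add: keval.hom_minus m)
  have pq: "p \<ominus>\<^bsub>free_star_algebra\<^esub> q \<in> carrier free_star_algebra" using assms by simp
  show 1: "conv_norm A (\<lambda>\<gamma>. keval A p \<gamma> - keval A q \<gamma>) \<le> O.u A (p \<ominus>\<^bsub>free_star_algebra\<^esub> q)"
    using keval_contractive[OF pq] unfolding * .
  have "keval A (p \<ominus>\<^bsub>free_star_algebra\<^esub> q) \<in> Cc A" using keval_Cc[OF pq] ..
  from value_le_conv_norm[OF this, of \<gamma>] 1
  show "cmod (keval A p \<gamma> - keval A q \<gamma>) \<le> O.u A (p \<ominus>\<^bsub>free_star_algebra\<^esub> q)" unfolding * by linarith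
qed

lemma keval_Cauchy:
  assumes X: "X \<in> O.C A"
  shows "(\<lambda>n. keval A (X n)) \<in> cauchy_seqs (convolution_algebra A) {}" "convergent (\<lambda>n. keval A (X n) \<gamma>)"
proof -
  have c: "X n \<in> carrier free_star_algebra" for n by (rule O.cauchy_carrier[OF X])
  have C: "keval A (X n) \<in> Cc A" for n using keval_Cc[OF c] ..
  show "(\<lambda>n. keval A (X n)) \<in> cauchy_seqs (convolution_algebra A) {}"
    unfolding cauchy_seqs_def
  proof (intro CollectI conjI allI impI)
    show "keval A (X n) \<in> Cc A" for n by (rule C)
    fix e :: real assume "e > 0"
    then obtain M where "\<forall>m\<ge>M. \<forall>n\<ge>M. O.u A (X m \<ominus>\<^bsub>free_star_algebra\<^esub> X n) < e" using O.cauchyD[OF X] by blast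
    then show "\<exists>M. \<forall>m\<ge>M. \<forall>n\<ge>M. conv_norm A (keval A (X m) \<ominus>\<^bsub>convolution_algebra A\<^esub> keval A (X n)) < e"
      unfolding conv_minus[OF C C] using keval_diff(1)[OF c c] by (meson order_le_less_trans)
  qed
  have "Cauchy (\<lambda>n. keval A (X n) \<gamma>)"
  proof (rule metric_CauchyI)
    fix e :: real assume "e > 0"
    then obtain M where "\<forall>m\<ge>M. \<forall>n\<ge>M. O.u A (X m \<ominus>\<^bsub>free_star_algebra\<^esub> X n) < e" using O.cauchyD[OF X] by blast
    then show "\<exists>M. \<forall>m\<ge>M. \<forall>n\<ge>M. dist (keval A (X m) \<gamma>) (keval A (X n) \<gamma>) < e"
      unfolding dist_norm using keval_diff(2)[OF c c] by (meson order_le_less_trans)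
  qed
  then show "convergent (\<lambda>n. keval A (X n) \<gamma>)" by (simp add: Cauchy_convergent)
qed

text \<open>The description behind \<open>ck_fun\<close> ranges over all representatives of the
  image class. Each differs from the evaluated sequence by two sequences that are null in norm, and
  norms dominate values, so all of them have the same pointwise limit.\<close>

lemma ck_fun_tendsto:
  assumes X: "X \<in> O.C A"
  shows "(\<lambda>n. keval A (X n) \<gamma>) \<longlonglongrightarrow> ck_fun A (O.cls A X) \<gamma>"
proof -
  let ?a = "ck_to_groupoid A (O.cls A X)"
  have mem: "Y \<in> ?a \<longleftrightarrow> (\<exists>X'\<in>O.cls A X. (\<lambda>n. keval A (X' n), Y) \<in> null_rel (convolution_algebra A) {})" for Y
  proof -
    have "(\<lambda>n. eval_poly (convolution_algebra A) (groupoid_gen A) (X' n)) = (\<lambda>n. keval A (X' n))"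
      if "X' \<in> O.cls A X" for X'
    proof -
      have "X' \<in> O.C A" using that by (simp add: null_rel_def)
      from conv_eval_poly[OF O.cauchy_carrier[OF this]] show ?thesis by (rule ext)
    qed
    then show ?thesis unfolding ck_to_groupoid_def envelope_map_def by auto
  qed
  obtain c where c: "(\<lambda>n. keval A (X n) \<gamma>) \<longlonglongrightarrow> c"
    using keval_Cauchy(2)[OF X] unfolding convergent_def by blast
  have lim: "(\<lambda>n. Y n \<gamma>) \<longlonglongrightarrow> c" if Yin: "Y \<in> ?a" for Y
  proof -
    obtain X' where X': "X' \<in> O.cls A X" and Y: "(\<lambda>n. keval A (X' n), Y) \<in> null_rel (convolution_algebra A) {}"
      using Yin[unfolded mem] by blast
    have X'C: "X' \<in> O.C A" and n1: "(\<lambda>n. O.u A (X n \<ominus>\<^bsub>free_star_algebra\<^esub> X' n)) \<longlonglongrightarrow> 0"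
      using X' by (auto simp: null_rel_def)
    have C: "keval A (X' n) \<in> Cc A" "Y n \<in> Cc A" for n
      using Y unfolding null_rel_def cauchy_seqs_def by blast+
    have n2: "(\<lambda>n. conv_norm A (\<lambda>\<gamma>. keval A (X' n) \<gamma> - Y n \<gamma>)) \<longlonglongrightarrow> 0"
      using Y unfolding null_rel_def by (simp add: conv_minus[OF C])
    have "(\<lambda>n. keval A (X n) \<gamma> - keval A (X' n) \<gamma>) \<longlonglongrightarrow> 0"
      by (rule Lim_null_comparison[OF always_eventually n1])
         (intro allI keval_diff(2) O.cauchy_carrier[OF X] O.cauchy_carrier[OF X'C])
    moreover have "(\<lambda>n. keval A (X' n) \<gamma> - Y n \<gamma>) \<longlonglongrightarrow> 0"
      by (rule Lim_null_comparison[OF always_eventually n2])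
         (use value_le_conv_norm[OF Cc_minus[OF C]] in blast)
    ultimately have "(\<lambda>n. keval A (X n) \<gamma> - (keval A (X n) \<gamma> - keval A (X' n) \<gamma>) - (keval A (X' n) \<gamma> - Y n \<gamma>)) \<longlonglongrightarrow> c - 0 - 0"
      using c by (intro tendsto_diff)
    then show ?thesis by simp
  qed
  have "(\<lambda>n. keval A (X n)) \<in> ?a"
    unfolding mem
  proof (rule bexI[OF _ O.cls_self[OF X]])
    have C: "keval A (X n) \<in> Cc A" for n using keval_Cc[OF O.cauchy_carrier[OF X]] ..
    have "conv_norm A (\<lambda>\<gamma>. keval A (X n) \<gamma> - keval A (X n) \<gamma>) = 0" for n
    proof (rule antisym)
      show "conv_norm A (\<lambda>\<gamma>. keval A (X n) \<gamma> - keval A (X n) \<gamma>) \<le> 0"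
        using keval_diff(1)[OF O.cauchy_carrier[OF X] O.cauchy_carrier[OF X], of n n] O.u_zero[of A]
        by (simp add: a_minus_def free.r_neg O.cauchy_carrier[OF X])
      show "0 \<le> conv_norm A (\<lambda>\<gamma>. keval A (X n) \<gamma> - keval A (X n) \<gamma>)"
        using value_le_conv_norm[OF Cc_minus[OF C C]] norm_ge_zero order_trans by blast
    qed
    then show "(\<lambda>n. keval A (X n), \<lambda>n. keval A (X n)) \<in> null_rel (convolution_algebra A) {}"
      unfolding null_rel_def using keval_Cauchy(1)[OF X] by (simp add: conv_minus[OF C C])
  qed
  then have "ck_fun A (O.cls A X) \<gamma> = c"
    unfolding ck_fun_def groupoid_fun_def using lim
    by (intro the_equality) (auto intro: LIMSEQ_unique)
  then show ?thesis using c by simp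
qed

lemma ck_fun_emb: "p \<in> carrier free_star_algebra \<Longrightarrow> ck_fun A (ck_emb A p) \<gamma> = keval A p \<gamma>"
  using ck_fun_tendsto[of "\<lambda>_. p" \<gamma>] O.cauchy_const[of p A]
  by (simp add: envelope_emb_def LIMSEQ_const_iff)

lemma ck_fun_minus:
  assumes "a \<in> carrier (ck_algebra A)" "b \<in> carrier (ck_algebra A)"
  shows "ck_fun A (a \<ominus>\<^bsub>ck_algebra A\<^esub> b) \<gamma> = ck_fun A a \<gamma> - ck_fun A b \<gamma>"
    and "cmod (ck_fun A a \<gamma>) \<le> cnorm (ck_algebra A) a"
proof -
  obtain X Y where X: "X \<in> O.C A" "\<forall>n. X n \<in> carrier free_star_algebra" "a = O.cls A X"
    and Y: "Y \<in> O.C A" "\<forall>n. Y n \<in> carrier free_star_algebra" "b = O.cls A Y"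
    using assms O.Q_cases unfolding ck_algebra_def by metis
  have "a \<ominus>\<^bsub>ck_algebra A\<^esub> b = O.cls A (\<lambda>n. X n \<ominus>\<^bsub>free_star_algebra\<^esub> Y n)"
    unfolding ck_algebra_def X(3) Y(3) by (rule O.Q_minus[OF X(1) Y(1)])
  then have "(\<lambda>n. keval A (X n \<ominus>\<^bsub>free_star_algebra\<^esub> Y n) \<gamma>) \<longlonglongrightarrow> ck_fun A (a \<ominus>\<^bsub>ck_algebra A\<^esub> b) \<gamma>"
    using ck_fun_tendsto[OF O.cauchy_minus[OF X(1) Y(1)]] by simp
  moreover have "keval A (X n \<ominus>\<^bsub>free_star_algebra\<^esub> Y n) \<gamma> = keval A (X n) \<gamma> - keval A (Y n) \<gamma>" for n
    using X Y by (simp add: keval.hom_minus) (simp add: a_minus_def K.smult_minus_1[symmetric] kernel_simps)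
  ultimately show "ck_fun A (a \<ominus>\<^bsub>ck_algebra A\<^esub> b) \<gamma> = ck_fun A a \<gamma> - ck_fun A b \<gamma>"
    using tendsto_diff[OF ck_fun_tendsto[OF X(1)] ck_fun_tendsto[OF Y(1)], of \<gamma> \<gamma>] X(3) Y(3)
    by (auto intro: LIMSEQ_unique)
  have "cmod (keval A (X n) \<gamma>) \<le> O.u A (X n)" for n
  proof -
    have "keval A (X n) \<in> Cc A" using keval_Cc X(2) by blast
    from value_le_conv_norm[OF this, of \<gamma>] keval_contractive[of "X n"] X(2) show ?thesis by fastforce
  qed
  then show "cmod (ck_fun A a \<gamma>) \<le> cnorm (ck_algebra A) a"
    unfolding ck_algebra_def X(3)
    by (intro LIMSEQ_le[OF tendsto_norm[OF ck_fun_tendsto[OF X(1)]] O.cnorm_tendsto[OF X(1)]]) auto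
qed

lemma ck_fun_tends:
  assumes "O.tends A X a" shows "(\<lambda>n. ck_fun A (X n) \<gamma>) \<longlonglongrightarrow> ck_fun A a \<gamma>"
proof -
  have c: "X n \<in> carrier (ck_algebra A)" "a \<in> carrier (ck_algebra A)" for n using assms by (auto simp: O.tends_def)
  have "(\<lambda>n. ck_fun A (X n) \<gamma> - ck_fun A a \<gamma>) \<longlonglongrightarrow> 0"
  proof (rule Lim_null_comparison[OF always_eventually])
    show "\<forall>n. cmod (ck_fun A (X n) \<gamma> - ck_fun A a \<gamma>) \<le> cnorm (ck_algebra A) (X n \<ominus>\<^bsub>ck_algebra A\<^esub> a)"
      unfolding ck_fun_minus(1)[OF c, symmetric] using c by (intro allI ck_fun_minus(2)) auto
  qed (use assms in \<open>simp add: O.tends_def\<close>)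
  then show ?thesis by (rule LIM_zero_cancel)
qed

section \<open>The diagonal\<close>

text \<open>A lift of \<open>CK.D n f\<close> to polynomials, through which its values on the
  groupoid are computed by evaluation.\<close>

definition free_diag :: "nat \<Rightarrow> ((nat \<Rightarrow> 'n) \<Rightarrow> complex) \<Rightarrow> 'n star_poly" where
  "free_diag n f = diag free_star_algebra A free_gen n f"

lemma free_diag_closed [simp]: "free_diag n f \<in> carrier free_star_algebra"
  unfolding free_diag_def by (rule free.diag_closed) simp

lemma emb_free_diag: "ck_emb A (free_diag n f) = CK.D n f"
  unfolding free_diag_def by (subst emb.hom_diag) (simp_all add: ck_emb_gen)

lemma keval_free_diag: "keval A (free_diag n f) = G.D n f"
  unfolding free_diag_def by (subst keval.hom_diag) (simp_all add: K.eval_poly_gen)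

lemma ck_fun_diag: "level A n f \<Longrightarrow> ck_fun A (CK.D n f) (x, m, y) = (if x \<in> shift_space A \<and> m = 0 \<and> y = x then f x else 0)"
  unfolding emb_free_diag[symmetric] by (simp add: ck_fun_emb keval_free_diag groupoid_diag)

definition loc_diag :: "'n ck_elem set" where
  "loc_diag = {CK.D n f | n f. level A n f}"

lemma loc_diagI: "level A n f \<Longrightarrow> CK.D n f \<in> loc_diag"
  by (auto simp: loc_diag_def)

lemma loc_diag_subset: "loc_diag \<subseteq> carrier (ck_algebra A)"
  by (auto simp: loc_diag_def)

lemma loc_diag_cl: "closed_star_subalgebra (ck_algebra A) (O.cl A loc_diag)"
proof (rule O.cl_closed[OF loc_diag_subset])
  have "CK.D 0 (\<lambda>x. 0) \<in> loc_diag" by (rule loc_diagI) (simp add: level_def)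
  then show "\<zero>\<^bsub>ck_algebra A\<^esub> \<in> loc_diag" by (simp add: CK.D_zero)
next
  fix a b assume "a \<in> loc_diag" "b \<in> loc_diag"
  then obtain n f m g where ab: "a = CK.D n f" "level A n f" "b = CK.D m g" "level A m g" by (auto simp: loc_diag_def)
  let ?k = "max n m"
  have l: "level A ?k f" "level A ?k g" using ab level_mono by (metis max.cobounded1, metis max.cobounded2)
  have D: "a = CK.D ?k f" "b = CK.D ?k g" using ab CK.D_level[of n f ?k] CK.D_level[of m g ?k] by auto
  have lev: "level A ?k (\<lambda>x. q (f x) (g x))" for q :: "complex \<Rightarrow> complex \<Rightarrow> complex"
    unfolding level_def using levelD[OF l(1)] levelD[OF l(2)] by metis
  show "a \<oplus>\<^bsub>ck_algebra A\<^esub> b \<in> loc_diag \<and> a \<otimes>\<^bsub>ck_algebra A\<^esub> b \<in> loc_diag"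
    unfolding D CK.D_add[symmetric] CK.D_mult using loc_diagI lev by blast
next
  fix c a assume "a \<in> loc_diag"
  then obtain n f where a: "a = CK.D n f" "level A n f" by (auto simp: loc_diag_def)
  show "c \<odot>\<^bsub>ck_algebra A\<^esub> a \<in> loc_diag"
    unfolding a CK.D_smult[symmetric] by (rule loc_diagI[OF level_compose[OF a(2)]])
next
  fix a assume "a \<in> loc_diag"
  then obtain n f where a: "a = CK.D n f" "level A n f" by (auto simp: loc_diag_def)
  show "adj (ck_algebra A) a \<in> loc_diag"
    unfolding a CK.D_adj by (rule loc_diagI[OF level_compose[OF a(2)]])
qed

lemma ck_word_sword: "ck_word A \<alpha> = CK.sw \<alpha>"
  by (simp add: ck_word_def sword_def)

lemma diagonal_generated: "diagonal A = generated_cstar_subalgebra (ck_algebra A) {CK.pr \<alpha> | \<alpha>. admissible_word A \<alpha>}"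
  by (simp add: diagonal_def ck_word_sword sproj_def)

lemma pr_loc_diag: "CK.pr \<alpha> \<in> loc_diag"
proof -
  have "level A (length \<alpha>) (\<lambda>x. of_bool (prefix (length \<alpha>) x = \<alpha>) :: complex)" by (auto simp: level_def)
  from loc_diagI[OF this] show ?thesis by (simp add: CK.D_prefix)
qed

lemma diagonal_subset_cl: "diagonal A \<subseteq> O.cl A loc_diag"
  unfolding diagonal_generated
  by (rule O.generated_subset_cl[OF loc_diag_cl]) (use pr_loc_diag O.cl_superset[OF loc_diag_subset] in blast)

lemma diagonal_closed: "closed_star_subalgebra (ck_algebra A) (diagonal A)"
  and pr_diagonal: "admissible_word A \<alpha> \<Longrightarrow> CK.pr \<alpha> \<in> diagonal A"
proof -
  have *: "{CK.pr \<alpha> | \<alpha>. admissible_word A \<alpha>} \<subseteq> carrier (ck_algebra A)" by auto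
  show "closed_star_subalgebra (ck_algebra A) (diagonal A)"
    unfolding diagonal_generated by (rule O.generated_closed(1)[OF *])
  show "admissible_word A \<alpha> \<Longrightarrow> CK.pr \<alpha> \<in> diagonal A"
    unfolding diagonal_generated using O.generated_closed(2)[OF *] by blast
qed

lemma diagonal_ops:
  "diagonal A \<subseteq> carrier (ck_algebra A)" "\<zero>\<^bsub>ck_algebra A\<^esub> \<in> diagonal A"
  "a \<in> diagonal A \<Longrightarrow> b \<in> diagonal A \<Longrightarrow> a \<oplus>\<^bsub>ck_algebra A\<^esub> b \<in> diagonal A"
  "a \<in> diagonal A \<Longrightarrow> b \<in> diagonal A \<Longrightarrow> a \<otimes>\<^bsub>ck_algebra A\<^esub> b \<in> diagonal A"
  "a \<in> diagonal A \<Longrightarrow> c \<odot>\<^bsub>ck_algebra A\<^esub> a \<in> diagonal A"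
  "a \<in> diagonal A \<Longrightarrow> adj (ck_algebra A) a \<in> diagonal A"
  "(\<And>n. X n \<in> diagonal A) \<Longrightarrow> O.tends A X a \<Longrightarrow> a \<in> diagonal A"
  using diagonal_closed unfolding closed_star_subalgebra_def O.tends_def by blast+

lemma D_diagonal: "CK.D n f \<in> diagonal A"
proof -
  have pr: "CK.pr \<alpha> \<in> diagonal A" for \<alpha>
    using pr_diagonal[of \<alpha>] CK.pr_nonadmissible[of \<alpha>] diagonal_ops(2) by (cases "admissible_word A \<alpha>") auto
  have "finite I \<Longrightarrow> (\<Oplus>\<^bsub>ck_algebra A\<^esub>\<alpha>\<in>I. f (rep A \<alpha>) \<odot>\<^bsub>ck_algebra A\<^esub> CK.pr \<alpha>) \<in> diagonal A" for I
  proof (induction I rule: finite_induct)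
    case (insert \<alpha> I)
    then show ?case using diagonal_ops(3)[OF diagonal_ops(5)[OF pr, of _ \<alpha>]] by (subst O.finsum_insert) auto
  qed (simp add: diagonal_ops(2))
  then show ?thesis unfolding diag_def by simp
qed

lemma diagonal_approx:
  assumes "d \<in> diagonal A"
  obtains N F where "\<forall>n. level A (N n) (F n)" "O.tends A (\<lambda>n. CK.D (N n) (F n)) d"
proof -
  have "d \<in> O.cl A loc_diag" using assms diagonal_subset_cl by blast
  then obtain X where X: "\<forall>n. X n \<in> loc_diag" "O.tends A X d" using O.clD[OF _ loc_diag_subset] by blast
  then have "\<forall>n. \<exists>N F. X n = CK.D N F \<and> level A N F" by (auto simp: loc_diag_def)
  then obtain N F where NF: "\<And>n. X n = CK.D (N n) (F n)" "\<And>n. level A (N n) (F n)" by metis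
  have "X = (\<lambda>n. CK.D (N n) (F n))" using NF by auto
  then show thesis using that[of N F] NF X by simp
qed

lemma diagonal_off_units:
  assumes "d \<in> diagonal A" "\<gamma> \<notin> unit_space A" shows "ck_fun A d \<gamma> = 0"
proof -
  obtain N F where NF': "\<forall>n. level A (N n) (F n)" and NF2: "O.tends A (\<lambda>n. CK.D (N n) (F n)) d"
    by (rule diagonal_approx[OF assms(1)])
  note NF = NF'[rule_format] NF2
  obtain x m y where "\<gamma> = (x, m, y)" by (cases \<gamma>)
  then have "ck_fun A (CK.D (N n) (F n)) \<gamma> = 0" for n
    using assms(2) ck_fun_diag[OF NF(1)] by (auto simp: unit_space_iff)
  then show ?thesis using ck_fun_tends[OF NF(2), of \<gamma>] by (simp add: LIMSEQ_const_iff)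
qed

lemma diagonal_fun_D: "level A n f \<Longrightarrow> x \<in> shift_space A \<Longrightarrow> diagonal_fun A (CK.D n f) x = f x"
  by (simp add: diagonal_fun_def gunit_def ck_fun_diag)

text \<open>For approximants \<open>CK.D (N n) (F n)\<close> of \<open>e\<close>, the norm is at
  most the supremum of \<open>F n\<close>. Since the function of \<open>e\<close> vanishes, this
  supremum is at most the norm of the difference from \<open>e\<close>, which tends to 0.\<close>

lemma diagonal_zero:
  assumes e: "e \<in> diagonal A" "\<And>x. x \<in> shift_space A \<Longrightarrow> diagonal_fun A e x = 0"
  shows "e = \<zero>\<^bsub>ck_algebra A\<^esub>"
proof -
  have ec: "e \<in> carrier (ck_algebra A)" using e diagonal_ops(1) by blast
  obtain N F where NF': "\<forall>n. level A (N n) (F n)" and NF2: "O.tends A (\<lambda>n. CK.D (N n) (F n)) e"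
    by (rule diagonal_approx[OF e(1)])
  note NF = NF'[rule_format] NF2
  have "cnorm (ck_algebra A) (CK.D (N n) (F n)) \<le> cnorm (ck_algebra A) (CK.D (N n) (F n) \<ominus>\<^bsub>ck_algebra A\<^esub> e)" for n
  proof (rule CK.D_norm_le[OF O.cnorm_seminorm])
    fix x assume x: "x \<in> shift_space A"
    have "F n x = ck_fun A (CK.D (N n) (F n) \<ominus>\<^bsub>ck_algebra A\<^esub> e) (gunit x)"
      using diagonal_fun_D[OF NF(1) x, of n] e(2)[OF x] ck_fun_minus(1)[OF CK.D_closed ec]
      by (simp add: diagonal_fun_def)
    then show "cmod (F n x) \<le> cnorm (ck_algebra A) (CK.D (N n) (F n) \<ominus>\<^bsub>ck_algebra A\<^esub> e)"
      using ck_fun_minus(2)[of "CK.D (N n) (F n) \<ominus>\<^bsub>ck_algebra A\<^esub> e" _ "gunit x"] ec by simp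
  qed
  then have "cnorm (ck_algebra A) e \<le> 0"
    using NF(2) by (intro LIMSEQ_le[OF O.tends_norm[OF NF(2)], of _ 0]) (auto simp: O.tends_def)
  then show ?thesis using ec O.cnorm_nonneg[OF ec] by (intro O.cnorm_zeroD) auto
qed

text \<open>The identities of \<open>ck_phi\<close> and \<open>cond_exp\<close> under an isomorphism
  are verified pointwise through this rule.\<close>

lemma diagonal_eqI:
  assumes d: "d \<in> diagonal A" "d' \<in> diagonal A"
    and eq: "\<And>x. x \<in> shift_space A \<Longrightarrow> diagonal_fun A d x = diagonal_fun A d' x"
  shows "d = d'"
proof (rule O.minus_eq_zeroD)
  show c: "d \<in> carrier (ck_algebra A)" "d' \<in> carrier (ck_algebra A)" using d diagonal_ops(1) by auto
  show "d \<ominus>\<^bsub>ck_algebra A\<^esub> d' = \<zero>\<^bsub>ck_algebra A\<^esub>"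
  proof (rule diagonal_zero)
    have "d \<ominus>\<^bsub>ck_algebra A\<^esub> d' = d \<oplus>\<^bsub>ck_algebra A\<^esub> (-1) \<odot>\<^bsub>ck_algebra A\<^esub> d'"
      using c by (simp add: a_minus_def O.smult_minus_1)
    then show "d \<ominus>\<^bsub>ck_algebra A\<^esub> d' \<in> diagonal A" using d diagonal_ops(3,5) by simp
    show "diagonal_fun A (d \<ominus>\<^bsub>ck_algebra A\<^esub> d') x = 0" if "x \<in> shift_space A" for x
      using eq[OF that] by (simp add: diagonal_fun_def ck_fun_minus(1)[OF c])
  qed
qed

lemma phi_diag: "level A n f \<Longrightarrow> ck_phi A (CK.D n f) = CK.D (Suc n) (\<lambda>x. f (shift x))"
  unfolding ck_phi_def by (rule CK.phi_D)

lemma gen_sum_S: "ck_gen_sum A = CK.S"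
  by (simp add: ck_gen_sum_def gen_sum_def)

end

text \<open>Compactness: finitely many of the cylinders on which the function is constant cover the
  shift space, and the longest of their words gives the level.\<close>

lemma local_level:
  fixes A :: "nat^'n::finite^'n"
  assumes loc: "\<And>x. x \<in> shift_space A \<Longrightarrow> \<exists>m. \<forall>y\<in>shift_space A. prefix m y = prefix m x \<longrightarrow> \<phi> y = \<phi> x"
  shows "\<exists>m. level A m \<phi>"
proof -
  obtain M where M: "\<And>x y. x \<in> shift_space A \<Longrightarrow> y \<in> shift_space A \<Longrightarrow> prefix (M x) y = prefix (M x) x \<Longrightarrow> \<phi> y = \<phi> x"
    using loc by metis
  define U where "U x = {y \<in> shift_space A. prefix (M x) y = prefix (M x) x}" for x
  have op: "openin (shift_topology A) W" if W: "W \<in> U ` shift_space A" for W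
  proof -
    obtain x where x: "W = U x" using W by blast
    have "\<exists>m. \<forall>z\<in>shift_space A. prefix m z = prefix m y \<longrightarrow> z \<in> U x" if "y \<in> U x" for y
      using that by (intro exI[of _ "M x"]) (simp add: U_def)
    then show ?thesis unfolding openin_shift_iff x by (auto simp: U_def[of x])
  qed
  have "compactin (shift_topology A) (shift_space A)"
    using compact_space_shift[of A] by (simp add: compact_space_def)
  moreover have "shift_space A \<subseteq> \<Union>(U ` shift_space A)" by (auto simp: U_def)
  ultimately obtain \<F> where F: "finite \<F>" "\<F> \<subseteq> U ` shift_space A" "shift_space A \<subseteq> \<Union>\<F>"
    using compactinD[OF _ op] by meson
  then obtain T where T: "T \<subseteq> shift_space A" "finite T" "\<F> = U ` T"
    using finite_subset_image[OF F(1,2)] by metis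
  define m where "m = Max (insert 0 (M ` T))"
  have "level A m \<phi>"
    unfolding level_def
  proof (intro ballI impI)
    fix y z assume yz: "y \<in> shift_space A" "z \<in> shift_space A" "prefix m y = prefix m z"
    obtain x where x: "x \<in> T" "y \<in> U x" using F(3) T(3) yz(1) by blast
    have "M x \<le> m" unfolding m_def using x T(2) by (intro Max_ge) auto
    then have "prefix (M x) z = prefix (M x) x" using x(2) prefix_eq_mono[OF yz(3)] by (simp add: U_def)
    moreover have "x \<in> shift_space A" using x(1) T(1) by blast
    ultimately have "\<phi> z = \<phi> x" using M yz(2) by blast
    moreover have "\<phi> y = \<phi> x" by (rule M[OF \<open>x \<in> shift_space A\<close> yz(1)]) (use x(2) in \<open>simp add: U_def\<close>)
    ultimately show "\<phi> y = \<phi> z" by simp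
  qed
  then show ?thesis by blast
qed

lemma loc_const_units_level:
  fixes A :: "nat^'n::finite^'n"
  assumes "loc_const A f" shows "\<exists>m. level A m (\<lambda>x. f (gunit x))"
proof (rule local_level)
  fix x assume x: "x \<in> shift_space A"
  have "near A (x, 0, x) (\<lambda>x' y'. f (x', 0, y') = f (x, 0, x))"
    using assms groupoid_unit[OF x] unfolding loc_const_def by blast
  then obtain k l where kl: "(x, 0, x) \<in> cyl A (prefix k x) (prefix l x)"
    "\<forall>x' y'. (x', 0, y') \<in> cyl A (prefix k x) (prefix l x) \<longrightarrow> f (x', 0, y') = f (x, 0, x)"
    by (rule near_large[of A x 0 x _ 0]) blast
  have "f (gunit y) = f (gunit x)" if y: "y \<in> shift_space A" "prefix k y = prefix k x" for y
  proof -
    \<comment> \<open>A unit has integer 0, so both words have the same length and the units in the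
      cylinder form an ordinary cylinder set of points.\<close>
    have "k = l" using kl(1) by (simp add: cyl_iff)
    then have "(y, 0, y) \<in> cyl A (prefix k x) (prefix l x)" using y by (simp add: cyl_iff)
    then show ?thesis using kl(2) by (simp add: gunit_def)
  qed
  then show "\<exists>m. \<forall>y\<in>shift_space A. prefix m y = prefix m x \<longrightarrow> f (gunit y) = f (gunit x)" by blast
qed

context ck_mat
begin

text \<open>The restrictions to the units of approximating polynomials have a level, hence lift to
  diagonal polynomials \<open>q n\<close>. By \<open>CK.D_norm_le\<close> restriction does not
  increase norms, so \<open>q\<close> is again a Cauchy sequence and its class is the expectation.
  This existence gives the \<open>THE\<close> in \<open>cond_exp\<close> its meaning.\<close>

lemma cond_exp_ex:
  assumes "a \<in> carrier (ck_algebra A)"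
  shows "\<exists>d\<in>diagonal A. \<forall>\<gamma>. ck_fun A d \<gamma> = (if \<gamma> \<in> unit_space A then ck_fun A a \<gamma> else 0)"
proof -
  obtain X where X: "X \<in> O.C A" "\<forall>n. X n \<in> carrier free_star_algebra" "a = O.cls A X"
    using assms O.Q_cases unfolding ck_algebra_def by metis
  define \<phi> where "\<phi> n x = keval A (X n) (gunit x)" for n x
  have "\<exists>m. level A m (\<phi> n)" for n
    unfolding \<phi>_def using keval_Cc X(2) by (intro loc_const_units_level) blast
  then obtain m where m: "\<And>n. level A (m n) (\<phi> n)" by metis
  define q where "q n = free_diag (m n) (\<phi> n)" for n
  have q: "q n \<in> carrier free_star_algebra" "ck_emb A (q n) = CK.D (m n) (\<phi> n)" for n
    by (simp_all add: q_def emb_free_diag)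
  have qdiff: "O.u A (q j \<ominus>\<^bsub>free_star_algebra\<^esub> q k) \<le> O.u A (X j \<ominus>\<^bsub>free_star_algebra\<^esub> X k)" for j k
  proof -
    let ?m = "max (m j) (m k)"
    have "O.u A (q j \<ominus>\<^bsub>free_star_algebra\<^esub> q k) = cnorm (ck_algebra A) (ck_emb A (q j \<ominus>\<^bsub>free_star_algebra\<^esub> q k))"
      unfolding ck_algebra_def using q by (intro O.cnorm_emb[symmetric]) auto
    also have "ck_emb A (q j \<ominus>\<^bsub>free_star_algebra\<^esub> q k) = CK.D (m j) (\<phi> j) \<ominus>\<^bsub>ck_algebra A\<^esub> CK.D (m k) (\<phi> k)"
      using q by (simp add: emb.hom_minus)
    also have "\<dots> = CK.D ?m (\<phi> j) \<oplus>\<^bsub>ck_algebra A\<^esub> (-1) \<odot>\<^bsub>ck_algebra A\<^esub> CK.D ?m (\<phi> k)"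
      using CK.D_level[OF m, of j ?m] CK.D_level[OF m, of k ?m] by (simp add: a_minus_def O.smult_minus_1)
    also have "\<dots> = CK.D ?m (\<lambda>x. \<phi> j x + (-1) * \<phi> k x)" by (simp only: CK.D_add CK.D_smult)
    also have "cnorm (ck_algebra A) \<dots> \<le> O.u A (X j \<ominus>\<^bsub>free_star_algebra\<^esub> X k)"
      by (rule CK.D_norm_le[OF O.cnorm_seminorm]) (use keval_diff(2) X(2) in \<open>simp add: \<phi>_def\<close>)
    finally show ?thesis .
  qed
  have qC: "q \<in> O.C A"
    unfolding cauchy_seqs_def
  proof (intro CollectI conjI allI impI q)
    fix e :: real assume "e > 0"
    then obtain M where "\<forall>m\<ge>M. \<forall>n\<ge>M. O.u A (X m \<ominus>\<^bsub>free_star_algebra\<^esub> X n) < e" using O.cauchyD[OF X(1)] by blast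
    then show "\<exists>M. \<forall>m\<ge>M. \<forall>n\<ge>M. O.u A (q m \<ominus>\<^bsub>free_star_algebra\<^esub> q n) < e"
      using qdiff by (meson order_le_less_trans)
  qed
  have "O.tends A (\<lambda>n. ck_emb A (q n)) (O.cls A q)"
    unfolding O.tends_def using O.emb_tendsto[OF qC] q(1) O.Q_closed[OF qC] by (simp add: ck_algebra_def)
  then have d: "O.cls A q \<in> diagonal A"
    by (rule diagonal_ops(7)[rotated]) (simp add: q(2) D_diagonal)
  have "ck_fun A (O.cls A q) \<gamma> = (if \<gamma> \<in> unit_space A then ck_fun A a \<gamma> else 0)" for \<gamma>
  proof (cases "\<gamma> \<in> unit_space A")
    case True
    then obtain x where x: "x \<in> shift_space A" "\<gamma> = gunit x" by (auto simp: unit_space_def)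
    have "keval A (q n) \<gamma> = keval A (X n) \<gamma>" for n
      using x groupoid_diag[OF m, of n x 0 x] by (simp add: q_def keval_free_diag) (simp add: gunit_def \<phi>_def)
    then show ?thesis using ck_fun_tendsto[OF qC, of \<gamma>] ck_fun_tendsto[OF X(1), of \<gamma>] X(3) True
      by (auto intro: LIMSEQ_unique)
  next
    case False
    then show ?thesis using diagonal_off_units[OF d] by simp
  qed
  then show ?thesis using d by blast
qed

lemma cond_exp:
  assumes a: "a \<in> carrier (ck_algebra A)"
  shows "cond_exp A a \<in> diagonal A" "x \<in> shift_space A \<Longrightarrow> diagonal_fun A (cond_exp A a) x = ck_fun A a (gunit x)"
proof -
  let ?P = "\<lambda>d. d \<in> diagonal A \<and> (\<forall>\<gamma>\<in>ck_groupoid A. ck_fun A d \<gamma> = (if \<gamma> \<in> unit_space A then ck_fun A a \<gamma> else 0))"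
  have gu: "gunit x \<in> ck_groupoid A" "gunit x \<in> unit_space A" if "x \<in> shift_space A" for x
    using groupoid_unit[OF that] that by (auto simp: gunit_def unit_space_iff)
  obtain d where d: "?P d" using cond_exp_ex[OF a] by blast
  have "cond_exp A a = d"
    unfolding cond_exp_def
  proof (rule the_equality)
    show "?P d" by (rule d)
    fix d' assume d': "?P d'"
    show "d' = d"
      by (rule diagonal_eqI) (use d d' gu in \<open>simp_all add: diagonal_fun_def\<close>)
  qed
  then show "cond_exp A a \<in> diagonal A" "x \<in> shift_space A \<Longrightarrow> diagonal_fun A (cond_exp A a) x = ck_fun A a (gunit x)"
    using d gu by (simp_all add: diagonal_fun_def)
qed

end

section \<open>Homomorphisms of Cuntz--Krieger algebras\<close>

lemma (in cstar_alg) tends_finsum: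
  "finite I \<Longrightarrow> (\<And>i. i \<in> I \<Longrightarrow> tends (X i) (a i)) \<Longrightarrow> tends (\<lambda>n. \<Oplus>i\<in>I. X i n) (\<Oplus>i\<in>I. a i)"
proof (induction I rule: finite_induct)
  case (insert i I)
  have c: "\<And>j n. j \<in> insert i I \<Longrightarrow> X j n \<in> carrier R" "\<And>j. j \<in> insert i I \<Longrightarrow> a j \<in> carrier R"
    using insert.prems by (auto simp: tends_def)
  have "tends (\<lambda>n. X i n \<oplus> (\<Oplus>j\<in>I. X j n)) (a i \<oplus> (\<Oplus>j\<in>I. a j))"
    using insert.prems by (intro tends_add insert.IH) auto
  moreover have "(\<Oplus>j\<in>insert i I. X j n) = X i n \<oplus> (\<Oplus>j\<in>I. X j n)" for n
    using insert.hyps c by (intro finsum_insert) auto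
  moreover have "(\<Oplus>j\<in>insert i I. a j) = a i \<oplus> (\<Oplus>j\<in>I. a j)"
    using insert.hyps c by (intro finsum_insert) auto
  ultimately show ?case by simp
qed (simp add: tends_const)

lemma ck_approx:
  fixes A :: "nat^'n::finite^'n"
  assumes "a \<in> carrier (ck_algebra A)"
  obtains X where "X \<in> O.C A" "\<forall>n. X n \<in> carrier free_star_algebra" "a = O.cls A X"
    "O.tends A (\<lambda>n. ck_emb A (X n)) a"
proof -
  obtain X where X: "X \<in> O.C A" "\<forall>n. X n \<in> carrier free_star_algebra" "a = O.cls A X"
    using assms O.Q_cases unfolding ck_algebra_def by metis
  have "O.tends A (\<lambda>n. ck_emb A (X n)) a"
    unfolding O.tends_def using O.emb_tendsto[OF X(1)] X assms by (simp add: ck_algebra_def)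
  then show ?thesis using that X by blast
qed

text \<open>Contractivity is built in, to make the maps continuous; for maps obtained by
  substitution it comes from \<open>map_cnorm\<close>.\<close>

locale ck_hom = star_alg_hom "ck_algebra A" "ck_algebra B" \<Psi>
  for A :: "nat^'n::finite^'n" and B :: "nat^'m::finite^'m" and \<Psi> +
  assumes contractive: "a \<in> carrier (ck_algebra A) \<Longrightarrow> cnorm (ck_algebra B) (\<Psi> a) \<le> cnorm (ck_algebra A) a"
begin

lemma hom_tends:
  assumes X: "O.tends A X a" shows "O.tends B (\<lambda>n. \<Psi> (X n)) (\<Psi> a)"
proof (rule O.tendsI)
  have c: "\<And>n. X n \<in> carrier (ck_algebra A)" "a \<in> carrier (ck_algebra A)" using X by (auto simp: O.tends_def)
  show "\<Psi> (X n) \<in> carrier (ck_algebra B)" "\<Psi> a \<in> carrier (ck_algebra B)" for n using c by auto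
  show "cnorm (ck_algebra B) (\<Psi> (X n) \<ominus>\<^bsub>ck_algebra B\<^esub> \<Psi> a) \<le> cnorm (ck_algebra A) (X n \<ominus>\<^bsub>ck_algebra A\<^esub> a)" for n
    using contractive[of "X n \<ominus>\<^bsub>ck_algebra A\<^esub> a"] c by (simp add: hom_minus)
  show "(\<lambda>n. cnorm (ck_algebra A) (X n \<ominus>\<^bsub>ck_algebra A\<^esub> a)) \<longlonglongrightarrow> 0" using X by (simp add: O.tends_def)
qed

end

lemma ck_hom_comp:
  assumes "ck_hom A B \<Psi>" "ck_hom B C \<Phi>" shows "ck_hom A C (\<lambda>a. \<Phi> (\<Psi> a))"
proof -
  interpret P: ck_hom A B \<Psi> by fact
  interpret Q: ck_hom B C \<Phi> by fact
  have "star_hom (ck_algebra A) (ck_algebra C) (\<lambda>a. \<Phi> (\<Psi> a))"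
    using star_hom_comp[OF P.hom Q.hom] by (simp add: comp_def)
  moreover have "cnorm (ck_algebra C) (\<Phi> (\<Psi> a)) \<le> cnorm (ck_algebra A) a" if "a \<in> carrier (ck_algebra A)" for a
    using order_trans[OF Q.contractive P.contractive] that by simp
  ultimately show ?thesis by unfold_locales
qed

lemma ck_hom_id: "ck_hom A A (\<lambda>a. a)"
  by unfold_locales (auto simp: star_hom_def)

text \<open>The generators generate a dense star-subalgebra.\<close>

lemma ck_hom_eqI:
  assumes "ck_hom A B \<Psi>" "ck_hom A B \<Phi>" and gen: "\<And>i. \<Psi> (ck_gen A i) = \<Phi> (ck_gen A i)"
    and a: "a \<in> carrier (ck_algebra A)"
  shows "\<Psi> a = \<Phi> a"
proof -
  interpret P: ck_hom A B \<Psi> by fact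
  interpret Q: ck_hom A B \<Phi> by fact
  obtain X where X: "\<forall>n. X n \<in> carrier free_star_algebra" "O.tends A (\<lambda>n. ck_emb A (X n)) a"
    by (rule ck_approx[OF a]) blast
  have "(\<Psi> \<circ> ck_emb A) p = (\<Phi> \<circ> ck_emb A) p" if "p \<in> carrier free_star_algebra" for p
    by (rule star_hom_free_eqI[OF star_hom_comp[OF ck_emb_hom P.hom] star_hom_comp[OF ck_emb_hom Q.hom]
          O.star_alg_axioms _ that]) (simp add: ck_emb_gen gen)
  then have "(\<lambda>n. \<Psi> (ck_emb A (X n))) = (\<lambda>n. \<Phi> (ck_emb A (X n)))" using X(1) by (auto simp: fun_eq_iff)
  then show ?thesis using P.hom_tends[OF X(2)] Q.hom_tends[OF X(2)] O.tends_unique by metis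
qed

text \<open>Universality for families that are given by polynomials in the generators of
  \<open>B\<close>: the induced map substitutes them in the representing Cauchy sequences, in the
  same form as \<open>gauge_action\<close> is defined.\<close>

locale ck_subst =
  fixes A :: "nat^'n::finite^'n" and B :: "nat^'m::finite^'m" and g :: "'n \<Rightarrow> 'm star_poly"
  assumes g_closed [simp]: "g i \<in> carrier free_star_algebra"
    and family: "ck_family (ck_algebra B) A (\<lambda>i. ck_emb B (g i))"
begin

lemma subst_hom: "star_hom free_star_algebra free_star_algebra (eval_poly free_star_algebra g)"
  by (rule free.eval_poly_hom) simp

lemma emb_subst:
  assumes p: "p \<in> carrier free_star_algebra"
  shows "ck_emb B (eval_poly free_star_algebra g p) = eval_poly (ck_algebra B) (\<lambda>i. ck_emb B (g i)) p"
proof -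
  have "(ck_emb B \<circ> eval_poly free_star_algebra g) p = eval_poly (ck_algebra B) (\<lambda>i. ck_emb B (g i)) p"
    by (rule star_hom_free_eqI[OF star_hom_comp[OF subst_hom ck_emb_hom] O.eval_poly_hom O.star_alg_axioms _ p])
      (simp_all add: free.eval_poly_gen O.eval_poly_gen)
  then show ?thesis by simp
qed

sublocale E: enveloping_hom free_star_algebra "ck_relators A" free_star_algebra "ck_relators B"
  "eval_poly free_star_algebra g"
proof (unfold_locales, rule subst_hom)
  fix e assume e: "e \<in> ck_relators A"
  then have ec: "e \<in> carrier free_star_algebra" using ck_relators_closed by blast
  then have c: "eval_poly free_star_algebra g e \<in> carrier free_star_algebra" by simp
  have "O.u B (eval_poly free_star_algebra g e) = cnorm (ck_algebra B) (ck_emb B (eval_poly free_star_algebra g e))"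
    unfolding ck_algebra_def using O.cnorm_emb[OF c] by simp
  also have "\<dots> = 0"
    unfolding emb_subst[OF ec] ck_family.eval_relator[OF family e] by (rule O.cnorm_zero)
  finally show "O.u B (eval_poly free_star_algebra g e) = 0" .
qed

abbreviation "subst_map \<equiv> envelope_map free_star_algebra (ck_relators B) (eval_poly free_star_algebra g)"

lemma subst_map_hom: "ck_hom A B subst_map"
proof -
  have "star_hom (ck_algebra A) (ck_algebra B) subst_map" unfolding ck_algebra_def by (rule E.map_hom)
  moreover have "cnorm (ck_algebra B) (subst_map a) \<le> cnorm (ck_algebra A) a" if "a \<in> carrier (ck_algebra A)" for a
    using E.map_cnorm that unfolding ck_algebra_def by blast
  ultimately show ?thesis by unfold_locales
qed

lemma subst_map_gen: "subst_map (ck_gen A i) = ck_emb B (g i)"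
  using E.map_emb[of "free_gen i"] by (simp add: ck_emb_gen free.eval_poly_gen)

end

section \<open>Rotation of a family by a complex number of modulus 1\<close>

context ck_family
begin

context
  fixes z :: complex assumes z: "cmod z = 1"
begin

lemma cnj_unit: "cnj z * z = 1" "z * cnj z = 1"
  using z by (simp_all add: complex_norm_square[symmetric] mult.commute)

lemmas scaled_simps = smult_mult_left smult_mult_right adj_smult smult_smult cnj_unit mult.assoc

lemma scaled_family: "ck_family R A (\<lambda>i. z \<odot> s i)"
  by unfold_locales
    (simp_all add: A scaled_simps m_closed[simplified] partial_isometry orthogonal source total)

lemma scaled_sword: "sword R (\<lambda>i. z \<odot> s i) \<alpha> = z ^ length \<alpha> \<odot> sw \<alpha>"
  by (induction \<alpha>) (simp_all add: sword_def smult_mult_left smult_mult_right smult_smult sw_closed[unfolded sword_def] mult.commute)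

text \<open>A word of length \<open>m\<close> is scaled by \<open>z ^ m\<close>, which cancels
  against its conjugate in the projection.\<close>

lemma scaled_diag: "diag R A (\<lambda>i. z \<odot> s i) n f = D n f"
proof -
  have "cnj (z ^ m) * z ^ m = 1" for m
    using cnj_unit(1) by (simp add: power_mult_distrib[symmetric])
  then have "sproj R (\<lambda>i. z \<odot> s i) \<alpha> = pr \<alpha>" for \<alpha>
    unfolding sproj_def scaled_sword
    by (simp add: smult_mult_left smult_mult_right adj_smult smult_smult)
  then show ?thesis by (simp add: diag_def)
qed

lemma scaled_gen_sum: "gen_sum R (\<lambda>i. z \<odot> s i) = z \<odot> S"
  unfolding gen_sum_def by (rule finsum_smult[symmetric]) auto

end
end

context ck_mat
begin

lemma gauge_subst: "cmod z = 1 \<Longrightarrow> ck_subst A A (\<lambda>i. z \<odot>\<^bsub>free_star_algebra\<^esub> free_gen i)"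
  using CK.scaled_family[of z] by (intro ck_subst.intro) (simp_all add: emb.hom_smult ck_emb_gen)

lemma gauge_hom: "cmod z = 1 \<Longrightarrow> ck_hom A A (gauge_action A z)"
  and gauge_gen: "cmod z = 1 \<Longrightarrow> gauge_action A z (ck_gen A i) = z \<odot>\<^bsub>ck_algebra A\<^esub> ck_gen A i"
  unfolding gauge_action_def using ck_subst.subst_map_hom[OF gauge_subst] ck_subst.subst_map_gen[OF gauge_subst]
  by (simp_all add: emb.hom_smult ck_emb_gen)

lemma phi_tends:
  assumes X: "O.tends A X a" shows "O.tends A (\<lambda>n. ck_phi A (X n)) (ck_phi A a)"
  unfolding ck_phi_def by (intro O.tends_finsum O.tends_mult O.tends_const X) simp_all

text \<open>On locally constant functions this is \<open>phi_diag\<close>; both claims pass to norm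
  limits.\<close>

lemma phi_diagonal:
  assumes d: "d \<in> diagonal A"
  shows "ck_phi A d \<in> diagonal A" "x \<in> shift_space A \<Longrightarrow> diagonal_fun A (ck_phi A d) x = diagonal_fun A d (shift x)"
proof -
  obtain N F where NF': "\<forall>n. level A (N n) (F n)" and NF2: "O.tends A (\<lambda>n. CK.D (N n) (F n)) d"
    by (rule diagonal_approx[OF d])
  note phi = phi_diag[OF NF'[rule_format]]
  have t: "O.tends A (\<lambda>n. CK.D (Suc (N n)) (\<lambda>x. F n (shift x))) (ck_phi A d)"
    using phi_tends[OF NF2] by (simp add: phi)
  show "ck_phi A d \<in> diagonal A" by (rule diagonal_ops(7)[OF D_diagonal t])
  assume x: "x \<in> shift_space A"
  have "(\<lambda>n. F n (shift x)) \<longlonglongrightarrow> diagonal_fun A (ck_phi A d) x"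
    using ck_fun_tends[OF t, of "gunit x"] x diagonal_fun_D[OF level_shift[OF NF'[rule_format]] x]
    by (simp add: diagonal_fun_def)
  moreover have "(\<lambda>n. F n (shift x)) \<longlonglongrightarrow> diagonal_fun A d (shift x)"
    using ck_fun_tends[OF NF2, of "gunit (shift x)"] diagonal_fun_D[OF NF'[rule_format] shift_in_shift_space[OF x]]
    by (simp add: diagonal_fun_def)
  ultimately show "diagonal_fun A (ck_phi A d) x = diagonal_fun A d (shift x)" by (rule LIMSEQ_unique)
qed

end

section \<open>The isomorphism induced by a conjugacy\<close>

lemma (in shift_conj) h_shift_pow: "x \<in> shift_space A \<Longrightarrow> (shift ^^ m) (h x) = h ((shift ^^ m) x)"
  by (induction m) (auto simp: h_shift shift_funpow_in)

lemma shift_conj_tail: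
  assumes "shift_conj A B h k" "x \<in> shift_space A" "y \<in> shift_space A"
  shows "(shift ^^ i) (h x) = (shift ^^ j) (h y) \<longleftrightarrow> (shift ^^ i) x = (shift ^^ j) y"
proof -
  interpret shift_conj A B h k by fact
  show ?thesis using h_shift_pow kh shift_funpow_in assms(2,3) by metis
qed

lemma shift_conj_groupoid:
  assumes "shift_conj A B h k" "x \<in> shift_space A" "y \<in> shift_space A"
  shows "(h x, n, h y) \<in> ck_groupoid B \<longleftrightarrow> (x, n, y) \<in> ck_groupoid A"
proof -
  interpret shift_conj A B h k by fact
  show ?thesis using assms(2,3) by (simp add: groupoid_iff h_in shift_conj_tail[OF assms])
qed

locale conj_alg = shift_conj A B h k
  for A :: "nat^'n::finite^'n" and B :: "nat^'m::finite^'m"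
    and h :: "(nat \<Rightarrow> 'n) \<Rightarrow> nat \<Rightarrow> 'm" and k :: "(nat \<Rightarrow> 'm) \<Rightarrow> nat \<Rightarrow> 'n"
begin

sublocale MA: ck_mat A by unfold_locales (rule mat_A)
sublocale MB: ck_mat B by unfold_locales (rule mat_B)
sublocale T: ck_conj "ck_algebra B" B "ck_gen B" A h k
  by (intro ck_conj.intro MB.CK.ck_family_axioms shift_conj_axioms)

text \<open>A polynomial lift of \<open>T.t i\<close>, so that \<open>ck_subst\<close>
  applies.\<close>

definition conj_poly :: "'n \<Rightarrow> 'm star_poly" where
  "conj_poly i = MB.free_diag (Suc conj_level) (T.letter i) \<otimes>\<^bsub>free_star_algebra\<^esub> gen_sum free_star_algebra free_gen"

lemma conj_poly_closed [simp]: "conj_poly i \<in> carrier free_star_algebra"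
  by (simp add: conj_poly_def free.gen_sum_closed)

lemma emb_conj_poly: "ck_emb B (conj_poly i) = T.t i"
  by (simp add: conj_poly_def T.t_def emb.hom_mult MB.emb_free_diag emb.hom_gen_sum ck_emb_gen free.gen_sum_closed)

sublocale TS: ck_subst A B conj_poly
  by (rule ck_subst.intro) (simp_all add: emb_conj_poly T.conj_family)

definition conj_map :: "'n ck_elem \<Rightarrow> 'm ck_elem" where "conj_map = TS.subst_map"

sublocale P: ck_hom A B conj_map
  unfolding conj_map_def by (rule TS.subst_map_hom)

lemma conj_map_gen: "conj_map (ck_gen A i) = T.t i"
  by (simp add: conj_map_def TS.subst_map_gen emb_conj_poly)

lemma conj_map_diag: "conj_map (MA.CK.D n f) = diag (ck_algebra B) A T.t n f"
  and conj_map_gen_sum: "conj_map MA.CK.S = MB.CK.S"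
  by (simp_all add: P.hom_diag P.hom_gen_sum conj_map_gen T.conj_gen_sum)

lemma conj_map_D:
  assumes f: "level A n f"
  shows "conj_map (MA.CK.D n f) \<in> diagonal B"
    and "y \<in> shift_space B \<Longrightarrow> diagonal_fun B (conj_map (MA.CK.D n f)) y = f (k y)"
proof -
  obtain M where M: "\<And>m. m \<ge> M \<Longrightarrow> diag (ck_algebra B) A T.t n f = MB.CK.D m (\<lambda>y. f (k y))"
    using T.conj_diag[OF f] by blast
  obtain m where m: "level B m (\<lambda>y. f (k y))" using level_comp[OF f] by blast
  have eq: "conj_map (MA.CK.D n f) = MB.CK.D (max M m) (\<lambda>y. f (k y))"
    unfolding conj_map_diag by (rule M) simp
  show "conj_map (MA.CK.D n f) \<in> diagonal B" unfolding eq by (rule MB.D_diagonal)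
  show "y \<in> shift_space B \<Longrightarrow> diagonal_fun B (conj_map (MA.CK.D n f)) y = f (k y)"
    unfolding eq by (rule MB.diagonal_fun_D[OF level_mono[OF m]]) simp_all
qed

lemma conj_map_diagonal:
  assumes d: "d \<in> diagonal A"
  shows "conj_map d \<in> diagonal B"
    and "y \<in> shift_space B \<Longrightarrow> diagonal_fun B (conj_map d) y = diagonal_fun A d (k y)"
proof -
  obtain N F where NF': "\<forall>n. level A (N n) (F n)" and NF2: "O.tends A (\<lambda>n. MA.CK.D (N n) (F n)) d"
    by (rule MA.diagonal_approx[OF d])
  note D = conj_map_D[OF NF'[rule_format]]
  show "conj_map d \<in> diagonal B" by (rule MB.diagonal_ops(7)[OF D(1) P.hom_tends[OF NF2]])
  assume y: "y \<in> shift_space B"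
  have "(\<lambda>n. F n (k y)) \<longlonglongrightarrow> diagonal_fun B (conj_map d) y"
    using MB.ck_fun_tends[OF P.hom_tends[OF NF2], of "gunit y"] D(2)[OF y] by (simp add: diagonal_fun_def)
  moreover have "(\<lambda>n. F n (k y)) \<longlonglongrightarrow> diagonal_fun A d (k y)"
    using MA.ck_fun_tends[OF NF2, of "gunit (k y)"] MA.diagonal_fun_D[OF NF'[rule_format] k_in[OF y]]
    by (simp add: diagonal_fun_def)
  ultimately show "diagonal_fun B (conj_map d) y = diagonal_fun A d (k y)" by (rule LIMSEQ_unique)
qed

lemma conj_map_phi:
  assumes d: "d \<in> diagonal A" shows "conj_map (ck_phi A d) = ck_phi B (conj_map d)"
proof (rule MB.diagonal_eqI)
  note D = conj_map_diagonal[OF d] and D' = conj_map_diagonal[OF MA.phi_diagonal(1)[OF d]]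
  show "conj_map (ck_phi A d) \<in> diagonal B" "ck_phi B (conj_map d) \<in> diagonal B"
    by (rule D' MB.phi_diagonal D)+
  fix y assume y: "y \<in> shift_space B"
  show "diagonal_fun B (conj_map (ck_phi A d)) y = diagonal_fun B (ck_phi B (conj_map d)) y"
    using D'(2)[OF y] MB.phi_diagonal(2)[OF D(1) y] MA.phi_diagonal(2)[OF d k_in[OF y]]
      D(2)[OF shift_in_shift_space[OF y]] by (simp add: k_shift y)
qed

lemma conj_map_tau:
  assumes a: "a \<in> carrier (ck_algebra A)" shows "conj_map (ck_tau A a) = ck_tau B (conj_map a)"
  using a unfolding ck_tau_def MA.gen_sum_S MB.gen_sum_S
  by (simp add: P.hom_mult P.hom_adj conj_map_gen_sum)

text \<open>On generators, the gauge action fixes the diagonal factor of \<open>T.t i\<close> and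
  multiplies the sum of the generators by \<open>z\<close>.\<close>

lemma conj_map_gauge:
  assumes z: "cmod z = 1" and a: "a \<in> carrier (ck_algebra A)"
  shows "conj_map (gauge_action A z a) = gauge_action B z (conj_map a)"
proof (rule ck_hom_eqI[OF ck_hom_comp[OF MA.gauge_hom[OF z] P.ck_hom_axioms]
      ck_hom_comp[OF P.ck_hom_axioms MB.gauge_hom[OF z]] _ a])
  fix i
  interpret Z: ck_hom B B "gauge_action B z" by (rule MB.gauge_hom[OF z])
  have "gauge_action B z (T.t i) = diag (ck_algebra B) B (\<lambda>i. z \<odot>\<^bsub>ck_algebra B\<^esub> ck_gen B i) (Suc conj_level) (T.letter i)
      \<otimes>\<^bsub>ck_algebra B\<^esub> gen_sum (ck_algebra B) (\<lambda>i. z \<odot>\<^bsub>ck_algebra B\<^esub> ck_gen B i)"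
    by (simp add: T.t_def Z.hom_mult Z.hom_diag Z.hom_gen_sum MB.gauge_gen[OF z])
  also have "\<dots> = z \<odot>\<^bsub>ck_algebra B\<^esub> T.t i"
    by (simp add: MB.CK.scaled_diag[OF z] MB.CK.scaled_gen_sum[OF z] T.t_def O.smult_mult_right)
  finally show "conj_map (gauge_action A z (ck_gen A i)) = gauge_action B z (conj_map (ck_gen A i))"
    by (simp add: MA.gauge_gen[OF z] P.hom_smult conj_map_gen)
qed

text \<open>Applying \<open>conj_map\<close> to the family of the reverse construction replaces each
  generator for \<open>A\<close> by \<open>T.t\<close>. The result is the family of the construction
  applied twice, which by \<open>conj_conj\<close> consists of the original generators.\<close>

lemma conj_map_inverse:
  assumes b: "b \<in> carrier (ck_algebra B)"
  shows "conj_map (conj_alg.conj_map A h b) = b"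
proof -
  interpret V: conj_alg B A k h by (intro conj_alg.intro sym)
  interpret U: ck_conj "ck_algebra B" A T.t B k h by (intro ck_conj.intro T.conj_family sym)
  show ?thesis
  proof (rule ck_hom_eqI[OF ck_hom_comp[OF V.P.ck_hom_axioms P.ck_hom_axioms] ck_hom_id _ b])
    fix j
    have "conj_map (V.T.t j) = U.t j"
      by (simp add: V.T.t_def U.t_def P.hom_mult P.hom_diag P.hom_gen_sum conj_map_gen)
    then show "conj_map (V.conj_map (ck_gen B j)) = ck_gen B j"
      by (simp add: V.conj_map_gen T.conj_conj)
  qed
qed

text \<open>The groupoid counterpart of \<open>conj_map\<close>. As \<open>cond_exp\<close> is
  defined through \<open>ck_fun\<close>, its compatibility requires the effect of
  \<open>conj_map\<close> on the function of an arbitrary element.\<close>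

definition pull :: "('n arrow \<Rightarrow> complex) \<Rightarrow> 'm arrow \<Rightarrow> complex" where
  "pull f = (\<lambda>(y, n, z). if y \<in> shift_space B \<and> z \<in> shift_space B then f (k y, n, k z) else 0)"

lemma pull_apply: "pull f (y, n, z) = (if y \<in> shift_space B \<and> z \<in> shift_space B then f (k y, n, k z) else 0)"
  by (simp add: pull_def)

lemma ker_pull: "ker (pull f) i j =
    (if fst i \<in> shift_space B \<and> fst j \<in> shift_space B then ker f (map_prod k id i) (map_prod k id j) else 0)"
  by (simp add: ker_def pull_apply)

lemma pull_closed:
  assumes f: "f \<in> carrier (kernel_algebra A)" shows "pull f \<in> carrier (kernel_algebra B)"
proof (rule kernel_carrierI)
  fix \<gamma> assume \<gamma>: "\<gamma> \<notin> ck_groupoid B"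
  obtain y n z where yz: "\<gamma> = (y, n, z)" by (cases \<gamma>)
  show "pull f \<gamma> = 0"
    using \<gamma> kernel_carrierD(1)[OF f, of "(k y, n, k z)"] shift_conj_groupoid[OF sym, of y z n]
    by (auto simp: yz pull_apply)
next
  have inv: "i = map_prod h id (map_prod k id i)" if "fst i \<in> shift_space B" for i :: "'m index"
    using that by (cases i) (simp add: hk)
  fix j
  have "{i. ker (pull f) i j \<noteq> 0} \<subseteq> map_prod h id ` {i. ker f i (map_prod k id j) \<noteq> 0}"
  proof
    fix i assume "i \<in> {i. ker (pull f) i j \<noteq> 0}"
    then show "i \<in> map_prod h id ` {i. ker f i (map_prod k id j) \<noteq> 0}"
      by (intro image_eqI[of _ _ "map_prod k id i"] inv) (auto simp: ker_pull split: if_splits)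
  qed
  then show "finite {i. ker (pull f) i j \<noteq> 0}"
    by (rule finite_subset) (intro finite_imageI kernel_carrierD(2)[OF f])
  have "{i. ker (pull f) j i \<noteq> 0} \<subseteq> map_prod h id ` {i. ker f (map_prod k id j) i \<noteq> 0}"
  proof
    fix i assume "i \<in> {i. ker (pull f) j i \<noteq> 0}"
    then show "i \<in> map_prod h id ` {i. ker f (map_prod k id j) i \<noteq> 0}"
      by (intro image_eqI[of _ _ "map_prod k id i"] inv) (auto simp: ker_pull split: if_splits)
  qed
  then show "finite {i. ker (pull f) j i \<noteq> 0}"
    by (rule finite_subset) (intro finite_imageI kernel_carrierD(3)[OF f])
qed

text \<open>The intermediate index is transported by \<open>k\<close> and back by \<open>h\<close>;
  nonzero terms have it over the shift space, so the correspondence is bijective.\<close>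

lemma pull_mult:
  assumes f: "f \<in> carrier (kernel_algebra A)" and g: "g \<in> carrier (kernel_algebra A)"
  shows "pull (f \<otimes>\<^bsub>kernel_algebra A\<^esub> g) = pull f \<otimes>\<^bsub>kernel_algebra B\<^esub> pull g"
proof (rule ker_eqI)
  fix i l
  have "ker (pull f \<otimes>\<^bsub>kernel_algebra B\<^esub> pull g) i l = (\<Sum>j | ker (pull g) j l \<noteq> 0. ker (pull f) i j * ker (pull g) j l)"
    by (simp add: kernel_mult[OF pull_closed[OF f] pull_closed[OF g]] act_def)
  also have "\<dots> = ker (pull (f \<otimes>\<^bsub>kernel_algebra A\<^esub> g)) i l"
  proof (cases "fst i \<in> shift_space B \<and> fst l \<in> shift_space B")
    case True
    have inA: "fst j \<in> shift_space A" if "ker g j (map_prod k id l) \<noteq> 0" for j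
      using ker_outside[OF g that] by (simp add: groupoid_iff)
    have "(\<Sum>j | ker (pull g) j l \<noteq> 0. ker (pull f) i j * ker (pull g) j l) =
        (\<Sum>j | ker g j (map_prod k id l) \<noteq> 0. ker f (map_prod k id i) j * ker g j (map_prod k id l))"
      by (rule sum.reindex_bij_witness[of _ "map_prod h id" "map_prod k id"])
        (use True inA in \<open>auto simp: ker_pull hk kh h_in split: if_splits\<close>)
    then show ?thesis using True by (simp add: ker_pull kernel_mult[OF f g] act_def)
  next
    case False
    then show ?thesis by (auto simp: ker_pull intro!: sum.neutral)
  qed
  finally show "ker (pull (f \<otimes>\<^bsub>kernel_algebra A\<^esub> g)) i l = ker (pull f \<otimes>\<^bsub>kernel_algebra B\<^esub> pull g) i l" ..
qed

lemma pull_hom: "star_hom (kernel_algebra A) (kernel_algebra B) pull"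
  unfolding star_hom_def
proof (intro conjI ballI allI)
  show "pull \<in> carrier (kernel_algebra A) \<rightarrow> carrier (kernel_algebra B)" using pull_closed by blast
  have inj: "k y = k z \<longleftrightarrow> y = z" if "y \<in> shift_space B" "z \<in> shift_space B" for y z
    using that hk by metis
  show "pull \<one>\<^bsub>kernel_algebra A\<^esub> = \<one>\<^bsub>kernel_algebra B\<^esub>"
  proof
    fix \<gamma> :: "'m arrow"
    obtain y n z where "\<gamma> = (y, n, z)" by (cases \<gamma>)
    then show "pull \<one>\<^bsub>kernel_algebra A\<^esub> \<gamma> = \<one>\<^bsub>kernel_algebra B\<^esub> \<gamma>"
      using inj[of y z] by (simp add: pull_apply kernel_simps indicator_def unit_space_iff k_in) blast
  qed
qed (auto simp: pull_mult kernel_simps fun_eq_iff pull_apply)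

text \<open>On the groupoid, the sum of the generators is the indicator of all arrows
  \<open>(y, 1, shift y)\<close>, and multiplying by the letter projection keeps those with
  \<open>k y 0 = i\<close>.\<close>

lemma pull_groupoid_gen: "pull (groupoid_gen A i) = keval B (conj_poly i)"
proof
  fix \<gamma> :: "'m arrow"
  obtain y n z where yz: "\<gamma> = (y, n, z)" by (cases \<gamma>)
  have S: "MB.G.S \<gamma> = (\<Sum>j\<in>UNIV. groupoid_gen B j \<gamma>)"
    unfolding gen_sum_def using MB.G.s_closed by (subst kernel_finsum) auto
  have S': "MB.G.S (y, n, z) = (if y \<in> shift_space B \<and> n = 1 \<and> z = shift y then 1 else 0)"
    using S by (simp add: yz groupoid_gen_apply sum.If_cases)
  have lev: "level B (Suc conj_level) (T.letter i)" by (rule level_mono[OF T.level_letter]) simp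
  have gens: "keval B (free_gen j) = groupoid_gen B j" for j
    using MB.G.s_closed by (rule K.eval_poly_gen)
  have "keval B (conj_poly i) \<gamma> = (MB.G.D (Suc conj_level) (T.letter i) \<otimes>\<^bsub>kernel_algebra B\<^esub> MB.G.S) \<gamma>"
    by (simp add: conj_poly_def keval.hom_mult MB.keval_free_diag keval.hom_gen_sum gens free.gen_sum_closed)
  also have "\<dots> = MB.G.D (Suc conj_level) (T.letter i) (y, 0, y) * MB.G.S (y, n, z)"
    unfolding yz by (rule diag_kernel_mult) (auto simp: MB.groupoid_diag[OF lev] split: if_splits)
  also have "\<dots> = pull (groupoid_gen A i) \<gamma>"
  proof -
    have "k z = shift (k y) \<longleftrightarrow> z = shift y" if "y \<in> shift_space B" "z \<in> shift_space B"
      using that k_shift[of y] hk[of z] hk[OF shift_in_shift_space, of y] by metis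
    then show ?thesis
      by (auto simp: MB.groupoid_diag[OF lev] S' yz pull_apply groupoid_gen_apply T.letter_def k_in shift_in_shift_space)
  qed
  finally show "pull (groupoid_gen A i) \<gamma> = keval B (conj_poly i) \<gamma>" ..
qed

lemma pull_keval:
  assumes p: "p \<in> carrier free_star_algebra"
  shows "keval B (eval_poly free_star_algebra conj_poly p) = pull (keval A p)"
proof -
  have "(keval B \<circ> eval_poly free_star_algebra conj_poly) p = (pull \<circ> keval A) p"
  proof (rule star_hom_free_eqI[OF star_hom_comp[OF TS.subst_hom keval.hom] star_hom_comp[OF keval.hom pull_hom]
        kernel_star_alg _ p])
    fix i
    have "keval A (free_gen i) = groupoid_gen A i" using MA.G.s_closed by (rule K.eval_poly_gen)
    then show "(keval B \<circ> eval_poly free_star_algebra conj_poly) (free_gen i) = (pull \<circ> keval A) (free_gen i)"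
      by (simp add: free.eval_poly_gen pull_groupoid_gen)
  qed
  then show ?thesis by simp
qed

lemma ck_fun_conj_map:
  assumes a: "a \<in> carrier (ck_algebra A)" and y: "y \<in> shift_space B"
  shows "ck_fun B (conj_map a) (gunit y) = ck_fun A a (gunit (k y))"
proof -
  obtain X where X: "X \<in> O.C A" "\<forall>n. X n \<in> carrier free_star_algebra" "a = O.cls A X"
    by (rule ck_approx[OF a]) blast
  have "(\<lambda>n. keval B (eval_poly free_star_algebra conj_poly (X n)) (gunit y)) \<longlonglongrightarrow> ck_fun B (conj_map a) (gunit y)"
    using MB.ck_fun_tendsto[OF TS.E.hom_cauchy[OF X(1)], of "gunit y"] TS.E.map_cls[OF X(1)]
    by (simp add: conj_map_def X(3))
  then have "(\<lambda>n. keval A (X n) (gunit (k y))) \<longlonglongrightarrow> ck_fun B (conj_map a) (gunit y)"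
    using X(2) y by (simp add: pull_keval gunit_def pull_apply)
  then show ?thesis using MA.ck_fun_tendsto[OF X(1), of "gunit (k y)"] X(3) LIMSEQ_unique by blast
qed

lemma conj_map_cond_exp:
  assumes a: "a \<in> carrier (ck_algebra A)"
  shows "conj_map (cond_exp A a) = cond_exp B (conj_map a)"
proof (rule MB.diagonal_eqI)
  note E = MA.cond_exp[OF a] and E' = MB.cond_exp[OF P.hom_closed[OF a]]
  show "conj_map (cond_exp A a) \<in> diagonal B" "cond_exp B (conj_map a) \<in> diagonal B"
    by (rule conj_map_diagonal(1)[OF E(1)] E'(1))+
  fix y assume y: "y \<in> shift_space B"
  show "diagonal_fun B (conj_map (cond_exp A a)) y = diagonal_fun B (cond_exp B (conj_map a)) y"
    using conj_map_diagonal(2)[OF E(1) y] E(2)[OF k_in[OF y]] E'(2)[OF y] ck_fun_conj_map[OF a y] by simp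
qed

lemma conj_map_bij: "bij_betw conj_map (carrier (ck_algebra A)) (carrier (ck_algebra B))"
  and conj_map_diagonal_bij: "bij_betw conj_map (diagonal A) (diagonal B)"
proof -
  interpret V: conj_alg B A k h by (intro conj_alg.intro sym)
  note inv = conj_map_inverse V.conj_map_inverse
  show "bij_betw conj_map (carrier (ck_algebra A)) (carrier (ck_algebra B))"
    by (rule bij_betw_byWitness[where f' = V.conj_map]) (auto simp: inv)
  have "a \<in> carrier (ck_algebra A)" if "a \<in> diagonal A" for a using that MA.diagonal_ops(1) by blast
  moreover have "b \<in> carrier (ck_algebra B)" if "b \<in> diagonal B" for b using that MB.diagonal_ops(1) by blast
  ultimately show "bij_betw conj_map (diagonal A) (diagonal B)"
    by (intro bij_betw_byWitness[where f' = V.conj_map])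
      (auto simp: inv conj_map_diagonal(1) V.conj_map_diagonal(1))
qed

lemma conj_map_iso: "star_iso (ck_algebra A) (ck_algebra B) conj_map"
  using conj_map_bij by (auto simp: star_iso_def ring_iso_def ring_hom_def P.hom_mult P.hom_add P.hom_smult P.hom_adj)

lemma conj_map_diagonal_iso: "star_iso (diagonal_algebra A) (diagonal_algebra B) conj_map"
proof -
  have c: "a \<in> carrier (ck_algebra A)" if "a \<in> diagonal A" for a using that MA.diagonal_ops(1) by blast
  show ?thesis
    using conj_map_diagonal_bij by (auto simp: star_iso_def ring_iso_def ring_hom_def diagonal_algebra_def
        conj_map_diagonal(1) c P.hom_mult P.hom_add P.hom_smult P.hom_adj)
qed

end

section \<open>Recovering the shift\<close>

text \<open>Continuity makes each prefix of \<open>h x\<close> locally constant, and compactness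
  makes the dependence uniform.\<close>

lemma continuous_level:
  fixes A :: "nat^'n::finite^'n"
  assumes "continuous_map (shift_topology A) (shift_topology B) h"
  shows "\<exists>n. level A n (\<lambda>x. prefix m (h x))"
proof (rule local_level)
  fix x assume x: "x \<in> shift_space A"
  define U where "U = {y \<in> shift_space B. prefix m y = prefix m (h x)}"
  have hx: "h y \<in> shift_space B" if "y \<in> shift_space A" for y
    using assms that by (auto simp: continuous_map_def)
  have "openin (shift_topology B) U"
    unfolding openin_shift_iff by (auto simp: U_def intro!: exI[of _ m])
  then have "openin (shift_topology A) {y \<in> shift_space A. h y \<in> U}"
    using assms by (auto simp: continuous_map_def)
  moreover have "x \<in> {y \<in> shift_space A. h y \<in> U}" using x hx by (simp add: U_def)
  ultimately obtain n where "\<forall>y\<in>shift_space A. prefix n y = prefix n x \<longrightarrow> y \<in> {y \<in> shift_space A. h y \<in> U}"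
    unfolding openin_shift_iff by blast
  then show "\<exists>n. \<forall>y\<in>shift_space A. prefix n y = prefix n x \<longrightarrow> prefix m (h y) = prefix m (h x)"
    by (intro exI[of _ n]) (auto simp: U_def)
qed

lemma shift_homeo_ex:
  fixes A :: "nat^'n::finite^'n" and B :: "nat^'m::finite^'m"
  assumes "ck_matrix A" "ck_matrix B" "homeomorphic_map (shift_topology A) (shift_topology B) h"
  obtains k where "shift_homeo A B h k"
proof -
  obtain k where "homeomorphic_maps (shift_topology A) (shift_topology B) h k"
    using assms(3) by (auto simp: homeomorphic_map_maps)
  then have c: "continuous_map (shift_topology A) (shift_topology B) h" "continuous_map (shift_topology B) (shift_topology A) k"
    and inv: "\<And>x. x \<in> shift_space A \<Longrightarrow> k (h x) = x" "\<And>y. y \<in> shift_space B \<Longrightarrow> h (k y) = y"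
    by (auto simp: homeomorphic_maps_def)
  have "h x \<in> shift_space B" if "x \<in> shift_space A" for x using c(1) that by (auto simp: continuous_map_def)
  moreover have "k y \<in> shift_space A" if "y \<in> shift_space B" for y using c(2) that by (auto simp: continuous_map_def)
  ultimately have "shift_homeo A B h k"
    using assms(1,2) inv continuous_level[OF c(1)] continuous_level[OF c(2)] by (intro shift_homeo.intro) auto
  then show ?thesis by (rule that)
qed

lemma (in ck_mat) pr_prefix_nonzero:
  assumes x: "x \<in> shift_space A" shows "CK.pr (prefix m x) \<noteq> \<zero>\<^bsub>ck_algebra A\<^esub>"
proof
  assume 0: "CK.pr (prefix m x) = \<zero>\<^bsub>ck_algebra A\<^esub>"
  have lev: "level A m (\<lambda>y. of_bool (prefix m y = prefix m x) :: complex)" "level A m (\<lambda>y. 0 :: complex)"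
    by (simp_all add: level_def)
  have "CK.D m (\<lambda>y. of_bool (prefix m y = prefix m x)) = CK.D m (\<lambda>y. 0)"
    using CK.D_prefix[of "prefix m x"] 0 by (simp add: CK.D_zero)
  then show False using diagonal_fun_D[OF lev(1) x] diagonal_fun_D[OF lev(2) x] by simp
qed

context shift_homeo
begin

interpretation MA: ck_mat A by unfold_locales (rule mat_A)
interpretation MB: ck_mat B by unfold_locales (rule mat_B)

lemma inv_h: "y \<in> shift_space B \<Longrightarrow> inv_into (shift_space A) h y = k y"
  by (rule inv_into_f_eq) (auto simp: hk k_in intro: inj_on_inverseI[of _ k] kh)

lemma implements_D:
  assumes imp: "implements_on_diagonal A B h \<Theta>" and f: "level A n f"
  obtains m where "level B m (\<lambda>y. f (k y))" "\<Theta> (MA.CK.D n f) = MB.CK.D m (\<lambda>y. f (k y))"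
proof -
  obtain m where m: "level B m (\<lambda>y. f (k y))" using level_comp[OF f] by blast
  have "\<Theta> (MA.CK.D n f) = MB.CK.D m (\<lambda>y. f (k y))"
  proof (rule MB.diagonal_eqI)
    show "\<Theta> (MA.CK.D n f) \<in> diagonal B" "MB.CK.D m (\<lambda>y. f (k y)) \<in> diagonal B"
      using imp MA.D_diagonal MB.D_diagonal by (auto simp: implements_on_diagonal_def)
    fix y assume y: "y \<in> shift_space B"
    have "diagonal_fun B (\<Theta> (MA.CK.D n f)) y = diagonal_fun A (MA.CK.D n f) (k y)"
      using imp MA.D_diagonal[of n f] y inv_h[OF y] by (simp add: implements_on_diagonal_def)
    then show "diagonal_fun B (\<Theta> (MA.CK.D n f)) y = diagonal_fun B (MB.CK.D m (\<lambda>y. f (k y))) y"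
      using MA.diagonal_fun_D[OF f k_in[OF y]] MB.diagonal_fun_D[OF m y] by simp
  qed
  then show ?thesis using m that by blast
qed

text \<open>Evaluated at \<open>h x\<close>, the images of cylinder functions around
  \<open>shift x\<close> show that \<open>k (shift (h x))\<close> and \<open>shift x\<close> have
  the same prefixes of every length.\<close>

lemma conj_if_phi:
  assumes imp: "implements_on_diagonal A B h \<Theta>"
    and phi: "\<And>f. f \<in> diagonal A \<Longrightarrow> \<Theta> (ck_phi A f) = ck_phi B (\<Theta> f)"
    and x: "x \<in> shift_space A"
  shows "h (shift x) = shift (h x)"
proof -
  have hx: "h x \<in> shift_space B" "shift (h x) \<in> shift_space B" using x by (auto intro: h_in shift_in_shift_space)
  note imp' = imp[unfolded implements_on_diagonal_def, rule_format]
  have "prefix n (k (shift (h x))) = prefix n (shift x)" for n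
  proof -
    let ?f = "\<lambda>z. of_bool (prefix n z = prefix n (shift x)) :: complex"
    have lev: "level A n ?f" by (simp add: level_def)
    let ?d = "MA.CK.D n ?f"
    have d: "?d \<in> diagonal A" "ck_phi A ?d \<in> diagonal A" by (rule MA.D_diagonal MA.phi_diagonal)+
    have "diagonal_fun B (\<Theta> (ck_phi A ?d)) (h x) = ?f (shift x)"
      using imp'[OF d(2)] hx inv_h[OF hx(1)] MA.phi_diagonal(2)[OF d(1) x]
        MA.diagonal_fun_D[OF lev shift_in_shift_space[OF x]] by (simp add: kh x)
    moreover have "diagonal_fun B (ck_phi B (\<Theta> ?d)) (h x) = ?f (k (shift (h x)))"
      using imp'[OF d(1)] hx inv_h[OF hx(2)] MB.phi_diagonal(2)[OF _ hx(1), of "\<Theta> ?d"]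
        MA.diagonal_fun_D[OF lev k_in[OF hx(2)]] by simp
    ultimately show ?thesis using phi[OF d(1)] by (auto split: if_splits)
  qed
  then have "k (shift (h x)) n = shift x n" for n
    using prefix_eq_iff[of "Suc n"] by blast
  then have "k (shift (h x)) = shift x" by blast
  then show ?thesis using hk[OF hx(2)] by simp
qed

text \<open>If \<open>\<sigma> x\<close> and \<open>x\<^sub>1 = h\<^sup>-\<^sup>1 (\<sigma> (h x))\<close> were different, a cylinder \<open>f\<close> around \<open>x\<^sub>1\<close> and a cylinder \<open>g\<close>
  around \<open>x\<close> would satisfy \<open>g \<tau>(f) = 0\<close>. But the image of this product compresses to a nonzero
  projection.\<close>

lemma conj_if_tau:
  assumes iso: "star_iso (ck_algebra A) (ck_algebra B) \<Psi>" and imp: "implements_on_diagonal A B h \<Psi>"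
    and tau: "\<And>a. a \<in> carrier (ck_algebra A) \<Longrightarrow> \<Psi> (ck_tau A a) = ck_tau B (\<Psi> a)"
    and x: "x \<in> shift_space A"
  shows "h (shift x) = shift (h x)"
proof (rule ccontr)
  assume neq: "h (shift x) \<noteq> shift (h x)"
  have hx: "h x \<in> shift_space B" "shift (h x) \<in> shift_space B" using x by (auto intro: h_in shift_in_shift_space)
  define x1 where "x1 = k (shift (h x))"
  have "x1 \<noteq> shift x" using neq hk[OF hx(2)] by (auto simp: x1_def)
  then obtain j where "x1 j \<noteq> shift x j" by blast
  then have pre: "prefix (Suc j) x1 \<noteq> prefix (Suc j) (shift x)" unfolding prefix_eq_iff by blast
  \<comment> \<open>Long enough to separate \<open>x1\<close> from \<open>shift x\<close>;
    \<open>g\<close> looks one letter further, so that \<open>n\<close> letters are left after a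
    shift.\<close>
  define n where "n = Suc j"
  define f g where "f = (\<lambda>z. of_bool (prefix n z = prefix n x1) :: complex)"
    and "g = (\<lambda>z. of_bool (prefix (Suc n) z = prefix (Suc n) x) :: complex)"
  have f: "level A n f" and g: "level A (Suc n) g" by (simp_all add: level_def f_def g_def)
  have gf: "g z * f (shift z) = 0" for z
    using pre by (auto simp: f_def g_def prefix_Suc n_def[symmetric])
  have "MA.CK.D (Suc n) g \<otimes>\<^bsub>ck_algebra A\<^esub> (MA.CK.S \<otimes>\<^bsub>ck_algebra A\<^esub> MA.CK.D n f) =
      (MA.CK.D (Suc n) g \<otimes>\<^bsub>ck_algebra A\<^esub> MA.CK.D (Suc n) (\<lambda>z. f (shift z))) \<otimes>\<^bsub>ck_algebra A\<^esub> MA.CK.S"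
    by (simp add: MA.CK.D_shift_times_S[OF f, symmetric] O.m_assoc)
  also have "\<dots> = \<zero>\<^bsub>ck_algebra A\<^esub>" by (simp add: MA.CK.D_mult gf MA.CK.D_zero)
  finally have "(MA.CK.D (Suc n) g \<otimes>\<^bsub>ck_algebra A\<^esub> (MA.CK.S \<otimes>\<^bsub>ck_algebra A\<^esub> MA.CK.D n f))
      \<otimes>\<^bsub>ck_algebra A\<^esub> adj (ck_algebra A) MA.CK.S = \<zero>\<^bsub>ck_algebra A\<^esub>" by simp
  then have zA: "MA.CK.D (Suc n) g \<otimes>\<^bsub>ck_algebra A\<^esub> ck_tau A (MA.CK.D n f) = \<zero>\<^bsub>ck_algebra A\<^esub>"
    by (simp add: ck_tau_def MA.gen_sum_S O.m_assoc)
  obtain m1 where m1: "level B m1 (\<lambda>y. g (k y))" "\<Psi> (MA.CK.D (Suc n) g) = MB.CK.D m1 (\<lambda>y. g (k y))"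
    by (rule implements_D[OF imp g])
  obtain m2 where m2: "level B m2 (\<lambda>y. f (k y))" "\<Psi> (MA.CK.D n f) = MB.CK.D m2 (\<lambda>y. f (k y))"
    by (rule implements_D[OF imp f])
  \<comment> \<open>A common level, so that covariance for \<open>B\<close> applies at level
    \<open>m\<close> and the product is formed at \<open>Suc m\<close>.\<close>
  define m where "m = max m1 m2"
  have Dg: "\<Psi> (MA.CK.D (Suc n) g) = MB.CK.D (Suc m) (\<lambda>y. g (k y))"
    and Df: "\<Psi> (MA.CK.D n f) = MB.CK.D m (\<lambda>y. f (k y))"
    unfolding m1(2) m2(2) by (rule MB.CK.D_level[symmetric, OF m1(1)], simp add: m_def,
        rule MB.CK.D_level[symmetric, OF m2(1)], simp add: m_def)
  have levf: "level B m (\<lambda>y. f (k y))" and levg: "level B (Suc m) (\<lambda>y. g (k y))"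
    by (rule level_mono[OF m2(1)], simp add: m_def, rule level_mono[OF m1(1)], simp add: m_def)
  have mult: "\<Psi> (a \<otimes>\<^bsub>ck_algebra A\<^esub> b) = \<Psi> a \<otimes>\<^bsub>ck_algebra B\<^esub> \<Psi> b"
    and smult: "\<Psi> (c \<odot>\<^bsub>ck_algebra A\<^esub> a) = c \<odot>\<^bsub>ck_algebra B\<^esub> \<Psi> a" and cl: "\<Psi> a \<in> carrier (ck_algebra B)"
    if "a \<in> carrier (ck_algebra A)" "b \<in> carrier (ck_algebra A)" for a b c
    using iso that by (auto simp: star_iso_def ring_iso_def ring_hom_def)
  have "\<Psi> \<zero>\<^bsub>ck_algebra A\<^esub> = \<zero>\<^bsub>ck_algebra B\<^esub>"
    using smult[of "\<zero>\<^bsub>ck_algebra A\<^esub>" "\<zero>\<^bsub>ck_algebra A\<^esub>" 0] cl[of "\<zero>\<^bsub>ck_algebra A\<^esub>" "\<zero>\<^bsub>ck_algebra A\<^esub>"] by simp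
  then have "MB.CK.D (Suc m) (\<lambda>y. g (k y)) \<otimes>\<^bsub>ck_algebra B\<^esub> ck_tau B (MB.CK.D m (\<lambda>y. f (k y))) = \<zero>\<^bsub>ck_algebra B\<^esub>"
    using arg_cong[OF zA, of \<Psi>] mult[of "MA.CK.D (Suc n) g" "ck_tau A (MA.CK.D n f)"] tau[of "MA.CK.D n f"]
    by (simp add: Dg Df) (simp add: ck_tau_def MA.gen_sum_S)
  then have "MB.CK.D (Suc m) (\<lambda>y. g (k y)) \<otimes>\<^bsub>ck_algebra B\<^esub> (MB.CK.S \<otimes>\<^bsub>ck_algebra B\<^esub> MB.CK.D m (\<lambda>y. f (k y)))
      \<otimes>\<^bsub>ck_algebra B\<^esub> adj (ck_algebra B) MB.CK.S = \<zero>\<^bsub>ck_algebra B\<^esub>"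
    by (simp add: ck_tau_def MB.gen_sum_S O.m_assoc)
  then have zB: "(MB.CK.D (Suc m) (\<lambda>y. g (k y) * f (k (shift y))) \<otimes>\<^bsub>ck_algebra B\<^esub> MB.CK.S)
      \<otimes>\<^bsub>ck_algebra B\<^esub> adj (ck_algebra B) MB.CK.S = \<zero>\<^bsub>ck_algebra B\<^esub>"
    by (simp add: MB.CK.D_shift_times_S[OF levf, symmetric] MB.CK.D_mult[symmetric] O.m_assoc)
  \<comment> \<open>On this cylinder around \<open>h x\<close>, both \<open>g (k y)\<close> and
    \<open>f (k (shift y))\<close> equal 1, so its projection absorbs their product.\<close>
  define \<alpha> where "\<alpha> = prefix (Suc m) (h x)"
  have "MB.CK.pr \<alpha> = MB.CK.D (Suc m) (\<lambda>y. of_bool (prefix (Suc m) y = \<alpha>) * (g (k y) * f (k (shift y))))"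
    (is "_ = MB.CK.D _ ?w")
  proof -
    have "(of_bool (prefix (Suc m) y = \<alpha>) :: complex) = ?w y" if y: "y \<in> shift_space B" for y
    proof (cases "prefix (Suc m) y = \<alpha>")
      case True
      then have "g (k y) = g (k (h x))"
        by (intro levelD[OF levg y hx(1)]) (simp add: \<alpha>_def)
      moreover have "f (k (shift y)) = f (k (shift (h x)))"
        using True by (intro levelD[OF levf shift_in_shift_space[OF y] hx(2)]) (simp add: \<alpha>_def prefix_Suc)
      ultimately show ?thesis using True by (simp add: f_def g_def x1_def kh x)
    qed simp
    then have "MB.CK.D (Suc m) (\<lambda>y. of_bool (prefix (Suc m) y = \<alpha>)) = MB.CK.D (Suc m) ?w" by (rule MB.CK.D_cong)
    then show ?thesis using MB.CK.D_prefix[of \<alpha>] by (simp add: \<alpha>_def)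
  qed
  also have "\<dots> = MB.CK.pr \<alpha> \<otimes>\<^bsub>ck_algebra B\<^esub> MB.CK.D (Suc m) (\<lambda>y. g (k y) * f (k (shift y)))"
    using MB.CK.D_prefix[of \<alpha>] by (simp add: \<alpha>_def MB.CK.D_mult[symmetric])
  finally have pr: "MB.CK.pr \<alpha> = MB.CK.pr \<alpha> \<otimes>\<^bsub>ck_algebra B\<^esub> MB.CK.D (Suc m) (\<lambda>y. g (k y) * f (k (shift y)))" .
  \<comment> \<open>The nonzero cylinder projection compresses \<open>S\<close> times its adjoint to
    itself; inserting the absorbed factor next to \<open>S\<close> exhibits the vanishing product
    \<open>zB\<close>.\<close>
  have "MB.CK.pr \<alpha> = (MB.CK.pr \<alpha> \<otimes>\<^bsub>ck_algebra B\<^esub> MB.CK.S) \<otimes>\<^bsub>ck_algebra B\<^esub>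
      adj (ck_algebra B) (MB.CK.pr \<alpha> \<otimes>\<^bsub>ck_algebra B\<^esub> MB.CK.S)"
    by (rule MB.CK.pr_S_S_pr_same[symmetric]) (simp add: \<alpha>_def prefix_Suc)
  also have "\<dots> = (MB.CK.pr \<alpha> \<otimes>\<^bsub>ck_algebra B\<^esub> MB.CK.S) \<otimes>\<^bsub>ck_algebra B\<^esub>
      (adj (ck_algebra B) MB.CK.S \<otimes>\<^bsub>ck_algebra B\<^esub> MB.CK.pr \<alpha>)"
    by (simp add: O.adj_mult)
  also have "\<dots> = ((MB.CK.pr \<alpha> \<otimes>\<^bsub>ck_algebra B\<^esub> MB.CK.D (Suc m) (\<lambda>y. g (k y) * f (k (shift y)))) \<otimes>\<^bsub>ck_algebra B\<^esub> MB.CK.S) \<otimes>\<^bsub>ck_algebra B\<^esub>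
      (adj (ck_algebra B) MB.CK.S \<otimes>\<^bsub>ck_algebra B\<^esub> MB.CK.pr \<alpha>)"
    by (subst pr) (rule refl)
  also have "\<dots> = (MB.CK.pr \<alpha> \<otimes>\<^bsub>ck_algebra B\<^esub> ((MB.CK.D (Suc m) (\<lambda>y. g (k y) * f (k (shift y))) \<otimes>\<^bsub>ck_algebra B\<^esub> MB.CK.S)
      \<otimes>\<^bsub>ck_algebra B\<^esub> adj (ck_algebra B) MB.CK.S)) \<otimes>\<^bsub>ck_algebra B\<^esub> MB.CK.pr \<alpha>"
    by (simp add: O.m_assoc)
  also have "\<dots> = \<zero>\<^bsub>ck_algebra B\<^esub>" unfolding zB by simp
  finally show False using MB.pr_prefix_nonzero[OF hx(1)] by (simp add: \<alpha>_def)
qed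

text \<open>\<open>ck_epsilon\<close> maps the unit at \<open>x\<close> to the unit at
  \<open>shift x\<close>, so conjugacy is the hypothesis \<open>eps\<close> read at units.\<close>

lemma conj_if_groupoid:
  assumes units: "induces_on_units A \<Phi> h"
    and eps: "\<And>\<gamma>. \<gamma> \<in> ck_groupoid A \<Longrightarrow> \<Phi> (ck_epsilon \<gamma>) = ck_epsilon (\<Phi> \<gamma>)"
    and x: "x \<in> shift_space A"
  shows "h (shift x) = shift (h x)"
proof -
  have "ck_epsilon (gunit x) = gunit (shift x)" by (simp add: gunit_def)
  then have "gunit (h (shift x)) = ck_epsilon (gunit (h x))"
    using eps[of "gunit x"] groupoid_unit[OF x] units x shift_in_shift_space[OF x]
    by (simp add: induces_on_units_def) (simp add: gunit_def)
  then show ?thesis by (simp add: gunit_def)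
qed

end

text \<open>A conjugacy respects tail equations with unchanged exponents, so a cylinder for
  \<open>B\<close> with word lengths \<open>i\<close> and \<open>j\<close> is approached by arrows
  with the same tail equation; the \<open>m\<close> additional letters control the prefixes of
  \<open>h\<close> by uniform continuity.\<close>

lemma shift_conj_groupoid_continuous:
  fixes A :: "nat^'n::finite^'n" and B :: "nat^'m::finite^'m"
  assumes conj: "shift_conj A B h k"
  shows "continuous_map (groupoid_topology A) (groupoid_topology B) (\<lambda>(x, n, y). (h x, n, h y))" (is "continuous_map _ _ ?\<Phi>")
proof -
  interpret shift_conj A B h k by fact
  have in_G: "?\<Phi> \<gamma> \<in> ck_groupoid B" if "\<gamma> \<in> ck_groupoid A" for \<gamma>
    using that shift_conj_groupoid[OF conj] by (cases \<gamma>) (auto simp: groupoid_iff)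
  have "openin (groupoid_topology A) {\<gamma> \<in> ck_groupoid A. ?\<Phi> \<gamma> \<in> U}" if U: "openin (groupoid_topology B) U" for U
    unfolding openin_groupoid_iff
  proof (intro conjI allI impI)
    fix x n y assume xy: "(x, n, y) \<in> {\<gamma> \<in> ck_groupoid A. ?\<Phi> \<gamma> \<in> U}"
    then have X: "x \<in> shift_space A" "y \<in> shift_space A" by (auto simp: groupoid_iff)
    have "near B (h x, n, h y) (\<lambda>x' y'. (x', n, y') \<in> U)"
      using U xy unfolding openin_groupoid_iff by auto
    then obtain i j where ij: "(h x, n, h y) \<in> cyl B (prefix i (h x)) (prefix j (h y))"
      "\<forall>x' y'. (x', n, y') \<in> cyl B (prefix i (h x)) (prefix j (h y)) \<longrightarrow> (x', n, y') \<in> U"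
      by (rule near_large[where K = 0]) blast
    obtain m1 where m1: "level A m1 (\<lambda>x. prefix i (h x))" using h_unif by blast
    obtain m2 where m2: "level A m2 (\<lambda>x. prefix j (h x))" using h_unif by blast
    define m where "m = max m1 m2"
    have c: "(x, n, y) \<in> cyl A (prefix i x) (prefix j y)"
      using ij(1) X by (simp add: cyl_iff shift_conj_tail[OF conj])
    show "near A (x, n, y) (\<lambda>x' y'. (x', n, y') \<in> {\<gamma> \<in> ck_groupoid A. ?\<Phi> \<gamma> \<in> U})"
    proof (rule nearI[OF cyl_mono(1)[OF c, of m]])
      fix x' y' assume c': "(x', n, y') \<in> cyl A (prefix (i + m) x) (prefix (j + m) y)"
      then have X': "x' \<in> shift_space A" "y' \<in> shift_space A"
        "prefix (i + m) x' = prefix (i + m) x" "prefix (j + m) y' = prefix (j + m) y"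
        by (auto simp: cyl_iff)
      have "(x', n, y') \<in> cyl A (prefix i x) (prefix j y)" by (rule cyl_mono(2)[OF c c'])
      then have tail: "n = int i - int j" "(shift ^^ i) x' = (shift ^^ j) y'" by (auto simp: cyl_iff)
      have "prefix i (h x') = prefix i (h x)"
        by (rule levelD[OF m1 X'(1) X(1)], rule prefix_eq_mono[OF X'(3)]) (simp add: m_def)
      moreover have "prefix j (h y') = prefix j (h y)"
        by (rule levelD[OF m2 X'(2) X(2)], rule prefix_eq_mono[OF X'(4)]) (simp add: m_def)
      ultimately have "(h x', n, h y') \<in> cyl B (prefix i (h x)) (prefix j (h y))"
        using tail X'(1,2) by (simp add: cyl_iff h_in shift_conj_tail[OF conj])
      moreover have "(x', n, y') \<in> ck_groupoid A" using c' cyl_groupoid by blast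
      ultimately show "(x', n, y') \<in> {\<gamma> \<in> ck_groupoid A. ?\<Phi> \<gamma> \<in> U}" using ij(2) by simp
    qed
  qed auto
  then show ?thesis using in_G by (simp add: continuous_map_def Pi_iff)
qed

lemma (in shift_conj) groupoid_iso:
  "topological_groupoid_iso A B (\<lambda>(x, n, y). (h x, n, h y))" (is "topological_groupoid_iso _ _ ?\<Phi>")
proof -
  let ?\<Phi>' = "\<lambda>(x, n, y). (k x, n, k y)"
  have inv: "?\<Phi>' (?\<Phi> \<gamma>) = \<gamma>" if "\<gamma> \<in> ck_groupoid A" for \<gamma>
    using that by (cases \<gamma>) (auto simp: groupoid_iff kh)
  have inv': "?\<Phi> (?\<Phi>' \<gamma>) = \<gamma>" if "\<gamma> \<in> ck_groupoid B" for \<gamma>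
    using that by (cases \<gamma>) (auto simp: groupoid_iff hk)
  have maps: "homeomorphic_maps (groupoid_topology A) (groupoid_topology B) ?\<Phi> ?\<Phi>'"
    unfolding homeomorphic_maps_def
    using shift_conj_groupoid_continuous[OF shift_conj_axioms] shift_conj_groupoid_continuous[OF sym] inv inv' by simp
  then have homeo: "homeomorphic_map (groupoid_topology A) (groupoid_topology B) ?\<Phi>"
    by (auto simp: homeomorphic_map_maps)
  then have "bij_betw ?\<Phi> (ck_groupoid A) (ck_groupoid B)"
    using homeomorphic_imp_surjective_map[OF homeo] homeomorphic_imp_injective_map[OF homeo]
    by (simp add: bij_betw_def)
  moreover have "gsource (?\<Phi> \<gamma>) = grange (?\<Phi> \<eta>) \<and> ?\<Phi> (gmult \<gamma> \<eta>) = gmult (?\<Phi> \<gamma>) (?\<Phi> \<eta>)"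
    if "gsource \<gamma> = grange \<eta>" for \<gamma> \<eta>
    using that by (cases \<gamma>; cases \<eta>) (auto simp: gunit_def)
  ultimately show ?thesis using homeo unfolding topological_groupoid_iso_def by blast
qed

theorem theorem3p3:
  fixes A :: "nat^'n::finite^'n" and B :: "nat^'m::finite^'m"
    and h :: "(nat \<Rightarrow> 'n) \<Rightarrow> (nat \<Rightarrow> 'm)"
  assumes "ck_matrix A" and "ck_matrix B"
    and "homeomorphic_map (shift_topology A) (shift_topology B) h"
  defines "i \<equiv> (\<forall>x\<in>shift_space A. h (shift x) = shift (h x))"
    and "ii \<equiv> (\<exists>\<Phi>. topological_groupoid_iso A B \<Phi> \<and>
           (\<forall>\<gamma>\<in>ck_groupoid A. ck_cocycle (\<Phi> \<gamma>) = ck_cocycle \<gamma>) \<and>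
           induces_on_units A \<Phi> h \<and>
           (\<forall>\<gamma>\<in>ck_groupoid A. \<Phi> (ck_epsilon \<gamma>) = ck_epsilon (\<Phi> \<gamma>)))"
    and "iii \<equiv> (\<exists>\<Phi>. topological_groupoid_iso A B \<Phi> \<and>
           induces_on_units A \<Phi> h \<and>
           (\<forall>\<gamma>\<in>ck_groupoid A. \<Phi> (ck_epsilon \<gamma>) = ck_epsilon (\<Phi> \<gamma>)))"
    and "iv \<equiv> (\<exists>\<Psi>. star_iso (ck_algebra A) (ck_algebra B) \<Psi> \<and>
           (\<forall>z. cmod z = 1 \<longrightarrow> (\<forall>a\<in>carrier (ck_algebra A).
              \<Psi> (gauge_action A z a) = gauge_action B z (\<Psi> a))) \<and>
           (\<forall>a\<in>carrier (ck_algebra A). \<Psi> (cond_exp A a) = cond_exp B (\<Psi> a)) \<and>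
           implements_on_diagonal A B h \<Psi> \<and>
           (\<forall>f\<in>diagonal A. \<Psi> (ck_phi A f) = ck_phi B (\<Psi> f)) \<and>
           (\<forall>a\<in>carrier (ck_algebra A). \<Psi> (ck_tau A a) = ck_tau B (\<Psi> a)))"
    and "v \<equiv> (\<exists>\<Psi>. star_iso (ck_algebra A) (ck_algebra B) \<Psi> \<and>
           \<Psi> ` diagonal A = diagonal B \<and>
           implements_on_diagonal A B h \<Psi> \<and>
           (\<forall>a\<in>carrier (ck_algebra A). \<Psi> (ck_tau A a) = ck_tau B (\<Psi> a)))"
    and "vi \<equiv> (\<exists>\<Theta>. star_iso (diagonal_algebra A) (diagonal_algebra B) \<Theta> \<and>
           implements_on_diagonal A B h \<Theta> \<and>
           (\<forall>f\<in>diagonal A. \<Theta> (ck_phi A f) = ck_phi B (\<Theta> f)))"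
  shows "(i \<longleftrightarrow> ii) \<and> (i \<longleftrightarrow> iii) \<and> (i \<longleftrightarrow> iv) \<and> (i \<longleftrightarrow> v) \<and> (i \<longleftrightarrow> vi)"
proof -
  obtain k where k: "shift_homeo A B h k" by (rule shift_homeo_ex[OF assms(1-3)])
  interpret H: shift_homeo A B h k by (rule k)
  have "ii \<Longrightarrow> iii" unfolding ii_def iii_def by blast
  moreover have "iii \<Longrightarrow> i" unfolding iii_def i_def using H.conj_if_groupoid by blast
  moreover have "iv \<Longrightarrow> i" unfolding iv_def i_def using H.conj_if_tau by blast
  moreover have "v \<Longrightarrow> i" unfolding v_def i_def using H.conj_if_tau by blast
  moreover have "vi \<Longrightarrow> i" unfolding vi_def i_def using H.conj_if_phi by blast
  moreover have "ii \<and> iv \<and> v \<and> vi" if i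
  proof -
    interpret C: conj_alg A B h k
      using that unfolding i_def by (intro conj_alg.intro shift_conj.intro shift_conj_axioms.intro k) blast
    have imp: "implements_on_diagonal A B h C.conj_map"
      by (simp add: implements_on_diagonal_def C.conj_map_diagonal H.inv_h)
    have ii
      unfolding ii_def
    proof (intro exI conjI ballI)
      show "topological_groupoid_iso A B (\<lambda>(x, n, y). (h x, n, h y))" by (rule C.groupoid_iso)
      show "induces_on_units A (\<lambda>(x, n, y). (h x, n, h y)) h" by (simp add: induces_on_units_def gunit_def)
    qed (auto simp: groupoid_iff C.h_shift)
    moreover have iv
      unfolding iv_def
      by (intro exI[of _ C.conj_map] conjI allI ballI impI C.conj_map_iso C.conj_map_gauge C.conj_map_cond_exp imp
          C.conj_map_phi C.conj_map_tau)
    moreover have v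
      unfolding v_def
      by (intro exI[of _ C.conj_map] conjI ballI C.conj_map_iso C.conj_map_tau imp
          bij_betw_imp_surj_on[OF C.conj_map_diagonal_bij])
    moreover have vi
      unfolding vi_def by (intro exI[of _ C.conj_map] conjI ballI C.conj_map_diagonal_iso imp C.conj_map_phi)
    ultimately show ?thesis by blast
  qed
  ultimately show ?thesis by blast
qed

end
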